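(* Let $G$ be a discrete group with a proper Dirac weight $l\colon G\to\mathbb{R}$, acting by automorphisms $\alpha$ on a unital $C^*$-algebra $A$, and let $(\mathcal{A},H,D,u)$ be an odd $G$-equivariant spectral triple on $A$ with faithful representation $\pi$. Then the spectral triple $(C_c(G,\mathcal{A}),\widehat{H},\widehat{D},\hat\pi_2\rtimes\hat\Gamma)$ on $A\rtimes_{\alpha,r}G$ is equivariant with respect to the dual coaction $\widehat{\alpha}\colon A\rtimes_{\alpha,r}G\to(A\rtimes_{\alpha,r}G)\otimes C^*_r(G)$, $\widehat{\alpha}(a\delta_g)=a\delta_g\otimes\delta_g$, of $G$.
   Context: Conventions: Hilbert spaces and $C^*$-algebras are separable, algebras are complex and unital, discrete groups are countable. An odd spectral triple $(\mathcal{A},H,D)$ on $A$ consists of a dense $*$-subalgebra $\mathcal{A}\subseteq A$, a representation $\pi\colon A\to\mathcal{L}(H)$ and a densely defined self-adjoint $D$ on $H$ with $(1+D^2)^{-1/2}$ compact and, for $a\in\mathcal{A}$, $\pi(a)\mathrm{Dom}(D)\subseteq\mathrm{Dom}(D)$ and $[D,\pi(a)]$ bounded; an even one has in addition a self-adjoint grading $\chi$, $\chi^2=1$, commuting with $\pi$, preserving $\mathrm{Dom}(D)$ and anticommuting with $D$. It is $G$-equivariant if there is a unitary representation $u\colon G\to\mathcal{L}(H)$ with $u_g\pi(a)u_g^*=\pi(\alpha_g(a))$, $u_g\mathrm{Dom}(D)\subseteq\mathrm{Dom}(D)$ and $[D,u_g]$ bounded for every $g\in G$. A weight $l\colon G\to\mathbb{R}$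 is proper if $\{g:-m\le l(g)\le m\}$ is finite for all $m\in\mathbb{N}$, and a Dirac weight if $x\mapsto l(x)-l(g^{-1}x)$ is bounded for each $g\in G$. $M_l$ is multiplication by $l$ on $\ell^2(G)$, with basis $(\delta_g)$. $C_c(G,\mathcal{A})$ is the set of finite sums $\sum a_g\delta_g$, $a_g\in\mathcal{A}$, with product and involution determined by $\delta_g\delta_h=\delta_{gh}$, $\delta_g^*=\delta_{g^{-1}}$, $\delta_ga\delta_g^*=\alpha_g(a)$, dense in $A\rtimes_{\alpha,r}G$. $\widehat{H}=H\otimes\ell^2(G)\otimes\mathbb{C}^2$, the algebra acts by $a\delta_h\mapsto\hat\pi_2(a)\hat\Gamma_h\otimes1$ with $\hat\pi_2(a)\hat\Gamma_h(\xi\otimes\delta_x)=\pi(a)u_h\xi\otimes\delta_{hx}$, $\widehat{D}=D\otimes1\otimes\sigma_1+1\otimes M_l\otimes\sigma_2$ with Pauli matrices $\sigma_i$, and the grading is $1\otimes1\otimes\sigma_3$. Coactions. In $C^*_r(G)$ write $\delta_g$ for the unitary of $g\in G$; $\Delta\colon C^*_r(G)\to C^*_r(G)\otimes C^*_r(G)$ is $\Delta(\delta_g)=\delta_g\otimes\delta_g$. A coaction of $G$ on a unital $C^*$-algebra $B$ is a unital $*$-homomorphism $\theta\colon B\to B\otimes C^*_r(G)$ with $(\theta\otimes\mathrm{id})\theta=(\mathrm{id}\otimes\Delta)\theta$ and $\mathrm{span}\{\theta(a)(1\otimes b)\}$ norm dense in $B\otimes C^*_r(G)$; one writes $\theta(b)=\sum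 b_{(-1)}\otimes b_{(0)}$. A unitary corepresentation of $G$ on a Hilbert space $K$ is a linear map $\Theta\colon K\to K\otimes C^*_r(G)$ (exterior tensor product Hilbert $C^*_r(G)$-module) with $(\Theta\otimes\mathrm{id})\Theta=(\mathrm{id}\otimes\Delta)\Theta$, $\Theta(K)C^*_r(G)$ linearly dense, and $\langle\Theta(x),\Theta(y)\rangle=\langle x,y\rangle1$; one writes $\Theta(x)=\sum x_{(-1)}\otimes x_{(0)}$. Its operator form is the unitary $X\in\mathcal{L}(K\otimes C^*_r(G))$ with $X(x\otimes q)=\Theta(x)q$. A spectral triple $(\mathcal{B},K,D',\chi)$ on $B$ (with $B$ represented on $K$), where $G$ coacts on $B$, is equivariant for the coaction of $G$ if there exist a dense subspace $W\subseteq K$ and a unitary corepresentation $\Theta\colon K\to K\otimes C^*_r(G)$ with operator form $X$ such that: (1) $W$ is a $C^*_r(G)$-equivariant $B$-module in the sense that $\Theta(b\triangleright x)=b_{(-1)}\triangleright x_{(-1)}\otimes b_{(0)}x_{(0)}$ for every $b\in B$ and $x\in K$, where $\triangleright$ is the action of $B$ on $K$; (2) $X$ commutes with $D'\otimes1$ and with $\chi\otimes1$; (3) $(\mathrm{id}\otimes\varphi)(X(b\otimes1)X^* )\in B''$ for every $b\in B$ and every state $\varphi$ of $C^*_r(G)$. *)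

theory Defs
  imports "HOL-Analysis.Analysis" "HOL-Library.Countable"
begin

section \<open>Complex vector spaces, Hilbert spaces and C*-algebras\<close>

class scaleC =
  fixes scaleC :: "complex \<Rightarrow> 'a \<Rightarrow> 'a"  (infixr \<open>*\<^sub>C\<close> 75)

class complex_vector = real_vector + scaleC +
  assumes scaleC_add_right: "a *\<^sub>C (x + y) = a *\<^sub>C x + a *\<^sub>C y"
    and scaleC_add_left: "(a + b) *\<^sub>C x = a *\<^sub>C x + b *\<^sub>C x"
    and scaleC_scaleC: "a *\<^sub>C b *\<^sub>C x = (a * b) *\<^sub>C x"
    and scaleR_scaleC: "r *\<^sub>R x = complex_of_real r *\<^sub>C x"

lemma scaleC_one [simp]: "1 *\<^sub>C (x::'a::complex_vector) = x"
  using scaleR_scaleC[of 1 x] by simp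

global_interpretation complex_vector: vector_space "scaleC :: complex \<Rightarrow> 'a \<Rightarrow> 'a::complex_vector"
  defines csubspace = complex_vector.subspace
    and cspan = complex_vector.span
  by unfold_locales (simp_all add: scaleC_add_right scaleC_add_left scaleC_scaleC)

definition is_clinear :: "('a::complex_vector \<Rightarrow> 'b::complex_vector) \<Rightarrow> bool" where
  "is_clinear f \<longleftrightarrow> (\<forall>x y. f (x + y) = f x + f y) \<and> (\<forall>c x. f (c *\<^sub>C x) = c *\<^sub>C f x)"

text \<open>The inner product is linear in the second variable. The norm is the one of \<^class>\<open>real_inner\<close>,
  hence is induced by \<open>cinner\<close>.\<close>

class chilbert_space = complex_vector + real_inner + banach +
  fixes cinner :: "'a \<Rightarrow> 'a \<Rightarrow> complex"
  assumes cinner_commute: "cinner x y = cnj (cinner y x)"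
    and cinner_add_right: "cinner x (y + z) = cinner x y + cinner x z"
    and cinner_scaleC_right: "cinner x (c *\<^sub>C y) = c * cinner x y"
    and inner_eq_Re_cinner: "inner x y = Re (cinner x y)"

class cstar_algebra = complex_vector + real_normed_algebra + monoid_mult + banach +
  fixes star :: "'a \<Rightarrow> 'a"
  assumes mult_scaleC_left: "(c *\<^sub>C x) * y = c *\<^sub>C (x * y)"
    and mult_scaleC_right: "x * (c *\<^sub>C y) = c *\<^sub>C (x * y)"
    and norm_scaleC: "norm (c *\<^sub>C x) = cmod c * norm x"
    and star_star: "star (star x) = x"
    and star_add: "star (x + y) = star x + star y"
    and star_scaleC: "star (c *\<^sub>C x) = cnj c *\<^sub>C star x"
    and star_mult: "star (x * y) = star y * star x"
    and cstar_identity: "norm (star x * x) = (norm x)\<^sup>2"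

subsection \<open>Elementary facts on inner products\<close>

lemma cinner_add_left: "cinner (x + y) z = cinner x z + cinner y (z::'a::chilbert_space)"
  by (metis cinner_commute cinner_add_right complex_cnj_add)

lemma cinner_scaleC_left: "cinner (c *\<^sub>C x) y = cnj c * cinner x (y::'a::chilbert_space)"
  by (metis cinner_commute cinner_scaleC_right complex_cnj_mult)

lemma inner_scaleC: "inner (c *\<^sub>C x) y = inner x (cnj c *\<^sub>C (y::'a::chilbert_space))"
  by (simp add: inner_eq_Re_cinner cinner_scaleC_left cinner_scaleC_right)

lemma cinner_eq_inner: "cinner x y = Complex (inner x y) (inner (\<i> *\<^sub>C x) (y::'a::chilbert_space))"
  by (simp add: inner_eq_Re_cinner cinner_scaleC_left complex_eq_iff)

lemma norm_scaleC_hilbert: "norm (c *\<^sub>C (x::'a::chilbert_space)) = cmod c * norm x"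
proof -
  have c: "cnj c * c = complex_of_real ((cmod c)\<^sup>2)"
    by (metis complex_norm_square mult.commute)
  have "inner (c *\<^sub>C x) (c *\<^sub>C x) = inner x ((cnj c * c) *\<^sub>C x)"
    unfolding inner_scaleC scaleC_scaleC ..
  also have "\<dots> = (cmod c)\<^sup>2 * inner x x"
    unfolding c scaleR_scaleC[symmetric] by simp
  finally show ?thesis
    by (simp add: norm_eq_sqrt_inner real_sqrt_mult)
qed

subsection \<open>The complex numbers, products, spaces of bounded operators\<close>

instantiation complex :: chilbert_space
begin
definition scaleC_complex :: "complex \<Rightarrow> complex \<Rightarrow> complex" where "scaleC_complex c x = c * x"
definition cinner_complex :: "complex \<Rightarrow> complex \<Rightarrow> complex" where "cinner_complex x y = cnj x * y"
instance
  by standard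
     (auto simp: scaleC_complex_def cinner_complex_def algebra_simps scaleR_conv_of_real inner_complex_def)
end

instantiation prod :: (complex_vector, complex_vector) complex_vector
begin
definition scaleC_prod :: "complex \<Rightarrow> 'a \<times> 'b \<Rightarrow> 'a \<times> 'b" where
  "scaleC_prod c p = (c *\<^sub>C fst p, c *\<^sub>C snd p)"
instance
  by standard
     (auto simp: scaleC_prod_def scaleC_add_right scaleC_add_left scaleC_scaleC scaleR_scaleC prod_eq_iff)
end

lemma bounded_linear_scaleC: "bounded_linear (\<lambda>x::'a::chilbert_space. c *\<^sub>C x)"
proof (rule bounded_linear_intro[where K = "cmod c"])
  show "c *\<^sub>C (r *\<^sub>R x) = r *\<^sub>R c *\<^sub>C x" for r and x :: 'a
    by (simp add: scaleR_scaleC scaleC_scaleC mult.commute)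
qed (simp_all add: scaleC_add_right norm_scaleC_hilbert mult.commute)

instantiation blinfun :: (real_normed_vector, chilbert_space) complex_vector
begin
lift_definition scaleC_blinfun :: "complex \<Rightarrow> 'a \<Rightarrow>\<^sub>L 'b \<Rightarrow> 'a \<Rightarrow>\<^sub>L 'b" is "\<lambda>c f x. c *\<^sub>C f x"
  by (rule bounded_linear_compose[OF bounded_linear_scaleC])
instance
  by standard (transfer; simp add: fun_eq_iff scaleC_add_right scaleC_add_left scaleC_scaleC scaleR_scaleC)+
end

subsection \<open>Adjoints\<close>

lemma riesz:
  fixes f :: "'a::{real_inner, banach} \<Rightarrow> real"
  assumes "bounded_linear f"
  shows "\<exists>z. \<forall>x. f x = inner z x"
proof -
  interpret f: bounded_linear f by fact
  define J where "J x = inner x x - 2 * f x" for x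
  obtain K where K: "\<And>x. norm (f x) \<le> norm x * K" using f.bounded by blast
  have lower: "J x \<ge> - K\<^sup>2" for x
  proof -
    have "f x \<le> norm x * K" using K[of x] by simp
    moreover have "0 \<le> (norm x - K)\<^sup>2" by simp
    ultimately show ?thesis by (simp add: J_def power2_norm_eq_inner[symmetric] power2_diff)
  qed
  define m where "m = (INF x. J x)"
  have bdd: "bdd_below (range J)" using lower by (intro bdd_belowI2) blast
  have m_le: "m \<le> J x" for x unfolding m_def by (rule cINF_lower[OF bdd]) simp
  have "\<exists>x. J x < m + 1 / real (Suc n)" for n
  proof -
    have "(INF x. J x) < m + 1 / real (Suc n)" unfolding m_def[symmetric] by simp
    then show ?thesis by (subst (asm) cINF_less_iff[OF _ bdd]) auto
  qed
  then obtain s where s: "\<And>n. J (s n) < m + 1 / real (Suc n)" by metis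
  have par: "(norm (x - y))\<^sup>2 = 2 * J x + 2 * J y - 4 * J ((1/2) *\<^sub>R (x + y))" for x y
    by (simp add: J_def power2_norm_eq_inner inner_diff_left inner_diff_right inner_add_left
        inner_add_right f.add f.scaleR inner_commute algebra_simps)
  have sq: "(norm (s i - s j))\<^sup>2 \<le> 2 / real (Suc i) + 2 / real (Suc j)" for i j
    using par[of "s i" "s j"] s[of i] s[of j] m_le[of "(1/2) *\<^sub>R (s i + s j)"] by simp
  have "Cauchy s"
  proof (rule metric_CauchyI)
    fix e :: real assume "e > 0"
    then obtain N where N: "4 / e\<^sup>2 < real N" using reals_Archimedean2 by blast
    have "dist (s i) (s j) < e" if "i \<ge> N" "j \<ge> N" for i j
    proof -
      have Npos: "real N > 0" using N \<open>e > 0\<close> by (smt (verit) divide_nonneg_nonneg zero_le_power2)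
      have "2 / real (Suc i) \<le> 2 / real N" "2 / real (Suc j) \<le> 2 / real N"
        using that Npos by (auto intro!: divide_left_mono)
      then have "(norm (s i - s j))\<^sup>2 \<le> 4 / real N" using sq[of i j] by simp
      also have "\<dots> < e\<^sup>2" using N Npos \<open>e > 0\<close> by (simp add: field_simps)
      finally show ?thesis using \<open>e > 0\<close> by (simp add: dist_norm power_less_imp_less_base)
    qed
    then show "\<exists>M. \<forall>m\<ge>M. \<forall>n\<ge>M. dist (s m) (s n) < e" by blast
  qed
  then obtain z where z: "s \<longlonglongrightarrow> z" using Cauchy_convergent convergent_def by blast
  have "(\<lambda>n. J (s n)) \<longlonglongrightarrow> J z"
    unfolding J_def by (intro tendsto_intros f.tendsto z)
  moreover have "(\<lambda>n. m + 1 / real (Suc n)) \<longlonglongrightarrow> m + 0"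
    by (intro tendsto_intros) (use LIMSEQ_inverse_real_of_nat in \<open>simp add: inverse_eq_divide\<close>)
  ultimately have "J z \<le> m + 0" by (rule LIMSEQ_le) (use s in \<open>blast intro: less_imp_le\<close>)
  then have min: "J z \<le> J y" for y using m_le[of y] by linarith
  have "f x = inner z x" for x
  proof (rule ccontr)
    assume neq: "f x \<noteq> inner z x"
    define d where "d = inner z x - f x"
    have d: "d \<noteq> 0" using neq by (simp add: d_def)
    have *: "0 \<le> 2 * t * d + t\<^sup>2 * inner x x" for t
    proof -
      have "J (z + t *\<^sub>R x) = J z + 2 * t * d + t\<^sup>2 * inner x x"
        by (simp add: J_def d_def f.add f.scaleR inner_add_left inner_add_right inner_commute
            power2_eq_square algebra_simps)
      then show ?thesis using min[of "z + t *\<^sub>R x"] by simp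
    qed
    have x: "inner x x > 0"
      using d f.zero by (metis d_def inner_eq_zero_iff inner_ge_zero inner_zero_right less_eq_real_def right_minus_eq)
    have "2 * (- d / inner x x) * d + (- d / inner x x)\<^sup>2 * inner x x = - (d\<^sup>2 / inner x x)"
      using x by (simp add: power2_eq_square field_simps)
    moreover have "d\<^sup>2 / inner x x > 0" using d x by simp
    ultimately show False using *[of "- d / inner x x"] by linarith
  qed
  then show ?thesis by blast
qed

lemma adjoint_exists:
  fixes T :: "'a::{real_inner, banach} \<Rightarrow>\<^sub>L 'a"
  shows "\<exists>S :: 'a \<Rightarrow>\<^sub>L 'a. \<forall>x y. inner (S x) y = inner x (T y)"
proof -
  have "\<exists>z. \<forall>y. inner x (T y) = inner z y" for x
    by (rule riesz) (intro bounded_linear_intros)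
  then obtain S where S: "\<And>x y. inner x (T y) = inner (S x) y" by metis
  have "bounded_linear S"
  proof (rule bounded_linear_intro[where K = "norm T"])
    show "S (x + y) = S x + S y" for x y
      by (rule vector_eq_ldot[THEN iffD1]) (metis S inner_add_left inner_commute)
    show "S (r *\<^sub>R x) = r *\<^sub>R S x" for r x
      by (rule vector_eq_ldot[THEN iffD1]) (metis S inner_scaleR_left inner_commute)
    show "norm (S x) \<le> norm x * norm T" for x
    proof -
      have "norm (S x) * norm (S x) = inner x (T (S x))"
        using S[of x "S x"] by (simp add: power2_norm_eq_inner[symmetric] power2_eq_square)
      also have "\<dots> \<le> norm x * norm (T (S x))" using Cauchy_Schwarz_ineq2[of x "T (S x)"] by simp
      also have "\<dots> \<le> norm x * (norm T * norm (S x))" by (simp add: mult_left_mono norm_blinfun)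
      finally have "norm (S x) * norm (S x) \<le> (norm x * norm T) * norm (S x)" by (simp add: mult.assoc)
      then show ?thesis by (cases "norm (S x) = 0") auto
    qed
  qed
  then have "inner (Blinfun S x) y = inner x (T y)" for x y
    by (simp add: S bounded_linear_Blinfun_apply)
  then show ?thesis by blast
qed

subsection \<open>The C*-algebra of bounded operators on a Hilbert space\<close>

typedef (overloaded) 'h bop =
  "{T :: 'h::chilbert_space \<Rightarrow>\<^sub>L 'h. \<forall>c x. blinfun_apply T (c *\<^sub>C x) = c *\<^sub>C blinfun_apply T x}"
  morphisms bop_blinfun Bop
  by (rule exI[of _ 0]) simp

setup_lifting type_definition_bop

abbreviation bop_apply :: "'h::chilbert_space bop \<Rightarrow> 'h \<Rightarrow> 'h"  (infixr \<open>\<cdot>\<close> 75) where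
  "T \<cdot> x \<equiv> blinfun_apply (bop_blinfun T) x"

lemma bop_scaleC: "T \<cdot> (c *\<^sub>C x) = c *\<^sub>C (T \<cdot> x)"
  using bop_blinfun[of T] by simp

lemma bop_eqI: "(\<And>x. S \<cdot> x = T \<cdot> x) \<Longrightarrow> S = T"
  by (metis blinfun_eqI bop_blinfun_inject)

lemma bop_adjoint_exists:
  fixes T :: "'h::chilbert_space bop"
  shows "\<exists>S :: 'h bop. \<forall>x y. cinner (S \<cdot> x) y = cinner x (T \<cdot> y)"
proof -
  obtain S :: "'h \<Rightarrow>\<^sub>L 'h" where S: "\<And>x y. inner (S x) y = inner x (T \<cdot> y)"
    using adjoint_exists by blast
  have lin: "S (c *\<^sub>C x) = c *\<^sub>C S x" for c x
    by (rule vector_eq_rdot[THEN iffD1]) (simp add: S inner_scaleC bop_scaleC)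
  then have "bop_blinfun (Bop S) = S" by (simp add: Bop_inverse)
  moreover have "cinner (S x) y = cinner x (T \<cdot> y)" for x y
    using S by (simp add: cinner_eq_inner lin[symmetric])
  ultimately show ?thesis by metis
qed

instantiation bop :: (chilbert_space) real_normed_vector
begin

lift_definition zero_bop :: "'a bop" is 0 by simp
lift_definition plus_bop :: "'a bop \<Rightarrow> 'a bop \<Rightarrow> 'a bop" is "(+)"
  by (simp add: blinfun.add_left scaleC_add_right)
lift_definition uminus_bop :: "'a bop \<Rightarrow> 'a bop" is uminus
  by (simp add: blinfun.minus_left)
lift_definition minus_bop :: "'a bop \<Rightarrow> 'a bop \<Rightarrow> 'a bop" is "(-)"
  by (simp add: blinfun.diff_left complex_vector.scale_right_diff_distrib)
lift_definition scaleR_bop :: "real \<Rightarrow> 'a bop \<Rightarrow> 'a bop" is scaleR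
  unfolding blinfun.scaleR_left by (simp add: scaleR_scaleC scaleC_scaleC mult.commute)
lift_definition norm_bop :: "'a bop \<Rightarrow> real" is norm .
definition "dist_bop (S::'a bop) T = norm (S - T)"
definition "sgn_bop (T::'a bop) = scaleR (inverse (norm T)) T"
definition [code del]: "(uniformity :: ('a bop \<times> 'a bop) filter) =
  (INF e\<in>{0 <..}. principal {(x, y). dist x y < e})"
definition [code del]: "open_bop (U :: 'a bop set) \<longleftrightarrow>
  (\<forall>x\<in>U. \<forall>\<^sub>F (x', y) in uniformity. x' = x \<longrightarrow> y \<in> U)"

instance
  apply standard
  unfolding dist_bop_def sgn_bop_def uniformity_bop_def open_bop_def
  by (rule refl | (transfer, simp add: algebra_simps norm_triangle_ineq))+

end

instance bop :: (chilbert_space) banach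
proof
  fix X :: "nat \<Rightarrow> 'a bop" assume X: "Cauchy X"
  have d: "dist (bop_blinfun S) (bop_blinfun T) = dist S T" for S T :: "'a bop"
    unfolding dist_norm by transfer simp
  have "Cauchy (\<lambda>n. bop_blinfun (X n))"
    using X unfolding Cauchy_def d .
  then obtain L where L: "(\<lambda>n. bop_blinfun (X n)) \<longlonglongrightarrow> L"
    using Cauchy_convergent convergent_def by blast
  have "L (c *\<^sub>C x) = c *\<^sub>C L x" for c x
  proof -
    have "(\<lambda>n. X n \<cdot> (c *\<^sub>C x)) \<longlonglongrightarrow> L (c *\<^sub>C x)" by (intro tendsto_intros L)
    moreover have "(\<lambda>n. c *\<^sub>C (X n \<cdot> x)) \<longlonglongrightarrow> c *\<^sub>C L x"
      by (intro bounded_linear.tendsto[OF bounded_linear_scaleC] tendsto_intros L)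
    ultimately show ?thesis unfolding bop_scaleC using LIMSEQ_unique by blast
  qed
  then have "bop_blinfun (Bop L) = L" by (simp add: Bop_inverse)
  then have "X \<longlonglongrightarrow> Bop L" using L unfolding tendsto_iff by (metis (no_types, lifting) d eventually_mono)
  then show "convergent X" by (auto simp: convergent_def)
qed

instantiation bop :: (chilbert_space) cstar_algebra
begin

lift_definition one_bop :: "'a bop" is id_blinfun by simp
lift_definition times_bop :: "'a bop \<Rightarrow> 'a bop \<Rightarrow> 'a bop" is "(o\<^sub>L)" by simp
lift_definition scaleC_bop :: "complex \<Rightarrow> 'a bop \<Rightarrow> 'a bop" is scaleC
  by (simp add: scaleC_blinfun.rep_eq scaleC_scaleC mult.commute)
definition star_bop :: "'a bop \<Rightarrow> 'a bop" where
  "star_bop T = (THE S. \<forall>x y. cinner (S \<cdot> x) y = cinner x (T \<cdot> y))"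

lemma bop_eqI_cinner:
  fixes S T :: "'a bop"
  assumes "\<And>x y. cinner (S \<cdot> x) y = cinner (T \<cdot> x) y"
  shows "S = T"
  by (rule bop_eqI, rule vector_eq_rdot[THEN iffD1]) (simp add: inner_eq_Re_cinner assms)

lemma cinner_star: "cinner (star T \<cdot> x) y = cinner x (T \<cdot> y)" for T :: "'a bop"
proof -
  have "\<exists>!S. \<forall>x y. cinner (S \<cdot> x) y = cinner x (T \<cdot> y)"
    using bop_adjoint_exists[of T] by (metis bop_eqI_cinner)
  from theI'[OF this] show ?thesis unfolding star_bop_def by blast
qed

lemma cinner_star': "cinner x (star T \<cdot> y) = cinner (T \<cdot> x) y" for T :: "'a bop"
  by (metis cinner_commute cinner_star)

lemma bop_simps:
  fixes S T :: "'a bop"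
  shows "(S + T) \<cdot> x = S \<cdot> x + T \<cdot> x" "(S * T) \<cdot> x = S \<cdot> T \<cdot> x" "(c *\<^sub>C T) \<cdot> x = c *\<^sub>C (T \<cdot> x)"
    "(1 :: 'a bop) \<cdot> x = x"
  by (transfer, simp add: blinfun.add_left scaleC_blinfun.rep_eq)+

lemma norm_star_mult: "norm (star T * T) = (norm T)\<^sup>2" for T :: "'a bop"
proof -
  have app: "norm (U \<cdot> x) \<le> norm U * norm x" for U :: "'a bop" and x
    by transfer (rule norm_blinfun)
  have bound: "norm U \<le> b" if "b \<ge> 0" "\<And>x. norm (U \<cdot> x) \<le> b * norm x" for U :: "'a bop" and b
    using that by transfer (rule norm_blinfun_bound)
  have mult: "norm (U * V) \<le> norm U * norm V" for U V :: "'a bop"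
    by transfer (rule norm_blinfun_compose)
  have sq: "(norm (U \<cdot> x))\<^sup>2 \<le> norm (star U * U) * (norm x)\<^sup>2" for U :: "'a bop" and x
  proof -
    have "(norm (U \<cdot> x))\<^sup>2 = inner ((star U * U) \<cdot> x) x"
      by (simp add: power2_norm_eq_inner inner_eq_Re_cinner bop_simps cinner_star)
    also have "\<dots> \<le> norm ((star U * U) \<cdot> x) * norm x"
      using Cauchy_Schwarz_ineq2[of "(star U * U) \<cdot> x" x] by simp
    also have "\<dots> \<le> norm (star U * U) * norm x * norm x"
      by (intro mult_right_mono app) simp
    finally show ?thesis by (simp add: power2_eq_square mult.assoc)
  qed
  have le: "(norm U)\<^sup>2 \<le> norm (star U * U)" for U :: "'a bop"
  proof -
    have "norm U \<le> sqrt (norm (star U * U))"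
    proof (rule bound)
      show "norm (U \<cdot> x) \<le> sqrt (norm (star U * U)) * norm x" for x
        using real_sqrt_le_mono[OF sq[of U x]] by (simp add: real_sqrt_mult)
    qed simp
    then have "(norm U)\<^sup>2 \<le> (sqrt (norm (star U * U)))\<^sup>2"
      by (intro power_mono) auto
    then show ?thesis by simp
  qed
  have half: "norm U \<le> norm (star U)" for U :: "'a bop"
  proof -
    have "norm U * norm U \<le> norm (star U) * norm U"
      using le[of U] mult[of "star U" U] by (simp add: power2_eq_square)
    then show ?thesis by (cases "norm U = 0") auto
  qed
  have "star (star T) = T"
    by (rule bop_eqI_cinner) (simp add: cinner_star cinner_star')
  then have "norm (star T) = norm T" using half[of T] half[of "star T"] by simp
  then show ?thesis using le[of T] mult[of "star T" T] by (simp add: power2_eq_square)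
qed

instance
proof
  fix a b c :: "'a bop" and r :: real and z w :: complex
  show "norm (z *\<^sub>C a) = cmod z * norm a"
  proof (cases "z = 0")
    case True
    have "0 *\<^sub>C a = 0" by (transfer, rule blinfun_eqI) (simp add: scaleC_blinfun.rep_eq)
    then show ?thesis using True by simp
  next
    case False
    have le: "norm (u *\<^sub>C T) \<le> cmod u * norm T" for u and T :: "'a bop"
    proof (transfer, rule norm_blinfun_bound)
      fix u and T :: "'a \<Rightarrow>\<^sub>L 'a" and x
      show "norm (blinfun_apply (u *\<^sub>C T) x) \<le> cmod u * norm T * norm x"
        by (simp add: scaleC_blinfun.rep_eq norm_scaleC_hilbert mult.assoc mult_left_mono norm_blinfun)
    qed simp
    have "inverse z *\<^sub>C z *\<^sub>C a = a"
      by (rule bop_eqI) (simp add: bop_simps scaleC_scaleC False)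
    then have "norm a \<le> inverse (cmod z) * norm (z *\<^sub>C a)"
      using le[of "inverse z" "z *\<^sub>C a"] by (simp add: norm_inverse)
    then show ?thesis using le[of z a] False by (simp add: field_simps)
  qed
  show "norm (a * b) \<le> norm a * norm b" by transfer (rule norm_blinfun_compose)
  show "r *\<^sub>R a * b = r *\<^sub>R (a * b)" "a * r *\<^sub>R b = r *\<^sub>R (a * b)"
    by (transfer, rule blinfun_eqI, simp add: blinfun.scaleR_left blinfun.scaleR_right)+
  show "star (star a) = a" by (rule bop_eqI_cinner) (simp add: cinner_star cinner_star')
  show "norm (star a * a) = (norm a)\<^sup>2" by (rule norm_star_mult)
  show "r *\<^sub>R a = complex_of_real r *\<^sub>C a"
    by (transfer, rule blinfun_eqI) (simp add: scaleC_blinfun.rep_eq scaleR_scaleC blinfun.scaleR_left)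
  show "star (a + b) = star a + star b" "star (z *\<^sub>C a) = cnj z *\<^sub>C star a" "star (a * b) = star b * star a"
    by (rule bop_eqI_cinner;
        simp add: bop_simps cinner_star cinner_star' cinner_add_left cinner_add_right
          cinner_scaleC_left cinner_scaleC_right)+
qed (rule bop_eqI; simp add: bop_simps blinfun.add_right scaleC_add_right scaleC_add_left
      scaleC_scaleC bop_scaleC)+

end

section \<open>The Hilbert spaces \<open>K \<otimes> l2(I)\<close>\<close>

text \<open>\<open>K \<otimes> l2(I)\<close> is realised as the space of square summable families of vectors of \<open>K\<close> indexed by
  the type \<open>'i\<close>. In particular \<open>l2(I)\<close> itself is \<open>('i, complex) ell2\<close>, and \<open>(K \<otimes> l2(I)) \<otimes> l2(J)\<close> is
  \<open>('j, ('i, 'k) ell2) ell2\<close>. The space \<open>\<complex>\<^sup>2\<close> is \<open>(bool, complex) ell2\<close>, with \<open>False\<close> the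
  first and \<open>True\<close> the second index.\<close>

typedef (overloaded) ('i, 'h) ell2 =
  "{f :: 'i \<Rightarrow> 'h::chilbert_space. (\<lambda>i. (norm (f i))\<^sup>2) summable_on UNIV}"
  morphisms ell2_fun Ell2
  by (rule exI[of _ "\<lambda>_. 0"]) simp

setup_lifting type_definition_ell2

lemma square_summable_add:
  fixes f g :: "'i \<Rightarrow> 'h::real_normed_vector"
  assumes "(\<lambda>i. (norm (f i))\<^sup>2) summable_on UNIV" "(\<lambda>i. (norm (g i))\<^sup>2) summable_on UNIV"
  shows "(\<lambda>i. (norm (f i + g i))\<^sup>2) summable_on UNIV"
proof (rule summable_on_comparison_test)
  show "(\<lambda>i. 2 * (norm (f i))\<^sup>2 + 2 * (norm (g i))\<^sup>2) summable_on UNIV"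
    by (intro summable_on_add summable_on_cmult_right assms)
  show "(norm (f i + g i))\<^sup>2 \<le> 2 * (norm (f i))\<^sup>2 + 2 * (norm (g i))\<^sup>2" for i
  proof -
    have "(norm (f i + g i))\<^sup>2 \<le> (norm (f i) + norm (g i))\<^sup>2"
      by (intro power_mono norm_triangle_ineq) simp
    also have "\<dots> \<le> 2 * (norm (f i))\<^sup>2 + 2 * (norm (g i))\<^sup>2"
      using zero_le_power2[of "norm (f i) - norm (g i)"] by (simp add: power2_sum power2_diff)
    finally show ?thesis .
  qed
qed simp

lemma square_summable_scaleC:
  fixes f :: "'i \<Rightarrow> 'h::chilbert_space"
  assumes "(\<lambda>i. (norm (f i))\<^sup>2) summable_on UNIV"
  shows "(\<lambda>i. (norm (c *\<^sub>C f i))\<^sup>2) summable_on UNIV"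
  using summable_on_cmult_right[OF assms, of "(cmod c)\<^sup>2"] by (simp add: norm_scaleC_hilbert power_mult_distrib)

lemma cinner_abs_summable:
  fixes f g :: "'i \<Rightarrow> 'h::chilbert_space"
  assumes "(\<lambda>i. (norm (f i))\<^sup>2) summable_on UNIV" "(\<lambda>i. (norm (g i))\<^sup>2) summable_on UNIV"
  shows "(\<lambda>i. inner (f i) (g i)) summable_on UNIV" "(\<lambda>i. cinner (f i) (g i)) summable_on UNIV"
proof -
  have in_le: "\<bar>inner x y\<bar> \<le> (norm x)\<^sup>2 + (norm y)\<^sup>2" for x y :: 'h
  proof -
    have "2 * (norm x * norm y) \<le> (norm x)\<^sup>2 + (norm y)\<^sup>2"
      using zero_le_power2[of "norm x - norm y"] by (simp add: power2_diff)
    then show ?thesis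
      using Cauchy_Schwarz_ineq2[of x y] mult_nonneg_nonneg[OF norm_ge_zero[of x] norm_ge_zero[of y]]
      by linarith
  qed
  have *: "(\<lambda>i. (norm (f i))\<^sup>2 + (norm (g i))\<^sup>2) summable_on UNIV"
    by (intro summable_on_add assms)
  have i: "(\<lambda>i. inner (u *\<^sub>C f i) (g i)) summable_on UNIV" if u: "cmod u = 1" for u
  proof (rule abs_summable_summable, rule summable_on_comparison_test[OF *])
    show "norm (inner (u *\<^sub>C f i) (g i)) \<le> (norm (f i))\<^sup>2 + (norm (g i))\<^sup>2" for i
      using in_le[of "u *\<^sub>C f i" "g i"] by (simp add: norm_scaleC_hilbert u)
  qed simp
  from i[of 1] show "(\<lambda>i. inner (f i) (g i)) summable_on UNIV" by simp
  then have "(\<lambda>i. complex_of_real (inner (f i) (g i)) + \<i> * complex_of_real (inner (\<i> *\<^sub>C f i) (g i)))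
      summable_on UNIV"
    by (intro summable_on_add summable_on_cmult_right summable_on_of_real i) simp_all
  then show "(\<lambda>i. cinner (f i) (g i)) summable_on UNIV"
    by (simp add: cinner_eq_inner Complex_eq)
qed

instantiation ell2 :: (type, chilbert_space) complex_vector
begin

lift_definition zero_ell2 :: "('a, 'b) ell2" is "\<lambda>_. 0" by simp
lift_definition plus_ell2 :: "('a, 'b) ell2 \<Rightarrow> ('a, 'b) ell2 \<Rightarrow> ('a, 'b) ell2" is "\<lambda>f g i. f i + g i"
  by (rule square_summable_add)
lift_definition uminus_ell2 :: "('a, 'b) ell2 \<Rightarrow> ('a, 'b) ell2" is "\<lambda>f i. - f i" by simp
lift_definition minus_ell2 :: "('a, 'b) ell2 \<Rightarrow> ('a, 'b) ell2 \<Rightarrow> ('a, 'b) ell2" is "\<lambda>f g i. f i - g i"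
proof -
  fix f g :: "'a \<Rightarrow> 'b"
  assume "(\<lambda>i. (norm (f i))\<^sup>2) summable_on UNIV" "(\<lambda>i. (norm (g i))\<^sup>2) summable_on UNIV"
  then show "(\<lambda>i. (norm (f i - g i))\<^sup>2) summable_on UNIV"
    using square_summable_add[of f "\<lambda>i. - g i"] by simp
qed
lift_definition scaleC_ell2 :: "complex \<Rightarrow> ('a, 'b) ell2 \<Rightarrow> ('a, 'b) ell2" is "\<lambda>c f i. c *\<^sub>C f i"
  by (rule square_summable_scaleC)
definition scaleR_ell2 :: "real \<Rightarrow> ('a, 'b) ell2 \<Rightarrow> ('a, 'b) ell2" where
  "scaleR_ell2 r f = complex_of_real r *\<^sub>C f"

instance
  by standard
     (unfold scaleR_ell2_def, (transfer, simp add: fun_eq_iff scaleC_add_right scaleC_add_left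
       scaleC_scaleC algebra_simps)+)

end

instantiation ell2 :: (type, chilbert_space) real_inner
begin

lift_definition inner_ell2 :: "('a, 'b) ell2 \<Rightarrow> ('a, 'b) ell2 \<Rightarrow> real" is
  "\<lambda>f g. \<Sum>\<^sub>\<infinity>i. inner (f i) (g i)" .
definition "norm_ell2 (f :: ('a, 'b) ell2) = sqrt (inner f f)"
definition "dist_ell2 (f :: ('a, 'b) ell2) g = norm (f - g)"
definition "sgn_ell2 (f :: ('a, 'b) ell2) = scaleR (inverse (norm f)) f"
definition [code del]: "(uniformity :: (('a, 'b) ell2 \<times> ('a, 'b) ell2) filter) =
  (INF e\<in>{0 <..}. principal {(x, y). dist x y < e})"
definition [code del]: "open_ell2 (U :: ('a, 'b) ell2 set) \<longleftrightarrow>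
  (\<forall>x\<in>U. \<forall>\<^sub>F (x', y) in uniformity. x' = x \<longrightarrow> y \<in> U)"

instance
proof
  fix f g h :: "('a, 'b) ell2" and r :: real
  show "inner f g = inner g f" by transfer (simp add: inner_commute)
  show "inner (f + g) h = inner f h + inner g h"
    by transfer (simp add: inner_add_left infsum_add cinner_abs_summable)
  show "inner (r *\<^sub>R f) g = r * inner f g"
    unfolding scaleR_ell2_def
    by transfer (simp add: scaleR_scaleC[symmetric] infsum_cmult_right')
  show "0 \<le> inner f f" by transfer (simp add: infsum_nonneg)
  show "inner f f = 0 \<longleftrightarrow> f = 0"
  proof (transfer, rule iffI)
    fix f :: "'a \<Rightarrow> 'b"
    assume s: "(\<lambda>i. (norm (f i))\<^sup>2) summable_on UNIV" and 0: "(\<Sum>\<^sub>\<infinity>i. inner (f i) (f i)) = 0"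
    have "inner (f i) (f i) = 0" for i
      by (rule nonneg_infsum_le_0D[of "\<lambda>i. inner (f i) (f i)" UNIV])
         (use s 0 in \<open>auto simp: power2_norm_eq_inner\<close>)
    then show "f = (\<lambda>_. 0)" by auto
  qed simp
qed (simp_all add: norm_ell2_def dist_ell2_def sgn_ell2_def uniformity_ell2_def open_ell2_def)

end

lemma ell2_sum_le: "finite F \<Longrightarrow> (\<Sum>i\<in>F. (norm (ell2_fun f i))\<^sup>2) \<le> (norm f)\<^sup>2"
  unfolding power2_norm_eq_inner
  by transfer (auto intro!: finite_sum_le_infsum simp: power2_norm_eq_inner)

lemma ell2_coord_le: "norm (ell2_fun f i) \<le> norm f"
  using ell2_sum_le[of "{i}" f] by (simp add: power2_le_iff_abs_le)

instance ell2 :: (type, chilbert_space) banach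
proof
  fix X :: "nat \<Rightarrow> ('a, 'b) ell2" assume X: "Cauchy X"
  have minus: "ell2_fun (f - g) i = ell2_fun f i - ell2_fun g i" for f g :: "('a, 'b) ell2" and i
    by transfer simp
  have "convergent (\<lambda>n. ell2_fun (X n) i)" for i
  proof (rule Cauchy_convergent, rule metric_CauchyI)
    fix e :: real assume "e > 0"
    then obtain N where N: "\<And>m n. m \<ge> N \<Longrightarrow> n \<ge> N \<Longrightarrow> dist (X m) (X n) < e"
      using X by (meson metric_CauchyD)
    have "dist (ell2_fun (X m) i) (ell2_fun (X n) i) < e" if "m \<ge> N" "n \<ge> N" for m n
      using ell2_coord_le[of "X m - X n" i] N[OF that] by (simp add: dist_norm minus)
    then show "\<exists>N. \<forall>m\<ge>N. \<forall>n\<ge>N. dist (ell2_fun (X m) i) (ell2_fun (X n) i) < e" by blast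
  qed
  then obtain L where L: "\<And>i. (\<lambda>n. ell2_fun (X n) i) \<longlonglongrightarrow> L i"
    unfolding convergent_def by metis
  have tail: "\<exists>N. \<forall>n\<ge>N. \<forall>F. finite F \<longrightarrow> (\<Sum>i\<in>F. (norm (ell2_fun (X n) i - L i))\<^sup>2) \<le> e\<^sup>2"
    if e: "e > 0" for e
  proof -
    obtain N where N: "\<And>m n. m \<ge> N \<Longrightarrow> n \<ge> N \<Longrightarrow> dist (X m) (X n) < e"
      using X e by (meson metric_CauchyD)
    have "(\<Sum>i\<in>F. (norm (ell2_fun (X n) i - L i))\<^sup>2) \<le> e\<^sup>2" if "n \<ge> N" "finite F" for n F
    proof (rule LIMSEQ_le_const2)
      show "(\<lambda>m. \<Sum>i\<in>F. (norm (ell2_fun (X n) i - ell2_fun (X m) i))\<^sup>2)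
          \<longlonglongrightarrow> (\<Sum>i\<in>F. (norm (ell2_fun (X n) i - L i))\<^sup>2)"
        by (intro tendsto_intros L)
      have "(\<Sum>i\<in>F. (norm (ell2_fun (X n) i - ell2_fun (X m) i))\<^sup>2) \<le> e\<^sup>2" if "m \<ge> N" for m
      proof -
        have "(norm (X n - X m))\<^sup>2 \<le> e\<^sup>2"
          using N[OF \<open>n \<ge> N\<close> that] by (intro power_mono) (auto simp: dist_norm)
        then show ?thesis using ell2_sum_le[OF \<open>finite F\<close>, of "X n - X m"] by (simp add: minus)
      qed
      then show "\<exists>N. \<forall>m\<ge>N. (\<Sum>i\<in>F. (norm (ell2_fun (X n) i - ell2_fun (X m) i))\<^sup>2) \<le> e\<^sup>2" by blast
    qed
    then show ?thesis by blast
  qed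
  have diff: "(\<lambda>i. (norm (ell2_fun (X n) i - L i))\<^sup>2) summable_on UNIV"
    if "\<And>F. finite F \<Longrightarrow> (\<Sum>i\<in>F. (norm (ell2_fun (X n) i - L i))\<^sup>2) \<le> e\<^sup>2" for n e
    by (rule nonneg_bdd_above_summable_on) (use that in \<open>auto intro!: bdd_aboveI2\<close>)
  have Lsum: "(\<lambda>i. (norm (L i))\<^sup>2) summable_on UNIV"
  proof -
    obtain N where "\<And>F. finite F \<Longrightarrow> (\<Sum>i\<in>F. (norm (ell2_fun (X N) i - L i))\<^sup>2) \<le> 1\<^sup>2"
      using tail[of 1] by auto
    from diff[OF this] have "(\<lambda>i. (norm (L i - ell2_fun (X N) i))\<^sup>2) summable_on UNIV"
      by (simp add: norm_minus_commute)
    from square_summable_add[OF this, of "ell2_fun (X N)"] ell2_fun[of "X N"] show ?thesis by simp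
  qed
  have "X \<longlonglongrightarrow> Ell2 L"
  proof (rule metric_LIMSEQ_I)
    fix r :: real assume "r > 0"
    then obtain N where N: "\<And>n F. n \<ge> N \<Longrightarrow> finite F \<Longrightarrow>
        (\<Sum>i\<in>F. (norm (ell2_fun (X n) i - L i))\<^sup>2) \<le> (r / 2)\<^sup>2"
      using tail[of "r / 2"] by auto
    have "dist (X n) (Ell2 L) < r" if "n \<ge> N" for n
    proof -
      have fn: "ell2_fun (X n - Ell2 L) i = ell2_fun (X n) i - L i" for i
        by (simp add: minus Ell2_inverse Lsum)
      have "(norm (X n - Ell2 L))\<^sup>2 = (\<Sum>\<^sub>\<infinity>i. (norm (ell2_fun (X n) i - L i))\<^sup>2)"
        unfolding power2_norm_eq_inner inner_ell2.rep_eq fn ..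
      also have "\<dots> \<le> (r / 2)\<^sup>2"
        by (rule infsum_le_finite_sums[OF diff[OF N[OF that]]]) (use N[OF that] in auto)
      finally have "norm (X n - Ell2 L) \<le> r / 2" using \<open>r > 0\<close> by (simp add: power2_le_iff_abs_le)
      then show ?thesis using \<open>r > 0\<close> by (simp add: dist_norm)
    qed
    then show "\<exists>N. \<forall>n\<ge>N. dist (X n) (Ell2 L) < r" by blast
  qed
  then show "convergent X" by (auto simp: convergent_def)
qed

instantiation ell2 :: (type, chilbert_space) chilbert_space
begin

lift_definition cinner_ell2 :: "('a, 'b) ell2 \<Rightarrow> ('a, 'b) ell2 \<Rightarrow> complex" is
  "\<lambda>f g. \<Sum>\<^sub>\<infinity>i. cinner (f i) (g i)" .

instance
proof
  fix f g h :: "('a, 'b) ell2" and c :: complex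
  show "cinner f g = cnj (cinner g f)"
    by transfer (unfold infsum_cnj[symmetric], rule infsum_cong, rule cinner_commute)
  show "cinner f (g + h) = cinner f g + cinner f h"
    by transfer (simp add: cinner_add_right infsum_add cinner_abs_summable)
  show "cinner f (c *\<^sub>C g) = c * cinner f g"
    by transfer (simp add: cinner_scaleC_right infsum_cmult_right')
  show "inner f g = Re (cinner f g)"
    by transfer (subst infsum_Re[symmetric], simp_all add: cinner_abs_summable inner_eq_Re_cinner)
qed

end

lift_definition ket :: "'i \<Rightarrow> ('i, complex) ell2" is "\<lambda>i j. if j = i then 1 else 0"
proof -
  fix i :: 'i
  have "(\<lambda>j. (norm (if j = i then 1 else 0 :: complex))\<^sup>2) summable_on {i}" by simp
  then show "(\<lambda>j. (norm (if j = i then 1 else 0 :: complex))\<^sup>2) summable_on UNIV"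
    by (rule summable_on_cong_neutral[THEN iffD1, rotated -1]) auto
qed

lift_definition tensor_vec :: "'h::chilbert_space \<Rightarrow> ('i, complex) ell2 \<Rightarrow> ('i, 'h) ell2"
  (infixr \<open>\<otimes>\<^sub>v\<close> 76) is "\<lambda>x v i. v i *\<^sub>C x"
  by (simp add: norm_scaleC_hilbert power_mult_distrib summable_on_cmult_left)

definition creation :: "'h::chilbert_space \<Rightarrow> ('i, complex) ell2 \<Rightarrow>\<^sub>L ('i, 'h) ell2" where
  "creation x = Blinfun (\<lambda>v. x \<otimes>\<^sub>v v)"

text \<open>The operators below are specified by their values on a total set; for complex linear bounded
  \<open>S\<close> and \<open>T\<close> the operator \<open>S \<otimes> T\<close> exists and is unique.\<close>

definition tensor_blinfun ::
  "('v::chilbert_space \<Rightarrow>\<^sub>L 'w::chilbert_space) \<Rightarrow> (('i, complex) ell2 \<Rightarrow>\<^sub>L ('i, complex) ell2)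
    \<Rightarrow> ('i, 'v) ell2 \<Rightarrow>\<^sub>L ('i, 'w) ell2"  (infixr \<open>\<otimes>\<^sub>L\<close> 76) where
  "S \<otimes>\<^sub>L T = (THE R. \<forall>x v. blinfun_apply R (x \<otimes>\<^sub>v v) = S x \<otimes>\<^sub>v T v)"

definition tensor_bop ::
  "'h::chilbert_space bop \<Rightarrow> ('i, complex) ell2 bop \<Rightarrow> ('i, 'h) ell2 bop"  (infixr \<open>\<otimes>\<^sub>b\<close> 76) where
  "S \<otimes>\<^sub>b T = (THE R. \<forall>x v. R \<cdot> (x \<otimes>\<^sub>v v) = (S \<cdot> x) \<otimes>\<^sub>v (T \<cdot> v))"

definition bop_on_basis :: "('i \<Rightarrow> ('i, complex) ell2) \<Rightarrow> ('i, complex) ell2 bop" where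
  "bop_on_basis f = (THE R. \<forall>i. R \<cdot> ket i = f i)"

section \<open>C*-algebras, representations and tensor products\<close>

text \<open>C*-algebras are closed *-subalgebras of an ambient type of class \<^class>\<open>cstar_algebra\<close>,
  possibly the whole type. The unit of such an algebra need not be the one of the ambient type, and
  representations are not required to be unital.\<close>

definition star_subalgebra :: "'a::cstar_algebra set \<Rightarrow> bool" where
  "star_subalgebra B \<longleftrightarrow> csubspace B \<and> (\<forall>x\<in>B. \<forall>y\<in>B. x * y \<in> B) \<and> (\<forall>x\<in>B. star x \<in> B)"

definition is_unit_of :: "'a::cstar_algebra set \<Rightarrow> 'a \<Rightarrow> bool" where
  "is_unit_of B e \<longleftrightarrow> e \<in> B \<and> (\<forall>b\<in>B. e * b = b \<and> b * e = b)"

definition unit_of :: "'a::cstar_algebra set \<Rightarrow> 'a" where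
  "unit_of B = (THE e. is_unit_of B e)"

definition unital_cstar_subalgebra :: "'a::cstar_algebra set \<Rightarrow> bool" where
  "unital_cstar_subalgebra B \<longleftrightarrow> star_subalgebra B \<and> closed B \<and> (\<exists>e. is_unit_of B e)"

definition star_hom :: "'a::cstar_algebra set \<Rightarrow> 'b::cstar_algebra set \<Rightarrow> ('a \<Rightarrow> 'b) \<Rightarrow> bool" where
  "star_hom A B \<phi> \<longleftrightarrow> \<phi> ` A \<subseteq> B \<and>
     (\<forall>x\<in>A. \<forall>y\<in>A. \<phi> (x + y) = \<phi> x + \<phi> y \<and> \<phi> (x * y) = \<phi> x * \<phi> y) \<and>
     (\<forall>x\<in>A. (\<forall>c. \<phi> (c *\<^sub>C x) = c *\<^sub>C \<phi> x) \<and> \<phi> (star x) = star (\<phi> x))"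

definition commutant :: "'h::chilbert_space bop set \<Rightarrow> 'h bop set" where
  "commutant S = {T. \<forall>s\<in>S. T * s = s * T}"

definition state :: "'a::cstar_algebra set \<Rightarrow> ('a \<Rightarrow> complex) \<Rightarrow> bool" where
  "state C \<phi> \<longleftrightarrow> (\<forall>x\<in>C. \<forall>y\<in>C. \<phi> (x + y) = \<phi> x + \<phi> y) \<and> (\<forall>x\<in>C. \<forall>c. \<phi> (c *\<^sub>C x) = c * \<phi> x) \<and>
     (\<forall>x\<in>C. \<phi> (star x * x) \<in> \<real>\<^sub>\<ge>\<^sub>0) \<and> \<phi> (unit_of C) = 1"

text \<open>The spatial (minimal) tensor product.\<close>

definition min_tensor ::
  "'h::chilbert_space bop set \<Rightarrow> ('i, complex) ell2 bop set \<Rightarrow> ('i, 'h) ell2 bop set"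
  (infixr \<open>\<otimes>\<^sub>m\<^sub>i\<^sub>n\<close> 76) where
  "B \<otimes>\<^sub>m\<^sub>i\<^sub>n C = closure (cspan {b \<otimes>\<^sub>b c | b c. b \<in> B \<and> c \<in> C})"

section \<open>Unbounded operators\<close>

text \<open>An unbounded operator is represented by its graph.\<close>

type_synonym 'h unbounded_op = "('h \<times> 'h) set"

definition bop_graph :: "'h::chilbert_space bop \<Rightarrow> 'h unbounded_op" where
  "bop_graph T = {(x, T \<cdot> x) | x. True}"

definition adjoint_op :: "'h::chilbert_space unbounded_op \<Rightarrow> 'h unbounded_op" where
  "adjoint_op D = {(y, z). \<forall>(x, w)\<in>D. cinner y w = cinner z x}"

definition self_adjoint_op :: "'h::chilbert_space unbounded_op \<Rightarrow> bool" where
  "self_adjoint_op D \<longleftrightarrow> csubspace D \<and> single_valued D \<and> closure (Domain D) = UNIV \<and> adjoint_op D = D"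

definition sum_op :: "'h::chilbert_space unbounded_op \<Rightarrow> 'h unbounded_op \<Rightarrow> 'h unbounded_op" where
  "sum_op S T = {(x, y + z) | x y z. (x, y) \<in> S \<and> (x, z) \<in> T}"

definition commutator_bounded :: "'h::chilbert_space unbounded_op \<Rightarrow> 'h bop \<Rightarrow> bool" where
  "commutator_bounded D T \<longleftrightarrow>
     (\<exists>M. \<forall>x y z. (x, y) \<in> D \<longrightarrow> (T \<cdot> x, z) \<in> D \<longrightarrow> norm (z - T \<cdot> y) \<le> M * norm x)"

definition positive_bop :: "'h::chilbert_space bop \<Rightarrow> bool" where
  "positive_bop S \<longleftrightarrow> (\<forall>x. cinner x (S \<cdot> x) \<in> \<real>\<^sub>\<ge>\<^sub>0)"

definition compact_bop :: "'h::chilbert_space bop \<Rightarrow> bool" where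
  "compact_bop S \<longleftrightarrow> compact (closure ((\<lambda>x. S \<cdot> x) ` cball 0 1))"

text \<open>\<open>S = (1 + D^2)^(-1/2)\<close>: the positive square root of the inverse of \<open>1 + D\<^sup>2\<close>.\<close>

definition is_inv_sqrt_one_plus_square :: "'h::chilbert_space unbounded_op \<Rightarrow> 'h bop \<Rightarrow> bool" where
  "is_inv_sqrt_one_plus_square D S \<longleftrightarrow>
     positive_bop S \<and> bop_graph (S * S) = (sum_op Id (D O D))\<inverse>"

text \<open>The closure of the algebraic tensor product of two operators.\<close>

definition tensor_op ::
  "'h::chilbert_space unbounded_op \<Rightarrow> ('i, complex) ell2 unbounded_op \<Rightarrow> ('i, 'h) ell2 unbounded_op"
  (infixr \<open>\<otimes>\<^sub>u\<close> 76) where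
  "D \<otimes>\<^sub>u T = closure (cspan {(x \<otimes>\<^sub>v v, y \<otimes>\<^sub>v w) | x y v w. (x, y) \<in> D \<and> (v, w) \<in> T})"

definition mult_op :: "('i \<Rightarrow> real) \<Rightarrow> ('i, complex) ell2 unbounded_op" where
  "mult_op l = {(v, w). \<forall>x. ell2_fun w x = complex_of_real (l x) * ell2_fun v x}"

section \<open>Spectral triples\<close>

definition odd_spectral_triple ::
  "'a::cstar_algebra set \<Rightarrow> 'a set \<Rightarrow> ('a \<Rightarrow> 'h::chilbert_space bop) \<Rightarrow> 'h unbounded_op \<Rightarrow> bool" where
  "odd_spectral_triple A \<A> \<pi> D \<longleftrightarrow>
     unital_cstar_subalgebra A \<and> star_subalgebra \<A> \<and> \<A> \<subseteq> A \<and> A \<subseteq> closure \<A> \<and>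
     star_hom A UNIV \<pi> \<and> self_adjoint_op D \<and>
     (\<exists>S. is_inv_sqrt_one_plus_square D S \<and> compact_bop S) \<and>
     (\<forall>a\<in>\<A>. (\<lambda>x. \<pi> a \<cdot> x) ` Domain D \<subseteq> Domain D \<and> commutator_bounded D (\<pi> a))"

definition even_spectral_triple ::
  "'a::cstar_algebra set \<Rightarrow> 'a set \<Rightarrow> ('a \<Rightarrow> 'h::chilbert_space bop) \<Rightarrow> 'h unbounded_op \<Rightarrow> 'h bop \<Rightarrow> bool" where
  "even_spectral_triple A \<A> \<pi> D \<gamma> \<longleftrightarrow>
     odd_spectral_triple A \<A> \<pi> D \<and> star \<gamma> = \<gamma> \<and> \<gamma> * \<gamma> = 1 \<and> (\<forall>a\<in>A. \<gamma> * \<pi> a = \<pi> a * \<gamma>) \<and>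
     (\<lambda>x. \<gamma> \<cdot> x) ` Domain D \<subseteq> Domain D \<and> (\<forall>(x, y)\<in>D. (\<gamma> \<cdot> x, - (\<gamma> \<cdot> y)) \<in> D)"

section \<open>Group actions\<close>

text \<open>A discrete group is a type \<open>'g\<close> of class \<^class>\<open>group_add\<close>, which is not assumed to be
  commutative: the product \<open>g h\<close> is written \<open>g + h\<close>, the inverse \<open>- g\<close> and the unit \<open>0\<close>.\<close>

definition cstar_action :: "('g::group_add \<Rightarrow> 'a::cstar_algebra \<Rightarrow> 'a) \<Rightarrow> bool" where
  "cstar_action \<alpha> \<longleftrightarrow> \<alpha> 0 = id \<and> (\<forall>g h. \<alpha> (g + h) = \<alpha> g \<circ> \<alpha> h) \<and>
     (\<forall>g. bij (\<alpha> g) \<and> star_hom UNIV UNIV (\<alpha> g))"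

definition unitary_rep :: "('g::group_add \<Rightarrow> 'h::chilbert_space bop) \<Rightarrow> bool" where
  "unitary_rep u \<longleftrightarrow> u 0 = 1 \<and> (\<forall>g h. u (g + h) = u g * u h) \<and>
     (\<forall>g. star (u g) * u g = 1 \<and> u g * star (u g) = 1)"

definition equivariant_via ::
  "('g::group_add \<Rightarrow> 'a::cstar_algebra \<Rightarrow> 'a) \<Rightarrow> ('a \<Rightarrow> 'h::chilbert_space bop) \<Rightarrow> 'h unbounded_op
    \<Rightarrow> ('g \<Rightarrow> 'h bop) \<Rightarrow> bool" where
  "equivariant_via \<alpha> \<pi> D u \<longleftrightarrow> unitary_rep u \<and>
     (\<forall>g a. u g * \<pi> a * star (u g) = \<pi> (\<alpha> g a)) \<and>
     (\<forall>g. (\<lambda>x. u g \<cdot> x) ` Domain D \<subseteq> Domain D \<and> commutator_bounded D (u g))"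

definition proper_weight :: "('g \<Rightarrow> real) \<Rightarrow> bool" where
  "proper_weight l \<longleftrightarrow> (\<forall>m::nat. finite {g. - real m \<le> l g \<and> l g \<le> real m})"

definition dirac_weight :: "('g::group_add \<Rightarrow> real) \<Rightarrow> bool" where
  "dirac_weight l \<longleftrightarrow> (\<forall>g. bounded (range (\<lambda>x. l x - l (- g + x))))"

section \<open>The reduced group C*-algebra and reduced crossed products\<close>

definition lshift :: "'g::group_add \<Rightarrow> ('g, complex) ell2 bop" where
  "lshift g = bop_on_basis (\<lambda>x. ket (g + x))"

definition Cred :: "('g::group_add, complex) ell2 bop set" where
  "Cred = closure (cspan (range lshift))"

definition comult :: "('g::group_add, complex) ell2 bop \<Rightarrow> ('g, ('g, complex) ell2) ell2 bop" where
  "comult = (THE \<Delta>. \<Delta> \<in> extensional Cred \<and> star_hom Cred (Cred \<otimes>\<^sub>m\<^sub>i\<^sub>n Cred) \<Delta> \<and>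
     (\<forall>g. \<Delta> (lshift g) = lshift g \<otimes>\<^sub>b lshift g))"

text \<open>The regular representation of the crossed product on \<open>H \<otimes> l2(G)\<close> induced by \<open>\<pi>\<close>. The
  reduced crossed product is its image, for faithful \<open>\<pi>\<close>.\<close>

definition reg_alg ::
  "('g::group_add \<Rightarrow> 'a \<Rightarrow> 'a) \<Rightarrow> ('a \<Rightarrow> 'h::chilbert_space bop) \<Rightarrow> 'a \<Rightarrow> ('g, 'h) ell2 bop" where
  "reg_alg \<alpha> \<pi> a = (THE R. \<forall>\<xi> x. R \<cdot> (\<xi> \<otimes>\<^sub>v ket x) = (\<pi> (\<alpha> (- x) a) \<cdot> \<xi>) \<otimes>\<^sub>v ket x)"

definition reg_elt ::
  "('g::group_add \<Rightarrow> 'a \<Rightarrow> 'a) \<Rightarrow> ('a \<Rightarrow> 'h::chilbert_space bop) \<Rightarrow> 'a \<Rightarrow> 'g \<Rightarrow> ('g, 'h) ell2 bop" where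
  "reg_elt \<alpha> \<pi> a g = reg_alg \<alpha> \<pi> a * (1 \<otimes>\<^sub>b lshift g)"

definition Cc ::
  "('g::group_add \<Rightarrow> 'a \<Rightarrow> 'a) \<Rightarrow> ('a \<Rightarrow> 'h::chilbert_space bop) \<Rightarrow> 'a set \<Rightarrow> ('g, 'h) ell2 bop set" where
  "Cc \<alpha> \<pi> \<A> = {\<Sum>g\<in>F. reg_elt \<alpha> \<pi> (a g) g | F a. finite F \<and> a ` F \<subseteq> \<A>}"

definition crossed_product ::
  "('g::group_add \<Rightarrow> 'a \<Rightarrow> 'a) \<Rightarrow> ('a \<Rightarrow> 'h::chilbert_space bop) \<Rightarrow> ('g, 'h) ell2 bop set" where
  "crossed_product \<alpha> \<pi> = closure (Cc \<alpha> \<pi> UNIV)"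

definition dual_coaction ::
  "('g::group_add \<Rightarrow> 'a \<Rightarrow> 'a) \<Rightarrow> ('a \<Rightarrow> 'h::chilbert_space bop)
    \<Rightarrow> ('g, 'h) ell2 bop \<Rightarrow> ('g, ('g, 'h) ell2) ell2 bop" where
  "dual_coaction \<alpha> \<pi> = (THE \<theta>. \<theta> \<in> extensional (crossed_product \<alpha> \<pi>) \<and>
     star_hom (crossed_product \<alpha> \<pi>) (crossed_product \<alpha> \<pi> \<otimes>\<^sub>m\<^sub>i\<^sub>n Cred) \<theta> \<and>
     (\<forall>a g. \<theta> (reg_elt \<alpha> \<pi> a g) = reg_elt \<alpha> \<pi> a g \<otimes>\<^sub>b lshift g))"

section \<open>Coactions\<close>

text \<open>\<open>tensor_id B \<phi>\<close> is the *-homomorphism \<open>\<phi> \<otimes> id\<close> on \<open>B \<otimes> C*\<^sub>r(G)\<close>.\<close>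

definition tensor_id ::
  "'l::chilbert_space bop set \<Rightarrow> ('l bop \<Rightarrow> 'k::chilbert_space bop)
    \<Rightarrow> ('g::group_add, 'l) ell2 bop \<Rightarrow> ('g, 'k) ell2 bop" where
  "tensor_id B \<phi> = (THE \<Phi>. \<Phi> \<in> extensional (B \<otimes>\<^sub>m\<^sub>i\<^sub>n Cred) \<and> star_hom (B \<otimes>\<^sub>m\<^sub>i\<^sub>n Cred) UNIV \<Phi> \<and>
     (\<forall>b\<in>B. \<forall>c\<in>Cred. \<Phi> (b \<otimes>\<^sub>b c) = \<phi> b \<otimes>\<^sub>b c))"

text \<open>Under \<open>L \<otimes> (l2(G) \<otimes> l2(G)) = (L \<otimes> l2(G)) \<otimes> l2(G)\<close> the operator \<open>x \<otimes> -\<close> is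
  \<open>creation x \<otimes>\<^sub>L id\<close>; \<open>tensor_bop23 b R\<close> is \<open>b \<otimes> R\<close>, where \<open>R\<close> acts on \<open>l2(G) \<otimes> l2(G)\<close>.\<close>

definition tensor_bop23 ::
  "'l::chilbert_space bop \<Rightarrow> ('g, ('g, complex) ell2) ell2 bop \<Rightarrow> ('g, ('g, 'l) ell2) ell2 bop" where
  "tensor_bop23 b R = (THE T. \<forall>x w. T \<cdot> ((creation x \<otimes>\<^sub>L id_blinfun) w)
                                   = (creation (b \<cdot> x) \<otimes>\<^sub>L id_blinfun) (R \<cdot> w))"

definition id_comult ::
  "'l::chilbert_space bop set \<Rightarrow> ('g::group_add, 'l) ell2 bop \<Rightarrow> ('g, ('g, 'l) ell2) ell2 bop" where
  "id_comult B = (THE \<Phi>. \<Phi> \<in> extensional (B \<otimes>\<^sub>m\<^sub>i\<^sub>n Cred) \<and> star_hom (B \<otimes>\<^sub>m\<^sub>i\<^sub>n Cred) UNIV \<Phi> \<and>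
     (\<forall>b\<in>B. \<forall>c\<in>Cred. \<Phi> (b \<otimes>\<^sub>b c) = tensor_bop23 b (comult c)))"

definition coaction ::
  "'l::chilbert_space bop set \<Rightarrow> ('l bop \<Rightarrow> ('g::group_add, 'l) ell2 bop) \<Rightarrow> bool" where
  "coaction B \<theta> \<longleftrightarrow> unital_cstar_subalgebra B \<and>
     star_hom B (B \<otimes>\<^sub>m\<^sub>i\<^sub>n Cred) \<theta> \<and> \<theta> (unit_of B) = unit_of (B \<otimes>\<^sub>m\<^sub>i\<^sub>n Cred) \<and>
     (\<forall>b\<in>B. tensor_id B \<theta> (\<theta> b) = id_comult B (\<theta> b)) \<and>
     closure (cspan {\<theta> a * (unit_of B \<otimes>\<^sub>b c) | a c. a \<in> B \<and> c \<in> Cred}) = B \<otimes>\<^sub>m\<^sub>i\<^sub>n Cred"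

section \<open>Unitary corepresentations\<close>

text \<open>The exterior tensor product Hilbert module \<open>K \<otimes> C*\<^sub>r(G)\<close> is realised as a norm closed space of
  bounded operators from \<open>l2(G)\<close> to \<open>K \<otimes> l2(G)\<close>, the elementary tensor \<open>x \<otimes> q\<close> being the operator
  \<open>v \<mapsto> x \<otimes> q v\<close>. The right action of \<open>C*\<^sub>r(G)\<close> is composition on the right, and
  the \<open>C*\<^sub>r(G)\<close>-valued inner product of \<open>S\<close> and \<open>T\<close> is \<open>S* T\<close>. The operator norm is the module norm.\<close>

definition mod_tensor ::
  "'k::chilbert_space \<Rightarrow> ('g, complex) ell2 bop \<Rightarrow> ('g, complex) ell2 \<Rightarrow>\<^sub>L ('g, 'k) ell2" where
  "mod_tensor x q = creation x o\<^sub>L bop_blinfun q"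

definition hmod :: "(('g::group_add, complex) ell2 \<Rightarrow>\<^sub>L ('g, 'k::chilbert_space) ell2) set" where
  "hmod = closure (cspan {mod_tensor x q | x q. q \<in> Cred})"

definition mod_inner ::
  "('v::chilbert_space \<Rightarrow>\<^sub>L 'w::chilbert_space) \<Rightarrow> ('v \<Rightarrow>\<^sub>L 'w) \<Rightarrow> 'v bop" where
  "mod_inner S T = (THE q. \<forall>v w. cinner v (q \<cdot> w) = cinner (S v) (T w))"

definition bounded_clinear_on :: "'a set \<Rightarrow> ('a::{complex_vector, real_normed_vector}
    \<Rightarrow> 'b::{complex_vector, real_normed_vector}) \<Rightarrow> bool" where
  "bounded_clinear_on E f \<longleftrightarrow> (\<forall>x\<in>E. \<forall>y\<in>E. f (x + y) = f x + f y) \<and>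
     (\<forall>x\<in>E. \<forall>c. f (c *\<^sub>C x) = c *\<^sub>C f x) \<and> (\<exists>M. \<forall>x\<in>E. norm (f x) \<le> M * norm x)"

text \<open>The maps \<open>\<Theta> \<otimes> id\<close> and \<open>id \<otimes> \<Delta>\<close> from \<open>K \<otimes> C*\<^sub>r(G)\<close> to \<open>K \<otimes> C*\<^sub>r(G) \<otimes> C*\<^sub>r(G)\<close>, whose elements
  are operators from \<open>l2(G) \<otimes> l2(G)\<close> to \<open>K \<otimes> l2(G) \<otimes> l2(G)\<close>.\<close>

definition corep_tensor_id ::
  "('k::chilbert_space \<Rightarrow> ('g::group_add, complex) ell2 \<Rightarrow>\<^sub>L ('g, 'k) ell2)
    \<Rightarrow> (('g, complex) ell2 \<Rightarrow>\<^sub>L ('g, 'k) ell2)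
    \<Rightarrow> ('g, ('g, complex) ell2) ell2 \<Rightarrow>\<^sub>L ('g, ('g, 'k) ell2) ell2" where
  "corep_tensor_id \<Theta> = (THE \<Phi>. \<Phi> \<in> extensional hmod \<and> bounded_clinear_on hmod \<Phi> \<and>
     (\<forall>x. \<forall>q\<in>Cred. \<Phi> (mod_tensor x q) = \<Theta> x \<otimes>\<^sub>L bop_blinfun q))"

definition mod_id_comult ::
  "(('g::group_add, complex) ell2 \<Rightarrow>\<^sub>L ('g, 'k::chilbert_space) ell2)
    \<Rightarrow> ('g, ('g, complex) ell2) ell2 \<Rightarrow>\<^sub>L ('g, ('g, 'k) ell2) ell2" where
  "mod_id_comult = (THE \<Phi>. \<Phi> \<in> extensional hmod \<and> bounded_clinear_on hmod \<Phi> \<and>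
     (\<forall>x. \<forall>q\<in>Cred. \<Phi> (mod_tensor x q) = (creation x \<otimes>\<^sub>L id_blinfun) o\<^sub>L bop_blinfun (comult q)))"

definition unitary_corep ::
  "('k::chilbert_space \<Rightarrow> ('g::group_add, complex) ell2 \<Rightarrow>\<^sub>L ('g, 'k) ell2) \<Rightarrow> bool" where
  "unitary_corep \<Theta> \<longleftrightarrow> is_clinear \<Theta> \<and> range \<Theta> \<subseteq> hmod \<and>
     (\<forall>x. corep_tensor_id \<Theta> (\<Theta> x) = mod_id_comult (\<Theta> x)) \<and>
     closure (cspan {\<Theta> x o\<^sub>L bop_blinfun q | x q. q \<in> Cred}) = hmod \<and>
     (\<forall>x y. mod_inner (\<Theta> x) (\<Theta> y) = cinner x y *\<^sub>C 1)"

definition mod_adjoint_pair ::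
  "((('g::group_add, complex) ell2 \<Rightarrow>\<^sub>L ('g, 'k::chilbert_space) ell2) \<Rightarrow> ('g, complex) ell2 \<Rightarrow>\<^sub>L ('g, 'k) ell2)
    \<Rightarrow> ((('g, complex) ell2 \<Rightarrow>\<^sub>L ('g, 'k) ell2) \<Rightarrow> ('g, complex) ell2 \<Rightarrow>\<^sub>L ('g, 'k) ell2) \<Rightarrow> bool" where
  "mod_adjoint_pair X Y \<longleftrightarrow> X ` hmod \<subseteq> hmod \<and> Y ` hmod \<subseteq> hmod \<and>
     (\<forall>S\<in>hmod. \<forall>T\<in>hmod. mod_inner (X S) T = mod_inner S (Y T))"

text \<open>\<open>X\<close> is a unitary in \<open>L(K \<otimes> C*\<^sub>r(G))\<close> with adjoint \<open>Y\<close>, and is the operator form of \<open>\<Theta>\<close>.\<close>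

definition operator_form ::
  "('k::chilbert_space \<Rightarrow> ('g::group_add, complex) ell2 \<Rightarrow>\<^sub>L ('g, 'k) ell2)
    \<Rightarrow> ((('g, complex) ell2 \<Rightarrow>\<^sub>L ('g, 'k) ell2) \<Rightarrow> ('g, complex) ell2 \<Rightarrow>\<^sub>L ('g, 'k) ell2)
    \<Rightarrow> ((('g, complex) ell2 \<Rightarrow>\<^sub>L ('g, 'k) ell2) \<Rightarrow> ('g, complex) ell2 \<Rightarrow>\<^sub>L ('g, 'k) ell2) \<Rightarrow> bool" where
  "operator_form \<Theta> X Y \<longleftrightarrow> mod_adjoint_pair X Y \<and>
     (\<forall>S\<in>hmod. Y (X S) = S \<and> X (Y S) = S) \<and>
     (\<forall>x. \<forall>q\<in>Cred. X (mod_tensor x q) = \<Theta> x o\<^sub>L bop_blinfun q)"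

text \<open>The graph of \<open>D \<otimes> 1\<close> on the Hilbert module \<open>K \<otimes> C*\<^sub>r(G)\<close>.\<close>

definition mod_op :: "'k::chilbert_space unbounded_op \<Rightarrow>
    ((('g::group_add, complex) ell2 \<Rightarrow>\<^sub>L ('g, 'k) ell2) \<times> (('g, complex) ell2 \<Rightarrow>\<^sub>L ('g, 'k) ell2)) set" where
  "mod_op D = closure (cspan {(mod_tensor x q, mod_tensor y q) | x y q. (x, y) \<in> D \<and> q \<in> Cred})"

text \<open>The slice map \<open>id \<otimes> \<phi>\<close> on \<open>L(K \<otimes> C*\<^sub>r(G))\<close>, determined by
  \<open>\<langle>x, (id \<otimes> \<phi>)(T) y\<rangle> = \<phi>(\<langle>x \<otimes> 1, T (y \<otimes> 1)\<rangle>)\<close>.\<close>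

definition slice :: "(('g::group_add, complex) ell2 bop \<Rightarrow> complex)
    \<Rightarrow> ((('g, complex) ell2 \<Rightarrow>\<^sub>L ('g, 'k::chilbert_space) ell2) \<Rightarrow> ('g, complex) ell2 \<Rightarrow>\<^sub>L ('g, 'k) ell2)
    \<Rightarrow> 'k bop" where
  "slice \<phi> T = (THE S. \<forall>x y. cinner x (S \<cdot> y) = \<phi> (mod_inner (mod_tensor x 1) (T (mod_tensor y 1))))"

text \<open>For \<open>T\<close> on \<open>K\<close>, the operator \<open>T \<otimes> 1\<close> on \<open>K \<otimes> C*\<^sub>r(G)\<close> is composition with \<open>T \<otimes>\<^sub>b 1\<close> on the left.
  More generally \<open>tensor_id B \<rho>\<close> lets \<open>B \<otimes> C*\<^sub>r(G)\<close> act on \<open>K \<otimes> C*\<^sub>r(G)\<close>, where \<open>\<rho>\<close> is the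
  representation of \<open>B\<close> on \<open>K\<close>, so that in Sweedler notation
  \<open>b(-1) \<triangleright> x(-1) \<otimes> b(0) x(0)\<close> is \<open>(\<rho> \<otimes> id)(\<theta> b)\<close> applied to \<open>\<Theta> x\<close>.\<close>

definition coaction_equivariant ::
  "'l::chilbert_space bop set \<Rightarrow> ('l bop \<Rightarrow> 'k::chilbert_space bop) \<Rightarrow> 'k unbounded_op \<Rightarrow> 'k bop
    \<Rightarrow> ('l bop \<Rightarrow> ('g::group_add, 'l) ell2 bop) \<Rightarrow> bool" where
  "coaction_equivariant B \<rho> D \<gamma> \<theta> \<longleftrightarrow> coaction B \<theta> \<and>
     (\<exists>W \<Theta> X Y. csubspace W \<and> closure W = UNIV \<and> unitary_corep \<Theta> \<and> operator_form \<Theta> X Y \<and>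
        (\<forall>b\<in>B. (\<lambda>x. \<rho> b \<cdot> x) ` W \<subseteq> W) \<and>
        (\<forall>b\<in>B. \<forall>x. \<Theta> (\<rho> b \<cdot> x) = bop_blinfun (tensor_id B \<rho> (\<theta> b)) o\<^sub>L \<Theta> x) \<and>
        map_prod X X ` mod_op D = mod_op D \<and>
        (\<forall>S\<in>hmod. X (bop_blinfun (\<gamma> \<otimes>\<^sub>b 1) o\<^sub>L S) = bop_blinfun (\<gamma> \<otimes>\<^sub>b 1) o\<^sub>L X S) \<and>
        (\<forall>b\<in>B. \<forall>\<phi>. state Cred \<phi> \<longrightarrow>
           slice \<phi> (\<lambda>S. X (bop_blinfun (\<rho> b \<otimes>\<^sub>b 1) o\<^sub>L Y S)) \<in> commutant (commutant (\<rho> ` B))))"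

section \<open>The spectral triple on the crossed product\<close>

definition pauli1 :: "(bool, complex) ell2 bop" where
  "pauli1 = bop_on_basis (\<lambda>i. ket (\<not> i))"

definition pauli2 :: "(bool, complex) ell2 bop" where
  "pauli2 = bop_on_basis (\<lambda>i. (if i then - \<i> else \<i>) *\<^sub>C ket (\<not> i))"

definition pauli3 :: "(bool, complex) ell2 bop" where
  "pauli3 = bop_on_basis (\<lambda>i. (if i then - 1 else 1) *\<^sub>C ket i)"

text \<open>The two summands anticommute, so that their sum is closed on the intersection of the domains.\<close>

definition dirac_hat ::
  "'h::chilbert_space unbounded_op \<Rightarrow> ('g \<Rightarrow> real) \<Rightarrow> (bool, ('g, 'h) ell2) ell2 unbounded_op" where
  "dirac_hat D l = sum_op ((D \<otimes>\<^sub>u Id) \<otimes>\<^sub>u bop_graph pauli1) ((Id \<otimes>\<^sub>u mult_op l) \<otimes>\<^sub>u bop_graph pauli2)"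

definition grading_hat :: "(bool, ('g, 'h::chilbert_space) ell2) ell2 bop" where
  "grading_hat = 1 \<otimes>\<^sub>b pauli3"

definition rep_hat ::
  "('g::group_add \<Rightarrow> 'a \<Rightarrow> 'a) \<Rightarrow> ('a \<Rightarrow> 'h::chilbert_space bop) \<Rightarrow> ('g \<Rightarrow> 'h bop)
    \<Rightarrow> ('g, 'h) ell2 bop \<Rightarrow> (bool, ('g, 'h) ell2) ell2 bop" where
  "rep_hat \<alpha> \<pi> u = (THE \<rho>. \<rho> \<in> extensional (crossed_product \<alpha> \<pi>) \<and>
     star_hom (crossed_product \<alpha> \<pi>) UNIV \<rho> \<and>
     (\<forall>a h. \<rho> (reg_elt \<alpha> \<pi> a h) = ((\<pi> a \<otimes>\<^sub>b 1) * (u h \<otimes>\<^sub>b lshift h)) \<otimes>\<^sub>b 1))"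

end

theory Submission
  imports Defs
begin

text \<open>All homomorphisms in sight are spatial. The comultiplication, the dual coaction and \<open>id \<otimes> \<Delta>\<close> are
  \<open>T \<mapsto> W (T \<otimes> 1) W*\<close> for the unitary \<open>W: \<xi> \<otimes> \<delta>\<^sub>x \<otimes> \<delta>\<^sub>y \<mapsto> \<xi> \<otimes> \<delta>\<^sub>x \<otimes> \<delta>\<^sub>x\<^sub>y\<close>, and the representation of the crossed
  product is conjugation by \<open>\<xi> \<otimes> \<delta>\<^sub>x \<mapsto> u\<^sub>x \<xi> \<otimes> \<delta>\<^sub>x\<close>. As homomorphisms of C*-algebras are contractive, they are
  determined by their values on the elements \<open>a \<delta>\<^sub>g\<close>, where all identities are immediate.

  The corepresentation is \<open>\<Theta> (\<xi> \<otimes> \<delta>\<^sub>x \<otimes> e) = \<xi> \<otimes> \<delta>\<^sub>x \<otimes> e \<otimes> \<delta>\<^sub>x\<close>. Its operator form \<open>X\<close> satisfies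
  \<open>X (b \<otimes> 1) X* = (\<rho> \<otimes> id) (\<theta> b)\<close>, which gives equivariance of the action; for \<open>b = a \<delta>\<^sub>h\<close> the right hand
  side is \<open>\<rho> b \<otimes> \<delta>\<^sub>h\<close>, so that the slices are norm limits of elements of the image of \<open>\<rho>\<close>.

  The Dirac operator decomposes over \<open>x \<in> G\<close> into odd operators with off-diagonal entries
  \<open>D \<plusminus> \<i> l x\<close>, hence commutes with \<open>X\<close>. Its square is \<open>D\<^sup>2 + (l x)\<^sup>2\<close> over \<open>x\<close>, so that the resolvent is
  compact because \<open>l\<close> is proper.\<close>

section \<open>Square summable families\<close>

text \<open>Most objects of the statement are definite descriptions, so existence and uniqueness
  must be supplied before anything can be computed. Existence comes from formulas in coordinates,
  uniqueness from boundedness. For homomorphisms that bound is obtained without spectral theory: for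
  a self-adjoint contraction \<open>h\<close> a binomial series exhibits \<open>1 - h\<close> as a
  square, which yields contractivity of representations and continuity of states. The same series
  provides the square root of the resolvent.

  The unitary of the corepresentation acts by a different translation over each group element, so
  its values on \<open>x \<otimes> q\<close> are infinite sums and their membership in the norm
  closed Hilbert module is not immediate. The projections \<open>fibre g\<close> settle this:
  \<open>x\<close> is the sum of its fibres, on each fibre the unitary is a single translation, and
  the sums converge in norm.

  For the Dirac operator the obstacle is the domain, as it is a sum of closures of algebraic tensor
  products. Once its graph is described by conditions on single coordinates, self-adjointness,
  squares and commutators reduce to \<open>D\<close> together with estimates that ensure square
  summability.\<close>

lemmas ell2_fun_simps [simp] = zero_ell2.rep_eq plus_ell2.rep_eq minus_ell2.rep_eq uminus_ell2.rep_eq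
  scaleC_ell2.rep_eq tensor_vec.rep_eq ket.rep_eq

lemma ell2_fun_scaleR [simp]: "ell2_fun (r *\<^sub>R f) i = r *\<^sub>R ell2_fun f i"
  by (simp add: scaleR_ell2_def scaleR_scaleC)

lemma ell2_fun_sum [simp]: "ell2_fun (sum f F) i = (\<Sum>x\<in>F. ell2_fun (f x) i)"
  by (induction F rule: infinite_finite_induct) simp_all

lemma ell2_eqI: "(\<And>i. ell2_fun f i = ell2_fun g i) \<Longrightarrow> f = g"
  by (metis ell2_fun_inject ext)

lemma ell2_norm_has_sum: "((\<lambda>i. (norm (ell2_fun f i))\<^sup>2) has_sum (norm f)\<^sup>2) UNIV"
proof -
  have "(norm f)\<^sup>2 = (\<Sum>\<^sub>\<infinity>i. (norm (ell2_fun f i))\<^sup>2)"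
    unfolding power2_norm_eq_inner inner_ell2.rep_eq ..
  then show ?thesis using ell2_fun[of f] by (simp add: has_sum_infsum)
qed

lemma ell2_norm_le:
  assumes "M \<ge> 0" and "\<And>F. finite F \<Longrightarrow> (\<Sum>i\<in>F. (norm (ell2_fun f i))\<^sup>2) \<le> M\<^sup>2"
  shows "norm f \<le> M"
proof -
  have "(norm f)\<^sup>2 \<le> M\<^sup>2"
    by (rule has_sum_le_finite_sums[OF ell2_norm_has_sum]) (rule assms(2))
  then show ?thesis using assms(1) by (simp add: power2_le_iff_abs_le)
qed

lemma ell2_fun_Ell2:
  assumes "\<And>F. finite F \<Longrightarrow> (\<Sum>i\<in>F. (norm (p i))\<^sup>2) \<le> C"
  shows "ell2_fun (Ell2 p) = p"
  by (rule Ell2_inverse) (use assms in \<open>auto intro!: nonneg_bdd_above_summable_on bdd_aboveI2\<close>)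

text \<open>Since \<open>Ell2\<close> is meaningful only on square summable families, every
  construction in coordinates owes such a proof. Domination by the coordinates of a known vector,
  read along an injection, provides it and bounds the norm at the same time.\<close>

lemma ell2_dominated:
  assumes "inj \<sigma>" and "M \<ge> 0" and p: "\<And>i. norm (p i) \<le> M * norm (ell2_fun g (\<sigma> i))"
  shows "ell2_fun (Ell2 p) = p" and "norm (Ell2 p) \<le> M * norm g"
proof -
  have *: "(\<Sum>i\<in>F. (norm (p i))\<^sup>2) \<le> (M * norm g)\<^sup>2" if "finite F" for F
  proof -
    have "(\<Sum>i\<in>F. (norm (p i))\<^sup>2) \<le> (\<Sum>i\<in>F. (M * norm (ell2_fun g (\<sigma> i)))\<^sup>2)"
      by (intro sum_mono power_mono p) simp
    also have "\<dots> = M\<^sup>2 * (\<Sum>j\<in>\<sigma> ` F. (norm (ell2_fun g j))\<^sup>2)"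
      by (simp add: sum.reindex inj_on_subset[OF assms(1)] power_mult_distrib sum_distrib_left)
    also have "\<dots> \<le> (M * norm g)\<^sup>2"
      unfolding power_mult_distrib using that by (intro mult_left_mono ell2_sum_le) auto
    finally show ?thesis .
  qed
  show 1: "ell2_fun (Ell2 p) = p" by (rule ell2_fun_Ell2) (rule *)
  show "norm (Ell2 p) \<le> M * norm g"
    by (rule ell2_norm_le) (use * assms(2) in \<open>simp_all add: 1\<close>)
qed

lemma ell2_norm_dominated:
  assumes "inj \<sigma>" and "M \<ge> 0" and "\<And>i. norm (ell2_fun f i) \<le> M * norm (ell2_fun g (\<sigma> i))"
  shows "norm f \<le> M * norm g"
  using ell2_dominated(2)[OF assms] by (simp add: ell2_fun_inverse)

lemma ell2_fun_bounded_linear: "bounded_linear (\<lambda>f. ell2_fun f i)"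
  by (rule bounded_linear_intro[where K = 1]) (simp_all add: ell2_coord_le)

lemmas continuous_on_ell2_fun [continuous_intros] = bounded_linear.continuous_on[OF ell2_fun_bounded_linear]

section \<open>Calculus of the complex inner product\<close>

lemma cinner_zero_left [simp]: "cinner 0 x = 0" and cinner_zero_right [simp]: "cinner x 0 = 0"
  using cinner_add_left[of 0 0 x] cinner_add_right[of x 0 0] by simp_all

lemma cinner_minus_left [simp]: "cinner (- x) y = - cinner x y"
  and cinner_minus_right [simp]: "cinner x (- y) = - cinner x y"
  using cinner_add_left[of x "- x" y] cinner_add_right[of x y "- y"] by (simp_all add: add_eq_0_iff2)

lemma cinner_diff_left: "cinner (x - y) z = cinner x z - cinner y z"
  and cinner_diff_right: "cinner z (x - y) = cinner z x - cinner z y"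
  using cinner_add_left[of x "- y" z] cinner_add_right[of z x "- y"] by simp_all

lemma cinner_scaleR_right: "cinner x (r *\<^sub>R y) = r * cinner x y"
  and cinner_scaleR_left: "cinner (r *\<^sub>R x) y = r * cinner x y"
  by (simp_all add: scaleR_scaleC cinner_scaleC_right cinner_scaleC_left)

lemma cinner_self: "cinner x x = complex_of_real ((norm x)\<^sup>2)"
proof -
  have "Im (cinner x x) = 0" using arg_cong[OF cinner_commute[of x x], of Im] by simp
  then show ?thesis by (simp add: complex_eq_iff power2_norm_eq_inner inner_eq_Re_cinner)
qed

lemma cinner_cauchy_schwarz: "cmod (cinner x y) \<le> norm x * norm y"
proof (cases "cinner x y = 0")
  case False
  \<comment> \<open>The phase \<open>c\<close> turns \<open>cinner x y\<close> into its modulus, so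
    that the inequality for the real inner product applies.\<close>
  define c where "c = cnj (cinner x y) / cmod (cinner x y)"
  have c: "cmod c = 1" using False by (simp add: c_def norm_divide)
  have "c * cinner x y = cmod (cinner x y)"
    using False complex_norm_square[of "cinner x y"] by (simp add: c_def field_simps power2_eq_square)
  then have "cinner x (c *\<^sub>C y) = cmod (cinner x y)" by (simp add: cinner_scaleC_right)
  then have "cmod (cinner x y) = inner x (c *\<^sub>C y)" by (simp add: inner_eq_Re_cinner)
  also have "\<dots> \<le> norm x * norm (c *\<^sub>C y)" using norm_cauchy_schwarz by blast
  finally show ?thesis by (simp add: norm_scaleC_hilbert c)
qed simp

lemma cinner_eqI: "(\<And>z. cinner z x = cinner z y) \<Longrightarrow> x = y"
  by (metis cinner_diff_right cinner_self eq_iff_diff_eq_0 norm_eq_zero of_real_eq_0_iff zero_eq_power2)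

lemma cinner_ell2_fun: "cinner f g = (\<Sum>\<^sub>\<infinity>i. cinner (ell2_fun f i) (ell2_fun g i))"
  by (rule cinner_ell2.rep_eq)

lemma cinner_ell2_has_sum: "((\<lambda>i. cinner (ell2_fun f i) (ell2_fun g i)) has_sum cinner f g) UNIV"
  using cinner_abs_summable(2)[of "ell2_fun f" "ell2_fun g"] ell2_fun[of f] ell2_fun[of g]
  by (simp add: cinner_ell2_fun has_sum_infsum)

lemma cinner_tensor_ket: "cinner f (x \<otimes>\<^sub>v ket i) = cinner (ell2_fun f i) x"
proof -
  have "((\<lambda>j. cinner (ell2_fun f j) (ell2_fun (x \<otimes>\<^sub>v ket i) j)) has_sum cinner (ell2_fun f i) x) {i}"
    by (simp add: has_sum_finiteI)
  then have "((\<lambda>j. cinner (ell2_fun f j) (ell2_fun (x \<otimes>\<^sub>v ket i) j)) has_sum cinner (ell2_fun f i) x) UNIV"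
    by (rule has_sum_cong_neutral[THEN iffD1, rotated -1]) auto
  then show ?thesis using cinner_ell2_has_sum has_sum_unique by blast
qed

lemma cinner_tensor_ket': "cinner (x \<otimes>\<^sub>v ket i) f = cinner x (ell2_fun f i)"
  by (metis cinner_commute cinner_tensor_ket)

text \<open>The terms are orthogonal, so the remainder after a finite set \<open>F\<close> has
  squared norm \<open>(norm f)\<^sup>2\<close> minus the sum of squares over \<open>F\<close>, which
  tends to 0. All reductions to vectors \<open>x \<otimes>\<^sub>v ket i\<close> rest on
  this.\<close>

lemma ell2_has_sum: "((\<lambda>i. ell2_fun f i \<otimes>\<^sub>v ket i) has_sum f) UNIV"
proof -
  have eq: "(norm (f - (\<Sum>i\<in>F. ell2_fun f i \<otimes>\<^sub>v ket i)))\<^sup>2 = (norm f)\<^sup>2 - (\<Sum>i\<in>F. (norm (ell2_fun f i))\<^sup>2)"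
    if "finite F" for F
  proof -
    define t where "t = (\<Sum>i\<in>F. ell2_fun f i \<otimes>\<^sub>v ket i)"
    have t: "inner g t = (\<Sum>i\<in>F. inner (ell2_fun g i) (ell2_fun f i))" for g
      unfolding t_def inner_sum_right by (simp add: inner_eq_Re_cinner cinner_tensor_ket)
    have "ell2_fun t i = ell2_fun f i" if "i \<in> F" for i
    proof -
      have "ell2_fun t i = (\<Sum>j\<in>F. if i = j then ell2_fun f j else 0)"
        unfolding t_def ell2_fun_sum by (intro sum.cong) auto
      then show ?thesis using that \<open>finite F\<close> by simp
    qed
    then have "inner t t = inner f t" by (simp add: t)
    then have "(norm (f - t))\<^sup>2 = inner f f - inner f t"
      by (simp add: power2_norm_eq_inner inner_diff_left inner_diff_right inner_commute)
    then show ?thesis by (simp add: t_def[symmetric] t[of f] power2_norm_eq_inner)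
  qed
  have "((\<lambda>F. (norm f)\<^sup>2 - (\<Sum>i\<in>F. (norm (ell2_fun f i))\<^sup>2)) \<longlongrightarrow> (norm f)\<^sup>2 - (norm f)\<^sup>2) (finite_subsets_at_top UNIV)"
    using ell2_norm_has_sum[of f] unfolding has_sum_def by (intro tendsto_intros)
  then have "((\<lambda>F. (norm f)\<^sup>2 - (\<Sum>i\<in>F. (norm (ell2_fun f i))\<^sup>2)) \<longlongrightarrow> 0) (finite_subsets_at_top UNIV)"
    by simp
  then have "((\<lambda>F. (norm (f - (\<Sum>i\<in>F. ell2_fun f i \<otimes>\<^sub>v ket i)))\<^sup>2) \<longlongrightarrow> 0) (finite_subsets_at_top UNIV)"
    by (rule Lim_transform_eventually) (use eq in \<open>auto simp: eventually_finite_subsets_at_top\<close>)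
  then have "((\<lambda>F. sqrt ((norm (f - (\<Sum>i\<in>F. ell2_fun f i \<otimes>\<^sub>v ket i)))\<^sup>2)) \<longlongrightarrow> sqrt 0) (finite_subsets_at_top UNIV)"
    by (intro tendsto_intros)
  then have "((\<lambda>F. f - (\<Sum>i\<in>F. ell2_fun f i \<otimes>\<^sub>v ket i)) \<longlongrightarrow> 0) (finite_subsets_at_top UNIV)"
    by (simp add: tendsto_norm_zero_iff)
  from tendsto_diff[OF tendsto_const this, of f] show ?thesis
    unfolding has_sum_def by simp
qed

lemma has_sum_in_closed:
  assumes "closed S" and "\<And>F. finite F \<Longrightarrow> sum f F \<in> S" and "(f has_sum s) UNIV"
  shows "s \<in> S"
  by (rule Lim_in_closed_set[of S "sum f" "finite_subsets_at_top UNIV"])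
     (use assms in \<open>auto simp: has_sum_def eventually_finite_subsets_at_top\<close>)

subsection \<open>Bounded operators between square summable families\<close>

lemma blinfun_ell2_eqI:
  fixes R S :: "('i, 'v::chilbert_space) ell2 \<Rightarrow>\<^sub>L 'w::real_normed_vector"
  assumes "\<And>x i. R (x \<otimes>\<^sub>v ket i) = S (x \<otimes>\<^sub>v ket i)"
  shows "R = S"
proof (rule blinfun_eqI)
  fix f
  have "((\<lambda>i. T (ell2_fun f i \<otimes>\<^sub>v ket i)) has_sum T f) UNIV" for T :: "('i, 'v) ell2 \<Rightarrow>\<^sub>L 'w"
    by (rule has_sum_bounded_linear[OF blinfun.bounded_linear_right ell2_has_sum])
  from this[of R] this[of S] show "R f = S f" by (simp add: assms has_sum_unique)
qed

lemma tensor_vec_add_left: "(x + y) \<otimes>\<^sub>v v = x \<otimes>\<^sub>v v + y \<otimes>\<^sub>v v"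
  and tensor_vec_add_right: "x \<otimes>\<^sub>v (v + w) = x \<otimes>\<^sub>v v + x \<otimes>\<^sub>v w"
  and tensor_vec_scaleC_left: "(c *\<^sub>C x) \<otimes>\<^sub>v v = c *\<^sub>C (x \<otimes>\<^sub>v v)"
  and tensor_vec_scaleC_right: "x \<otimes>\<^sub>v (c *\<^sub>C v) = c *\<^sub>C (x \<otimes>\<^sub>v v)"
  and tensor_vec_zero_left [simp]: "0 \<otimes>\<^sub>v v = 0"
  and tensor_vec_zero_right [simp]: "x \<otimes>\<^sub>v 0 = 0"
  by (rule ell2_eqI; simp add: scaleC_add_left scaleC_add_right scaleC_scaleC scaleC_complex_def mult.commute)+

lemma tensor_vec_sum_right: "x \<otimes>\<^sub>v sum v F = (\<Sum>i\<in>F. x \<otimes>\<^sub>v v i)"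
  by (induction F rule: infinite_finite_induct) (simp_all add: tensor_vec_add_right)

lemma ell2_scalar_tensor: "v \<otimes>\<^sub>v ket i = v *\<^sub>C ket i" for v :: complex
  by (rule ell2_eqI) (simp add: scaleC_complex_def)

lemma cinner_tensor_tensor: "cinner (x \<otimes>\<^sub>v v) (y \<otimes>\<^sub>v w) = cinner x y * cinner v w"
proof -
  have "((\<lambda>i. cinner x y * cinner (ell2_fun v i) (ell2_fun w i)) has_sum cinner x y * cinner v w) UNIV"
    by (intro has_sum_cmult_right cinner_ell2_has_sum)
  moreover have "cinner (ell2_fun (x \<otimes>\<^sub>v v) i) (ell2_fun (y \<otimes>\<^sub>v w) i) = cinner x y * cinner (ell2_fun v i) (ell2_fun w i)" for i
    by (simp add: cinner_scaleC_left cinner_scaleC_right cinner_complex_def)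
  ultimately show ?thesis using cinner_ell2_has_sum[of "x \<otimes>\<^sub>v v" "y \<otimes>\<^sub>v w"] has_sum_unique by fastforce
qed

lemma norm_tensor_vec: "norm (x \<otimes>\<^sub>v v) = norm x * norm v"
proof -
  have "complex_of_real ((norm (x \<otimes>\<^sub>v v))\<^sup>2) = complex_of_real ((norm x * norm v)\<^sup>2)"
    using cinner_tensor_tensor[of x v x v] by (simp add: cinner_self power_mult_distrib)
  then have "(norm (x \<otimes>\<^sub>v v))\<^sup>2 = (norm x * norm v)\<^sup>2" unfolding of_real_eq_iff .
  then show ?thesis by (simp add: power2_eq_iff_nonneg)
qed

lemma bounded_linear_tensor_right: "bounded_linear (\<lambda>v. x \<otimes>\<^sub>v v)"
  by (rule bounded_linear_intro[where K = "norm x"])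
     (simp_all add: tensor_vec_add_right scaleR_scaleC tensor_vec_scaleC_right norm_tensor_vec mult.commute)

lemma creation_apply [simp]: "creation x v = x \<otimes>\<^sub>v v"
  by (simp add: creation_def bounded_linear_Blinfun_apply bounded_linear_tensor_right)

text \<open>The common form of translations, block diagonal operators and amplifications. The value
  is meaningful for injective \<open>\<sigma>\<close> and uniformly bounded \<open>T\<close>, when
  the family under \<open>Ell2\<close> is square summable.\<close>

definition mono_op :: "('i \<Rightarrow> 'j) \<Rightarrow> ('i \<Rightarrow> 'v::chilbert_space \<Rightarrow>\<^sub>L 'w::chilbert_space) \<Rightarrow> ('j, 'v) ell2 \<Rightarrow>\<^sub>L ('i, 'w) ell2" where
  "mono_op \<sigma> T = Blinfun (\<lambda>f. Ell2 (\<lambda>i. T i (ell2_fun f (\<sigma> i))))"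

lemma mono_op:
  assumes "inj \<sigma>" and T: "\<And>i. norm (T i) \<le> M"
  shows mono_op_fun: "ell2_fun (mono_op \<sigma> T f) i = T i (ell2_fun f (\<sigma> i))"
    and norm_mono_op: "norm (mono_op \<sigma> T) \<le> M"
proof -
  have M: "M \<ge> 0" using T norm_ge_zero order_trans by blast
  have dom: "norm (T i (ell2_fun f (\<sigma> i))) \<le> M * norm (ell2_fun f (\<sigma> i))" for f i
    by (meson T mult_right_mono norm_blinfun norm_ge_zero order_trans)
  note d = ell2_dominated[OF assms(1) M dom]
  have lin: "bounded_linear (\<lambda>f. Ell2 (\<lambda>i. T i (ell2_fun f (\<sigma> i))))"
  proof (rule bounded_linear_intro[where K = M])
    show "Ell2 (\<lambda>i. T i (ell2_fun (f + g) (\<sigma> i)))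
        = Ell2 (\<lambda>i. T i (ell2_fun f (\<sigma> i))) + Ell2 (\<lambda>i. T i (ell2_fun g (\<sigma> i)))" for f g
      by (rule ell2_eqI) (subst d(1), simp add: d(1) blinfun.add_right)
    show "Ell2 (\<lambda>i. T i (ell2_fun (r *\<^sub>R f) (\<sigma> i))) = r *\<^sub>R Ell2 (\<lambda>i. T i (ell2_fun f (\<sigma> i)))" for r f
      by (rule ell2_eqI) (subst d(1), simp add: d(1) blinfun.scaleR_right)
  qed (use d(2) in \<open>simp add: mult.commute\<close>)
  show "ell2_fun (mono_op \<sigma> T f) i = T i (ell2_fun f (\<sigma> i))"
    by (simp add: mono_op_def bounded_linear_Blinfun_apply lin d(1))
  show "norm (mono_op \<sigma> T) \<le> M"
    by (rule norm_blinfun_bound[OF M]) (simp add: mono_op_def bounded_linear_Blinfun_apply lin d(2))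
qed

text \<open>This is \<open>S\<close> tensor the identity, available before tensor products of
  operators are known to exist, and also for \<open>S\<close> between different spaces.\<close>

definition amp :: "('v::chilbert_space \<Rightarrow>\<^sub>L 'w::chilbert_space) \<Rightarrow> ('i, 'v) ell2 \<Rightarrow>\<^sub>L ('i, 'w) ell2" where
  "amp S = mono_op id (\<lambda>_. S)"

lemma amp_fun [simp]: "ell2_fun (amp S f) i = S (ell2_fun f i)"
  unfolding amp_def by (subst mono_op_fun[where M = "norm S"]) simp_all

lemma norm_amp_le: "norm (amp S) \<le> norm S"
  unfolding amp_def by (rule norm_mono_op) simp_all

text \<open>An interchange of two sums of squares. Only finitely many of the new outer indices are
  added at a time, so additivity of \<open>has_sum\<close> and the bound \<open>ell2_sum_le\<close>
  in each old component suffice.\<close>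

lemma flip_exists:
  fixes f :: "('j, ('i, 'v::chilbert_space) ell2) ell2"
  shows "\<exists>h::('i, ('j, 'v) ell2) ell2. (\<forall>i j. ell2_fun (ell2_fun h i) j = ell2_fun (ell2_fun f j) i) \<and> norm h \<le> norm f"
proof -
  define p where "p i = Ell2 (\<lambda>j. ell2_fun (ell2_fun f j) i)" for i
  have p: "ell2_fun (p i) = (\<lambda>j. ell2_fun (ell2_fun f j) i)" for i
    unfolding p_def
    by (rule ell2_dominated(1)[of id 1 _ f]) (auto simp: ell2_coord_le)
  have s: "(\<Sum>i\<in>F. (norm (p i))\<^sup>2) \<le> (norm f)\<^sup>2" if "finite F" for F
  proof (rule has_sum_mono[OF _ ell2_norm_has_sum])
    show "((\<lambda>j. \<Sum>i\<in>F. (norm (ell2_fun (ell2_fun f j) i))\<^sup>2) has_sum (\<Sum>i\<in>F. (norm (p i))\<^sup>2)) UNIV"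
      using that
    proof (induction F)
      case (insert i F)
      then show ?case using ell2_norm_has_sum[of "p i"] by (auto simp: p intro!: has_sum_add)
    qed simp
  qed (rule ell2_sum_le[OF that])
  have "ell2_fun (Ell2 p) = p" by (rule ell2_fun_Ell2) (rule s)
  moreover from this have "norm (Ell2 p) \<le> norm f" by (intro ell2_norm_le) (simp_all add: s)
  ultimately show ?thesis by (metis p)
qed

definition flip :: "('j, ('i, 'v::chilbert_space) ell2) ell2 \<Rightarrow>\<^sub>L ('i, ('j, 'v) ell2) ell2" where
  "flip = Blinfun (\<lambda>f. Ell2 (\<lambda>i. Ell2 (\<lambda>j. ell2_fun (ell2_fun f j) i)))"

lemma
  fixes f :: "('j, ('i, 'v::chilbert_space) ell2) ell2"
  shows flip_fun [simp]: "ell2_fun (ell2_fun (flip f) i) j = ell2_fun (ell2_fun f j) i"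
    and norm_flip_le: "norm (flip f) \<le> norm f"
proof -
  obtain h :: "('j, ('i, 'v::chilbert_space) ell2) ell2 \<Rightarrow> ('i, ('j, 'v) ell2) ell2" where h: "\<And>f i j. ell2_fun (ell2_fun (h f) i) j = ell2_fun (ell2_fun f j) i"
     and n: "\<And>f. norm (h f) \<le> norm f"
    using flip_exists by metis
  have eq: "Ell2 (\<lambda>i. Ell2 (\<lambda>j. ell2_fun (ell2_fun f j) i)) = h f" for f
    by (simp add: h[symmetric] ell2_fun_inverse)
  have "bounded_linear h"
    by (rule bounded_linear_intro[where K = 1]) (auto intro!: ell2_eqI simp: h n)
  then have "flip f = h f" for f by (simp add: flip_def eq bounded_linear_Blinfun_apply)
  then show "ell2_fun (ell2_fun (flip f) i) j = ell2_fun (ell2_fun f j) i" "norm (flip f) \<le> norm f"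
    by (simp_all add: h n)
qed

lemma flip_flip [simp]: "flip (flip f) = f"
  by (intro ell2_eqI) simp

lemma amp_tensor [simp]: "is_clinear (blinfun_apply S) \<Longrightarrow> amp S (x \<otimes>\<^sub>v v) = S x \<otimes>\<^sub>v v"
  by (rule ell2_eqI) (simp add: is_clinear_def)

section \<open>C*-algebras\<close>

subsection \<open>Closed complex subspaces\<close>

lemmas csubspace_intros = complex_vector.subspace_0 complex_vector.subspace_add complex_vector.subspace_scale
  complex_vector.subspace_diff complex_vector.subspace_sum complex_vector.subspace_neg

lemma csubspaceI:
  assumes "0 \<in> S" "\<And>x y. x \<in> S \<Longrightarrow> y \<in> S \<Longrightarrow> x + y \<in> S" "\<And>c x. x \<in> S \<Longrightarrow> c *\<^sub>C x \<in> S"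
  shows "csubspace S"
  using assms unfolding complex_vector.subspace_def by blast

lemma closure_cspan_minimal: "S \<subseteq> T \<Longrightarrow> csubspace T \<Longrightarrow> closed T \<Longrightarrow> closure (cspan S) \<subseteq> T"
  by (intro closure_minimal complex_vector.span_minimal)

lemma closure_cspan_superset: "x \<in> S \<Longrightarrow> x \<in> closure (cspan S)"
  using closure_subset complex_vector.span_superset by blast

lemma norm_scaleC_blinfun_le: "norm (c *\<^sub>C T) \<le> cmod c * norm T"
  for T :: "'a::real_normed_vector \<Rightarrow>\<^sub>L 'b::chilbert_space"
proof (rule norm_blinfun_bound)
  fix x
  show "norm (blinfun_apply (c *\<^sub>C T) x) \<le> cmod c * norm T * norm x"
    by (simp add: scaleC_blinfun.rep_eq norm_scaleC_hilbert mult.assoc mult_left_mono norm_blinfun)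
qed simp

lemma bounded_linear_scaleC_blinfun: "bounded_linear (\<lambda>T::'a::real_normed_vector \<Rightarrow>\<^sub>L 'b::chilbert_space. c *\<^sub>C T)"
  by (rule bounded_linear_intro[where K = "cmod c"])
     (auto simp: scaleC_add_right scaleR_scaleC scaleC_scaleC mult.commute norm_scaleC_blinfun_le)

lemma bounded_linear_scaleC_cstar: "bounded_linear (\<lambda>x::'a::cstar_algebra. c *\<^sub>C x)"
  by (rule bounded_linear_intro[where K = "cmod c"])
     (auto simp: scaleC_add_right scaleR_scaleC scaleC_scaleC mult.commute norm_scaleC)

lemma bounded_linear_scaleC_prod:
  assumes "bounded_linear (\<lambda>x::'a. c *\<^sub>C x)" "bounded_linear (\<lambda>x::'b. c *\<^sub>C x)"
  shows "bounded_linear (\<lambda>x::'a::{complex_vector, real_normed_vector} \<times> 'b::{complex_vector, real_normed_vector}. c *\<^sub>C x)"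
  unfolding scaleC_prod_def
  by (intro bounded_linear_Pair bounded_linear_compose[OF assms(1)] bounded_linear_compose[OF assms(2)]
      bounded_linear_fst bounded_linear_snd)

text \<open>Continuity of complex scaling is a premise because the sort relates only real scaling to
  the norm. It is discharged separately for Hilbert spaces, C*-algebras, spaces of operators and
  pairs.\<close>

lemma csubspace_closure:
  fixes S :: "'a::{complex_vector, real_normed_vector} set"
  assumes c: "\<And>c. bounded_linear (\<lambda>x::'a. c *\<^sub>C x)" and S: "csubspace S"
  shows "csubspace (closure S)"
proof (rule csubspaceI)
  show "0 \<in> closure S" using S csubspace_intros(1) closure_subset by blast
  show "x + y \<in> closure S" if xy: "x \<in> closure S" "y \<in> closure S" for x y
  proof -
    obtain X Y where "\<And>n. X n \<in> S" "X \<longlonglongrightarrow> x" "\<And>n. Y n \<in> S" "Y \<longlonglongrightarrow> y"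
      using xy unfolding closure_sequential by metis
    then show ?thesis
      unfolding closure_sequential using csubspace_intros(2)[OF S]
      by (intro exI[of _ "\<lambda>n. X n + Y n"]) (auto intro: tendsto_add)
  qed
  show "c *\<^sub>C x \<in> closure S" if x: "x \<in> closure S" for c x
  proof -
    obtain X where "\<And>n. X n \<in> S" "X \<longlonglongrightarrow> x" using x unfolding closure_sequential by metis
    then show ?thesis
      unfolding closure_sequential using csubspace_intros(3)[OF S] bounded_linear.tendsto[OF c]
      by (intro exI[of _ "\<lambda>n. c *\<^sub>C X n"]) auto
  qed
qed

lemmas csubspace_closure_cspan = csubspace_closure[OF _ complex_vector.subspace_span]
lemmas csubspace_closure_cstar = csubspace_closure[OF bounded_linear_scaleC_cstar]

subsection \<open>Star subalgebras\<close>

lemma star_zero [simp]: "star 0 = (0::'a::cstar_algebra)"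
  using star_add[of 0 "0::'a"] by simp

lemma star_minus: "star (- x) = - star (x::'a::cstar_algebra)"
  using star_add[of x "- x"] by (simp add: add_eq_0_iff)

lemma star_diff: "star (x - y) = star x - star (y::'a::cstar_algebra)"
  using star_add[of x "- y"] by (simp add: star_minus)

lemma star_scaleR: "star (r *\<^sub>R x) = r *\<^sub>R star (x::'a::cstar_algebra)"
  by (simp add: scaleR_scaleC star_scaleC)

lemma star_one [simp]: "star 1 = (1::'a::cstar_algebra)"
  by (metis mult.left_neutral mult.right_neutral star_mult star_star)

lemma norm_star [simp]: "norm (star x) = norm (x::'a::cstar_algebra)"
proof -
  have *: "norm y \<le> norm (star y)" for y :: 'a
    using norm_mult_ineq[of "star y" y] cstar_identity[of y]
    by (cases "norm y = 0") (auto simp: power2_eq_square)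
  from *[of x] *[of "star x"] show ?thesis by (simp add: star_star)
qed

lemma bounded_linear_star: "bounded_linear (star :: 'a::cstar_algebra \<Rightarrow> 'a)"
  by (rule bounded_linear_intro[where K = 1]) (auto simp: star_add star_scaleR)

lemma star_subalgebra_closure:
  fixes A :: "'a::cstar_algebra set"
  assumes "star_subalgebra A"
  shows "star_subalgebra (closure A)"
  unfolding star_subalgebra_def
proof (intro conjI ballI)
  show "csubspace (closure A)"
    using assms by (auto simp: star_subalgebra_def intro: csubspace_closure_cstar)
  show "x * y \<in> closure A" if xy: "x \<in> closure A" "y \<in> closure A" for x y
  proof -
    obtain X Y where "\<And>n. X n \<in> A" "X \<longlonglongrightarrow> x" "\<And>n. Y n \<in> A" "Y \<longlonglongrightarrow> y"
      using xy unfolding closure_sequential by metis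
    then show ?thesis
      unfolding closure_sequential using assms
      by (intro exI[of _ "\<lambda>n. X n * Y n"]) (auto intro: tendsto_mult simp: star_subalgebra_def)
  qed
  show "star x \<in> closure A" if x: "x \<in> closure A" for x
  proof -
    obtain X where "\<And>n. X n \<in> A" "X \<longlonglongrightarrow> x" using x unfolding closure_sequential by metis
    then show ?thesis
      unfolding closure_sequential using assms bounded_linear.tendsto[OF bounded_linear_star]
      by (intro exI[of _ "\<lambda>n. star (X n)"]) (auto simp: star_subalgebra_def)
  qed
qed

lemma star_subalgebra_cspan:
  fixes S :: "'a::cstar_algebra set"
  assumes m: "\<And>x y. x \<in> S \<Longrightarrow> y \<in> S \<Longrightarrow> x * y \<in> cspan S" and s: "\<And>x. x \<in> S \<Longrightarrow> star x \<in> cspan S"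
  shows "star_subalgebra (cspan S)"
  unfolding star_subalgebra_def
proof (intro conjI ballI)
  note sp = complex_vector.subspace_span[of S]
  show "csubspace (cspan S)" by (rule sp)
  have 1: "x * y \<in> cspan S" if "x \<in> S" "y \<in> cspan S" for x y
  proof -
    have "cspan S \<subseteq> {y. x * y \<in> cspan S}"
      by (rule complex_vector.span_minimal)
         (use m[OF that(1)] in \<open>auto intro!: csubspaceI csubspace_intros[OF sp] simp: distrib_left mult_scaleC_right\<close>)
    then show ?thesis using that by blast
  qed
  show "x * y \<in> cspan S" if "x \<in> cspan S" "y \<in> cspan S" for x y
  proof -
    have "cspan S \<subseteq> {x. x * y \<in> cspan S}"
      by (rule complex_vector.span_minimal)
         (use 1[OF _ that(2)] in \<open>auto intro!: csubspaceI csubspace_intros[OF sp] simp: distrib_right mult_scaleC_left\<close>)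
    then show ?thesis using that by blast
  qed
  show "star x \<in> cspan S" if "x \<in> cspan S" for x
  proof -
    have "cspan S \<subseteq> {x. star x \<in> cspan S}"
      by (rule complex_vector.span_minimal)
         (use s in \<open>auto intro!: csubspaceI csubspace_intros[OF sp] simp: star_add star_scaleC\<close>)
    then show ?thesis using that by blast
  qed
qed

lemma is_unit_of_unique: "is_unit_of B e \<Longrightarrow> unit_of B = e"
  unfolding unit_of_def is_unit_of_def by (rule the_equality) metis+

lemma is_unit_of_star:
  assumes "star_subalgebra B" "is_unit_of B e"
  shows "star e = e"
proof -
  have "star e \<in> B" using assms by (auto simp: star_subalgebra_def is_unit_of_def)
  then have "star e * e = star e" using assms by (auto simp: is_unit_of_def)
  then show ?thesis by (metis star_mult star_star)
qed

lemma is_unit_of_closure_cspan: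
  fixes S :: "'a::cstar_algebra set"
  assumes "e \<in> S" "\<And>x. x \<in> S \<Longrightarrow> e * x = x \<and> x * e = x"
  shows "is_unit_of (closure (cspan S)) e"
proof -
  have cl: "closed {x. e * x = x \<and> x * e = x}"
    by (intro closed_Collect_conj closed_Collect_eq continuous_intros)
  have sub: "csubspace {x. e * x = x \<and> x * e = x}"
    by (rule csubspaceI) (auto simp: distrib_left distrib_right mult_scaleC_left mult_scaleC_right)
  have "closure (cspan S) \<subseteq> {x. e * x = x \<and> x * e = x}"
    by (rule closure_cspan_minimal[OF _ sub cl]) (use assms(2) in auto)
  then show ?thesis using closure_cspan_superset[OF assms(1)] unfolding is_unit_of_def by blast
qed

subsection \<open>Square roots\<close>

text \<open>The coefficients of \<open>1 - sqrt (1 - t) = (\<Sum>n. c n t^(n + 1))\<close>.\<close>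

definition sqrt_coeff :: "nat \<Rightarrow> real" where
  "sqrt_coeff n = ((1/2) gchoose Suc n) * (- 1) ^ n"

lemma sqrt_coeff_0: "sqrt_coeff 0 = 1/2"
  by (simp add: sqrt_coeff_def)

text \<open>Up to sign, consecutive binomial coefficients differ by the factor
  \<open>(n + 1/2) / (n + 2)\<close>. Nonnegativity and the closed form of the partial sums follow
  from it by induction.\<close>

lemma sqrt_coeff_Suc: "sqrt_coeff (Suc n) * (2 * n + 4) = sqrt_coeff n * (2 * n + 1)"
proof -
  define a where "a = ((1/2::real) gchoose Suc n)"
  define b where "b = ((1/2::real) gchoose Suc (Suc n))"
  have "(1/2) * a = of_nat (Suc n) * a + of_nat (Suc (Suc n)) * b"
    unfolding a_def b_def by (rule gbinomial_mult_1)
  then have "- b * (2 * n + 4) = a * (2 * n + 1)" by (simp add: algebra_simps)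
  moreover have "sqrt_coeff (Suc n) = (- 1) ^ n * (- b)" "sqrt_coeff n = (- 1) ^ n * a"
    by (simp_all add: sqrt_coeff_def a_def b_def mult.commute)
  ultimately show ?thesis by (simp only: mult.assoc)
qed

lemma sqrt_coeff_nonneg: "sqrt_coeff n \<ge> 0"
proof (induction n)
  case (Suc n)
  have "sqrt_coeff (Suc n) * (2 * n + 4) \<ge> 0" unfolding sqrt_coeff_Suc using Suc by simp
  then show ?case by (simp add: zero_le_mult_iff)
qed (simp add: sqrt_coeff_0)

text \<open>The numbers \<open>(2 * N + 2) * sqrt_coeff N\<close> start at 1 and drop by exactly
  \<open>sqrt_coeff N\<close>, so the sum telescopes. The nonnegative remainder bounds all partial
  sums by 1, without evaluating the power series on the boundary of its disc.\<close>

lemma sqrt_coeff_sum: "(\<Sum>n<N. sqrt_coeff n) = 1 - (2 * N + 2) * sqrt_coeff N"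
proof (induction N)
  case (Suc N)
  have "(\<Sum>n<Suc N. sqrt_coeff n) = 1 - sqrt_coeff N * (2 * N + 1)"
    using Suc by (simp add: algebra_simps)
  also have "\<dots> = 1 - (2 * Suc N + 2) * sqrt_coeff (Suc N)"
    unfolding sqrt_coeff_Suc[symmetric] by (simp add: algebra_simps)
  finally show ?case by simp
qed (simp add: sqrt_coeff_0)

lemma sqrt_coeff_summable: "summable sqrt_coeff" and sqrt_coeff_suminf: "(\<Sum>n. sqrt_coeff n) \<le> 1"
proof -
  have le: "(\<Sum>n<N. sqrt_coeff n) \<le> 1" for N
    using sqrt_coeff_nonneg[of N] by (simp add: sqrt_coeff_sum)
  show 1: "summable sqrt_coeff" by (rule summableI_nonneg_bounded[OF sqrt_coeff_nonneg le])
  show "(\<Sum>n. sqrt_coeff n) \<le> 1" by (rule suminf_le_const[OF 1 le])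
qed

text \<open>In coefficients this is \<open>y * y = 2 * y - t\<close> for
  \<open>y = 1 - sqrt (1 - t)\<close>. It comes from the Vandermonde convolution for 1/2 + 1/2 = 1:
  the binomial coefficient of 1 in degree \<open>n + 2\<close> vanishes, and the two extreme terms
  of the convolution supply the right hand side.\<close>

lemma sqrt_coeff_convolution: "(\<Sum>i\<le>n. sqrt_coeff i * sqrt_coeff (n - i)) = 2 * sqrt_coeff (Suc n)"
proof -
  let ?g = "\<lambda>k. (1/2::real) gchoose k"
  have "0 = (1/2 + 1/2::real) gchoose Suc (Suc n)"
    using binomial_gbinomial[of 1 "Suc (Suc n)", where ?'a = real] by simp
  also have "\<dots> = (\<Sum>k=0..Suc (Suc n). ?g k * ?g (Suc (Suc n) - k))"
    by (rule gbinomial_Vandermonde[symmetric])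
  also have "\<dots> = 2 * ?g (Suc (Suc n)) + (\<Sum>i\<le>n. ?g (Suc i) * ?g (Suc (Suc n) - Suc i))"
    unfolding sum.atLeast0_atMost_Suc[of _ "Suc n"] sum.atLeast0_atMost_Suc_shift[of _ n]
    by (simp only: atLeast0AtMost) simp
  also have "(\<Sum>i\<le>n. ?g (Suc i) * ?g (Suc (Suc n) - Suc i)) = (\<Sum>i\<le>n. (-1)^n * (sqrt_coeff i * sqrt_coeff (n - i)))"
  proof (intro sum.cong refl)
    fix i assume "i \<in> {..n}"
    then have "(-1::real)^n = (-1)^i * (-1)^(n - i)" and n: "Suc (Suc n) - Suc i = Suc (n - i)"
      by (simp_all flip: power_add)
    then have "(-1)^n * ((-1)^i * (-1)^(n - i)) = (1::real)"
      by (metis power_mult_distrib mult_minus1 minus_minus power_one)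
    then have "(-1)^n * (sqrt_coeff i * sqrt_coeff (n - i)) = ?g (Suc i) * ?g (Suc (n - i))"
      by (simp add: sqrt_coeff_def mult_ac)
    then show "?g (Suc i) * ?g (Suc (Suc n) - Suc i) = (-1)^n * (sqrt_coeff i * sqrt_coeff (n - i))"
      by (simp only: n)
  qed
  also have "2 * ?g (Suc (Suc n)) = - (2 * ((-1)^n * sqrt_coeff (Suc n)))"
    by (simp add: sqrt_coeff_def mult.left_commute)
  finally have "(-1)^n * (\<Sum>i\<le>n. sqrt_coeff i * sqrt_coeff (n - i)) = (-1)^n * (2 * sqrt_coeff (Suc n))"
    by (simp add: sum_distrib_left)
  then show ?thesis by simp
qed

text \<open>Only positive powers are treated because the sort does not contain
  \<open>norm 1 = 1\<close>, which fails for operators on the zero space.\<close>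

lemma norm_power_Suc_le: "norm (h ^ Suc n) \<le> norm (h::'a::{real_normed_algebra, monoid_mult}) ^ Suc n"
proof (induction n)
  case (Suc n)
  have "norm (h ^ Suc (Suc n)) \<le> norm h * norm (h ^ Suc n)"
    using norm_mult_ineq[of h "h ^ Suc n"] by simp
  also have "\<dots> \<le> norm h * norm h ^ Suc n" by (intro mult_left_mono Suc) simp
  finally show ?case by simp
qed simp

text \<open>The element \<open>y\<close> is \<open>1 - sqrt (1 - h)\<close>.\<close>

lemma one_minus_sqrt_exists:
  fixes h :: "'a::cstar_algebra"
  assumes h: "star h = h" "norm h \<le> 1"
  obtains y where "y * y = 2 *\<^sub>R y - h" "star y = y" "norm y \<le> 1"
    "\<And>C. star_subalgebra C \<Longrightarrow> closed C \<Longrightarrow> h \<in> C \<Longrightarrow> y \<in> C"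
proof -
  define t where "t n = sqrt_coeff n *\<^sub>R h ^ Suc n" for n
  have nt: "norm (t n) \<le> sqrt_coeff n" for n
  proof -
    have "norm (h ^ Suc n) \<le> 1"
      using norm_power_Suc_le[of h n] power_le_one[OF norm_ge_zero h(2), of "Suc n"] by linarith
    then show ?thesis
      using mult_left_mono[of "norm (h ^ Suc n)" 1 "sqrt_coeff n"] sqrt_coeff_nonneg[of n] by (simp add: t_def)
  qed
  have sn: "summable (\<lambda>n. norm (t n))"
    by (rule summable_comparison_test'[OF sqrt_coeff_summable, of 0]) (simp add: nt)
  then have s: "summable t" by (rule summable_norm_cancel)
  define y where "y = (\<Sum>n. t n)"
  have ty: "t sums y" using s by (simp add: y_def summable_sums)
  have "(\<lambda>n. \<Sum>i\<le>n. t i * t (n - i)) sums (y * y)"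
    unfolding y_def by (rule Cauchy_product_sums[OF sn sn])
  moreover have "(\<Sum>i\<le>n. t i * t (n - i)) = 2 *\<^sub>R t (Suc n)" for n
  proof -
    have "t i * t (n - i) = (sqrt_coeff i * sqrt_coeff (n - i)) *\<^sub>R h ^ Suc (Suc n)" if "i \<le> n" for i
    proof -
      have "Suc i + Suc (n - i) = Suc (Suc n)" using that by simp
      then have "h ^ Suc i * h ^ Suc (n - i) = h ^ Suc (Suc n)" by (metis power_add)
      then show ?thesis by (simp add: t_def del: power_Suc)
    qed
    then show ?thesis
      by (simp add: t_def scaleR_sum_left[symmetric] sqrt_coeff_convolution del: power_Suc)
  qed
  ultimately have "(\<lambda>n. 2 *\<^sub>R t (Suc n)) sums (y * y)" by simp
  moreover have "(\<lambda>n. 2 *\<^sub>R t (Suc n)) sums (2 *\<^sub>R (y - t 0))"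
    using ty by (intro sums_scaleR_right) (simp add: sums_Suc_iff)
  ultimately have "y * y = 2 *\<^sub>R (y - t 0)" by (rule sums_unique2)
  then have 1: "y * y = 2 *\<^sub>R y - h" by (simp add: t_def sqrt_coeff_0 algebra_simps)
  have "star (h ^ n) = h ^ n" for n
    by (induction n) (simp_all add: star_mult h(1) power_commutes)
  then have "star (t n) = t n" for n by (simp add: t_def star_scaleR del: power_Suc)
  then have 2: "star y = y"
    using bounded_linear.sums[OF bounded_linear_star ty] ty by (simp add: sums_unique2)
  have "norm y \<le> (\<Sum>n. sqrt_coeff n)"
    unfolding y_def by (rule norm_suminf_le[OF nt sqrt_coeff_summable]) 
  then have 3: "norm y \<le> 1" using sqrt_coeff_suminf by linarith
  \<comment> \<open>The series has no constant term, so its partial sums stay in \<open>C\<close>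
    even if the unit of \<open>C\<close> differs from \<open>1\<close>.\<close>
  have "y \<in> C" if C: "star_subalgebra C" "closed C" "h \<in> C" for C
  proof -
    have sub: "csubspace C" using C by (simp add: star_subalgebra_def)
    have "h ^ Suc n \<in> C" for n
      by (induction n) (use C in \<open>auto simp: star_subalgebra_def\<close>)
    then have "t n \<in> C" for n
      unfolding t_def scaleR_scaleC by (intro csubspace_intros[OF sub])
    then have "(\<Sum>i<n. t i) \<in> C" for n by (intro csubspace_intros[OF sub])
    then show ?thesis using closed_sequentially[OF C(2), of "\<lambda>n. \<Sum>i<n. t i"] ty unfolding sums_def by blast
  qed
  with 1 2 3 show thesis using that by blast
qed

text \<open>Take \<open>s = e - y\<close> with \<open>y\<close> from the binomial series; here
  \<open>e\<close> is the unit of \<open>C\<close> and may differ from \<open>1\<close>. This is the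
  form in which positivity enters the two continuity results below.\<close>

lemma unit_minus_square:
  fixes h :: "'a::cstar_algebra"
  assumes C: "star_subalgebra C" "closed C" "is_unit_of C e" and h: "h \<in> C" "star h = h" "norm h \<le> 1"
  shows "\<exists>s\<in>C. star s = s \<and> s * s = e - h"
proof -
  obtain y where y: "y * y = 2 *\<^sub>R y - h" "star y = y" "y \<in> C"
    using one_minus_sqrt_exists[OF h(2,3)] C h(1) by metis
  have e: "e \<in> C" "e * e = e" "e * y = y" "y * e = y" using C(3) y(3) by (auto simp: is_unit_of_def)
  have "(e - y) * (e - y) = e - h"
    by (simp add: algebra_simps e y(1)) (simp add: scaleR_2)
  moreover have "e - y \<in> C"
    using C(1) e(1) y(3) csubspace_intros(4)[of C] by (auto simp: star_subalgebra_def)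
  ultimately show ?thesis
    using is_unit_of_star[OF C(1,3)] y(2) by (intro bexI[of _ "e - y"]) (auto simp: star_diff)
qed

subsection \<open>Automatic continuity\<close>

text \<open>Let \<open>h\<close> be \<open>star b * b\<close> scaled to norm at most 1, so that
  \<open>e - h\<close> is a square. Applying \<open>\<phi>\<close> splits \<open>\<phi> e\<close>
  into two positive summands, one of them a multiple of \<open>star (\<phi> b) * \<phi> b\<close>.
  As \<open>\<phi> e\<close> is a projection, its quadratic form is at most that of the identity; it
  need not be the identity, since homomorphisms are not assumed unital.\<close>

lemma star_hom_norm_le:
  fixes \<phi> :: "'a::cstar_algebra \<Rightarrow> 'h::chilbert_space bop"
  assumes B: "unital_cstar_subalgebra B" and \<phi>: "star_hom B C \<phi>" and b: "b \<in> B"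
  shows "norm (\<phi> b) \<le> norm b"
proof (cases "b = 0")
  case True
  have "\<phi> (0 *\<^sub>C b) = 0 *\<^sub>C \<phi> b" using \<phi> b unfolding star_hom_def by blast
  then show ?thesis using True by simp
next
  case False
  obtain e where e: "is_unit_of B e" using B by (auto simp: unital_cstar_subalgebra_def)
  have B': "star_subalgebra B" "closed B" using B by (auto simp: unital_cstar_subalgebra_def)
  have sub: "csubspace B" using B' by (simp add: star_subalgebra_def)
  have hom: "\<phi> (x * y) = \<phi> x * \<phi> y" "\<phi> (star x) = star (\<phi> x)" "\<phi> (x + y) = \<phi> x + \<phi> y" "\<phi> (c *\<^sub>C x) = c *\<^sub>C \<phi> x"
    if "x \<in> B" "y \<in> B" for x y c
    using \<phi> that by (auto simp: star_hom_def)
  define r where "r = (norm b)\<^sup>2"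
  have r: "r > 0" using False by (simp add: r_def)
  define h where "h = complex_of_real (1 / r) *\<^sub>C (star b * b)"
  have eB: "e \<in> B" "e * e = e" "star e = e" using e is_unit_of_star[OF B'(1) e] by (auto simp: is_unit_of_def)
  have bb: "star b * b \<in> B" "star b \<in> B" using b B' by (auto simp: star_subalgebra_def)
  have h: "h \<in> B" "star h = h" "norm h \<le> 1"
    using bb csubspace_intros(3)[OF sub] r
    by (auto simp: h_def star_scaleC star_mult star_star norm_scaleC cstar_identity r_def norm_divide norm_power)
  obtain s where s: "s \<in> B" "star s = s" "s * s = e - h"
    using unit_minus_square[OF B' e h] by blast
  have "\<phi> e = \<phi> (s * s + h)" by (simp add: s)
  also have "\<dots> = star (\<phi> s) * \<phi> s + complex_of_real (1 / r) *\<^sub>C (star (\<phi> b) * \<phi> b)"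
  proof -
    have "s * s \<in> B" using s(1) B'(1) by (auto simp: star_subalgebra_def)
    then have "\<phi> (s * s + h) = \<phi> (s * s) + \<phi> h" using h(1) by (rule hom(3))
    also have "\<phi> (s * s) = star (\<phi> s) * \<phi> s" using hom(1)[OF s(1) s(1)] hom(2)[OF s(1) s(1)] s(2) by simp
    also have "\<phi> h = complex_of_real (1 / r) *\<^sub>C \<phi> (star b * b)" unfolding h_def by (rule hom(4)[OF bb(1) bb(1)])
    also have "\<phi> (star b * b) = star (\<phi> b) * \<phi> b" using hom(1)[OF bb(2) b] hom(2)[OF b b] by simp
    finally show ?thesis .
  qed
  finally have e_eq: "\<phi> e = star (\<phi> s) * \<phi> s + complex_of_real (1 / r) *\<^sub>C (star (\<phi> b) * \<phi> b)" .
  have q: "inner x ((star T * T) \<cdot> x) = (norm (T \<cdot> x))\<^sup>2" for T :: "'h bop" and x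
    by (simp add: inner_eq_Re_cinner bop_simps cinner_star' power2_norm_eq_inner)
  have p: "star (\<phi> e) * \<phi> e = \<phi> e" using hom(1)[OF eB(1) eB(1)] hom(2)[OF eB(1) eB(1)] eB by simp
  have pn: "inner x (\<phi> e \<cdot> x) \<le> (norm x)\<^sup>2" for x
  proof -
    have eq: "inner x (\<phi> e \<cdot> x) = (norm (\<phi> e \<cdot> x))\<^sup>2" using q[of x "\<phi> e"] p by simp
    have "norm (\<phi> e \<cdot> x) * norm (\<phi> e \<cdot> x) \<le> norm x * norm (\<phi> e \<cdot> x)"
      using norm_cauchy_schwarz[of x "\<phi> e \<cdot> x"] unfolding eq by (simp add: power2_eq_square)
    then have "norm (\<phi> e \<cdot> x) \<le> norm x" by (cases "norm (\<phi> e \<cdot> x) = 0") auto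
    then show ?thesis unfolding eq by (simp add: power_mono)
  qed
  have "norm (bop_blinfun (\<phi> b)) \<le> norm b"
  proof (rule norm_blinfun_bound)
    fix x
    have "inner x (\<phi> e \<cdot> x) = (norm (\<phi> s \<cdot> x))\<^sup>2 + (1 / r) * (norm (\<phi> b \<cdot> x))\<^sup>2"
      unfolding e_eq scaleR_scaleC[symmetric]
      by (simp only: bop_simps(1) inner_add_right q) (simp add: scaleR_scaleC bop_simps(3) q[symmetric] flip: inner_scaleR_right)
    then have "(1 / r) * (norm (\<phi> b \<cdot> x))\<^sup>2 \<le> (norm x)\<^sup>2" using pn[of x] by (smt (verit) zero_le_power2)
    then have "(norm (\<phi> b \<cdot> x))\<^sup>2 \<le> (norm b * norm x)\<^sup>2"
      using r by (simp add: field_simps r_def)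
    then show "norm (\<phi> b \<cdot> x) \<le> norm b * norm x" by (simp add: power2_le_iff_abs_le)
  qed simp
  then show ?thesis by (simp add: norm_bop.rep_eq)
qed

lemma star_hom_continuous_on:
  fixes \<phi> :: "'a::cstar_algebra \<Rightarrow> 'h::chilbert_space bop"
  assumes B: "unital_cstar_subalgebra B" and \<phi>: "star_hom B C \<phi>"
  shows "continuous_on B \<phi>"
  unfolding continuous_on_iff
proof (intro ballI allI impI)
  fix x e assume x: "x \<in> B" and "e > (0::real)"
  have "dist (\<phi> x') (\<phi> x) \<le> dist x' x" if "x' \<in> B" for x'
  proof -
    have sub: "csubspace B" using B by (simp add: star_subalgebra_def unital_cstar_subalgebra_def)
    \<comment> \<open>The definition of \<open>star_hom\<close> speaks of sums and complex
      multiples, so the difference is written with the scalar -1.\<close>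
    have nB: "(-1) *\<^sub>C x \<in> B" "x' + (-1) *\<^sub>C x \<in> B"
      using csubspace_intros(2,3)[OF sub] x that by blast+
    have "\<phi> (x' + (-1) *\<^sub>C x) = \<phi> x' + (-1) *\<^sub>C \<phi> x"
      using \<phi> nB x that unfolding star_hom_def by metis
    then show ?thesis
      using star_hom_norm_le[OF B \<phi> nB(2)] by (simp add: dist_norm complex_vector.scale_minus_left)
  qed
  then show "\<exists>d>0. \<forall>x'\<in>B. dist x' x < d \<longrightarrow> dist (\<phi> x') (\<phi> x) < e"
    using \<open>e > 0\<close> by (intro exI[of _ e]) (auto intro: le_less_trans)
qed

text \<open>By automatic continuity the elements on which the two homomorphisms agree form a closed
  subspace. Identities between homomorphisms on a crossed product are thereby reduced to its
  generators.\<close>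

lemma star_hom_eqI:
  fixes \<phi> \<psi> :: "'a::cstar_algebra \<Rightarrow> 'h::chilbert_space bop"
  assumes B: "unital_cstar_subalgebra B" "B = closure (cspan S)"
    and hom: "star_hom B C \<phi>" "star_hom B C' \<psi>" and eq: "\<And>s. s \<in> S \<Longrightarrow> \<phi> s = \<psi> s" and b: "b \<in> B"
  shows "\<phi> b = \<psi> b"
proof -
  have sub: "csubspace B" and cl: "closed B"
    using B(1) by (simp_all add: star_subalgebra_def unital_cstar_subalgebra_def)
  have SB: "S \<subseteq> B" using B(2) closure_cspan_superset by blast
  define E where "E = {b\<in>B. \<phi> b = \<psi> b}"
  have "csubspace E"
  proof (rule csubspaceI)
    have "\<phi> (0 *\<^sub>C 0) = 0 *\<^sub>C \<phi> 0" "\<psi> (0 *\<^sub>C 0) = 0 *\<^sub>C \<psi> 0"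
      using hom csubspace_intros(1)[OF sub] unfolding star_hom_def by blast+
    then show "0 \<in> E" using csubspace_intros(1)[OF sub] by (simp add: E_def)
  qed (use sub hom in \<open>auto simp: E_def star_hom_def csubspace_intros(2,3)\<close>)
  moreover have "closed E"
    unfolding E_def using continuous_closed_preimage[of B "\<lambda>b. \<phi> b - \<psi> b" "{0}"] cl
      continuous_on_diff[OF star_hom_continuous_on[OF B(1) hom(1)] star_hom_continuous_on[OF B(1) hom(2)]]
    by (simp add: vimage_def Int_def Collect_conj_eq[symmetric])
  ultimately have "closure (cspan S) \<subseteq> E"
    by (intro closure_cspan_minimal) (use SB eq in \<open>auto simp: E_def\<close>)
  then show ?thesis using b B(2) by (auto simp: E_def)
qed

text \<open>For a self-adjoint contraction \<open>h\<close> the element \<open>e - h\<close> is a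
  square, so \<open>\<phi> h\<close> is real and at most 1. The factor 2 comes from splitting
  \<open>x\<close> into its real and imaginary parts; the bound serves the continuity of slices,
  where any constant will do.\<close>

lemma state_norm_le:
  assumes C: "star_subalgebra C" "closed C" "is_unit_of C e" and \<phi>: "state C \<phi>" and x: "x \<in> C"
  shows "cmod (\<phi> x) \<le> 2 * norm x"
proof -
  have sub: "csubspace C" using C by (simp add: star_subalgebra_def)
  have e: "e \<in> C" "\<phi> e = 1" using C(3) \<phi> is_unit_of_unique[OF C(3)] by (auto simp: state_def is_unit_of_def)
  have add: "\<phi> (a + b) = \<phi> a + \<phi> b" and sc: "\<phi> (c *\<^sub>C a) = c * \<phi> a" if "a \<in> C" "b \<in> C" for a b c
    using \<phi> that by (auto simp: state_def)
  have pos: "\<phi> (star a * a) \<in> \<real>\<^sub>\<ge>\<^sub>0" if "a \<in> C" for a using \<phi> that by (auto simp: state_def)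
  have sa1: "Im (\<phi> h) = 0 \<and> Re (\<phi> h) \<le> 1" if h: "h \<in> C" "star h = h" "norm h \<le> 1" for h
  proof -
    obtain s where s: "s \<in> C" "star s = s" "s * s = e - h" using unit_minus_square[OF C h] by blast
    have "\<phi> (s * s + h) = \<phi> (s * s) + \<phi> h" using s(1) h(1) C(1) by (intro add) (auto simp: star_subalgebra_def)
    then have "1 = \<phi> (s * s) + \<phi> h" using s(3) e(2) by simp
    moreover have "\<phi> (s * s) \<in> \<real>\<^sub>\<ge>\<^sub>0" using pos[OF s(1)] s(2) by simp
    ultimately show ?thesis by (auto simp: complex_nonneg_Reals_iff complex_eq_iff)
  qed
  have sa: "cmod (\<phi> h) \<le> norm h" if h: "h \<in> C" "star h = h" for h
  proof (cases "h = 0")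
    case True
    then show ?thesis using sc[OF h(1) h(1), of 0] by simp
  next
    case False
    define k where "k = complex_of_real (1 / norm h) *\<^sub>C h"
    have k: "k \<in> C" "star k = k" "norm k \<le> 1"
      using h csubspace_intros(3)[OF sub] False by (auto simp: k_def star_scaleC norm_scaleC norm_divide)
    have mk: "- k \<in> C" "star (- k) = - k" "norm (- k) \<le> 1"
      using k csubspace_intros(6)[OF sub] by (auto simp: star_minus)
    have "\<phi> (- k) = - \<phi> k" using sc[OF k(1) k(1), of "-1"] by (simp add: complex_vector.scale_minus_left)
    then have "cmod (\<phi> k) \<le> 1" using sa1[OF k] sa1[OF mk] by (simp add: cmod_eq_Re abs_le_iff)
    moreover have "\<phi> k = complex_of_real (1 / norm h) * \<phi> h" unfolding k_def by (rule sc[OF h(1) h(1)])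
    ultimately show ?thesis using False by (simp add: norm_mult norm_divide field_simps)
  qed
  define a where "a = complex_of_real (1/2) *\<^sub>C (x + star x)"
  define b where "b = (- \<i> / 2) *\<^sub>C (x - star x)"
  have b': "b = (\<i> / 2) *\<^sub>C (star x - x)"
    by (metis b_def complex_vector.scale_minus_left complex_vector.scale_minus_right minus_diff_eq minus_divide_left)
  have sx: "star x \<in> C" using x C(1) by (auto simp: star_subalgebra_def)
  have ab: "a \<in> C" "b \<in> C" "star a = a" "star b = b"
  proof -
    show "a \<in> C" unfolding a_def by (intro csubspace_intros(2,3)[OF sub] x sx)
    show "b \<in> C" unfolding b_def by (intro csubspace_intros(3,4)[OF sub] x sx)
    show "star a = a" by (simp add: a_def star_scaleC star_add star_star add.commute)
    have "star b = (\<i> / 2) *\<^sub>C (star x - x)" unfolding b_def by (simp only: star_scaleC star_diff star_star) simp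
    then show "star b = b" using b' by simp
  qed
  have ib: "\<i> *\<^sub>C b \<in> C" by (rule csubspace_intros(3)[OF sub ab(2)])
  have xab: "x = a + \<i> *\<^sub>C b"
    by (simp add: a_def b_def scaleC_scaleC complex_vector.scale_right_distrib complex_vector.scale_right_diff_distrib
        flip: scaleC_add_left)
  have na: "norm a \<le> norm x" unfolding a_def norm_scaleC using norm_triangle_ineq[of x "star x"] by simp
  have nb: "norm b \<le> norm x" unfolding b_def norm_scaleC using norm_triangle_ineq4[of x "star x"] by simp
  have "\<phi> x = \<phi> a + \<i> * \<phi> b" using add[OF ab(1) ib] sc[OF ab(2) ab(2), of \<i>] xab by simp
  then have "cmod (\<phi> x) \<le> cmod (\<phi> a) + cmod (\<phi> b)" using norm_triangle_ineq[of "\<phi> a" "\<i> * \<phi> b"] by (simp add: norm_mult)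
  then show ?thesis using sa[OF ab(1,3)] sa[OF ab(2,4)] na nb by linarith
qed

section \<open>Tensor products of operators\<close>

subsection \<open>Complex linearity\<close>

lemma is_clinear_blinfun: "is_clinear (blinfun_apply T) \<longleftrightarrow> (\<forall>c x. T (c *\<^sub>C x) = c *\<^sub>C T x)"
  for T :: "'v::chilbert_space \<Rightarrow>\<^sub>L 'w::chilbert_space"
  by (simp add: is_clinear_def blinfun.add_right)

lemma is_clinear_scaleC: "is_clinear f \<Longrightarrow> f (c *\<^sub>C x) = c *\<^sub>C f x"
  by (simp add: is_clinear_def)

lemma is_clinear_bop [simp, intro]: "is_clinear (blinfun_apply (bop_blinfun T))"
  by (simp add: is_clinear_blinfun bop_scaleC)

lemma Bop_blinfun [simp]: "is_clinear (blinfun_apply T) \<Longrightarrow> bop_blinfun (Bop T) = T"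
  by (simp add: is_clinear_blinfun Bop_inverse)

lemma is_clinear_id [simp, intro]: "is_clinear (\<lambda>x. x)"
  by (simp add: is_clinear_def)

lemma is_clinear_compose [simp, intro]:
  "is_clinear (blinfun_apply S) \<Longrightarrow> is_clinear (blinfun_apply T) \<Longrightarrow> is_clinear (blinfun_apply (S o\<^sub>L T))"
  by (simp add: is_clinear_def blinfun.add_right)

lemma is_clinear_amp [simp, intro]: "is_clinear (blinfun_apply S) \<Longrightarrow> is_clinear (blinfun_apply (amp S))"
  by (auto simp: is_clinear_blinfun intro!: ell2_eqI)

lemma is_clinear_flip [simp, intro]: "is_clinear (blinfun_apply flip)"
  by (auto simp: is_clinear_blinfun intro!: ell2_eqI)

lemma is_clinear_creation [simp, intro]: "is_clinear (blinfun_apply (creation x))"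
  by (auto simp: is_clinear_blinfun tensor_vec_scaleC_right)

lemma is_clinear_mono_op:
  assumes "inj \<sigma>" "\<And>i. norm (T i) \<le> M" "\<And>i. is_clinear (blinfun_apply (T i))"
  shows "is_clinear (blinfun_apply (mono_op \<sigma> T))"
  using assms(3) by (auto simp: is_clinear_blinfun mono_op_fun[OF assms(1,2)] intro!: ell2_eqI)

subsection \<open>Existence of tensor products of operators\<close>

lemma bounded_linear_tensor_left: "bounded_linear (\<lambda>x. x \<otimes>\<^sub>v v)"
  by (rule bounded_linear_intro[where K = "norm v"])
     (simp_all add: tensor_vec_add_left scaleR_scaleC tensor_vec_scaleC_left norm_tensor_vec)

lemma blinfun_ell2_ell2_eqI:
  fixes R S :: "('j, ('i, 'v::chilbert_space) ell2) ell2 \<Rightarrow>\<^sub>L 'w::real_normed_vector"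
  assumes "\<And>x i j. R ((x \<otimes>\<^sub>v ket i) \<otimes>\<^sub>v ket j) = S ((x \<otimes>\<^sub>v ket i) \<otimes>\<^sub>v ket j)"
  shows "R = S"
proof (rule blinfun_ell2_eqI)
  fix f :: "('i, 'v) ell2" and j
  let ?t = "Blinfun (\<lambda>x. x \<otimes>\<^sub>v ket j) :: ('i, 'v) ell2 \<Rightarrow>\<^sub>L ('j, ('i, 'v) ell2) ell2"
  have t: "?t x = x \<otimes>\<^sub>v ket j" for x
    by (simp add: bounded_linear_Blinfun_apply bounded_linear_tensor_left)
  have "R o\<^sub>L ?t = S o\<^sub>L ?t" by (rule blinfun_ell2_eqI) (simp add: t assms)
  then have "(R o\<^sub>L ?t) f = (S o\<^sub>L ?t) f" by simp
  then show "R (f \<otimes>\<^sub>v ket j) = S (f \<otimes>\<^sub>v ket j)" by (simp add: t)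
qed

lemma bop_ell2_eqI:
  assumes "\<And>x i. R \<cdot> (x \<otimes>\<^sub>v ket i) = S \<cdot> (x \<otimes>\<^sub>v ket i)"
  shows "R = S"
  using blinfun_ell2_eqI[of "bop_blinfun R" "bop_blinfun S"] assms by (simp add: bop_blinfun_inject)

lemma bop_ell2_ell2_eqI:
  assumes "\<And>x i j. R \<cdot> ((x \<otimes>\<^sub>v ket i) \<otimes>\<^sub>v ket j) = S \<cdot> ((x \<otimes>\<^sub>v ket i) \<otimes>\<^sub>v ket j)"
  shows "R = S"
  using blinfun_ell2_ell2_eqI[of "bop_blinfun R" "bop_blinfun S"] assms by (simp add: bop_blinfun_inject)

lemma pythagoras_cinner:
  "cinner x y = 0 \<Longrightarrow> (norm (x + y))\<^sup>2 = (norm x)\<^sup>2 + (norm y)\<^sup>2"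
  by (simp add: power2_norm_eq_inner inner_add_left inner_add_right inner_commute[of y x])
     (simp add: inner_eq_Re_cinner)

lemma cinner_sum_right: "cinner x (sum f F) = (\<Sum>i\<in>F. cinner x (f i))"
  by (induction F rule: infinite_finite_induct) (simp_all add: cinner_add_right)

lemma bop_sum_right: "T \<cdot> sum f F = (\<Sum>i\<in>F. T \<cdot> f i)"
  by (rule blinfun.sum_right)

text \<open>Orthogonalising the left factors against \<open>x k\<close> reduces the estimate to fewer summands.\<close>

lemma norm_tensor_sum_le:
  fixes x :: "'k \<Rightarrow> 'h::chilbert_space" and T :: "('i, complex) ell2 bop"
  assumes "finite F"
  shows "norm (\<Sum>k\<in>F. x k \<otimes>\<^sub>v (T \<cdot> v k)) \<le> norm T * norm (\<Sum>k\<in>F. x k \<otimes>\<^sub>v v k)"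
  using assms
proof (induction F arbitrary: x v)
  case (insert k F)
  define a where "a = x k"
  show ?case
  proof (cases "a = 0")
    case True
    then show ?thesis using insert by (simp add: a_def)
  next
    case False
    \<comment> \<open>A Gram-Schmidt step: the part of \<open>x j\<close> along \<open>a\<close> is
      moved across the tensor sign and collected in \<open>w\<close>, which leaves
      \<open>x' j\<close> orthogonal to \<open>a\<close>.\<close>
    define c where "c j = cinner a (x j) / cinner a a" for j
    define x' where "x' j = x j - c j *\<^sub>C a" for j
    define w where "w = v k + (\<Sum>j\<in>F. c j *\<^sub>C v j)"
    have aa: "cinner a a \<noteq> 0" using False by (simp add: cinner_self)
    have orth: "cinner a (x' j) = 0" for j
      using aa by (simp add: x'_def c_def cinner_diff_right cinner_scaleC_right)
    have split: "(\<Sum>j\<in>insert k F. x j \<otimes>\<^sub>v (L \<cdot> v j)) = a \<otimes>\<^sub>v (L \<cdot> w) + (\<Sum>j\<in>F. x' j \<otimes>\<^sub>v (L \<cdot> v j))"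
      for L :: "('i, complex) ell2 bop"
    proof -
      have "x j \<otimes>\<^sub>v (L \<cdot> v j) = a \<otimes>\<^sub>v (c j *\<^sub>C (L \<cdot> v j)) + x' j \<otimes>\<^sub>v (L \<cdot> v j)" for j
        by (simp add: x'_def tensor_vec_scaleC_right flip: tensor_vec_scaleC_left tensor_vec_add_left)
      then show ?thesis
        using insert.hyps by (simp add: a_def w_def blinfun.add_right bop_sum_right bop_scaleC
            tensor_vec_add_right tensor_vec_sum_right sum.distrib)
    qed
    have sq: "(norm (\<Sum>j\<in>insert k F. x j \<otimes>\<^sub>v (L \<cdot> v j)))\<^sup>2
        = (norm a * norm (L \<cdot> w))\<^sup>2 + (norm (\<Sum>j\<in>F. x' j \<otimes>\<^sub>v (L \<cdot> v j)))\<^sup>2" for L :: "('i, complex) ell2 bop"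
      unfolding split
      by (subst pythagoras_cinner) (simp_all add: cinner_sum_right cinner_tensor_tensor orth norm_tensor_vec)
    have "norm (T \<cdot> w) \<le> norm T * norm w" by (simp add: norm_bop.rep_eq norm_blinfun)
    then have "(norm a * norm (T \<cdot> w))\<^sup>2 \<le> (norm a * (norm T * norm w))\<^sup>2"
      by (intro power_mono mult_left_mono) simp_all
    moreover have "(norm (\<Sum>j\<in>F. x' j \<otimes>\<^sub>v (T \<cdot> v j)))\<^sup>2 \<le> (norm T * norm (\<Sum>j\<in>F. x' j \<otimes>\<^sub>v v j))\<^sup>2"
      by (intro power_mono insert.IH) simp
    ultimately have "(norm (\<Sum>j\<in>insert k F. x j \<otimes>\<^sub>v (T \<cdot> v j)))\<^sup>2
        \<le> (norm T)\<^sup>2 * ((norm a * norm w)\<^sup>2 + (norm (\<Sum>j\<in>F. x' j \<otimes>\<^sub>v v j))\<^sup>2)"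
      unfolding sq[of T] by (simp add: power_mult_distrib algebra_simps)
    \<comment> \<open>The same splitting is used with the identity in place of \<open>T\<close>,
      since \<open>a\<close>, \<open>w\<close> and \<open>x'\<close> depend on the vectors
      only.\<close>
    also have "\<dots> = (norm T * norm (\<Sum>j\<in>insert k F. x j \<otimes>\<^sub>v v j))\<^sup>2"
      using sq[of 1] by (simp add: bop_simps(4) power_mult_distrib)
    finally show ?thesis by (rule power2_le_imp_le) simp
  qed
qed simp

text \<open>Completeness is stated for sequences, whereas an unordered sum is a limit over finite
  sets. The increasing sets \<open>G n\<close>, each capturing the sum up to
  \<open>1 / (n + 1)\<close>, pass from one to the other. The criterion covers sums that need not
  converge absolutely.\<close>

lemma summable_on_CauchyI:
  fixes f :: "'i \<Rightarrow> 'b::banach"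
  assumes "\<And>e. e > 0 \<Longrightarrow> \<exists>F0. finite F0 \<and> (\<forall>F. finite F \<longrightarrow> F \<inter> F0 = {} \<longrightarrow> norm (sum f F) < e)"
  shows "f summable_on UNIV"
proof -
  have "\<forall>n. \<exists>F0. finite F0 \<and> (\<forall>F. finite F \<longrightarrow> F \<inter> F0 = {} \<longrightarrow> norm (sum f F) < 1 / real (Suc n))"
    using assms by simp
  then obtain F0 where F0: "\<And>n. finite (F0 n)"
    "\<And>n F. finite F \<Longrightarrow> F \<inter> F0 n = {} \<Longrightarrow> norm (sum f F) < 1 / real (Suc n)" by metis
  define G where "G n = (\<Union>k\<le>n. F0 k)" for n
  have fG: "finite (G n)" for n using F0(1) by (simp add: G_def)
  have near: "norm (sum f F - sum f (G n)) < 1 / real (Suc n)" if "finite F" "G n \<subseteq> F" for F n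
  proof -
    have "sum f F - sum f (G n) = sum f (F - G n)" using that by (simp add: sum_diff)
    moreover have "(F - G n) \<inter> F0 n = {}" by (auto simp: G_def)
    ultimately show ?thesis using F0(2)[of "F - G n" n] that(1) by simp
  qed
  have mono: "G m \<subseteq> G n" if "m \<le> n" for m n using that unfolding G_def by (intro UN_mono) auto
  have "Cauchy (\<lambda>n. sum f (G n))"
  proof (rule metric_CauchyI)
    fix e :: real assume "e > 0"
    then obtain N where N: "2 / e < real (Suc N)" using reals_Archimedean2 less_Suc_eq by (metis less_trans of_nat_less_iff)
    have "dist (sum f (G m)) (sum f (G n)) < e" if "m \<ge> N" "n \<ge> N" for m n
    proof -
      have "norm (sum f (G m) - sum f (G n))
          \<le> norm (sum f (G m) - sum f (G N)) + norm (sum f (G n) - sum f (G N))"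
        using norm_triangle_ineq4[of "sum f (G m) - sum f (G N)" "sum f (G n) - sum f (G N)"] by simp
      also have "\<dots> < 1 / real (Suc N) + 1 / real (Suc N)"
        using near[OF fG mono[OF that(1)]] near[OF fG mono[OF that(2)]] by (rule add_strict_mono)
      also have "\<dots> < e" using N \<open>e > 0\<close> by (simp add: field_simps)
      finally show ?thesis by (simp add: dist_norm)
    qed
    then show "\<exists>M. \<forall>m\<ge>M. \<forall>n\<ge>M. dist (sum f (G m)) (sum f (G n)) < e" by blast
  qed
  then obtain s where s: "(\<lambda>n. sum f (G n)) \<longlonglongrightarrow> s" using Cauchy_convergent convergent_def by blast
  have "(f has_sum s) UNIV"
    unfolding has_sum_def tendsto_iff eventually_finite_subsets_at_top
  proof (intro allI impI)
    fix e :: real assume "e > 0"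
    then obtain N1 where N1: "\<And>n. n \<ge> N1 \<Longrightarrow> dist (sum f (G n)) s < e / 2"
      using s by (meson half_gt_zero metric_LIMSEQ_D)
    obtain N2 where N2: "2 / e < real (Suc N2)" using reals_Archimedean2 less_Suc_eq by (metis less_trans of_nat_less_iff)
    define N where "N = max N1 N2"
    have "1 / real (Suc N) \<le> 1 / real (Suc N2)" by (simp add: N_def frac_le)
    also have "\<dots> < e / 2" using N2 \<open>e > 0\<close> by (simp add: field_simps)
    finally have "1 / real (Suc N) < e / 2" .
    then have "dist (sum f Y) s < e" if "finite Y" "G N \<subseteq> Y" for Y
      using near[OF that] N1[of N] dist_triangle[of "sum f Y" s "sum f (G N)"] by (simp add: N_def dist_norm)
    then show "\<exists>X. finite X \<and> X \<subseteq> UNIV \<and> (\<forall>Y. finite Y \<and> X \<subseteq> Y \<and> Y \<subseteq> UNIV \<longrightarrow> dist (sum f Y) s < e)"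
      using fG by blast
  qed
  then show ?thesis by (auto simp: summable_on_def)
qed

lemma has_sum_tail:
  fixes f :: "'i \<Rightarrow> 'b::real_normed_vector"
  assumes "(f has_sum s) UNIV" "e > 0"
  shows "\<exists>F0. finite F0 \<and> (\<forall>F. finite F \<longrightarrow> F \<inter> F0 = {} \<longrightarrow> norm (sum f F) < e)"
proof -
  obtain F0 where F0: "finite F0" "\<And>Y. finite Y \<Longrightarrow> F0 \<subseteq> Y \<Longrightarrow> dist (sum f Y) s < e / 2"
    using assms unfolding has_sum_def tendsto_iff eventually_finite_subsets_at_top by (meson half_gt_zero subset_UNIV)
  have "norm (sum f F) < e" if F: "finite F" "F \<inter> F0 = {}" for F
  proof -
    have "sum f F = sum f (F \<union> F0) - sum f F0" using F F0(1) by (simp add: sum.union_disjoint)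
    then have "norm (sum f F) \<le> dist (sum f (F \<union> F0)) s + dist (sum f F0) s"
      by (metis dist_norm dist_triangle3 dist_commute)
    then show ?thesis using F0(2)[of "F \<union> F0"] F0(2)[of F0] F F0(1) by simp
  qed
  then show ?thesis using F0(1) by blast
qed

text \<open>The operator is defined by a series over the basis. The images
  \<open>T \<cdot> ket i\<close> need not be orthogonal, so convergence is obtained by applying
  \<open>norm_tensor_sum_le\<close> to the tails of the convergent expansion of
  \<open>f\<close>.\<close>

lemma id_tensor_exists:
  fixes T :: "('i, complex) ell2 bop"
  shows "\<exists>R :: ('i, 'h::chilbert_space) ell2 bop. (\<forall>x v. R \<cdot> (x \<otimes>\<^sub>v v) = x \<otimes>\<^sub>v (T \<cdot> v)) \<and> norm R \<le> norm T"
proof -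
  define t where "t f i = ell2_fun f i \<otimes>\<^sub>v (T \<cdot> ket i)" for f :: "('i, 'h) ell2" and i
  have le: "norm (sum (t f) F) \<le> norm T * norm (\<Sum>i\<in>F. ell2_fun f i \<otimes>\<^sub>v ket i)" if "finite F" for f F
    unfolding t_def by (rule norm_tensor_sum_le[OF that])
  have le': "norm (\<Sum>i\<in>F. ell2_fun f i \<otimes>\<^sub>v ket i) \<le> norm f" if "finite F" for f :: "('i, 'h) ell2" and F
  proof -
    have "ell2_fun (\<Sum>i\<in>F. ell2_fun f i \<otimes>\<^sub>v ket i) j = (if j \<in> F then ell2_fun f j else 0)" for j
    proof -
      have "ell2_fun (\<Sum>i\<in>F. ell2_fun f i \<otimes>\<^sub>v ket i) j = (\<Sum>i\<in>F. if j = i then ell2_fun f j else 0)"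
        unfolding ell2_fun_sum by (intro sum.cong) auto
      then show ?thesis using that by simp
    qed
    then have "norm (\<Sum>i\<in>F. ell2_fun f i \<otimes>\<^sub>v ket i) \<le> 1 * norm f"
      by (intro ell2_norm_dominated[of id]) (simp_all del: ell2_fun_sum)
    then show ?thesis by simp
  qed
  have sm: "t f summable_on UNIV" for f
  proof (rule summable_on_CauchyI)
    fix e :: real assume "e > 0"
    \<comment> \<open>The summand 1 keeps the denominator positive when
      \<open>T = 0\<close>.\<close>
    then have "e / (norm T + 1) > 0" by (simp add: add_nonneg_pos)
    from has_sum_tail[OF ell2_has_sum[of f] this] obtain F0 where F0: "finite F0"
      "\<And>F. finite F \<Longrightarrow> F \<inter> F0 = {} \<Longrightarrow> norm (\<Sum>i\<in>F. ell2_fun f i \<otimes>\<^sub>v ket i) < e / (norm T + 1)" by blast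
    have "norm (sum (t f) F) < e" if "finite F" "F \<inter> F0 = {}" for F
    proof -
      have "norm (sum (t f) F) \<le> norm T * (e / (norm T + 1))"
        using le[OF that(1), of f] mult_left_mono[OF less_imp_le[OF F0(2)[OF that]], of "norm T"] by simp
      also have "\<dots> < e"
      proof -
        have "norm T * e < e * (norm T + 1)" using \<open>e > 0\<close> by (simp add: algebra_simps)
        then show ?thesis using norm_ge_zero[of T] by (simp add: pos_divide_less_eq add_nonneg_pos)
      qed
      finally show ?thesis .
    qed
    then show "\<exists>F0. finite F0 \<and> (\<forall>F. finite F \<longrightarrow> F \<inter> F0 = {} \<longrightarrow> norm (sum (t f) F) < e)" using F0(1) by blast
  qed
  define r where "r f = infsum (t f) UNIV" for f
  have r: "(t f has_sum r f) UNIV" for f using sm by (simp add: r_def has_sum_infsum)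
  have radd: "r (f + g) = r f + r g" for f g
    by (rule has_sum_unique[OF r]) (use has_sum_add[OF r[of f] r[of g]] in \<open>simp add: t_def[abs_def] tensor_vec_add_left\<close>)
  have rsc: "r (c *\<^sub>C f) = c *\<^sub>C r f" for c f
    by (rule has_sum_unique[OF r])
       (use has_sum_bounded_linear[OF bounded_linear_scaleC r[of f], of c] in \<open>simp add: t_def[abs_def] tensor_vec_scaleC_left\<close>)
  have rn: "norm (r f) \<le> norm T * norm f" for f
  proof -
    have "norm (sum (t f) F) \<le> norm T * norm f" if "finite F" for F
      using le[OF that, of f] mult_left_mono[OF le'[OF that, of f] norm_ge_zero[of T]] by linarith
    then have "r f \<in> cball 0 (norm T * norm f)"
      by (intro has_sum_in_closed[OF _ _ r]) auto
    then show ?thesis by simp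
  qed
  have "bounded_linear r"
    by (rule bounded_linear_intro[where K = "norm T"]) (use radd rsc rn in \<open>auto simp: scaleR_scaleC mult.commute\<close>)
  then have R: "blinfun_apply (Blinfun r) = r" by (rule bounded_linear_Blinfun_apply)
  then have "is_clinear (blinfun_apply (Blinfun r))" by (simp add: is_clinear_def radd rsc)
  then have B: "bop_blinfun (Bop (Blinfun r)) = Blinfun r" by (rule Bop_blinfun)
  have "r (x \<otimes>\<^sub>v v) = x \<otimes>\<^sub>v (T \<cdot> v)" for x v
  proof (rule has_sum_unique[OF r])
    have "((\<lambda>i. x \<otimes>\<^sub>v (T \<cdot> (ell2_fun v i \<otimes>\<^sub>v ket i))) has_sum x \<otimes>\<^sub>v (T \<cdot> v)) UNIV"
      by (rule has_sum_bounded_linear[OF bounded_linear_compose[OF bounded_linear_tensor_right blinfun.bounded_linear_right] ell2_has_sum])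
    then show "(t (x \<otimes>\<^sub>v v) has_sum x \<otimes>\<^sub>v (T \<cdot> v)) UNIV"
      by (simp add: t_def[abs_def] ell2_scalar_tensor bop_scaleC tensor_vec_scaleC_left tensor_vec_scaleC_right)
  qed
  moreover have "norm (Bop (Blinfun r)) \<le> norm T"
    unfolding norm_bop.rep_eq[of "Bop (Blinfun r)"] B by (rule norm_blinfun_bound) (use rn in \<open>simp_all add: R\<close>)
  ultimately show ?thesis using B R by metis
qed

section \<open>Calculus of tensor products of bounded operators\<close>

lemma norm_bop_le: "norm (T \<cdot> x) \<le> norm T * norm x"
  by (simp add: norm_bop.rep_eq norm_blinfun)

lemma norm_bop_bound: "b \<ge> 0 \<Longrightarrow> (\<And>x. norm (T \<cdot> x) \<le> b * norm x) \<Longrightarrow> norm T \<le> b"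
  by (simp add: norm_bop.rep_eq norm_blinfun_bound)

lemma tensor_bop_eqI:
  assumes "\<And>x v. R \<cdot> (x \<otimes>\<^sub>v v) = (S \<cdot> x) \<otimes>\<^sub>v (T \<cdot> v)"
  shows "S \<otimes>\<^sub>b T = R"
  unfolding tensor_bop_def
  by (rule the_equality) (use assms in \<open>auto intro: bop_ell2_eqI\<close>)

lemma tensor_bop_ex:
  fixes S :: "'h::chilbert_space bop" and T :: "('i, complex) ell2 bop"
  shows "\<exists>R :: ('i, 'h) ell2 bop. (\<forall>x v. R \<cdot> (x \<otimes>\<^sub>v v) = (S \<cdot> x) \<otimes>\<^sub>v (T \<cdot> v)) \<and> norm R \<le> norm S * norm T"
proof -
  obtain R :: "('i, 'h) ell2 bop" where R: "\<And>x v. R \<cdot> (x \<otimes>\<^sub>v v) = x \<otimes>\<^sub>v (T \<cdot> v)" "norm R \<le> norm T" using id_tensor_exists by metis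
  define A :: "('i, 'h) ell2 bop" where "A = Bop (amp (bop_blinfun S))"
  have A: "bop_blinfun A = amp (bop_blinfun S)" by (simp add: A_def)
  have "norm A \<le> norm S" by (simp add: norm_bop.rep_eq A norm_amp_le)
  then have "norm (A * R) \<le> norm S * norm T"
    using norm_mult_ineq[of A R] R(2) mult_mono[of "norm A" "norm S" "norm R" "norm T"] by simp
  then show ?thesis by (intro exI[of _ "A * R"]) (simp add: bop_simps A R(1))
qed

lemma tensor_bop_apply [simp]: "(S \<otimes>\<^sub>b T) \<cdot> (x \<otimes>\<^sub>v v) = (S \<cdot> x) \<otimes>\<^sub>v (T \<cdot> v)"
  using tensor_bop_ex[of S T] tensor_bop_eqI by metis

lemma norm_tensor_bop_le: "norm (S \<otimes>\<^sub>b T) \<le> norm S * norm T"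
  using tensor_bop_ex[of S T] tensor_bop_eqI by metis

lemma tensor_bop_mult: "(S \<otimes>\<^sub>b T) * (S' \<otimes>\<^sub>b T') = (S * S') \<otimes>\<^sub>b (T * T')"
  by (rule tensor_bop_eqI[symmetric]) (simp add: bop_simps)

lemma tensor_bop_one [simp]: "1 \<otimes>\<^sub>b 1 = 1"
  by (rule tensor_bop_eqI) (simp add: bop_simps)

lemma tensor_bop_add_left: "(S + S') \<otimes>\<^sub>b T = S \<otimes>\<^sub>b T + S' \<otimes>\<^sub>b T"
  and tensor_bop_scaleC_left: "(c *\<^sub>C S) \<otimes>\<^sub>b T = c *\<^sub>C (S \<otimes>\<^sub>b T)"
  by (rule tensor_bop_eqI; simp add: bop_simps tensor_vec_add_left tensor_vec_scaleC_left)+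

lemma tensor_bop_zero_left [simp]: "0 \<otimes>\<^sub>b T = 0"
  using tensor_bop_add_left[of 0 0 T] by simp

lemma bop_ell2_eqI_cinner:
  assumes "\<And>x y i j. cinner (x \<otimes>\<^sub>v ket i) (R \<cdot> (y \<otimes>\<^sub>v ket j)) = cinner (x \<otimes>\<^sub>v ket i) (S \<cdot> (y \<otimes>\<^sub>v ket j))"
  shows "R = S"
proof (rule bop_ell2_eqI, rule ell2_eqI)
  fix y i j
  show "ell2_fun (R \<cdot> y \<otimes>\<^sub>v ket j) i = ell2_fun (S \<cdot> y \<otimes>\<^sub>v ket j) i"
    by (rule cinner_eqI) (use assms in \<open>simp add: cinner_tensor_ket'\<close>)
qed

lemma star_tensor_bop: "star (S \<otimes>\<^sub>b T) = star S \<otimes>\<^sub>b star T"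
  by (rule bop_ell2_eqI_cinner) (simp add: cinner_star' cinner_tensor_tensor)

lemma tensor_bop_one_right:
  "bop_blinfun (S \<otimes>\<^sub>b 1 :: ('i, 'h::chilbert_space) ell2 bop) = amp (bop_blinfun S)"
proof -
  have "(S \<otimes>\<^sub>b 1 :: ('i, 'h) ell2 bop) = Bop (amp (bop_blinfun S))"
    by (rule tensor_bop_eqI) (simp add: bop_simps)
  then show ?thesis by simp
qed

lemma bounded_linear_tensor_bop_left: "bounded_linear (\<lambda>S. S \<otimes>\<^sub>b T)"
  by (rule bounded_linear_intro[where K = "norm T"])
     (simp_all add: tensor_bop_add_left scaleR_scaleC tensor_bop_scaleC_left norm_tensor_bop_le)

lemma tensor_blinfun_eqI:
  fixes S :: "'v::chilbert_space \<Rightarrow>\<^sub>L 'w::chilbert_space" and T :: "('i, complex) ell2 \<Rightarrow>\<^sub>L ('i, complex) ell2"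
  assumes "\<And>x v. blinfun_apply R (x \<otimes>\<^sub>v v) = S x \<otimes>\<^sub>v T v"
  shows "S \<otimes>\<^sub>L T = R"
  unfolding tensor_blinfun_def
  by (rule the_equality) (use assms in \<open>auto intro: blinfun_ell2_eqI\<close>)

subsection \<open>Unitaries and spatial homomorphisms\<close>

text \<open>The inverse is carried along as data because \<open>star\<close> exists only for
  operators from a space to itself. Mutually inverse contractions are isometric, so contractivity is
  all that has to be recorded.\<close>

definition unitary_pair :: "('v::chilbert_space \<Rightarrow>\<^sub>L 'w::chilbert_space) \<Rightarrow> ('w \<Rightarrow>\<^sub>L 'v) \<Rightarrow> bool" where
  "unitary_pair J J' \<longleftrightarrow> is_clinear (blinfun_apply J) \<and> is_clinear (blinfun_apply J') \<and>
     (\<forall>x. J' (J x) = x) \<and> (\<forall>y. J (J' y) = y) \<and> (\<forall>x. norm (J x) \<le> norm x) \<and> (\<forall>y. norm (J' y) \<le> norm y)"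

lemma unitary_pairD:
  assumes "unitary_pair J J'"
  shows "is_clinear (blinfun_apply J)" "is_clinear (blinfun_apply J')" "J' (J x) = x" "J (J' y) = y"
  using assms by (auto simp: unitary_pair_def)

lemma unitary_pair_norm: "unitary_pair J J' \<Longrightarrow> norm (J x) = norm x"
  by (metis unitary_pair_def order_antisym)

lemma unitary_pair_sym: "unitary_pair J J' \<Longrightarrow> unitary_pair J' J"
  by (auto simp: unitary_pair_def)

lemma unitary_pair_cinner_same:
  assumes "unitary_pair J J'"
  shows "cinner (J x) (J y) = cinner x y"
proof -
  have i: "inner (J x) (J y) = inner x y" for x y
    using unitary_pair_norm[OF assms, of "x + y"] unitary_pair_norm[OF assms, of x] unitary_pair_norm[OF assms, of y]
    by (simp add: norm_eq_sqrt_inner blinfun.add_right inner_add_left inner_add_right inner_commute)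
  show ?thesis
    using unitary_pairD(1)[OF assms] by (simp add: cinner_eq_inner i is_clinear_scaleC[symmetric])
qed

lemma unitary_pair_cinner:
  assumes "unitary_pair J J'"
  shows "cinner (J x) y = cinner x (J' y)"
  using unitary_pair_cinner_same[OF assms, of x "J' y"] unitary_pairD(4)[OF assms] by simp

lemma unitary_pair_compose:
  "unitary_pair J J' \<Longrightarrow> unitary_pair K K' \<Longrightarrow> unitary_pair (J o\<^sub>L K) (K' o\<^sub>L J')"
  by (auto simp: unitary_pair_def) (meson order_trans)+

lemma unitary_pair_flip: "unitary_pair flip flip"
  by (simp add: unitary_pair_def norm_flip_le)

lemma unitary_pair_id: "unitary_pair id_blinfun id_blinfun"
  by (simp add: unitary_pair_def)

lemma unitary_pair_mono_op:
  assumes \<sigma>: "\<And>i. \<sigma> (\<tau> i) = i" "\<And>i. \<tau> (\<sigma> i) = i" and T: "\<And>i. unitary_pair (T i) (T' i)"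
  shows "unitary_pair (mono_op \<sigma> T) (mono_op \<tau> (\<lambda>j. T' (\<tau> j)))"
    and "ell2_fun (mono_op \<sigma> T f) i = T i (ell2_fun f (\<sigma> i))"
proof -
  have inj: "inj \<sigma>" "inj \<tau>" by (metis \<sigma> injI)+
  have n: "norm (T i) \<le> 1" "norm (T' i) \<le> 1" for i
    using T[of i] by (auto intro!: norm_blinfun_bound simp: unitary_pair_def)
  note f = mono_op_fun[OF inj(1), of T, OF n(1)] mono_op_fun[OF inj(2), of "\<lambda>j. T' (\<tau> j)", OF n(2)]
  show "ell2_fun (mono_op \<sigma> T f) i = T i (ell2_fun f (\<sigma> i))" by (rule f)
  note nn = norm_mono_op[OF inj(1), of T, OF n(1)] norm_mono_op[OF inj(2), of "\<lambda>j. T' (\<tau> j)", OF n(2)]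
  have "norm (mono_op \<sigma> T f) \<le> norm f" "norm (mono_op \<tau> (\<lambda>j. T' (\<tau> j)) g) \<le> norm g" for f g
    using norm_blinfun[of "mono_op \<sigma> T" f] norm_blinfun[of "mono_op \<tau> (\<lambda>j. T' (\<tau> j))" g] nn
    by (meson mult_left_le_one_le norm_ge_zero order_trans)+
  moreover have "is_clinear (blinfun_apply (mono_op \<sigma> T))" "is_clinear (blinfun_apply (mono_op \<tau> (\<lambda>j. T' (\<tau> j))))"
    using T by (auto intro!: is_clinear_mono_op[where M = 1] inj n simp: unitary_pair_def)
  ultimately show "unitary_pair (mono_op \<sigma> T) (mono_op \<tau> (\<lambda>j. T' (\<tau> j)))"
    unfolding unitary_pair_def
    by (auto intro!: ell2_eqI simp: f \<sigma> unitary_pairD[OF T])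
qed

lemma unitary_pair_amp: "unitary_pair J J' \<Longrightarrow> unitary_pair (amp J) (amp J')"
  using unitary_pair_mono_op(1)[of id id "\<lambda>_. J" "\<lambda>_. J'"] by (simp add: amp_def)

text \<open>Amplification followed by conjugation: one shape for the comultiplication, the coaction,
  the representation on the amplified space and conjugation by the corepresentation. Being defined
  on all bounded operators, it restricts to every algebra concerned.\<close>

definition spatial :: "(('i, 'k::chilbert_space) ell2 \<Rightarrow>\<^sub>L 'l::chilbert_space) \<Rightarrow> ('l \<Rightarrow>\<^sub>L ('i, 'k) ell2) \<Rightarrow> 'k bop \<Rightarrow> 'l bop" where
  "spatial J J' T = Bop (J o\<^sub>L amp (bop_blinfun T) o\<^sub>L J')"

lemma spatial_apply: "unitary_pair J J' \<Longrightarrow> spatial J J' T \<cdot> x = J (amp (bop_blinfun T) (J' x))"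
  unfolding spatial_def by (subst Bop_blinfun) (simp_all add: unitary_pairD)

lemma bop_minus [simp]: "(S - T) \<cdot> x = S \<cdot> x - T \<cdot> x"
  by (simp add: minus_bop.rep_eq blinfun.diff_left)

lemma star_hom_spatial:
  assumes J: "unitary_pair J J'"
  shows "star_hom UNIV UNIV (spatial J J')"
  unfolding star_hom_def
proof (intro conjI ballI allI)
  note a = spatial_apply[OF J]
  fix S T and c
  show "spatial J J' (S + T) = spatial J J' S + spatial J J' T"
  proof (rule bop_eqI)
    fix x
    have "amp (bop_blinfun (S + T)) (J' x) = amp (bop_blinfun S) (J' x) + amp (bop_blinfun T) (J' x)"
      by (rule ell2_eqI) (simp add: bop_simps)
    then show "spatial J J' (S + T) \<cdot> x = (spatial J J' S + spatial J J' T) \<cdot> x"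
      by (simp add: bop_simps a blinfun.add_right)
  qed
  show "spatial J J' (S * T) = spatial J J' S * spatial J J' T"
  proof (rule bop_eqI)
    fix x
    have "amp (bop_blinfun (S * T)) (J' x) = amp (bop_blinfun S) (amp (bop_blinfun T) (J' x))"
      by (rule ell2_eqI) (simp add: bop_simps)
    then show "spatial J J' (S * T) \<cdot> x = (spatial J J' S * spatial J J' T) \<cdot> x"
      by (simp add: bop_simps a unitary_pairD[OF J])
  qed
  show "spatial J J' (c *\<^sub>C S) = c *\<^sub>C spatial J J' S"
  proof (rule bop_eqI)
    fix x
    have "amp (bop_blinfun (c *\<^sub>C S)) (J' x) = c *\<^sub>C amp (bop_blinfun S) (J' x)"
      by (rule ell2_eqI) (simp add: bop_simps)
    then show "spatial J J' (c *\<^sub>C S) \<cdot> x = (c *\<^sub>C spatial J J' S) \<cdot> x"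
      using unitary_pairD(1)[OF J] by (simp add: bop_simps a is_clinear_scaleC)
  qed
  show "spatial J J' (star S) = star (spatial J J' S)"
  proof (rule bop_eqI_cinner)
    fix x y
    have amp: "cinner (amp (bop_blinfun (star S)) f) g = cinner f (amp (bop_blinfun S) g)" for f g
      by (simp add: cinner_ell2_fun cinner_star)
    show "cinner (spatial J J' (star S) \<cdot> x) y = cinner (star (spatial J J' S) \<cdot> x) y"
      by (simp add: cinner_star a unitary_pair_cinner[OF J] amp) (simp add: unitary_pair_cinner[OF unitary_pair_sym[OF J]])
  qed
qed simp

lemma unital_cstar_subalgebra_UNIV: "unital_cstar_subalgebra (UNIV :: 'a::cstar_algebra set)"
  by (auto simp: unital_cstar_subalgebra_def star_subalgebra_def is_unit_of_def intro!: csubspaceI exI[of _ 1])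

lemma star_hom_norm_le_UNIV: "star_hom UNIV UNIV \<phi> \<Longrightarrow> norm (\<phi> b) \<le> norm b"
  for \<phi> :: "'a::cstar_algebra \<Rightarrow> 'h::chilbert_space bop"
  using star_hom_norm_le[OF unital_cstar_subalgebra_UNIV] by blast

lemma star_hom_bounded_linear:
  fixes \<phi> :: "'a::cstar_algebra \<Rightarrow> 'h::chilbert_space bop"
  assumes "star_hom UNIV UNIV \<phi>"
  shows "bounded_linear \<phi>"
  by (rule bounded_linear_intro[where K = 1])
     (use assms star_hom_norm_le_UNIV[OF assms] in \<open>auto simp: star_hom_def scaleR_scaleC\<close>)

lemma star_hom_image_closure_cspan:
  fixes \<phi> :: "'a::cstar_algebra \<Rightarrow> 'h::chilbert_space bop"
  assumes \<phi>: "star_hom UNIV UNIV \<phi>" and C: "csubspace C" "closed C" and S: "\<phi> ` S \<subseteq> C"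
  shows "\<phi> ` closure (cspan S) \<subseteq> C"
proof -
  have "\<phi> 0 = 0" using bounded_linear.linear[OF star_hom_bounded_linear[OF \<phi>]] linear_0 by blast
  then have "csubspace (\<phi> -` C)"
    using \<phi> by (intro csubspaceI) (auto simp: star_hom_def csubspace_intros[OF C(1)])
  moreover have "closed (\<phi> -` C)"
    by (intro continuous_closed_vimage C linear_continuous_at star_hom_bounded_linear \<phi>)
  ultimately have "closure (cspan S) \<subseteq> \<phi> -` C" by (intro closure_cspan_minimal) (use S in auto)
  then show ?thesis by blast
qed

lemma star_hom_comp: "star_hom UNIV UNIV f \<Longrightarrow> star_hom UNIV UNIV g \<Longrightarrow> star_hom B UNIV (\<lambda>x. f (g x))"
  by (auto simp: star_hom_def)

lemma star_hom_restrict: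
  assumes "star_hom UNIV UNIV \<phi>" "star_subalgebra B" "\<phi> ` B \<subseteq> C"
  shows "star_hom B C (restrict \<phi> B)"
  using assms by (auto simp: star_hom_def star_subalgebra_def csubspace_intros(2,3))

text \<open>All maps specified by definite descriptions arise in this way from a homomorphism defined everywhere.\<close>

lemma the_star_hom_eq:
  fixes \<phi> :: "'a::cstar_algebra \<Rightarrow> 'h::chilbert_space bop"
  assumes B: "unital_cstar_subalgebra B" "B = closure (cspan S)" and \<phi>: "star_hom UNIV UNIV \<phi>"
    and C: "csubspace C" "closed C" "\<phi> ` S \<subseteq> C"
    and P: "\<And>\<theta>. P \<theta> \<longleftrightarrow> \<theta> \<in> extensional B \<and> star_hom B C \<theta> \<and> (\<forall>s\<in>S. \<theta> s = \<phi> s)"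
  shows "(THE \<theta>. P \<theta>) = restrict \<phi> B"
proof (rule the_equality)
  have SB: "S \<subseteq> B" using B(2) closure_cspan_superset by blast
  have im: "\<phi> ` B \<subseteq> C" unfolding B(2) by (rule star_hom_image_closure_cspan[OF \<phi> C])
  have hom: "star_hom B C (restrict \<phi> B)"
    using B(1) by (intro star_hom_restrict[OF \<phi> _ im]) (simp add: unital_cstar_subalgebra_def)
  then show "P (restrict \<phi> B)" using SB by (auto simp: P)
  fix \<theta> assume "P \<theta>"
  then have \<theta>: "\<theta> \<in> extensional B" "star_hom B C \<theta>" "\<And>s. s \<in> S \<Longrightarrow> \<theta> s = \<phi> s" by (auto simp: P)
  show "\<theta> = restrict \<phi> B"
  proof (rule extensionalityI[OF \<theta>(1) restrict_extensional])
    fix b assume "b \<in> B"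
    then show "\<theta> b = restrict \<phi> B b"
      by (rule star_hom_eqI[OF B \<theta>(2) hom, rotated]) (use \<theta>(3) SB in auto)
  qed
qed

section \<open>Coactions of a discrete group\<close>

subsection \<open>Translations and the reduced group C*-algebra\<close>

definition translation :: "'g::group_add \<Rightarrow> ('g, 'v::chilbert_space) ell2 \<Rightarrow>\<^sub>L ('g, 'v) ell2" where
  "translation g = mono_op (\<lambda>x. - g + x) (\<lambda>_. id_blinfun)"

lemma translation_fun [simp]: "ell2_fun (translation g f) x = ell2_fun f (- g + x)"
  unfolding translation_def
  by (subst unitary_pair_mono_op(2)[where \<tau> = "\<lambda>x. g + x" and T' = "\<lambda>_. id_blinfun"])
     (simp_all add: unitary_pair_id add.assoc[symmetric])

lemma unitary_pair_translation: "unitary_pair (translation g) (translation (- g))"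
  using unitary_pair_mono_op(1)[of "\<lambda>x. - g + x" "\<lambda>x. g + x" "\<lambda>_. id_blinfun" "\<lambda>_. id_blinfun"]
  by (simp add: translation_def unitary_pair_id add.assoc[symmetric])

lemma minus_add_eq_iff: "- g + y = x \<longleftrightarrow> y = g + (x :: 'g::group_add)"
  by (metis add.assoc add.left_inverse add.right_inverse add_0)

lemma translation_ket: "translation g (ket x) = ket (g + x)"
  by (rule ell2_eqI) (simp add: minus_add_eq_iff)

lemma translation_tensor: "translation g (x \<otimes>\<^sub>v v) = x \<otimes>\<^sub>v translation g v"
  by (rule ell2_eqI) simp

lemma bop_on_basis_eqI:
  assumes "\<And>i. R \<cdot> ket i = f i"
  shows "bop_on_basis f = R"
  unfolding bop_on_basis_def
proof (rule the_equality)
  fix S assume "\<forall>i. S \<cdot> ket i = f i"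
  then show "S = R" by (intro bop_ell2_eqI) (simp add: ell2_scalar_tensor bop_scaleC assms)
qed (use assms in blast)

lemma bop_blinfun_lshift: "bop_blinfun (lshift g) = translation g"
proof -
  have t: "bop_blinfun (Bop (translation g)) = translation g"
    using unitary_pair_translation unitary_pairD(1) by (intro Bop_blinfun) blast
  have "lshift g = Bop (translation g)"
    unfolding lshift_def by (rule bop_on_basis_eqI) (simp add: t translation_ket)
  then show ?thesis by (simp add: t)
qed

lemma lshift_ket: "lshift g \<cdot> ket x = ket (g + x)"
  by (simp add: bop_blinfun_lshift translation_ket)

lemma lshift_mult: "lshift g * lshift h = lshift (g + h)"
  by (rule bop_eqI, rule ell2_eqI) (simp add: bop_simps bop_blinfun_lshift minus_add add.assoc[symmetric])

lemma lshift_zero [simp]: "lshift 0 = 1"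
  by (rule bop_eqI, rule ell2_eqI) (simp add: bop_simps bop_blinfun_lshift)

lemma star_lshift: "star (lshift g) = lshift (- g)"
proof (rule bop_eqI_cinner)
  fix x y :: "('a, complex) ell2"
  show "cinner (star (lshift g) \<cdot> x) y = cinner (lshift (- g) \<cdot> x) y"
    using unitary_pair_cinner[OF unitary_pair_translation[of "- g"], of x y]
    by (simp add: cinner_star bop_blinfun_lshift)
qed

lemma tensor_lshift_fun: "ell2_fun ((S \<otimes>\<^sub>b lshift g) \<cdot> f) x = S \<cdot> ell2_fun f (- g + x)"
proof -
  have "bop_blinfun (S \<otimes>\<^sub>b lshift g) = amp (bop_blinfun S) o\<^sub>L translation g"
    by (rule blinfun_ell2_eqI) (simp add: bop_blinfun_lshift translation_tensor)
  then show ?thesis by simp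
qed

lemma unital_closure_cspan:
  fixes S :: "'a::cstar_algebra set"
  assumes "\<And>x y. x \<in> S \<Longrightarrow> y \<in> S \<Longrightarrow> x * y \<in> S" "\<And>x. x \<in> S \<Longrightarrow> star x \<in> S"
    and e: "e \<in> S" "\<And>x. x \<in> S \<Longrightarrow> e * x = x \<and> x * e = x"
  shows "unital_cstar_subalgebra (closure (cspan S))" "is_unit_of (closure (cspan S)) e"
proof -
  show "is_unit_of (closure (cspan S)) e" by (rule is_unit_of_closure_cspan[OF e])
  then show "unital_cstar_subalgebra (closure (cspan S))"
    unfolding unital_cstar_subalgebra_def
    using assms by (intro conjI star_subalgebra_closure star_subalgebra_cspan complex_vector.span_base) auto
qed

lemma Cred_unital: "unital_cstar_subalgebra (Cred :: ('g::group_add, complex) ell2 bop set)"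
  and Cred_unit: "is_unit_of (Cred :: ('g::group_add, complex) ell2 bop set) 1"
  unfolding Cred_def
  by (rule unital_closure_cspan[where e = 1];
      auto simp: lshift_mult star_lshift intro: range_eqI[of _ _ 0])+

lemma lshift_Cred [simp]: "lshift g \<in> Cred"
  unfolding Cred_def by (intro closure_cspan_superset rangeI)

lemma one_Cred [simp]: "1 \<in> Cred"
  using Cred_unit by (simp add: is_unit_of_def)

lemma Cred_star_subalgebra: "star_subalgebra Cred" and closed_Cred: "closed Cred" and csubspace_Cred: "csubspace Cred"
  using Cred_unital by (auto simp: unital_cstar_subalgebra_def star_subalgebra_def)

lemma min_tensor_mem: "b \<in> B \<Longrightarrow> c \<in> C \<Longrightarrow> b \<otimes>\<^sub>b c \<in> B \<otimes>\<^sub>m\<^sub>i\<^sub>n C"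
  unfolding min_tensor_def by (rule closure_cspan_superset) blast

lemma csubspace_min_tensor: "csubspace (B \<otimes>\<^sub>m\<^sub>i\<^sub>n C)" and closed_min_tensor: "closed (B \<otimes>\<^sub>m\<^sub>i\<^sub>n C)"
  unfolding min_tensor_def by (rule csubspace_closure_cspan[OF bounded_linear_scaleC_cstar]) simp

lemma min_tensor_unital:
  assumes B: "unital_cstar_subalgebra B" "is_unit_of B e" and C: "unital_cstar_subalgebra C" "is_unit_of C f"
  shows "unital_cstar_subalgebra (B \<otimes>\<^sub>m\<^sub>i\<^sub>n C)" "is_unit_of (B \<otimes>\<^sub>m\<^sub>i\<^sub>n C) (e \<otimes>\<^sub>b f)"
proof -
  let ?S = "{b \<otimes>\<^sub>b c | b c. b \<in> B \<and> c \<in> C}"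
  have m: "x * y \<in> ?S" if "x \<in> ?S" "y \<in> ?S" for x y
    using that B C unfolding unital_cstar_subalgebra_def star_subalgebra_def
    by (auto simp: tensor_bop_mult) blast
  have s: "star x \<in> ?S" if "x \<in> ?S" for x
    using that B C unfolding unital_cstar_subalgebra_def star_subalgebra_def
    by (auto simp: star_tensor_bop) blast
  have e: "e \<otimes>\<^sub>b f \<in> ?S" using B C by (auto simp: is_unit_of_def)
  have u: "e \<otimes>\<^sub>b f * x = x \<and> x * e \<otimes>\<^sub>b f = x" if "x \<in> ?S" for x
    using that B(2) C(2) by (auto simp: is_unit_of_def tensor_bop_mult)
  show "unital_cstar_subalgebra (B \<otimes>\<^sub>m\<^sub>i\<^sub>n C)" "is_unit_of (B \<otimes>\<^sub>m\<^sub>i\<^sub>n C) (e \<otimes>\<^sub>b f)"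
    unfolding min_tensor_def by (rule unital_closure_cspan[OF m s e u]; assumption)+
qed

lemma ball_Collect2: "(\<forall>s\<in>{f a b | a b. Q a b}. P s) \<longleftrightarrow> (\<forall>a b. Q a b \<longrightarrow> P (f a b))"
  by blast

subsection \<open>The comultiplication\<close>

text \<open>The unitary \<open>\<xi> \<otimes> \<delta>\<^sub>x \<otimes> \<delta>\<^sub>y \<mapsto> \<xi> \<otimes> \<delta>\<^sub>x \<otimes> \<delta>\<^sub>x\<^sub>y\<close> implements both the comultiplication and the dual coaction.\<close>

definition cotwist :: "('g::group_add, ('g, 'v::chilbert_space) ell2) ell2 \<Rightarrow>\<^sub>L ('g, ('g, 'v) ell2) ell2" where
  "cotwist = flip o\<^sub>L mono_op id translation o\<^sub>L flip"

definition cotwist_inv :: "('g::group_add, ('g, 'v::chilbert_space) ell2) ell2 \<Rightarrow>\<^sub>L ('g, ('g, 'v) ell2) ell2" where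
  "cotwist_inv = flip o\<^sub>L mono_op id (\<lambda>x. translation (- x)) o\<^sub>L flip"

lemma unitary_pair_cotwist:
  "unitary_pair (cotwist :: ('g::group_add, ('g, 'v::chilbert_space) ell2) ell2 \<Rightarrow>\<^sub>L _) cotwist_inv"
proof -
  let ?T = "mono_op id translation :: ('g, ('g, 'v) ell2) ell2 \<Rightarrow>\<^sub>L _"
  let ?T' = "mono_op id (\<lambda>x. translation (- x)) :: ('g, ('g, 'v) ell2) ell2 \<Rightarrow>\<^sub>L _"
  have "unitary_pair ?T ?T'"
    using unitary_pair_mono_op(1)[of id id translation "\<lambda>x. translation (- x)"] by (simp add: unitary_pair_translation)
  from unitary_pair_compose[OF unitary_pair_compose[OF unitary_pair_flip this] unitary_pair_flip]
  have "unitary_pair (cotwist :: ('g, ('g, 'v) ell2) ell2 \<Rightarrow>\<^sub>L _) (flip o\<^sub>L (?T' o\<^sub>L flip))"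
    unfolding cotwist_def .
  moreover have "flip o\<^sub>L (?T' o\<^sub>L flip) = (cotwist_inv :: ('g, ('g, 'v) ell2) ell2 \<Rightarrow>\<^sub>L _)"
    unfolding cotwist_inv_def by (rule blinfun_eqI) simp
  ultimately show ?thesis by simp
qed

lemma cotwist_fun [simp]: "ell2_fun (ell2_fun (cotwist f) y) x = ell2_fun (ell2_fun f (- x + y)) x"
  unfolding cotwist_def
  by (simp add: unitary_pair_mono_op(2)[of id id translation "\<lambda>x. translation (- x)"] unitary_pair_translation)

lemma cotwist_inv_fun [simp]: "ell2_fun (ell2_fun (cotwist_inv f) y) x = ell2_fun (ell2_fun f (x + y)) x"
  unfolding cotwist_inv_def
  by (simp add: unitary_pair_mono_op(2)[of id id "\<lambda>x. translation (- x)" translation, OF _ _ unitary_pair_sym[OF unitary_pair_translation]])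

lemma cotwist_ket: "cotwist ((\<xi> \<otimes>\<^sub>v ket x) \<otimes>\<^sub>v ket y) = (\<xi> \<otimes>\<^sub>v ket x) \<otimes>\<^sub>v ket (x + y)"
  by (intro ell2_eqI) (auto simp: minus_add_eq_iff)

lemma cotwist_inv_ket: "cotwist_inv ((\<xi> \<otimes>\<^sub>v ket x) \<otimes>\<^sub>v ket y) = (\<xi> \<otimes>\<^sub>v ket x) \<otimes>\<^sub>v ket (- x + y)"
  using cotwist_ket[of \<xi> x "- x + y"] unitary_pairD(3)[OF unitary_pair_cotwist]
  by (metis add.assoc add.right_inverse add_0)

text \<open>Operators of degree \<open>g\<close>, when the summand of the space over
  \<open>x\<close> is given degree \<open>x\<close>. The generators of \<open>Cred\<close> and of
  the crossed product are of this kind.\<close>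

definition homogeneous :: "'g::group_add \<Rightarrow> ('g, 'v::chilbert_space) ell2 bop \<Rightarrow> bool" where
  "homogeneous g T \<longleftrightarrow> (\<forall>\<xi> x. \<exists>\<zeta>. T \<cdot> (\<xi> \<otimes>\<^sub>v ket x) = \<zeta> \<otimes>\<^sub>v ket (g + x))"

lemma homogeneous_tensor_lshift: "homogeneous g (S \<otimes>\<^sub>b lshift g)"
  by (auto simp: homogeneous_def lshift_ket)

lemma homogeneous_lshift: "homogeneous g (lshift g)"
  by (auto simp: homogeneous_def ell2_scalar_tensor bop_scaleC lshift_ket)

text \<open>On indices the conjugation takes \<open>(x, y)\<close> to \<open>(x, - x + y)\<close>,
  then to \<open>(g + x, - x + y)\<close>, then to \<open>(g + x, g + y)\<close>. The last leg is
  thus translated by the degree.\<close>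

lemma spatial_cotwist_homogeneous:
  assumes "homogeneous g T"
  shows "spatial cotwist cotwist_inv T = T \<otimes>\<^sub>b lshift g"
proof (rule bop_ell2_ell2_eqI)
  fix \<xi> x y
  obtain \<zeta> where \<zeta>: "T \<cdot> (\<xi> \<otimes>\<^sub>v ket x) = \<zeta> \<otimes>\<^sub>v ket (g + x)" using assms by (auto simp: homogeneous_def)
  have "g + x + (- x + y) = g + y" by (simp add: add.assoc)
  then show "spatial cotwist cotwist_inv T \<cdot> (\<xi> \<otimes>\<^sub>v ket x) \<otimes>\<^sub>v ket y = (T \<otimes>\<^sub>b lshift g) \<cdot> (\<xi> \<otimes>\<^sub>v ket x) \<otimes>\<^sub>v ket y"
    by (simp add: spatial_apply[OF unitary_pair_cotwist] cotwist_inv_ket \<zeta> cotwist_ket lshift_ket)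
qed

lemma comult_eq: "comult = restrict (spatial cotwist cotwist_inv) Cred"
  unfolding comult_def
proof (rule the_star_hom_eq[where S = "range lshift"])
  show "Cred = closure (cspan (range lshift))" by (rule Cred_def)
  show "spatial cotwist cotwist_inv ` range lshift \<subseteq> Cred \<otimes>\<^sub>m\<^sub>i\<^sub>n Cred"
    by (auto simp: spatial_cotwist_homogeneous[OF homogeneous_lshift] min_tensor_mem)
qed (auto simp: Cred_unital csubspace_min_tensor closed_min_tensor star_hom_spatial unitary_pair_cotwist
    spatial_cotwist_homogeneous[OF homogeneous_lshift])

lemma amp_creation_cotwist: "cotwist (amp (creation x) w) = amp (creation x) (cotwist w)"
  and amp_creation_cotwist_inv: "cotwist_inv (amp (creation x) w) = amp (creation x) (cotwist_inv w)"
  by (intro ell2_eqI; simp)+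

lemma creation_tensor_id: "creation x \<otimes>\<^sub>L id_blinfun = amp (creation x)"
  by (rule tensor_blinfun_eqI) simp

text \<open>The unitary \<open>cotwist\<close> touches only the two group legs, hence commutes with
  \<open>amp (creation x)\<close>. Uniqueness holds because the basic vectors
  \<open>(\<xi> \<otimes>\<^sub>v ket x) \<otimes>\<^sub>v ket y\<close> are of the form
  \<open>amp (creation \<xi>) w\<close>.\<close>

lemma tensor_bop23_comult:
  fixes b :: "'l::chilbert_space bop" and c :: "('g::group_add, complex) ell2 bop"
  assumes c: "c \<in> Cred"
  shows "tensor_bop23 b (comult c) = spatial cotwist cotwist_inv (b \<otimes>\<^sub>b c)"
  unfolding tensor_bop23_def creation_tensor_id
proof (rule the_equality)
  have "amp (bop_blinfun (b \<otimes>\<^sub>b c)) (amp (creation x) w) = amp (creation (b \<cdot> x)) (amp (bop_blinfun c) w)"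
    for x and w :: "('g, ('g, complex) ell2) ell2"
    by (rule ell2_eqI) simp
  then show *: "\<forall>x w. spatial cotwist cotwist_inv (b \<otimes>\<^sub>b c) \<cdot> amp (creation x) w
      = amp (creation (b \<cdot> x)) (comult c \<cdot> w)"
    using c by (simp add: comult_eq spatial_apply[OF unitary_pair_cotwist] amp_creation_cotwist amp_creation_cotwist_inv)
  fix T assume T: "\<forall>x w. T \<cdot> amp (creation x) w = amp (creation (b \<cdot> x)) (comult c \<cdot> w)"
  show "T = spatial cotwist cotwist_inv (b \<otimes>\<^sub>b c)"
  proof (rule bop_ell2_ell2_eqI)
    fix \<xi> :: 'l and x y :: 'g
    have "(\<xi> \<otimes>\<^sub>v ket x) \<otimes>\<^sub>v ket y = amp (creation \<xi>) (ket x \<otimes>\<^sub>v ket y)"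
      by (rule amp_tensor[OF is_clinear_creation, unfolded creation_apply, symmetric])
    then show "T \<cdot> (\<xi> \<otimes>\<^sub>v ket x) \<otimes>\<^sub>v ket y = spatial cotwist cotwist_inv (b \<otimes>\<^sub>b c) \<cdot> (\<xi> \<otimes>\<^sub>v ket x) \<otimes>\<^sub>v ket y"
      using T * by metis
  qed
qed

lemma id_comult_eq:
  fixes B :: "'l::chilbert_space bop set"
  assumes B: "unital_cstar_subalgebra B"
  shows "id_comult B = restrict (spatial cotwist (cotwist_inv :: ('g::group_add, ('g, 'l) ell2) ell2 \<Rightarrow>\<^sub>L _)) (B \<otimes>\<^sub>m\<^sub>i\<^sub>n Cred)"
  unfolding id_comult_def
proof (rule the_star_hom_eq[where C = UNIV and S = "{b \<otimes>\<^sub>b c | b c. b \<in> B \<and> c \<in> Cred}"])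
  obtain e where "is_unit_of B e" using B by (auto simp: unital_cstar_subalgebra_def)
  then show "unital_cstar_subalgebra (B \<otimes>\<^sub>m\<^sub>i\<^sub>n (Cred :: ('g, complex) ell2 bop set))"
    by (rule min_tensor_unital(1)[OF B _ Cred_unital Cred_unit])
  show "B \<otimes>\<^sub>m\<^sub>i\<^sub>n Cred = closure (cspan {b \<otimes>\<^sub>b c | b c. b \<in> B \<and> c \<in> Cred})" by (rule min_tensor_def)
qed (unfold ball_Collect2, auto simp: star_hom_spatial unitary_pair_cotwist tensor_bop23_comult intro: csubspaceI)

lemma unitary_pair_amp_flip:
  "unitary_pair J J' \<Longrightarrow> unitary_pair (amp J o\<^sub>L flip) (flip o\<^sub>L amp J')"
  by (rule unitary_pair_compose[OF unitary_pair_amp unitary_pair_flip])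

text \<open>Amplifying an operator on the enlarged space puts the auxiliary index outside the group
  index. The flip moves it inwards, next to the space on which \<open>J\<close> acts, and the group
  leg becomes a spectator of \<open>J\<close>.\<close>

lemma spatial_amp_flip_tensor:
  fixes J :: "('i, 'k::chilbert_space) ell2 \<Rightarrow>\<^sub>L 'l::chilbert_space" and c :: "('g, complex) ell2 bop"
  assumes J: "unitary_pair J J'"
  shows "spatial (amp J o\<^sub>L flip) (flip o\<^sub>L amp J') (b \<otimes>\<^sub>b c) = spatial J J' b \<otimes>\<^sub>b c"
proof (rule tensor_bop_eqI[symmetric])
  fix x and v :: "('g, complex) ell2"
  have fl: "ell2_fun (flip (f \<otimes>\<^sub>v v)) i = ell2_fun f i \<otimes>\<^sub>v v" for f :: "('i, 'k) ell2" and i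
    by (rule ell2_eqI) simp
  have "flip (amp (bop_blinfun (b \<otimes>\<^sub>b c)) (flip (f \<otimes>\<^sub>v v))) = amp (bop_blinfun b) f \<otimes>\<^sub>v (c \<cdot> v)" for f :: "('i, 'k) ell2"
    by (intro ell2_eqI) (simp add: fl)
  then show "spatial (amp J o\<^sub>L flip) (flip o\<^sub>L amp J') (b \<otimes>\<^sub>b c) \<cdot> x \<otimes>\<^sub>v v = (spatial J J' b \<cdot> x) \<otimes>\<^sub>v (c \<cdot> v)"
    by (simp add: spatial_apply[OF unitary_pair_amp_flip[OF J]] spatial_apply[OF J] unitary_pairD[OF J])
qed

text \<open>Agreement with a spatial map is asked on \<open>B\<close> only, because the coaction and
  the representation to which this is applied are restrictions to the crossed product.\<close>

lemma tensor_id_eq: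
  fixes B :: "'l::chilbert_space bop set"
  assumes B: "unital_cstar_subalgebra B" and J: "unitary_pair J J'" and \<phi>: "\<And>b. b \<in> B \<Longrightarrow> \<phi> b = spatial J J' b"
  shows "tensor_id B \<phi> = restrict (spatial (amp J o\<^sub>L flip) (flip o\<^sub>L amp J')) (B \<otimes>\<^sub>m\<^sub>i\<^sub>n (Cred :: ('g::group_add, complex) ell2 bop set))"
  unfolding tensor_id_def
proof (rule the_star_hom_eq[where C = UNIV and S = "{b \<otimes>\<^sub>b c | b c. b \<in> B \<and> c \<in> Cred}"])
  obtain e where "is_unit_of B e" using B by (auto simp: unital_cstar_subalgebra_def)
  then show "unital_cstar_subalgebra (B \<otimes>\<^sub>m\<^sub>i\<^sub>n (Cred :: ('g, complex) ell2 bop set))"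
    by (rule min_tensor_unital(1)[OF B _ Cred_unital Cred_unit])
  show "B \<otimes>\<^sub>m\<^sub>i\<^sub>n Cred = closure (cspan {b \<otimes>\<^sub>b c | b c. b \<in> B \<and> c \<in> Cred})" by (rule min_tensor_def)
  show "star_hom UNIV UNIV (spatial (amp J o\<^sub>L flip) (flip o\<^sub>L amp J'))"
    by (rule star_hom_spatial[OF unitary_pair_amp_flip[OF J]])
qed (unfold ball_Collect2, auto simp: \<phi> spatial_amp_flip_tensor[OF J] intro: csubspaceI)

subsection \<open>The regular representation of the crossed product\<close>

locale covariant_rep =
  fixes \<alpha> :: "'g::group_add \<Rightarrow> 'a::cstar_algebra \<Rightarrow> 'a"
    and \<pi> :: "'a \<Rightarrow> 'h::chilbert_space bop"
    and u :: "'g \<Rightarrow> 'h bop"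
  assumes action: "cstar_action \<alpha>" and rep: "star_hom UNIV UNIV \<pi>" and unitary: "unitary_rep u"
    and covariant: "u g * \<pi> a * star (u g) = \<pi> (\<alpha> g a)"
begin

lemma \<alpha>_simps: "\<alpha> 0 a = a" "\<alpha> g (\<alpha> h a) = \<alpha> (g + h) a" "\<alpha> g (a + b) = \<alpha> g a + \<alpha> g b"
  "\<alpha> g (a * b) = \<alpha> g a * \<alpha> g b" "\<alpha> g (c *\<^sub>C a) = c *\<^sub>C \<alpha> g a" "\<alpha> g (star a) = star (\<alpha> g a)"
  using action by (auto simp: cstar_action_def star_hom_def)

text \<open>Homomorphisms are not unital by definition. Here \<open>\<alpha> g 1\<close> acts as a
  left unit on \<open>\<alpha> g (\<alpha> (- g) 1)\<close>, which is \<open>1\<close>.\<close>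

lemma \<alpha>_one: "\<alpha> g 1 = 1"
proof -
  have "\<alpha> g 1 * \<alpha> g (\<alpha> (- g) 1) = \<alpha> g (\<alpha> (- g) 1)" by (simp flip: \<alpha>_simps(4))
  then show ?thesis by (simp add: \<alpha>_simps)
qed

lemma \<pi>_simps: "\<pi> (a + b) = \<pi> a + \<pi> b" "\<pi> (a * b) = \<pi> a * \<pi> b" "\<pi> (c *\<^sub>C a) = c *\<^sub>C \<pi> a" "\<pi> (star a) = star (\<pi> a)"
  using rep by (auto simp: star_hom_def)

lemma norm_\<pi>\<alpha>_le: "norm (\<pi> (\<alpha> g a)) \<le> norm a"
proof -
  have "star_hom UNIV UNIV (\<lambda>a. \<pi> (\<alpha> g a))" by (simp add: star_hom_def \<alpha>_simps \<pi>_simps)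
  from star_hom_norm_le_UNIV[OF this] show ?thesis .
qed

lemma u_simps: "u 0 = 1" "u (g + h) = u g * u h" "star (u g) * u g = 1" "u g * star (u g) = 1" "star (u g) = u (- g)"
proof -
  show *: "u 0 = 1" "u (g + h) = u g * u h" "star (u g) * u g = 1" "u g * star (u g) = 1" for g h
    using unitary by (auto simp: unitary_rep_def)
  have "u g * u (- g) = 1" by (metis *(1,2) add.right_inverse)
  then show "star (u g) = u (- g)" by (metis *(3) mult.assoc mult.left_neutral mult.right_neutral)
qed

lemma u_\<pi>: "u g * \<pi> a = \<pi> (\<alpha> g a) * u g"
  unfolding covariant[symmetric] by (simp add: mult.assoc u_simps(3))

lemma reg_alg_fun: "ell2_fun (reg_alg \<alpha> \<pi> a \<cdot> f) x = \<pi> (\<alpha> (- x) a) \<cdot> ell2_fun f x"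
proof -
  define T where "T x = bop_blinfun (\<pi> (\<alpha> (- x) a))" for x
  have n: "norm (T x) \<le> norm a" for x using norm_\<pi>\<alpha>_le[of "- x" a] by (simp add: T_def norm_bop.rep_eq)
  note f = mono_op_fun[OF inj_on_id, of T, OF n]
  have B: "bop_blinfun (Bop (mono_op id T)) = mono_op id T"
    by (rule Bop_blinfun, rule is_clinear_mono_op[where M = "norm a"]) (simp_all add: n, simp add: T_def)
  have "Bop (mono_op id T) \<cdot> (\<xi> \<otimes>\<^sub>v ket x) = (\<pi> (\<alpha> (- x) a) \<cdot> \<xi>) \<otimes>\<^sub>v ket x" for \<xi> x
    unfolding B by (rule ell2_eqI) (simp add: f T_def)
  then have "reg_alg \<alpha> \<pi> a = Bop (mono_op id T)"
    unfolding reg_alg_def by (intro the_equality) (auto intro: bop_ell2_eqI)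
  then show ?thesis unfolding B by (simp add: B f) (simp add: T_def)
qed

lemma reg_elt_fun: "ell2_fun (reg_elt \<alpha> \<pi> a g \<cdot> f) x = \<pi> (\<alpha> (- x) a) \<cdot> ell2_fun f (- g + x)"
  by (simp add: reg_elt_def bop_simps reg_alg_fun tensor_lshift_fun)

lemma reg_elt_ket: "reg_elt \<alpha> \<pi> a g \<cdot> (\<xi> \<otimes>\<^sub>v ket x) = (\<pi> (\<alpha> (- (g + x)) a) \<cdot> \<xi>) \<otimes>\<^sub>v ket (g + x)"
  by (rule ell2_eqI) (auto simp: reg_elt_fun minus_add_eq_iff)

lemma reg_elt_add: "reg_elt \<alpha> \<pi> (a + b) g = reg_elt \<alpha> \<pi> a g + reg_elt \<alpha> \<pi> b g"
  and reg_elt_scaleC: "reg_elt \<alpha> \<pi> (c *\<^sub>C a) g = c *\<^sub>C reg_elt \<alpha> \<pi> a g"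
  by (rule bop_eqI, rule ell2_eqI; simp add: bop_simps reg_elt_fun \<alpha>_simps \<pi>_simps)+

lemma reg_elt_mult: "reg_elt \<alpha> \<pi> a g * reg_elt \<alpha> \<pi> b h = reg_elt \<alpha> \<pi> (a * \<alpha> g b) (g + h)"
  by (rule bop_eqI, rule ell2_eqI) (simp add: bop_simps reg_elt_fun \<alpha>_simps \<pi>_simps minus_add add.assoc[symmetric])

lemma reg_elt_star: "star (reg_elt \<alpha> \<pi> a g) = reg_elt \<alpha> \<pi> (\<alpha> (- g) (star a)) (- g)"
proof (rule bop_ell2_eqI_cinner)
  fix x y i j
  show "cinner (x \<otimes>\<^sub>v ket i) (star (reg_elt \<alpha> \<pi> a g) \<cdot> y \<otimes>\<^sub>v ket j)
      = cinner (x \<otimes>\<^sub>v ket i) (reg_elt \<alpha> \<pi> (\<alpha> (- g) (star a)) (- g) \<cdot> y \<otimes>\<^sub>v ket j)"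
    by (auto simp: cinner_star' cinner_tensor_ket cinner_tensor_ket' reg_elt_fun minus_add_eq_iff
        \<alpha>_simps \<pi>_simps minus_add)
qed

lemma reg_elt_unit: "reg_elt \<alpha> \<pi> 1 0 * reg_elt \<alpha> \<pi> a g = reg_elt \<alpha> \<pi> a g"
  "reg_elt \<alpha> \<pi> a g * reg_elt \<alpha> \<pi> 1 0 = reg_elt \<alpha> \<pi> a g"
  by (simp_all add: reg_elt_mult \<alpha>_one \<alpha>_simps)

lemma norm_reg_elt_le: "norm (reg_elt \<alpha> \<pi> a g) \<le> norm a"
proof (rule norm_bop_bound)
  fix f
  show "norm (reg_elt \<alpha> \<pi> a g \<cdot> f) \<le> norm a * norm f"
  proof (rule ell2_norm_dominated)
    show "inj (\<lambda>x. - g + x)" by simp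
    show "norm (ell2_fun (reg_elt \<alpha> \<pi> a g \<cdot> f) x) \<le> norm a * norm (ell2_fun f (- g + x))" for x
      unfolding reg_elt_fun using norm_bop_le norm_\<pi>\<alpha>_le by (meson mult_right_mono norm_ge_zero order_trans)
  qed simp
qed simp

lemma bounded_linear_reg_elt: "bounded_linear (\<lambda>a. reg_elt \<alpha> \<pi> a g)"
  by (rule bounded_linear_intro[where K = 1]) (auto simp: reg_elt_add scaleR_scaleC reg_elt_scaleC norm_reg_elt_le)

text \<open>Elements of \<open>Cc\<close> carry one coefficient for each group element of a finite
  set. The description as a span opens them to arguments by linearity and closure.\<close>

lemma Cc_eq_cspan:
  assumes "csubspace \<A>"
  shows "Cc \<alpha> \<pi> \<A> = cspan {reg_elt \<alpha> \<pi> a g | a g. a \<in> \<A>}" (is "?C = cspan ?S")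
proof
  show "?C \<subseteq> cspan ?S"
  proof
    fix x assume "x \<in> ?C"
    then obtain F a where *: "a ` F \<subseteq> \<A>" "x = (\<Sum>g\<in>F. reg_elt \<alpha> \<pi> (a g) g)" by (auto simp: Cc_def)
    show "x \<in> cspan ?S"
      unfolding *(2) by (rule csubspace_intros(5)[OF complex_vector.subspace_span], rule complex_vector.span_base) (use *(1) in auto)
  qed
  have reg0: "reg_elt \<alpha> \<pi> 0 g = 0" for g using reg_elt_scaleC[of 0 0 g] by simp
  \<comment> \<open>A normal form with coefficients extended by zero, so that two elements can be
    written over the union of their supports.\<close>
  have C': "x \<in> ?C \<longleftrightarrow> (\<exists>F a. finite F \<and> range a \<subseteq> \<A> \<and> (\<forall>g. g \<notin> F \<longrightarrow> a g = 0) \<and> x = (\<Sum>g\<in>F. reg_elt \<alpha> \<pi> (a g) g))" for x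
  proof
    assume "x \<in> ?C"
    then obtain F a where *: "finite F" "a ` F \<subseteq> \<A>" "x = (\<Sum>g\<in>F. reg_elt \<alpha> \<pi> (a g) g)" by (auto simp: Cc_def)
    show "\<exists>F a. finite F \<and> range a \<subseteq> \<A> \<and> (\<forall>g. g \<notin> F \<longrightarrow> a g = 0) \<and> x = (\<Sum>g\<in>F. reg_elt \<alpha> \<pi> (a g) g)"
      by (rule exI[of _ F], rule exI[of _ "\<lambda>g. if g \<in> F then a g else 0"])
         (use * csubspace_intros(1)[OF assms] in auto)
  next
    assume "\<exists>F a. finite F \<and> range a \<subseteq> \<A> \<and> (\<forall>g. g \<notin> F \<longrightarrow> a g = 0) \<and> x = (\<Sum>g\<in>F. reg_elt \<alpha> \<pi> (a g) g)"
    then obtain F a where *: "finite F" "range a \<subseteq> \<A>" "x = (\<Sum>g\<in>F. reg_elt \<alpha> \<pi> (a g) g)" by (elim exE conjE)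
    then have "a ` F \<subseteq> \<A>" by auto
    then show "x \<in> ?C" unfolding Cc_def using * by (intro CollectI exI[of _ F] exI[of _ a] conjI)
  qed
  have "csubspace ?C"
  proof (rule csubspaceI)
    show "0 \<in> ?C" unfolding Cc_def by (rule CollectI, rule exI[of _ "{}"]) auto
    fix x y assume "x \<in> ?C" "y \<in> ?C"
    then obtain F a G b where x: "finite F" "range a \<subseteq> \<A>" "\<forall>g. g \<notin> F \<longrightarrow> a g = 0" "x = (\<Sum>g\<in>F. reg_elt \<alpha> \<pi> (a g) g)"
      and y: "finite G" "range b \<subseteq> \<A>" "\<forall>g. g \<notin> G \<longrightarrow> b g = 0" "y = (\<Sum>g\<in>G. reg_elt \<alpha> \<pi> (b g) g)"
      unfolding C' by (elim exE conjE)
    have mem: "a g \<in> \<A>" "b g \<in> \<A>" for g using x(2) y(2) by auto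
    have "x = (\<Sum>g\<in>F \<union> G. reg_elt \<alpha> \<pi> (a g) g)" "y = (\<Sum>g\<in>F \<union> G. reg_elt \<alpha> \<pi> (b g) g)"
      using x y by (auto intro!: sum.mono_neutral_left simp: reg0)
    then have "x + y = (\<Sum>g\<in>F \<union> G. reg_elt \<alpha> \<pi> (a g + b g) g)" by (simp add: reg_elt_add sum.distrib)
    then show "x + y \<in> ?C"
      unfolding Cc_def using x(1) y(1) csubspace_intros(2)[OF assms mem]
      by (intro CollectI exI[of _ "F \<union> G"] exI[of _ "\<lambda>g. a g + b g"]) auto
    fix c
    have "c *\<^sub>C x = (\<Sum>g\<in>F. reg_elt \<alpha> \<pi> (c *\<^sub>C a g) g)"
      by (simp add: x(4) reg_elt_scaleC complex_vector.scale_sum_right)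
    then show "c *\<^sub>C x \<in> ?C"
      unfolding Cc_def using x(1) csubspace_intros(3)[OF assms mem(1)]
      by (intro CollectI exI[of _ F] exI[of _ "\<lambda>g. c *\<^sub>C a g"]) auto
  qed
  moreover have "?S \<subseteq> ?C"
  proof
    fix x assume "x \<in> ?S"
    then obtain a g where "a \<in> \<A>" "x = reg_elt \<alpha> \<pi> a g" by auto
    then show "x \<in> ?C" unfolding Cc_def by (intro CollectI exI[of _ "{g}"] exI[of _ "\<lambda>_. a"]) auto
  qed
  ultimately show "cspan ?S \<subseteq> ?C" by (intro complex_vector.span_minimal)
qed

lemma crossed_product_eq: "crossed_product \<alpha> \<pi> = closure (cspan {reg_elt \<alpha> \<pi> a g | a g. True})"
  unfolding crossed_product_def using Cc_eq_cspan[of UNIV] by (simp add: csubspaceI)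

lemma reg_elt_mem [simp]: "reg_elt \<alpha> \<pi> a g \<in> crossed_product \<alpha> \<pi>"
  unfolding crossed_product_eq by (rule closure_cspan_superset) blast

text \<open>The unit acts as \<open>\<pi> 1\<close> on every fibre and so differs from the identity
  operator when \<open>\<pi>\<close> is not unital.\<close>

lemma crossed_product_unital: "unital_cstar_subalgebra (crossed_product \<alpha> \<pi>)"
  and crossed_product_unit: "is_unit_of (crossed_product \<alpha> \<pi>) (reg_elt \<alpha> \<pi> 1 0)"
  unfolding crossed_product_eq
  by (rule unital_closure_cspan[where e = "reg_elt \<alpha> \<pi> 1 0"];
      auto simp: reg_elt_mult[symmetric] reg_elt_unit; auto simp: reg_elt_mult reg_elt_star)+

text \<open>Products and adjoints of generators have the coefficients
  \<open>a * \<alpha> g b\<close> and \<open>\<alpha> (- g) (star a)\<close>. Invariance under the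
  action keeps both in \<open>\<A>\<close>.\<close>

lemma Cc_star_subalgebra:
  assumes A: "star_subalgebra \<A>" and inv: "\<And>g. \<alpha> g ` \<A> \<subseteq> \<A>"
  shows "star_subalgebra (Cc \<alpha> \<pi> \<A>)"
proof -
  have mult: "a * \<alpha> g b \<in> \<A>" if "a \<in> \<A>" "b \<in> \<A>" for a b g
    using A inv that by (auto simp: star_subalgebra_def)
  have st: "\<alpha> g (star a) \<in> \<A>" if "a \<in> \<A>" for a g
  proof -
    have "star a \<in> \<A>" using A that by (simp add: star_subalgebra_def)
    then show ?thesis using inv by blast
  qed
  have sub: "csubspace \<A>" using A by (simp add: star_subalgebra_def)
  let ?S = "{reg_elt \<alpha> \<pi> a g | a g. a \<in> \<A>}"
  have "x * y \<in> ?S" if xy: "x \<in> ?S" "y \<in> ?S" for x y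
  proof -
    obtain a g b h where "x = reg_elt \<alpha> \<pi> a g" "a \<in> \<A>" "y = reg_elt \<alpha> \<pi> b h" "b \<in> \<A>"
      using xy by (elim CollectE exE conjE)
    then show ?thesis
      by (intro CollectI exI[of _ "a * \<alpha> g b"] exI[of _ "g + h"]) (simp add: reg_elt_mult mult)
  qed
  moreover have "star x \<in> ?S" if x: "x \<in> ?S" for x
  proof -
    obtain a g where "x = reg_elt \<alpha> \<pi> a g" "a \<in> \<A>" using x by (elim CollectE exE conjE)
    then show ?thesis
      by (intro CollectI exI[of _ "\<alpha> (- g) (star a)"] exI[of _ "- g"]) (simp add: reg_elt_star st)
  qed
  ultimately show ?thesis
    unfolding Cc_eq_cspan[OF sub] by (intro star_subalgebra_cspan complex_vector.span_base)
qed

lemma Cc_dense: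
  assumes A: "csubspace \<A>" and dense: "UNIV \<subseteq> closure \<A>"
  shows "crossed_product \<alpha> \<pi> \<subseteq> closure (Cc \<alpha> \<pi> \<A>)"
  unfolding crossed_product_eq
proof (rule closure_cspan_minimal)
  show "csubspace (closure (Cc \<alpha> \<pi> \<A>))"
    unfolding Cc_eq_cspan[OF A] by (rule csubspace_closure_cspan[OF bounded_linear_scaleC_cstar])
  have "reg_elt \<alpha> \<pi> a g \<in> closure (Cc \<alpha> \<pi> \<A>)" for a g
  proof -
    have "closure \<A> \<subseteq> (\<lambda>a. reg_elt \<alpha> \<pi> a g) -` closure (Cc \<alpha> \<pi> \<A>)"
    proof (rule closure_minimal)
      show "closed ((\<lambda>a. reg_elt \<alpha> \<pi> a g) -` closure (Cc \<alpha> \<pi> \<A>))"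
        by (intro continuous_closed_vimage linear_continuous_at bounded_linear_reg_elt) simp
      show "\<A> \<subseteq> (\<lambda>a. reg_elt \<alpha> \<pi> a g) -` closure (Cc \<alpha> \<pi> \<A>)"
        unfolding Cc_eq_cspan[OF A] by (rule subsetI, rule vimageI2, rule closure_cspan_superset) blast
    qed
    then show ?thesis using dense by blast
  qed
  then show "{reg_elt \<alpha> \<pi> a g | a g. True} \<subseteq> closure (Cc \<alpha> \<pi> \<A>)" by blast
qed simp

subsection \<open>The dual coaction\<close>

lemma homogeneous_reg_elt: "homogeneous g (reg_elt \<alpha> \<pi> a g)"
  by (auto simp: homogeneous_def reg_elt_ket)

lemma dual_coaction_eq: "dual_coaction \<alpha> \<pi> = restrict (spatial cotwist cotwist_inv) (crossed_product \<alpha> \<pi>)"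
  unfolding dual_coaction_def
proof (rule the_star_hom_eq[OF crossed_product_unital crossed_product_eq])
  show "spatial cotwist cotwist_inv ` {reg_elt \<alpha> \<pi> a g | a g. True} \<subseteq> crossed_product \<alpha> \<pi> \<otimes>\<^sub>m\<^sub>i\<^sub>n Cred"
    by (auto simp: spatial_cotwist_homogeneous[OF homogeneous_reg_elt] min_tensor_mem)
  show "star_hom UNIV UNIV (spatial cotwist (cotwist_inv :: ('g, ('g, 'h) ell2) ell2 \<Rightarrow>\<^sub>L _))"
    by (rule star_hom_spatial[OF unitary_pair_cotwist])
qed (unfold ball_Collect2, auto simp: csubspace_min_tensor closed_min_tensor spatial_cotwist_homogeneous[OF homogeneous_reg_elt])

lemma dual_coaction_reg_elt: "dual_coaction \<alpha> \<pi> (reg_elt \<alpha> \<pi> a g) = reg_elt \<alpha> \<pi> a g \<otimes>\<^sub>b lshift g"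
  by (simp add: dual_coaction_eq spatial_cotwist_homogeneous[OF homogeneous_reg_elt])

lemma star_hom_dual_coaction:
  "star_hom (crossed_product \<alpha> \<pi>) (crossed_product \<alpha> \<pi> \<otimes>\<^sub>m\<^sub>i\<^sub>n Cred) (dual_coaction \<alpha> \<pi>)"
  unfolding dual_coaction_eq
proof (rule star_hom_restrict[OF star_hom_spatial[OF unitary_pair_cotwist]])
  show "star_subalgebra (crossed_product \<alpha> \<pi>)"
    using crossed_product_unital by (simp add: unital_cstar_subalgebra_def)
  have "spatial cotwist cotwist_inv ` {reg_elt \<alpha> \<pi> a g | a g. True} \<subseteq> crossed_product \<alpha> \<pi> \<otimes>\<^sub>m\<^sub>i\<^sub>n Cred"
    by (auto simp: spatial_cotwist_homogeneous[OF homogeneous_reg_elt] min_tensor_mem)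
  then show "spatial cotwist cotwist_inv ` crossed_product \<alpha> \<pi> \<subseteq> crossed_product \<alpha> \<pi> \<otimes>\<^sub>m\<^sub>i\<^sub>n Cred"
    unfolding crossed_product_eq[symmetric]
    using star_hom_image_closure_cspan[OF star_hom_spatial[OF unitary_pair_cotwist] csubspace_min_tensor closed_min_tensor]
    by (simp add: crossed_product_eq)
qed

lemma dual_coaction_coaction: "coaction (crossed_product \<alpha> \<pi>) (dual_coaction \<alpha> \<pi>)"
proof -
  let ?B = "crossed_product \<alpha> \<pi>" and ?\<theta> = "dual_coaction \<alpha> \<pi>" and ?e = "reg_elt \<alpha> \<pi> 1 0"
  let ?M = "?B \<otimes>\<^sub>m\<^sub>i\<^sub>n (Cred :: ('g, complex) ell2 bop set)"
  note M = min_tensor_unital[OF crossed_product_unital crossed_product_unit Cred_unital Cred_unit]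
  note unit = is_unit_of_unique[OF crossed_product_unit] is_unit_of_unique[OF M(2)]
  have \<theta>M: "?\<theta> b \<in> ?M" if "b \<in> ?B" for b using star_hom_dual_coaction that by (auto simp: star_hom_def)
  \<comment> \<open>Coassociativity: both sides are spatial, and on a generator of degree
    \<open>g\<close> both append two factors \<open>lshift g\<close>.\<close>
  have "tensor_id ?B ?\<theta> (?\<theta> b) = id_comult ?B (?\<theta> b)" if b: "b \<in> ?B" for b
  proof -
    let ?s = "spatial cotwist cotwist_inv :: ('g, 'h) ell2 bop \<Rightarrow> _"
    let ?s' = "spatial cotwist cotwist_inv :: ('g, ('g, 'h) ell2) ell2 bop \<Rightarrow> _"
    let ?t = "spatial (amp cotwist o\<^sub>L flip) (flip o\<^sub>L amp cotwist_inv) :: ('g, ('g, 'h) ell2) ell2 bop \<Rightarrow> ('g, ('g, ('g, 'h) ell2) ell2) ell2 bop"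
    have hs: "star_hom UNIV UNIV ?s" by (rule star_hom_spatial[OF unitary_pair_cotwist])
    have ht: "star_hom UNIV UNIV ?t" by (rule star_hom_spatial[OF unitary_pair_amp_flip[OF unitary_pair_cotwist]])
    have hs': "star_hom UNIV UNIV ?s'" by (rule star_hom_spatial[OF unitary_pair_cotwist])
    have "?t (?s b) = ?s' (?s b)"
    proof (rule star_hom_eqI[OF crossed_product_unital crossed_product_eq star_hom_comp[OF ht hs] star_hom_comp[OF hs' hs] _ b])
      fix s assume "s \<in> {reg_elt \<alpha> \<pi> a g | a g. True}"
      then obtain a g where s: "s = reg_elt \<alpha> \<pi> a g" by blast
      show "?t (?s s) = ?s' (?s s)"
        by (simp add: s spatial_cotwist_homogeneous[OF homogeneous_reg_elt] spatial_amp_flip_tensor[OF unitary_pair_cotwist]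
            spatial_cotwist_homogeneous[OF homogeneous_tensor_lshift])
    qed
    moreover have "tensor_id ?B ?\<theta> = restrict ?t ?M"
      by (rule tensor_id_eq[OF crossed_product_unital unitary_pair_cotwist]) (simp add: dual_coaction_eq)
    ultimately show ?thesis
      using \<theta>M[OF b] b by (simp add: id_comult_eq[OF crossed_product_unital] dual_coaction_eq)
  qed
  moreover have "?\<theta> (unit_of ?B) = unit_of ?M"
    by (simp add: unit dual_coaction_reg_elt)
  moreover have "closure (cspan {?\<theta> a * (unit_of ?B \<otimes>\<^sub>b c) | a c. a \<in> ?B \<and> c \<in> Cred}) = ?M" (is "?L = ?M")
  proof
    have Mm: "x * y \<in> ?M" if "x \<in> ?M" "y \<in> ?M" for x y
      using M(1) that by (auto simp: unital_cstar_subalgebra_def star_subalgebra_def)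
    show "?L \<subseteq> ?M"
      by (rule closure_cspan_minimal[OF _ csubspace_min_tensor closed_min_tensor])
         (auto intro!: Mm \<theta>M min_tensor_mem simp: unit)
    have L: "csubspace ?L" "closed ?L"
      by (rule csubspace_closure_cspan[OF bounded_linear_scaleC_cstar]) simp
    have "b \<otimes>\<^sub>b c \<in> ?L" if c: "c \<in> Cred" and b: "b \<in> ?B" for b c
    proof -
      have "csubspace ((\<lambda>b. b \<otimes>\<^sub>b c) -` ?L)"
        using csubspace_intros(1-3)[OF L(1)]
        by (intro csubspaceI) (auto simp: tensor_bop_add_left tensor_bop_scaleC_left)
      moreover have "closed ((\<lambda>b. b \<otimes>\<^sub>b c) -` ?L)"
        by (intro continuous_closed_vimage linear_continuous_at bounded_linear_tensor_bop_left L)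
      \<comment> \<open>The translation produced by the coaction is cancelled by putting
        \<open>lshift (- g)\<close> in front of \<open>c\<close>.\<close>
      moreover have "reg_elt \<alpha> \<pi> a g \<otimes>\<^sub>b c \<in> ?L" for a g
      proof -
        have "lshift (- g) * c \<in> Cred" using Cred_star_subalgebra c by (auto simp: star_subalgebra_def)
        then have "?\<theta> (reg_elt \<alpha> \<pi> a g) * (unit_of ?B \<otimes>\<^sub>b (lshift (- g) * c)) \<in> ?L"
          by (intro closure_cspan_superset CollectI exI conjI refl) auto
        moreover have "lshift g * (lshift (- g) * c) = c" by (simp add: lshift_mult mult.assoc[symmetric])
        ultimately show ?thesis by (simp add: unit dual_coaction_reg_elt tensor_bop_mult reg_elt_unit)
      qed
      ultimately have "?B \<subseteq> (\<lambda>b. b \<otimes>\<^sub>b c) -` ?L"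
        unfolding crossed_product_eq[of] by (intro closure_cspan_minimal) auto
      then show ?thesis using b by blast
    qed
    then show "?M \<subseteq> ?L"
      unfolding min_tensor_def[of ?B] by (intro closure_cspan_minimal L) auto
  qed
  ultimately show ?thesis
    unfolding coaction_def using crossed_product_unital star_hom_dual_coaction by blast
qed

subsection \<open>The representation on the amplified Hilbert space\<close>

text \<open>Fell absorption: conjugation by \<open>\<xi> \<otimes> \<delta>\<^sub>x \<mapsto> u\<^sub>x \<xi> \<otimes> \<delta>\<^sub>x\<close> carries the regular representation to
  \<open>a \<delta>\<^sub>h \<mapsto> \<pi> a u\<^sub>h \<otimes> \<lambda>\<^sub>h\<close>, which therefore extends to the reduced crossed product.\<close>

definition \<Upsilon> :: "('g, 'h) ell2 \<Rightarrow>\<^sub>L ('g, 'h) ell2" where "\<Upsilon> = mono_op id (\<lambda>x. bop_blinfun (u x))"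
definition \<Upsilon>_inv :: "('g, 'h) ell2 \<Rightarrow>\<^sub>L ('g, 'h) ell2" where "\<Upsilon>_inv = mono_op id (\<lambda>x. bop_blinfun (u (- x)))"

lemma unitary_pair_u: "unitary_pair (bop_blinfun (u x)) (bop_blinfun (u (- x)))"
proof -
  have n: "norm (u x \<cdot> \<xi>) = norm \<xi>" for x \<xi>
  proof -
    have "inner (u x \<cdot> \<xi>) (u x \<cdot> \<xi>) = inner \<xi> ((star (u x) * u x) \<cdot> \<xi>)"
      by (simp only: inner_eq_Re_cinner bop_simps cinner_star')
    then show ?thesis by (simp add: u_simps(3) bop_simps norm_eq_sqrt_inner)
  qed
  have "u x \<cdot> u (- x) \<cdot> \<xi> = \<xi>" "u (- x) \<cdot> u x \<cdot> \<xi> = \<xi>" for \<xi>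
    by (simp_all add: bop_simps(2)[symmetric] u_simps(1,2)[symmetric] bop_simps(4)[symmetric] del: bop_simps)
       (simp_all add: u_simps(1) bop_simps)
  then show ?thesis by (simp add: unitary_pair_def n)
qed

lemma unitary_pair_\<Upsilon>: "unitary_pair \<Upsilon> \<Upsilon>_inv"
  and \<Upsilon>_fun: "ell2_fun (\<Upsilon> f) x = u x \<cdot> ell2_fun f x"
  and \<Upsilon>_inv_fun: "ell2_fun (\<Upsilon>_inv f) x = u (- x) \<cdot> ell2_fun f x"
  unfolding \<Upsilon>_def \<Upsilon>_inv_def
  using unitary_pair_mono_op[of id id "\<lambda>x. bop_blinfun (u x)" "\<lambda>x. bop_blinfun (u (- x))"]
    unitary_pair_mono_op(2)[of id id "\<lambda>x. bop_blinfun (u (- x))" "\<lambda>x. bop_blinfun (u x)"]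
    unitary_pair_u unitary_pair_sym[OF unitary_pair_u]
  by (simp_all)

text \<open>The amplification index is the factor \<open>\<complex>\<^sup>2\<close>, so tensoring
  with the identity there and conjugating by \<open>\<Upsilon>\<close> happen at once. The map is
  defined on all operators; \<open>rep_hat\<close> is its restriction.\<close>

definition \<rho> :: "('g, 'h) ell2 bop \<Rightarrow> (bool, ('g, 'h) ell2) ell2 bop" where
  "\<rho> = spatial (amp \<Upsilon>) (amp \<Upsilon>_inv)"

lemma star_hom_\<rho>: "star_hom UNIV UNIV \<rho>"
  unfolding \<rho>_def by (rule star_hom_spatial[OF unitary_pair_amp[OF unitary_pair_\<Upsilon>]])

text \<open>Covariance moves \<open>u x\<close> past the twisted coefficient, which becomes
  \<open>\<pi> a\<close> independently of \<open>x\<close>; the remaining unitaries multiply to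
  \<open>u h\<close>.\<close>

lemma \<rho>_reg_elt_fun:
  "ell2_fun (ell2_fun (\<rho> (reg_elt \<alpha> \<pi> a h) \<cdot> f) i) x = \<pi> a \<cdot> u h \<cdot> ell2_fun (ell2_fun f i) (- h + x)"
proof -
  have "u x * \<pi> (\<alpha> (- x) a) * u (- (- h + x)) = \<pi> a * (u x * u (- x + h))"
    by (simp add: u_\<pi> \<alpha>_simps mult.assoc minus_add)
  also have "u x * u (- x + h) = u h" by (simp flip: u_simps(2) add: add.assoc[symmetric])
  finally have "(u x * \<pi> (\<alpha> (- x) a) * u (- (- h + x))) \<cdot> \<xi> = (\<pi> a * u h) \<cdot> \<xi>" for \<xi> by simp
  then have "u x \<cdot> \<pi> (\<alpha> (- x) a) \<cdot> u (- (- h + x)) \<cdot> \<xi> = \<pi> a \<cdot> u h \<cdot> \<xi>" for \<xi> by (simp add: bop_simps)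
  then show ?thesis
    unfolding \<rho>_def spatial_apply[OF unitary_pair_amp[OF unitary_pair_\<Upsilon>]]
    by (simp add: \<Upsilon>_fun \<Upsilon>_inv_fun reg_elt_fun)
qed

lemma \<rho>_reg_elt: "\<rho> (reg_elt \<alpha> \<pi> a h) = ((\<pi> a \<otimes>\<^sub>b 1) * (u h \<otimes>\<^sub>b lshift h)) \<otimes>\<^sub>b 1"
  by (rule bop_eqI, intro ell2_eqI)
     (simp add: \<rho>_reg_elt_fun tensor_bop_one_right bop_simps tensor_lshift_fun)

lemma rep_hat_eq: "rep_hat \<alpha> \<pi> u = restrict \<rho> (crossed_product \<alpha> \<pi>)"
  unfolding rep_hat_def
  by (rule the_star_hom_eq[OF crossed_product_unital crossed_product_eq star_hom_\<rho>, where C = UNIV])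
     (unfold ball_Collect2, auto simp: \<rho>_reg_elt intro: csubspaceI)

lemma star_hom_rep_hat: "star_hom (crossed_product \<alpha> \<pi>) UNIV (rep_hat \<alpha> \<pi> u)"
  unfolding rep_hat_eq
  using crossed_product_unital by (intro star_hom_restrict star_hom_\<rho>) (auto simp: unital_cstar_subalgebra_def)

end

section \<open>The corepresentation\<close>

lemma Cred_mult: "p \<in> Cred \<Longrightarrow> q \<in> Cred \<Longrightarrow> p * q \<in> Cred"
  using Cred_star_subalgebra unfolding star_subalgebra_def by blast

subsection \<open>Fibres and the implementing unitary\<close>

text \<open>The projection onto the component at \<open>g\<close> of the group leg, with the outer
  index \<open>'j\<close> as spectator. These projections diagonalise the corepresentation.\<close>

definition fibre :: "'g \<Rightarrow> ('j, ('g, 'h::chilbert_space) ell2) ell2 \<Rightarrow>\<^sub>L ('j, ('g, 'h) ell2) ell2" where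
  "fibre g = amp (mono_op id (\<lambda>x. if x = g then id_blinfun else 0))"

lemma fibre_fun [simp]:
  fixes f :: "('j, ('g, 'h::chilbert_space) ell2) ell2"
  shows "ell2_fun (ell2_fun (fibre g f) i) x = (if x = g then ell2_fun (ell2_fun f i) x else 0)"
proof -
  let ?P = "\<lambda>x. if x = g then id_blinfun else 0 :: 'h \<Rightarrow>\<^sub>L 'h"
  have "norm (?P x) \<le> 1" for x
    by (auto intro: norm_blinfun_bound)
  from mono_op_fun[OF inj_on_id, of ?P, OF this] show ?thesis by (simp add: fibre_def)
qed

text \<open>After a flip the group index is outermost and the projections are those of the expansion
  \<open>ell2_has_sum\<close>.\<close>

lemma fibre_has_sum: "((\<lambda>g. fibre g f) has_sum f) UNIV"
proof -
  have "((\<lambda>g. flip (ell2_fun (flip f) g \<otimes>\<^sub>v ket g)) has_sum flip (flip f)) UNIV"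
    by (rule has_sum_bounded_linear[OF blinfun.bounded_linear_right ell2_has_sum])
  moreover have "flip (ell2_fun (flip f) g \<otimes>\<^sub>v ket g) = fibre g f" for g
    by (intro ell2_eqI) simp
  ultimately show ?thesis by simp
qed

text \<open>This is \<open>cotwist\<close> on the two group legs. The flips only carry the index
  \<open>'j\<close>, which stands between them, out of the way.\<close>

definition corep_unitary :: "('g::group_add, ('j, ('g, 'h::chilbert_space) ell2) ell2) ell2 \<Rightarrow>\<^sub>L ('g, ('j, ('g, 'h) ell2) ell2) ell2" where
  "corep_unitary = flip o\<^sub>L (amp cotwist o\<^sub>L flip)"

definition corep_unitary_inv :: "('g::group_add, ('j, ('g, 'h::chilbert_space) ell2) ell2) ell2 \<Rightarrow>\<^sub>L ('g, ('j, ('g, 'h) ell2) ell2) ell2" where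
  "corep_unitary_inv = (flip o\<^sub>L amp cotwist_inv) o\<^sub>L flip"

lemma unitary_pair_corep: "unitary_pair corep_unitary corep_unitary_inv"
  unfolding corep_unitary_def corep_unitary_inv_def
  by (intro unitary_pair_compose unitary_pair_flip unitary_pair_amp unitary_pair_cotwist)

lemma corep_unitary_fun [simp]:
  "ell2_fun (ell2_fun (ell2_fun (corep_unitary f) y) i) x = ell2_fun (ell2_fun (ell2_fun f (- x + y)) i) x"
  by (simp add: corep_unitary_def)

lemma corep_unitary_inv_fun [simp]:
  "ell2_fun (ell2_fun (ell2_fun (corep_unitary_inv f) y) i) x = ell2_fun (ell2_fun (ell2_fun f (x + y)) i) x"
  by (simp add: corep_unitary_inv_def)

lemma corep_unitary_fibre: "corep_unitary (fibre g k \<otimes>\<^sub>v v) = fibre g k \<otimes>\<^sub>v (lshift g \<cdot> v)"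
  by (intro ell2_eqI) (simp add: bop_blinfun_lshift)

lemma corep_unitary_inv_fibre: "corep_unitary_inv (fibre g k \<otimes>\<^sub>v v) = fibre g k \<otimes>\<^sub>v (lshift (- g) \<cdot> v)"
  by (intro ell2_eqI) (simp add: bop_blinfun_lshift)

subsection \<open>The Hilbert module\<close>

lemma mod_tensor_apply [simp]: "mod_tensor x q v = x \<otimes>\<^sub>v (q \<cdot> v)"
  by (simp add: mod_tensor_def)

lemma tensor_vec_scaleR_left: "(r *\<^sub>R x) \<otimes>\<^sub>v v = r *\<^sub>R (x \<otimes>\<^sub>v v)"
  by (simp add: scaleR_scaleC tensor_vec_scaleC_left)

lemma norm_mod_tensor_le: "norm (mod_tensor x q) \<le> norm x * norm q"
proof (rule norm_blinfun_bound)
  fix v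
  show "norm (mod_tensor x q v) \<le> norm x * norm q * norm v"
    by (simp add: norm_tensor_vec mult.assoc mult_left_mono norm_bop_le)
qed simp

lemma bounded_linear_mod_tensor: "bounded_linear (\<lambda>x. mod_tensor x q)"
  by (rule bounded_linear_intro[where K = "norm q"])
     (auto intro!: blinfun_eqI norm_mod_tensor_le
       simp: blinfun.add_left blinfun.scaleR_left tensor_vec_add_left tensor_vec_scaleR_left)

lemma csubspace_hmod: "csubspace hmod" and closed_hmod: "closed hmod"
  unfolding hmod_def by (rule csubspace_closure_cspan[OF bounded_linear_scaleC_blinfun]) simp

lemma mod_tensor_hmod: "q \<in> Cred \<Longrightarrow> mod_tensor x q \<in> hmod"
  unfolding hmod_def by (rule closure_cspan_superset) blast

lemma bounded_linear_compose_left: "bounded_linear (\<lambda>S. W o\<^sub>L S)"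
  by (rule bounded_bilinear.bounded_linear_right[OF bounded_bilinear_blinfun_compose])

lemmas blinfun_compose_add_right = bounded_bilinear.add_right[OF bounded_bilinear_blinfun_compose]
lemmas blinfun_compose_zero_right = bounded_bilinear.zero_right[OF bounded_bilinear_blinfun_compose]

lemma compose_scaleC_right: "is_clinear (blinfun_apply W) \<Longrightarrow> W o\<^sub>L (c *\<^sub>C S) = c *\<^sub>C (W o\<^sub>L S)"
  by (rule blinfun_eqI) (simp add: scaleC_blinfun.rep_eq is_clinear_scaleC)

text \<open>Decomposing \<open>x\<close> into fibres writes
  \<open>W o\<^sub>L mod_tensor x q\<close> as a norm convergent sum of elementary tensors
  \<open>mod_tensor (fibre g x) (lshift (h g) * q)\<close>. The map \<open>h\<close> is the identity
  for the unitary and inversion for its inverse.\<close>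

lemma fibrewise_hmod:
  assumes W: "is_clinear (blinfun_apply W)" and h: "\<And>g k v. W (fibre g k \<otimes>\<^sub>v v) = fibre g k \<otimes>\<^sub>v (lshift (h g) \<cdot> v)"
    and S: "S \<in> hmod"
  shows "W o\<^sub>L S \<in> hmod"
proof -
  have "W o\<^sub>L mod_tensor x q \<in> hmod" if q: "q \<in> Cred" for x q
  proof (rule has_sum_in_closed[OF closed_hmod])
    show "((\<lambda>g. W o\<^sub>L mod_tensor (fibre g x) q) has_sum (W o\<^sub>L mod_tensor x q)) UNIV"
      by (rule has_sum_bounded_linear[OF bounded_linear_compose[OF bounded_linear_compose_left bounded_linear_mod_tensor] fibre_has_sum])
    have "W o\<^sub>L mod_tensor (fibre g x) q = mod_tensor (fibre g x) (lshift (h g) * q)" for g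
      by (rule blinfun_eqI) (simp add: h bop_simps)
    moreover have "lshift (h g) * q \<in> Cred" for g
      by (rule Cred_mult) (simp_all add: q)
    ultimately show "(\<Sum>g\<in>F. W o\<^sub>L mod_tensor (fibre g x) q) \<in> hmod" for F
      by (intro csubspace_intros(5)[OF csubspace_hmod]) (simp add: mod_tensor_hmod)
  qed
  moreover have "csubspace ((\<lambda>S. W o\<^sub>L S) -` hmod)"
    using csubspace_intros[OF csubspace_hmod]
    by (intro csubspaceI) (auto simp: blinfun_compose_add_right blinfun_compose_zero_right compose_scaleC_right[OF W])
  moreover have "closed ((\<lambda>S. W o\<^sub>L S) -` hmod)"
    by (intro continuous_closed_vimage linear_continuous_at bounded_linear_compose_left closed_hmod)
  ultimately have "hmod \<subseteq> (\<lambda>S. W o\<^sub>L S) -` hmod"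
    unfolding hmod_def[symmetric] by (subst hmod_def, intro closure_cspan_minimal) auto
  then show ?thesis using S by blast
qed

lemma corep_unitary_hmod: "S \<in> hmod \<Longrightarrow> corep_unitary o\<^sub>L S \<in> hmod"
  by (rule fibrewise_hmod[where h = "\<lambda>g. g"]) (simp_all add: corep_unitary_fibre unitary_pairD[OF unitary_pair_corep])

lemma corep_unitary_inv_hmod: "S \<in> hmod \<Longrightarrow> corep_unitary_inv o\<^sub>L S \<in> hmod"
  by (rule fibrewise_hmod[where h = uminus]) (simp_all add: corep_unitary_inv_fibre unitary_pairD[OF unitary_pair_corep])

lemma bounded_clinear_on_eqI:
  assumes E: "csubspace E" "closed E" "E = closure (cspan S)"
    and fg: "bounded_clinear_on E f" "bounded_clinear_on E g" and eq: "\<And>s. s \<in> S \<Longrightarrow> f s = g s" and x: "x \<in> E"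
  shows "f x = g x"
proof -
  have cont: "continuous_on E f" if f: "bounded_clinear_on E f" for f
  proof -
    obtain M where M: "\<And>x. x \<in> E \<Longrightarrow> norm (f x) \<le> M * norm x"
      using f unfolding bounded_clinear_on_def by blast
    have d: "dist (f x) (f y) \<le> \<bar>M\<bar> * dist x y" if "x \<in> E" "y \<in> E" for x y
    proof -
      have m: "(-1) *\<^sub>C y \<in> E" "x - y \<in> E" using that csubspace_intros(3,4)[OF E(1)] by blast+
      have "f (x + (-1) *\<^sub>C y) = f x + (-1) *\<^sub>C f y"
        using f that m unfolding bounded_clinear_on_def by metis
      then have "f (x - y) = f x - f y" by (simp add: complex_vector.scale_minus_left)
      then have "dist (f x) (f y) \<le> M * norm (x - y)" using M[OF m(2)] by (simp add: dist_norm)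
      also have "\<dots> \<le> \<bar>M\<bar> * dist x y" by (simp add: dist_norm mult_right_mono)
      finally show ?thesis .
    qed
    show ?thesis
      by (rule lipschitz_on_continuous_on[OF lipschitz_onI[OF d]]) simp_all
  qed
  define Q where "Q = {x\<in>E. f x = g x}"
  have "csubspace Q"
  proof (rule csubspaceI)
    have "f (0 *\<^sub>C 0) = 0 *\<^sub>C f 0" "g (0 *\<^sub>C 0) = 0 *\<^sub>C g 0"
      using fg csubspace_intros(1)[OF E(1)] unfolding bounded_clinear_on_def by blast+
    then show "0 \<in> Q" using csubspace_intros(1)[OF E(1)] by (simp add: Q_def)
  qed (use E(1) fg in \<open>auto simp: Q_def bounded_clinear_on_def csubspace_intros(2,3)\<close>)
  moreover have "closed Q"
    unfolding Q_def using continuous_closed_preimage[of E "\<lambda>x. f x - g x" "{0}"] E(2)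
      continuous_on_diff[OF cont[OF fg(1)] cont[OF fg(2)]]
    by (simp add: vimage_def Int_def Collect_conj_eq[symmetric])
  moreover have "S \<subseteq> E" using E(3) closure_cspan_superset by blast
  ultimately have "closure (cspan S) \<subseteq> Q"
    by (intro closure_cspan_minimal) (use eq in \<open>auto simp: Q_def\<close>)
  then show ?thesis using x E(3) by (auto simp: Q_def)
qed

text \<open>The counterpart of \<open>the_star_hom_eq\<close> for the module: boundedness is part of
  the specification here and need not be derived.\<close>

lemma the_bounded_clinear_on_hmod_eq:
  fixes f :: "(('g::group_add, complex) ell2 \<Rightarrow>\<^sub>L ('g, 'k::chilbert_space) ell2) \<Rightarrow> 'v::{complex_vector, real_normed_vector}"
  assumes f: "bounded_clinear_on hmod f" and P: "\<And>\<Phi>. P \<Phi> \<longleftrightarrow> \<Phi> \<in> extensional hmod \<and> bounded_clinear_on hmod \<Phi> \<and>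
     (\<forall>x. \<forall>q\<in>Cred. \<Phi> (mod_tensor x q) = f (mod_tensor x q))"
  shows "(THE \<Phi>. P \<Phi>) = restrict f hmod"
proof (rule the_equality)
  have r: "bounded_clinear_on hmod (restrict f hmod)"
    using f csubspace_intros(2,3)[OF csubspace_hmod] by (auto simp: bounded_clinear_on_def)
  then show "P (restrict f hmod)" by (simp add: P mod_tensor_hmod)
  fix \<Phi> assume "P \<Phi>"
  then have \<Phi>: "\<Phi> \<in> extensional hmod" "bounded_clinear_on hmod \<Phi>" "\<And>x q. q \<in> Cred \<Longrightarrow> \<Phi> (mod_tensor x q) = f (mod_tensor x q)"
    by (auto simp: P)
  show "\<Phi> = restrict f hmod"
  proof (rule extensionalityI[OF \<Phi>(1) restrict_extensional])
    fix S :: "('g, complex) ell2 \<Rightarrow>\<^sub>L ('g, 'k) ell2" assume "S \<in> hmod"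
    then show "\<Phi> S = restrict f hmod S"
      by (rule bounded_clinear_on_eqI[OF csubspace_hmod closed_hmod hmod_def \<Phi>(2) r, rotated])
         (auto simp: \<Phi>(3) mod_tensor_hmod)
  qed
qed

lemma amp_scaleC: "amp (c *\<^sub>C S) f = c *\<^sub>C amp S f"
  by (rule ell2_eqI) (simp add: scaleC_blinfun.rep_eq)

lemma norm_amp_apply_le: "norm (amp S f) \<le> norm S * norm f"
  by (rule order_trans[OF norm_blinfun mult_right_mono[OF norm_amp_le]]) simp

text \<open>The formula of the comultiplication, with \<open>cotwist\<close> on vector valued and
  \<open>cotwist_inv\<close> on scalar families. It has the prescribed values because
  \<open>cotwist\<close> commutes with \<open>amp (creation x)\<close>.\<close>

lemma mod_id_comult_eq:
  "mod_id_comult = restrict (\<lambda>S. cotwist o\<^sub>L (amp S o\<^sub>L cotwist_inv)) hmod"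
  unfolding mod_id_comult_def
proof (rule the_bounded_clinear_on_hmod_eq)
  show "bounded_clinear_on hmod (\<lambda>S :: ('a, complex) ell2 \<Rightarrow>\<^sub>L ('a, 'b) ell2. cotwist o\<^sub>L (amp S o\<^sub>L cotwist_inv))"
    unfolding bounded_clinear_on_def
  proof (intro conjI ballI allI exI[of _ 1])
    fix S T :: "('a, complex) ell2 \<Rightarrow>\<^sub>L ('a, 'b) ell2" and c
    show "cotwist o\<^sub>L (amp (S + T) o\<^sub>L cotwist_inv) = (cotwist o\<^sub>L (amp S o\<^sub>L cotwist_inv)) + (cotwist o\<^sub>L (amp T o\<^sub>L cotwist_inv))"
      by (rule blinfun_eqI, intro ell2_eqI) (simp add: blinfun.add_left)
    show "cotwist o\<^sub>L (amp (c *\<^sub>C S) o\<^sub>L cotwist_inv) = c *\<^sub>C (cotwist o\<^sub>L (amp S o\<^sub>L cotwist_inv))"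
      by (rule blinfun_eqI)
         (simp only: blinfun_apply_blinfun_compose amp_scaleC scaleC_blinfun.rep_eq is_clinear_scaleC[OF unitary_pairD(1)[OF unitary_pair_cotwist]])
    show "norm (cotwist o\<^sub>L (amp S o\<^sub>L cotwist_inv)) \<le> 1 * norm S"
    proof (rule norm_blinfun_bound)
      fix f :: "('a, ('a, complex) ell2) ell2"
      have "norm (amp S (cotwist_inv f)) \<le> norm S * norm f"
        using norm_amp_apply_le[of S "cotwist_inv f"]
        by (simp add: unitary_pair_norm[OF unitary_pair_sym[OF unitary_pair_cotwist]])
      then show "norm ((cotwist o\<^sub>L (amp S o\<^sub>L cotwist_inv)) f) \<le> 1 * norm S * norm f"
        by (simp add: unitary_pair_norm[OF unitary_pair_cotwist])
    qed simp
  qed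
  fix \<Phi> :: "(('a, complex) ell2 \<Rightarrow>\<^sub>L ('a, 'b) ell2) \<Rightarrow> ('a, ('a, complex) ell2) ell2 \<Rightarrow>\<^sub>L ('a, ('a, 'b) ell2) ell2"
  have "(creation x \<otimes>\<^sub>L id_blinfun) o\<^sub>L bop_blinfun (comult q) = cotwist o\<^sub>L (amp (mod_tensor x q) o\<^sub>L cotwist_inv)"
    if "q \<in> Cred" for x :: 'b and q :: "('a, complex) ell2 bop"
  proof (rule blinfun_eqI)
    fix f :: "('a, ('a, complex) ell2) ell2"
    have "amp (mod_tensor x q) f' = amp (creation x) (amp (bop_blinfun q) f')" for f' :: "('a, ('a, complex) ell2) ell2"
      by (rule ell2_eqI) simp
    then show "((creation x \<otimes>\<^sub>L id_blinfun) o\<^sub>L bop_blinfun (comult q)) f = (cotwist o\<^sub>L (amp (mod_tensor x q) o\<^sub>L cotwist_inv)) f"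
      using that by (simp add: creation_tensor_id comult_eq spatial_apply[OF unitary_pair_cotwist] amp_creation_cotwist)
  qed
  then show "(\<Phi> \<in> extensional hmod \<and> bounded_clinear_on hmod \<Phi> \<and>
        (\<forall>x. \<forall>q\<in>Cred. \<Phi> (mod_tensor x q) = (creation x \<otimes>\<^sub>L id_blinfun) o\<^sub>L bop_blinfun (comult q))) =
    (\<Phi> \<in> extensional hmod \<and> bounded_clinear_on hmod \<Phi> \<and>
        (\<forall>x. \<forall>q\<in>Cred. \<Phi> (mod_tensor x q) = cotwist o\<^sub>L (amp (mod_tensor x q) o\<^sub>L cotwist_inv)))"
    by simp
qed

section \<open>The corepresentation and its axioms\<close>

definition corep :: "('j, ('g, 'h::chilbert_space) ell2) ell2 \<Rightarrow> ('g::group_add, complex) ell2 \<Rightarrow>\<^sub>L ('g, ('j, ('g, 'h) ell2) ell2) ell2" where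
  "corep x = corep_unitary o\<^sub>L creation x"

lemma corep_apply: "corep x v = corep_unitary (x \<otimes>\<^sub>v v)"
  by (simp add: corep_def)

lemma corep_compose: "corep x o\<^sub>L bop_blinfun q = corep_unitary o\<^sub>L mod_tensor x q"
  by (rule blinfun_eqI) (simp add: corep_apply)

text \<open>The inner flips let \<open>S\<close> act on the last group leg while the middle leg is a
  spectator; \<open>corep_unitary\<close> then acts on the middle leg.\<close>

lemma corep_tensor_id_eq:
  "corep_tensor_id (corep :: ('j, ('g::group_add, 'h::chilbert_space) ell2) ell2 \<Rightarrow> _) =
     restrict (\<lambda>S. amp corep_unitary o\<^sub>L (flip o\<^sub>L (amp S o\<^sub>L flip))) hmod"
  unfolding corep_tensor_id_def
proof (rule the_bounded_clinear_on_hmod_eq)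
  show "bounded_clinear_on hmod (\<lambda>S :: ('g, complex) ell2 \<Rightarrow>\<^sub>L ('g, ('j, ('g, 'h) ell2) ell2) ell2.
      amp corep_unitary o\<^sub>L (flip o\<^sub>L (amp S o\<^sub>L (flip :: ('g, ('g, complex) ell2) ell2 \<Rightarrow>\<^sub>L _))))"
    unfolding bounded_clinear_on_def
  proof (intro conjI ballI allI exI[of _ 1])
    fix S T :: "('g, complex) ell2 \<Rightarrow>\<^sub>L ('g, ('j, ('g, 'h) ell2) ell2) ell2" and c
    let ?f = "\<lambda>S :: ('g, complex) ell2 \<Rightarrow>\<^sub>L ('g, ('j, ('g, 'h) ell2) ell2) ell2.
      amp corep_unitary o\<^sub>L (flip o\<^sub>L (amp S o\<^sub>L (flip :: ('g, ('g, complex) ell2) ell2 \<Rightarrow>\<^sub>L _)))"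
    show "?f (S + T) = ?f S + ?f T"
      by (rule blinfun_eqI, intro ell2_eqI) (simp add: blinfun.add_left)
    show "?f (c *\<^sub>C S) = c *\<^sub>C ?f S"
      by (rule blinfun_eqI)
         (simp only: blinfun_apply_blinfun_compose amp_scaleC scaleC_blinfun.rep_eq is_clinear_scaleC[OF is_clinear_flip]
           is_clinear_scaleC[OF is_clinear_amp[OF unitary_pairD(1)[OF unitary_pair_corep]]])
    show "norm (?f S) \<le> 1 * norm S"
    proof (rule norm_blinfun_bound)
      fix f :: "('g, ('g, complex) ell2) ell2"
      have "norm (amp S (flip f)) \<le> norm S * norm f"
        using norm_amp_apply_le[of S "flip f"] by (simp add: unitary_pair_norm[OF unitary_pair_flip])
      then show "norm (?f S f) \<le> 1 * norm S * norm f"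
        by (simp add: unitary_pair_norm[OF unitary_pair_flip] unitary_pair_norm[OF unitary_pair_amp[OF unitary_pair_corep]])
    qed simp
  qed
  fix \<Phi> :: "(('g, complex) ell2 \<Rightarrow>\<^sub>L ('g, ('j, ('g, 'h) ell2) ell2) ell2) \<Rightarrow> ('g, ('g, complex) ell2) ell2 \<Rightarrow>\<^sub>L ('g, ('g, ('j, ('g, 'h) ell2) ell2) ell2) ell2"
  have "corep x \<otimes>\<^sub>L bop_blinfun q = amp corep_unitary o\<^sub>L (flip o\<^sub>L (amp (mod_tensor x q) o\<^sub>L flip))"
    for x :: "('j, ('g, 'h) ell2) ell2" and q :: "('g, complex) ell2 bop"
  proof (rule tensor_blinfun_eqI)
    fix v w :: "('g, complex) ell2"
    have fl: "ell2_fun (flip (v \<otimes>\<^sub>v w)) j = ell2_fun v j *\<^sub>C w" for j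
      by (rule ell2_eqI) (simp add: scaleC_complex_def)
    have "flip (amp (mod_tensor x q) (flip (v \<otimes>\<^sub>v w))) = (x \<otimes>\<^sub>v v) \<otimes>\<^sub>v (q \<cdot> w)"
      by (intro ell2_eqI) (simp add: fl bop_scaleC tensor_vec_scaleC_right scaleC_scaleC mult.commute)
    then show "(amp corep_unitary o\<^sub>L (flip o\<^sub>L (amp (mod_tensor x q) o\<^sub>L flip))) (v \<otimes>\<^sub>v w) = corep x v \<otimes>\<^sub>v (q \<cdot> w)"
      by (simp add: corep_apply unitary_pairD(1)[OF unitary_pair_corep])
  qed
  then show "(\<Phi> \<in> extensional hmod \<and> bounded_clinear_on hmod \<Phi> \<and>
        (\<forall>x. \<forall>q\<in>Cred. \<Phi> (mod_tensor x q) = corep x \<otimes>\<^sub>L bop_blinfun q)) =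
    (\<Phi> \<in> extensional hmod \<and> bounded_clinear_on hmod \<Phi> \<and>
        (\<forall>x. \<forall>q\<in>Cred. \<Phi> (mod_tensor x q) = amp corep_unitary o\<^sub>L (flip o\<^sub>L (amp (mod_tensor x q) o\<^sub>L flip))))"
    by simp
qed

lemma mod_inner_eqI: "(\<And>v w. cinner v (q \<cdot> w) = cinner (blinfun_apply S v) (blinfun_apply T w)) \<Longrightarrow> mod_inner S T = q"
  unfolding mod_inner_def by (rule the_equality) (simp, rule bop_eqI, rule cinner_eqI, simp)

lemma corep_hmod: "corep x \<in> hmod"
proof -
  have "corep x = corep_unitary o\<^sub>L mod_tensor x 1"
    by (rule blinfun_eqI) (simp add: corep_apply bop_simps)
  then show ?thesis by (simp add: corep_unitary_hmod mod_tensor_hmod)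
qed

lemma unitary_corep_corep: "unitary_corep (corep :: ('j, ('g::group_add, 'h::chilbert_space) ell2) ell2 \<Rightarrow> _)"
  unfolding unitary_corep_def
proof (intro conjI allI)
  let ?\<Theta> = "corep :: ('j, ('g, 'h) ell2) ell2 \<Rightarrow> _"
  note V = unitary_pairD[OF unitary_pair_corep]
  show "is_clinear ?\<Theta>"
    unfolding is_clinear_def
    by (auto intro!: blinfun_eqI simp: corep_apply tensor_vec_add_left blinfun.add_left blinfun.add_right
        tensor_vec_scaleC_left scaleC_blinfun.rep_eq is_clinear_scaleC[OF V(1)])
  show "range ?\<Theta> \<subseteq> hmod" using corep_hmod by blast
  \<comment> \<open>On a vector of the fibre over \<open>g\<close> each side applies
    \<open>lshift g\<close> to both group legs; in coordinates this is an identity of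
    indices.\<close>
  show "corep_tensor_id ?\<Theta> (?\<Theta> x) = mod_id_comult (?\<Theta> x)" for x
  proof -
    have "amp corep_unitary o\<^sub>L (flip o\<^sub>L (amp (?\<Theta> x) o\<^sub>L flip)) = cotwist o\<^sub>L (amp (?\<Theta> x) o\<^sub>L cotwist_inv)"
      by (rule blinfun_eqI, intro ell2_eqI) (simp add: corep_apply add.assoc[symmetric])
    then show ?thesis by (simp add: corep_tensor_id_eq mod_id_comult_eq corep_hmod)
  qed
  show "mod_inner (?\<Theta> x) (?\<Theta> y) = cinner x y *\<^sub>C 1" for x y
    by (rule mod_inner_eqI)
       (simp add: corep_apply unitary_pair_cinner_same[OF unitary_pair_corep] cinner_tensor_tensor bop_simps cinner_scaleC_right)
  show "closure (cspan {?\<Theta> x o\<^sub>L bop_blinfun q | x q. q \<in> Cred}) = hmod" (is "?L = hmod")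
  proof
    show "?L \<subseteq> hmod"
      by (rule closure_cspan_minimal[OF _ csubspace_hmod closed_hmod])
         (auto simp: corep_compose corep_unitary_hmod mod_tensor_hmod)
    have L: "csubspace ?L" "closed ?L"
      by (rule csubspace_closure_cspan[OF bounded_linear_scaleC_blinfun]) simp
    \<comment> \<open>Each fibre of \<open>x\<close> absorbs its translation into \<open>q\<close>:
      the translation \<open>lshift g\<close> created by the corepresentation is undone by
      \<open>lshift (- g) * q\<close>.\<close>
    have "mod_tensor x q \<in> ?L" if q: "q \<in> Cred" for x q
    proof (rule has_sum_in_closed[OF L(2)])
      show "((\<lambda>g. mod_tensor (fibre g x) q) has_sum mod_tensor x q) UNIV"
        by (rule has_sum_bounded_linear[OF bounded_linear_mod_tensor fibre_has_sum])
      have "mod_tensor (fibre g x) q = ?\<Theta> (fibre g x) o\<^sub>L bop_blinfun (lshift (- g) * q)" for g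
      proof (rule blinfun_eqI)
        fix v
        have "lshift g \<cdot> lshift (- g) \<cdot> q \<cdot> v = q \<cdot> v"
          by (simp add: bop_simps(2)[symmetric] lshift_mult mult.assoc[symmetric])
        then show "mod_tensor (fibre g x) q v = (?\<Theta> (fibre g x) o\<^sub>L bop_blinfun (lshift (- g) * q)) v"
          by (simp add: corep_apply corep_unitary_fibre bop_simps)
      qed
      moreover have "lshift (- g) * q \<in> Cred" for g
        by (rule Cred_mult) (simp_all add: q)
      ultimately have "mod_tensor (fibre g x) q \<in> ?L" for g
        by (metis (mono_tags, lifting) closure_cspan_superset mem_Collect_eq)
      then show "(\<Sum>g\<in>F. mod_tensor (fibre g x) q) \<in> ?L" for F
        by (intro csubspace_intros(5)[OF L(1)])
    qed
    then show "hmod \<subseteq> ?L"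
      unfolding hmod_def by (intro closure_cspan_minimal L) auto
  qed
qed

lemma operator_form_corep:
  "operator_form corep (\<lambda>S. corep_unitary o\<^sub>L S) (\<lambda>S. corep_unitary_inv o\<^sub>L S)"
  unfolding operator_form_def mod_adjoint_pair_def
proof (intro conjI ballI allI)
  note V = unitary_pairD[OF unitary_pair_corep]
  show "mod_inner (corep_unitary o\<^sub>L S) T = mod_inner S (corep_unitary_inv o\<^sub>L T)" for S T
    unfolding mod_inner_def by (simp add: unitary_pair_cinner[OF unitary_pair_corep])
  show "corep_unitary_inv o\<^sub>L (corep_unitary o\<^sub>L S) = S" "corep_unitary o\<^sub>L (corep_unitary_inv o\<^sub>L S) = S" for S
    by (rule blinfun_eqI; simp add: V)+
qed (auto simp: corep_unitary_hmod corep_unitary_inv_hmod corep_compose)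

subsection \<open>The operator \<open>D \<otimes> 1\<close>\<close>

text \<open>The series of \<open>fibrewise_hmod\<close>, run on pairs. Its terms lie in the graph
  because \<open>D\<close> contains the fibres of each of its pairs, and its sum does because the
  graph is closed.\<close>

lemma fibrewise_mod_op:
  assumes W: "is_clinear (blinfun_apply W)" and h: "\<And>g k v. W (fibre g k \<otimes>\<^sub>v v) = fibre g k \<otimes>\<^sub>v (lshift (h g) \<cdot> v)"
    and D: "\<And>g x y. (x, y) \<in> D \<Longrightarrow> (fibre g x, fibre g y) \<in> D" and ST: "(S, T) \<in> mod_op D"
  shows "(W o\<^sub>L S, W o\<^sub>L T) \<in> mod_op D"
proof -
  let ?S = "{(mod_tensor x q, mod_tensor y q) | x y q. (x, y) \<in> D \<and> q \<in> Cred}"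
  let ?f = "\<lambda>(S, T). (W o\<^sub>L S, W o\<^sub>L T)"
  have bl: "bounded_linear ?f"
    unfolding case_prod_unfold
    by (intro bounded_linear_Pair bounded_linear_compose[OF bounded_linear_compose_left]
        bounded_linear_fst bounded_linear_snd)
  have L: "csubspace (mod_op D)" "closed (mod_op D)"
    unfolding mod_op_def
    by (rule csubspace_closure_cspan[OF bounded_linear_scaleC_prod[OF bounded_linear_scaleC_blinfun bounded_linear_scaleC_blinfun]]) simp
  have "?f (mod_tensor x q, mod_tensor y q) \<in> mod_op D" if q: "q \<in> Cred" and xy: "(x, y) \<in> D" for x y q
  proof (rule has_sum_in_closed[OF L(2)])
    have m: "((\<lambda>g. mod_tensor (fibre g x) q) has_sum mod_tensor x q) UNIV" for x
      by (rule has_sum_bounded_linear[OF bounded_linear_mod_tensor fibre_has_sum])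
    have "((\<lambda>g. (mod_tensor (fibre g x) q, mod_tensor (fibre g y) q)) has_sum (mod_tensor x q, mod_tensor y q)) UNIV"
      using m[of x] m[of y] unfolding has_sum_def sum_prod by (rule tendsto_Pair)
    then show "((\<lambda>g. ?f (mod_tensor (fibre g x) q, mod_tensor (fibre g y) q)) has_sum ?f (mod_tensor x q, mod_tensor y q)) UNIV"
      by (rule has_sum_bounded_linear[OF bl])
    have eq: "W o\<^sub>L mod_tensor (fibre g z) q = mod_tensor (fibre g z) (lshift (h g) * q)" for g z
      by (rule blinfun_eqI) (simp add: h bop_simps)
    have "?f (mod_tensor (fibre g x) q, mod_tensor (fibre g y) q) \<in> ?S" for g
    proof -
      have "lshift (h g) * q \<in> Cred" by (rule Cred_mult) (simp_all add: q)
      then show ?thesis using D[OF xy, of g] by (auto simp: eq)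
    qed
    then have "?f (mod_tensor (fibre g x) q, mod_tensor (fibre g y) q) \<in> mod_op D" for g
      unfolding mod_op_def by (intro closure_cspan_superset)
    then show "(\<Sum>g\<in>F. ?f (mod_tensor (fibre g x) q, mod_tensor (fibre g y) q)) \<in> mod_op D" for F
      by (intro csubspace_intros(5)[OF L(1)])
  qed
  moreover have "csubspace (?f -` mod_op D)"
    using csubspace_intros(1-3)[OF L(1)]
    by (intro csubspaceI)
       (auto simp: zero_prod_def scaleC_prod_def blinfun_compose_add_right blinfun_compose_zero_right compose_scaleC_right[OF W], force+)
  moreover have "closed (?f -` mod_op D)"
    by (intro continuous_closed_vimage linear_continuous_at bl L)
  ultimately have "mod_op D \<subseteq> ?f -` mod_op D"
    by (subst mod_op_def, intro closure_cspan_minimal) auto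
  then show ?thesis using ST by auto
qed

text \<open>The inverse unitary has the same fibrewise form, so the two inclusions are two instances
  of \<open>fibrewise_mod_op\<close>.\<close>

lemma map_corep_mod_op:
  fixes D :: "('j, ('g::group_add, 'h::chilbert_space) ell2) ell2 unbounded_op"
  assumes D: "\<And>g x y. (x, y) \<in> D \<Longrightarrow> (fibre g x, fibre g y) \<in> D"
  shows "map_prod (\<lambda>S. corep_unitary o\<^sub>L S) (\<lambda>S. corep_unitary o\<^sub>L S) ` mod_op D = mod_op D"
proof
  note V = unitary_pairD[OF unitary_pair_corep]
  show "map_prod (\<lambda>S. corep_unitary o\<^sub>L S) (\<lambda>S. corep_unitary o\<^sub>L S) ` mod_op D \<subseteq> mod_op D"
    using fibrewise_mod_op[OF V(1) corep_unitary_fibre D] by auto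
  show "mod_op D \<subseteq> map_prod (\<lambda>S. corep_unitary o\<^sub>L S) (\<lambda>S. corep_unitary o\<^sub>L S) ` mod_op D"
  proof (rule subrelI)
    fix S T :: "('g, complex) ell2 \<Rightarrow>\<^sub>L ('g, ('j, ('g, 'h) ell2) ell2) ell2" assume ST: "(S, T) \<in> mod_op D"
    have "corep_unitary o\<^sub>L (corep_unitary_inv o\<^sub>L S) = S" for S :: "('g, complex) ell2 \<Rightarrow>\<^sub>L ('g, ('j, ('g, 'h) ell2) ell2) ell2"
      by (rule blinfun_eqI) (simp add: V)
    then show "(S, T) \<in> map_prod (\<lambda>S. corep_unitary o\<^sub>L S) (\<lambda>S. corep_unitary o\<^sub>L S) ` mod_op D"
      using fibrewise_mod_op[OF V(2) corep_unitary_inv_fibre D ST]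
      by (intro image_eqI[of _ _ "(corep_unitary_inv o\<^sub>L S, corep_unitary_inv o\<^sub>L T)"]) auto
  qed
qed

subsection \<open>Slices and bicommutants\<close>

text \<open>The real Riesz theorem represents the real part of the form; evaluating it at
  \<open>\<i> *\<^sub>C x\<close> recovers the imaginary part.\<close>

lemma sesquilinear_bop:
  fixes F :: "'h::chilbert_space \<Rightarrow> 'h \<Rightarrow> complex"
  assumes F: "\<And>x x' y. F (x + x') y = F x y + F x' y" "\<And>x y y'. F x (y + y') = F x y + F x y'"
    "\<And>c x y. F (c *\<^sub>C x) y = cnj c * F x y" "\<And>c x y. F x (c *\<^sub>C y) = c * F x y"
    and C: "C \<ge> 0" "\<And>x y. cmod (F x y) \<le> C * norm x * norm y"
  shows "\<exists>S. (\<forall>x y. cinner x (S \<cdot> y) = F x y) \<and> norm S \<le> C"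
proof -
  have "\<exists>z. \<forall>x. Re (F x y) = inner z x" for y
  proof (rule riesz, rule bounded_linear_intro[where K = "C * norm y"])
    show "norm (Re (F x y)) \<le> norm x * (C * norm y)" for x
      using C(2)[of x y] abs_Re_le_cmod[of "F x y"] by (simp add: mult_ac)
  qed (simp_all add: F scaleR_scaleC)
  then obtain s where s: "\<And>x y. Re (F x y) = inner (s y) x" by metis
  have cs: "cinner x (s y) = F x y" for x y
    using s[of x y] s[of "\<i> *\<^sub>C x" y] by (simp add: cinner_eq_inner complex_eq_iff F inner_commute)
  have add: "s (y + y') = s y + s y'" and sc: "s (c *\<^sub>C y) = c *\<^sub>C s y" for y y' c
    by (rule cinner_eqI; simp add: cs F cinner_add_right cinner_scaleC_right)+
  have n: "norm (s y) \<le> C * norm y" for y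
  proof -
    have "norm (s y) * norm (s y) = cmod (F (s y) y)"
      using cs[of "s y" y, symmetric] by (simp add: cinner_self norm_mult power2_eq_square)
    also have "\<dots> \<le> norm (s y) * (C * norm y)" using C(2)[of "s y" y] by (simp add: mult_ac)
    finally have "norm (s y) * norm (s y) \<le> norm (s y) * (C * norm y)" .
    then show ?thesis using C(1) by (cases "norm (s y) = 0") auto
  qed
  have "bounded_linear s"
    by (rule bounded_linear_intro[where K = C]) (use add sc n in \<open>auto simp: scaleR_scaleC mult.commute\<close>)
  then have S: "blinfun_apply (Blinfun s) = s" by (rule bounded_linear_Blinfun_apply)
  then have B: "bop_blinfun (Bop (Blinfun s)) = Blinfun s"
    by (intro Bop_blinfun) (simp add: is_clinear_def add sc)
  have "norm (Bop (Blinfun s)) \<le> C" by (rule norm_bop_bound[OF C(1)]) (simp add: B S n)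
  then show ?thesis using B S cs by metis
qed

text \<open>This is \<open>\<langle>x \<otimes> 1, T (y \<otimes> 1)\<rangle>\<close>, as \<open>creation x\<close> stands for \<open>x \<otimes> 1\<close>.\<close>

definition coefficient :: "('i, 'k::chilbert_space) ell2 bop \<Rightarrow> 'k \<Rightarrow> 'k \<Rightarrow> ('i, complex) ell2 bop" where
  "coefficient T x y = mod_inner (creation x) (bop_blinfun T o\<^sub>L creation y)"

lemma coefficient: "cinner v (coefficient T x y \<cdot> w) = cinner (x \<otimes>\<^sub>v v) (T \<cdot> (y \<otimes>\<^sub>v w))"
  and norm_coefficient_le: "norm (coefficient T x y) \<le> norm T * norm x * norm y"
proof -
  let ?F = "\<lambda>v w. cinner (x \<otimes>\<^sub>v v) (T \<cdot> (y \<otimes>\<^sub>v w))"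
  have b: "cmod (?F v w) \<le> (norm T * norm x * norm y) * norm v * norm w" for v w
  proof -
    have "cmod (?F v w) \<le> norm (x \<otimes>\<^sub>v v) * norm (T \<cdot> (y \<otimes>\<^sub>v w))" by (rule cinner_cauchy_schwarz)
    also have "\<dots> \<le> norm (x \<otimes>\<^sub>v v) * (norm T * norm (y \<otimes>\<^sub>v w))" by (intro mult_left_mono norm_bop_le) simp
    finally show ?thesis by (simp add: norm_tensor_vec mult_ac)
  qed
  have "\<exists>S. (\<forall>v w. cinner v (S \<cdot> w) = ?F v w) \<and> norm S \<le> norm T * norm x * norm y"
    by (rule sesquilinear_bop)
       (simp_all add: b tensor_vec_add_right tensor_vec_scaleC_right cinner_add_left cinner_add_right
         cinner_scaleC_left cinner_scaleC_right blinfun.add_right bop_scaleC)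
  then obtain S where S: "\<And>v w. cinner v (S \<cdot> w) = ?F v w" "norm S \<le> norm T * norm x * norm y" by blast
  have "coefficient T x y = S"
    unfolding coefficient_def by (rule mod_inner_eqI) (simp add: S)
  then show "cinner v (coefficient T x y \<cdot> w) = ?F v w" "norm (coefficient T x y) \<le> norm T * norm x * norm y"
    by (simp_all add: S)
qed

lemma coefficient_eqI:
  assumes "\<And>v w. cinner v (q \<cdot> w) = cinner (x \<otimes>\<^sub>v v) (T \<cdot> (y \<otimes>\<^sub>v w))"
  shows "coefficient T x y = q"
  by (rule bop_eqI, rule cinner_eqI) (simp add: coefficient assms)

lemma coefficient_add: "coefficient (S + T) x y = coefficient S x y + coefficient T x y"
  and coefficient_scaleC: "coefficient (c *\<^sub>C T) x y = c *\<^sub>C coefficient T x y"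
  by (rule coefficient_eqI; simp add: bop_simps cinner_add_right cinner_scaleC_right coefficient)+

lemma coefficient_tensor: "coefficient (S \<otimes>\<^sub>b c) x y = cinner x (S \<cdot> y) *\<^sub>C c"
  by (rule coefficient_eqI) (simp add: bop_simps cinner_scaleC_right cinner_tensor_tensor)

lemma bounded_linear_coefficient: "bounded_linear (\<lambda>T. coefficient T x y)"
  by (rule bounded_linear_intro[where K = "norm x * norm y"])
     (simp_all add: coefficient_add scaleR_scaleC coefficient_scaleC norm_coefficient_le mult.assoc[symmetric])

lemma slice_eqI:
  assumes "\<And>x y. cinner x (S \<cdot> y) = \<phi> (mod_inner (mod_tensor x 1) (T (mod_tensor y 1)))"
  shows "slice \<phi> T = S"
  unfolding slice_def
proof (rule the_equality)
  fix S' assume *: "\<forall>x y. cinner x (S' \<cdot> y) = \<phi> (mod_inner (mod_tensor x 1) (T (mod_tensor y 1)))"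
  show "S' = S" by (rule bop_eqI, rule cinner_eqI) (simp add: * assms)
qed (simp add: assms)

lemma csubspace_commutant: "csubspace (commutant A)"
  unfolding commutant_def
  by (rule csubspaceI) (auto simp: distrib_left distrib_right mult_scaleC_left mult_scaleC_right)

lemma closed_commutant: "closed (commutant A)"
proof -
  have "commutant A = (\<Inter>s\<in>A. {T. T * s = s * T})" by (auto simp: commutant_def)
  then show ?thesis by (auto intro!: closed_INT closed_Collect_eq continuous_intros)
qed

lemma subset_bicommutant: "A \<subseteq> commutant (commutant A)"
  by (auto simp: commutant_def)

subsection \<open>Equivariance for the dual coaction\<close>

text \<open>The coefficient space is left open so that the same operator is \<open>pauli3\<close> on
  scalars and the grading on the full space.\<close>

definition sign_op :: "(bool, 'v::chilbert_space) ell2 bop" where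
  "sign_op = Bop (mono_op id (\<lambda>i. if i then - id_blinfun else id_blinfun))"

lemma sign_op_fun: "ell2_fun (sign_op \<cdot> f) i = (if i then - ell2_fun f i else ell2_fun f i)"
  for f :: "(bool, 'v::chilbert_space) ell2"
proof -
  let ?T = "\<lambda>i. if i then - id_blinfun else id_blinfun :: 'v \<Rightarrow>\<^sub>L 'v"
  have n: "norm (?T i) \<le> 1" for i by (auto intro!: norm_blinfun_bound simp: blinfun.minus_left)
  have cl: "is_clinear (blinfun_apply (?T i))" for i
    by (auto simp: is_clinear_blinfun blinfun.minus_left)
  have "bop_blinfun sign_op = mono_op id ?T"
    unfolding sign_op_def by (rule Bop_blinfun, rule is_clinear_mono_op[OF inj_on_id n cl])
  then show ?thesis using mono_op_fun[OF inj_on_id, of ?T, OF n] by (simp add: blinfun.minus_left)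
qed

lemma grading_hat_eq: "grading_hat = sign_op"
proof -
  have "pauli3 = sign_op"
    unfolding pauli3_def
    by (rule bop_on_basis_eqI, rule ell2_eqI) (auto simp: sign_op_fun scaleC_complex_def)
  then show ?thesis
    unfolding grading_hat_def
    by (simp, intro tensor_bop_eqI ell2_eqI)
       (auto simp: sign_op_fun bop_simps complex_vector.scale_minus_left)
qed

context covariant_rep
begin

lemma spatial_corep_\<rho>_reg_elt:
  "spatial corep_unitary corep_unitary_inv (\<rho> (reg_elt \<alpha> \<pi> a g)) = \<rho> (reg_elt \<alpha> \<pi> a g) \<otimes>\<^sub>b lshift g"
  by (rule bop_eqI, intro ell2_eqI)
     (simp add: spatial_apply[OF unitary_pair_corep] \<rho>_reg_elt_fun tensor_lshift_fun add.assoc)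

lemma spatial_corep_\<rho>:
  assumes b: "b \<in> crossed_product \<alpha> \<pi>"
  shows "spatial corep_unitary corep_unitary_inv (\<rho> b)
       = tensor_id (crossed_product \<alpha> \<pi>) (rep_hat \<alpha> \<pi> u) (dual_coaction \<alpha> \<pi> b)"
proof -
  let ?B = "crossed_product \<alpha> \<pi>"
  let ?t = "spatial (amp (amp \<Upsilon>) o\<^sub>L flip) (flip o\<^sub>L amp (amp \<Upsilon>_inv)) ::
    ('g, ('g, 'h) ell2) ell2 bop \<Rightarrow> ('g, (bool, ('g, 'h) ell2) ell2) ell2 bop"
  let ?w = "spatial cotwist cotwist_inv :: ('g, 'h) ell2 bop \<Rightarrow> ('g, ('g, 'h) ell2) ell2 bop"
  let ?v = "spatial corep_unitary corep_unitary_inv :: (bool, ('g, 'h) ell2) ell2 bop \<Rightarrow> _"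
  have ht: "star_hom UNIV UNIV ?t" by (rule star_hom_spatial[OF unitary_pair_amp_flip[OF unitary_pair_amp[OF unitary_pair_\<Upsilon>]]])
  have hw: "star_hom UNIV UNIV ?w" by (rule star_hom_spatial[OF unitary_pair_cotwist])
  have hv: "star_hom UNIV UNIV ?v" by (rule star_hom_spatial[OF unitary_pair_corep])
  have "?v (\<rho> b) = ?t (?w b)"
  proof (rule star_hom_eqI[OF crossed_product_unital crossed_product_eq star_hom_comp[OF hv star_hom_\<rho>] star_hom_comp[OF ht hw] _ b])
    fix s assume "s \<in> {reg_elt \<alpha> \<pi> a g | a g. True}"
    then obtain a g where s: "s = reg_elt \<alpha> \<pi> a g" by blast
    have "?t (?w s) = \<rho> s \<otimes>\<^sub>b lshift g"
      by (simp add: s spatial_cotwist_homogeneous[OF homogeneous_reg_elt]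
          spatial_amp_flip_tensor[OF unitary_pair_amp[OF unitary_pair_\<Upsilon>]] \<rho>_def)
    moreover have "?v (\<rho> s) = \<rho> s \<otimes>\<^sub>b lshift g"
      unfolding s by (rule spatial_corep_\<rho>_reg_elt)
    ultimately show "?v (\<rho> s) = ?t (?w s)" by simp
  qed
  moreover have "tensor_id ?B (rep_hat \<alpha> \<pi> u) = restrict ?t (?B \<otimes>\<^sub>m\<^sub>i\<^sub>n Cred)"
    by (rule tensor_id_eq[OF crossed_product_unital unitary_pair_amp[OF unitary_pair_\<Upsilon>]]) (simp add: rep_hat_eq \<rho>_def)
  moreover have "dual_coaction \<alpha> \<pi> b \<in> ?B \<otimes>\<^sub>m\<^sub>i\<^sub>n Cred"
    using star_hom_dual_coaction b unfolding star_hom_def by blast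
  ultimately show ?thesis using b by (simp add: dual_coaction_eq)
qed

text \<open>The elements whose slice exists in the bicommutant form a closed subspace containing the
  generators. Closedness is the delicate point: the slices of a convergent sequence must themselves
  converge in norm, which follows from the bound on states and completeness.\<close>

lemma slice_bicommutant:
  assumes \<phi>: "state Cred \<phi>" and b: "b \<in> crossed_product \<alpha> \<pi>"
  shows "\<exists>S\<in>commutant (commutant (\<rho> ` crossed_product \<alpha> \<pi>)).
    \<forall>x y. cinner x (S \<cdot> y) = \<phi> (coefficient (spatial corep_unitary corep_unitary_inv (\<rho> b)) x y)"
proof -
  let ?B = "crossed_product \<alpha> \<pi>" and ?M = "commutant (commutant (\<rho> ` crossed_product \<alpha> \<pi>))"
  define \<Psi> :: "('g, 'h) ell2 bop \<Rightarrow> ('g, (bool, ('g, 'h) ell2) ell2) ell2 bop" where "\<Psi> b = spatial corep_unitary corep_unitary_inv (\<rho> b)" for b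
  have h\<Psi>: "star_hom UNIV UNIV \<Psi>"
    unfolding \<Psi>_def[abs_def] by (rule star_hom_comp[OF star_hom_spatial[OF unitary_pair_corep] star_hom_\<rho>])
  have bl: "bounded_linear \<Psi>" by (rule star_hom_bounded_linear[OF h\<Psi>])
  have \<Psi>: "\<Psi> (a + b) = \<Psi> a + \<Psi> b" "\<Psi> (c *\<^sub>C a) = c *\<^sub>C \<Psi> a" "norm (\<Psi> a) \<le> norm a" for a b c
    using h\<Psi> star_hom_norm_le_UNIV[OF h\<Psi>] by (auto simp: star_hom_def)
  have \<Psi>_reg: "\<Psi> (reg_elt \<alpha> \<pi> a g) = \<rho> (reg_elt \<alpha> \<pi> a g) \<otimes>\<^sub>b lshift g" for a g
    unfolding \<Psi>_def by (rule spatial_corep_\<rho>_reg_elt)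
  have \<phi>_add: "\<phi> (p + q) = \<phi> p + \<phi> q" and \<phi>_sc: "\<phi> (c *\<^sub>C p) = c * \<phi> p" if "p \<in> Cred" "q \<in> Cred" for p q c
    using \<phi> that by (auto simp: state_def)
  have \<phi>_diff: "\<phi> (p - q) = \<phi> p - \<phi> q" if "p \<in> Cred" "q \<in> Cred" for p q
    using \<phi>_add[OF csubspace_intros(4)[OF csubspace_Cred that] that(2)] by simp
  have \<phi>_n: "cmod (\<phi> p) \<le> 2 * norm p" if "p \<in> Cred" for p
    by (rule state_norm_le[OF Cred_star_subalgebra closed_Cred Cred_unit \<phi> that])
  have B: "csubspace ?B" "closed ?B"
    using crossed_product_unital by (auto simp: unital_cstar_subalgebra_def star_subalgebra_def)
  \<comment> \<open>The state is additive and bounded only on \<open>Cred\<close>, so coefficients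
    have to be placed there before it is applied.\<close>
  have Cr: "coefficient (\<Psi> b) x y \<in> Cred" if "b \<in> ?B" for b x y
  proof -
    have blc: "bounded_linear (\<lambda>b. coefficient (\<Psi> b) x y)" by (rule bounded_linear_compose[OF bounded_linear_coefficient bl])
    have "?B \<subseteq> (\<lambda>b. coefficient (\<Psi> b) x y) -` Cred"
      unfolding crossed_product_eq
    proof (rule closure_cspan_minimal)
      show "csubspace ((\<lambda>b. coefficient (\<Psi> b) x y) -` Cred)"
        using csubspace_intros(1-3)[OF csubspace_Cred] bounded_linear.linear[OF blc, THEN linear_0]
        by (intro csubspaceI) (auto simp: \<Psi> coefficient_add coefficient_scaleC)
      show "closed ((\<lambda>b. coefficient (\<Psi> b) x y) -` Cred)"
        by (intro continuous_closed_vimage linear_continuous_at blc closed_Cred)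
      show "{reg_elt \<alpha> \<pi> a g | a g. True} \<subseteq> (\<lambda>b. coefficient (\<Psi> b) x y) -` Cred"
        by (auto simp: \<Psi>_reg coefficient_tensor intro!: csubspace_intros(3)[OF csubspace_Cred])
    qed
    then show ?thesis using that by blast
  qed
  note M = csubspace_commutant closed_commutant
  define E where "E = {b\<in>?B. \<exists>S\<in>?M. \<forall>x y. cinner x (S \<cdot> y) = \<phi> (coefficient (\<Psi> b) x y)}"
  have "csubspace E"
  proof (rule csubspaceI)
    have z: "\<Psi> 0 = 0" using bl by (simp add: bounded_linear.linear linear_0)
    have z': "coefficient 0 x y = 0" for x y :: "(bool, ('g, 'h) ell2) ell2" 
      using coefficient_add[of 0 0 x y] by simp
    have "\<phi> 0 = 0" using \<phi>_sc[of 0 0 0] csubspace_intros(1)[OF csubspace_Cred] by simp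
    moreover have "(0 :: (bool, ('g, 'h) ell2) ell2 bop) \<cdot> y = 0" for y by (simp add: zero_bop.rep_eq)
    ultimately show "0 \<in> E" unfolding E_def
      using csubspace_intros(1)[OF B(1)] by (auto simp: z z' intro!: bexI[of _ 0] csubspace_intros(1)[OF M(1)])
  next
    fix a b assume "a \<in> E" "b \<in> E"
    then obtain S T where ab: "a \<in> ?B" "b \<in> ?B" "S \<in> ?M" "T \<in> ?M"
      "\<And>x y. cinner x (S \<cdot> y) = \<phi> (coefficient (\<Psi> a) x y)" "\<And>x y. cinner x (T \<cdot> y) = \<phi> (coefficient (\<Psi> b) x y)"
      unfolding E_def by blast
    then show "a + b \<in> E" unfolding E_def
      using csubspace_intros(2)[OF B(1)]
      by (auto simp: \<Psi> coefficient_add \<phi>_add Cr bop_simps cinner_add_right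
          intro!: bexI[of _ "S + T"] csubspace_intros(2)[OF M(1)])
  next
    fix a c assume "a \<in> E"
    then obtain S where a: "a \<in> ?B" "S \<in> ?M" "\<And>x y. cinner x (S \<cdot> y) = \<phi> (coefficient (\<Psi> a) x y)"
      unfolding E_def by blast
    then show "c *\<^sub>C a \<in> E" unfolding E_def
      using csubspace_intros(3)[OF B(1)] 
      by (auto simp: \<Psi> coefficient_scaleC \<phi>_sc[OF Cr Cr] bop_simps cinner_scaleC_right
          intro!: bexI[of _ "c *\<^sub>C S"] csubspace_intros(3)[OF M(1)])
  qed
  moreover have "closed E"
    unfolding closed_sequential_limits
  proof (intro allI impI, elim conjE)
    fix X l assume X: "\<forall>n. X n \<in> E" and l: "X \<longlonglongrightarrow> l"
    then have XB: "X n \<in> ?B" for n by (auto simp: E_def)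
    then have lB: "l \<in> ?B" using closed_sequentially[OF B(2) _ l] by blast
    obtain S where S: "\<And>n. S n \<in> ?M" "\<And>n x y. cinner x (S n \<cdot> y) = \<phi> (coefficient (\<Psi> (X n)) x y)"
      using X unfolding E_def by (auto simp: Bex_def) metis
    have dif: "\<phi> (coefficient (\<Psi> (X n)) x y) - \<phi> (coefficient (\<Psi> c) x y) = \<phi> (coefficient (\<Psi> (X n - c)) x y)" if "c \<in> ?B" for n x y c
    proof -
      have "coefficient (\<Psi> (X n - c)) x y = coefficient (\<Psi> (X n)) x y - coefficient (\<Psi> c) x y"
        using bounded_linear.linear[OF bounded_linear_compose[OF bounded_linear_coefficient bl], THEN linear_diff] .
      then show ?thesis using \<phi>_diff[OF Cr[OF XB] Cr[OF that]] by simp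
    qed
    have le: "cmod (\<phi> (coefficient (\<Psi> c) x y)) \<le> 2 * norm c * norm x * norm y" if "c \<in> ?B" for c x y
    proof -
      have "norm (coefficient (\<Psi> c) x y) \<le> norm (\<Psi> c) * norm x * norm y" by (rule norm_coefficient_le)
      also have "\<dots> \<le> norm c * norm x * norm y" by (intro mult_right_mono \<Psi>) simp_all
      finally show ?thesis using \<phi>_n[OF Cr[OF that], of x y] by simp
    qed
    \<comment> \<open>The constant 2 is that of \<open>state_norm_le\<close>; the estimate pairs the
      image of \<open>y\<close> with itself.\<close>
    have Sd: "norm (S m - S n) \<le> 2 * norm (X m - X n)" for m n
    proof (rule norm_bop_bound)
      fix y
      let ?z = "(S m - S n) \<cdot> y"
      have zz: "cinner z ((S m - S n) \<cdot> y) = \<phi> (coefficient (\<Psi> (X m - X n)) z y)" for z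
        by (simp add: cinner_diff_right S(2) dif[OF XB])
      have "norm ?z * norm ?z = cmod (cinner ?z ?z)" by (simp add: cinner_self norm_mult power2_eq_square)
      also have "cinner ?z ?z = \<phi> (coefficient (\<Psi> (X m - X n)) ?z y)"
        by (rule zz)
      also have "cmod \<dots> \<le> 2 * norm (X m - X n) * norm ?z * norm y"
        using csubspace_intros(4)[OF B(1) XB XB] by (rule le)
      finally have "norm ?z * norm ?z \<le> norm ?z * (2 * norm (X m - X n) * norm y)" by (simp add: mult_ac)
      then show "norm ?z \<le> 2 * norm (X m - X n) * norm y" by (cases "norm ?z = 0") auto
    qed simp
    have "Cauchy S"
    proof (rule metric_CauchyI)
      fix e :: real assume "e > 0"
      then obtain N where N: "\<And>m n. m \<ge> N \<Longrightarrow> n \<ge> N \<Longrightarrow> dist (X m) (X n) < e / 2"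
        using LIMSEQ_imp_Cauchy[OF l] by (meson half_gt_zero metric_CauchyD)
      have "dist (S m) (S n) < e" if "m \<ge> N" "n \<ge> N" for m n
        using Sd[of m n] N[OF that] by (simp add: dist_norm)
      then show "\<exists>M. \<forall>m\<ge>M. \<forall>n\<ge>M. dist (S m) (S n) < e" by blast
    qed
    then obtain T where T: "S \<longlonglongrightarrow> T" using Cauchy_convergent convergent_def by blast
    have TM: "T \<in> ?M" using closed_sequentially[OF M(2) _ T] S(1) by blast
    have "cinner x (T \<cdot> y) = \<phi> (coefficient (\<Psi> l) x y)" for x y
    proof (rule LIMSEQ_unique)
      have d0: "(\<lambda>n. norm (S n - T)) \<longlonglongrightarrow> 0" "(\<lambda>n. norm (X n - l)) \<longlonglongrightarrow> 0"
        using T l by (simp_all add: LIM_zero tendsto_norm_zero)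
      have "(\<lambda>n. cinner x (S n \<cdot> y) - cinner x (T \<cdot> y)) \<longlonglongrightarrow> 0"
      proof (rule Lim_null_comparison)
        show "\<forall>\<^sub>F n in sequentially. norm (cinner x (S n \<cdot> y) - cinner x (T \<cdot> y)) \<le> norm x * norm y * norm (S n - T)"
        proof (intro always_eventually allI)
          fix n
          have "norm (cinner x ((S n - T) \<cdot> y)) \<le> norm x * norm ((S n - T) \<cdot> y)" by (rule cinner_cauchy_schwarz)
          also have "\<dots> \<le> norm x * (norm (S n - T) * norm y)" by (intro mult_left_mono norm_bop_le) simp
          finally show "norm (cinner x (S n \<cdot> y) - cinner x (T \<cdot> y)) \<le> norm x * norm y * norm (S n - T)"
            by (simp add: cinner_diff_right mult_ac)
        qed
        show "(\<lambda>n. norm x * norm y * norm (S n - T)) \<longlonglongrightarrow> 0" using tendsto_mult_right_zero[OF d0(1)] .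
      qed
      then show "(\<lambda>n. cinner x (S n \<cdot> y)) \<longlonglongrightarrow> cinner x (T \<cdot> y)" by (simp add: LIM_zero_iff)
      have "(\<lambda>n. cinner x (S n \<cdot> y) - \<phi> (coefficient (\<Psi> l) x y)) \<longlonglongrightarrow> 0"
      proof (rule Lim_null_comparison)
        show "\<forall>\<^sub>F n in sequentially. norm (cinner x (S n \<cdot> y) - \<phi> (coefficient (\<Psi> l) x y)) \<le> 2 * norm x * norm y * norm (X n - l)"
        proof (intro always_eventually allI)
          fix n
          show "norm (cinner x (S n \<cdot> y) - \<phi> (coefficient (\<Psi> l) x y)) \<le> 2 * norm x * norm y * norm (X n - l)"
            using le[OF csubspace_intros(4)[OF B(1) XB lB], of n x y] by (simp add: S(2) dif[OF lB] mult_ac)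
        qed
        show "(\<lambda>n. 2 * norm x * norm y * norm (X n - l)) \<longlonglongrightarrow> 0" using tendsto_mult_right_zero[OF d0(2)] .
      qed
      then show "(\<lambda>n. cinner x (S n \<cdot> y)) \<longlonglongrightarrow> \<phi> (coefficient (\<Psi> l) x y)" by (simp add: LIM_zero_iff)
    qed
    then show "l \<in> E" using lB TM by (auto simp: E_def)
  qed
  moreover have "{reg_elt \<alpha> \<pi> a g | a g. True} \<subseteq> E"
  proof clarify
    fix a g
    \<comment> \<open>The coefficient of \<open>\<rho> b \<otimes>\<^sub>b lshift g\<close> is a
      scalar times \<open>lshift g\<close>, so the state contributes the number
      \<open>\<phi> (lshift g)\<close>.\<close>
    let ?S = "\<phi> (lshift g) *\<^sub>C \<rho> (reg_elt \<alpha> \<pi> a g)"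
    have "\<rho> (reg_elt \<alpha> \<pi> a g) \<in> ?M" using subset_bicommutant[of "\<rho> ` ?B"] by auto
    then have "?S \<in> ?M" by (rule csubspace_intros(3)[OF M(1)])
    moreover have "cinner x (?S \<cdot> y) = \<phi> (coefficient (\<Psi> (reg_elt \<alpha> \<pi> a g)) x y)" for x y
      using \<phi>_sc[OF lshift_Cred lshift_Cred]
      by (simp add: \<Psi>_reg coefficient_tensor bop_simps cinner_scaleC_right mult.commute)
    ultimately show "reg_elt \<alpha> \<pi> a g \<in> E" by (auto simp: E_def)
  qed
  ultimately have "?B \<subseteq> E" unfolding crossed_product_eq by (intro closure_cspan_minimal)
  then show ?thesis using b by (auto simp: E_def \<Psi>_def)
qed

theorem coaction_equivariant_dual:
  fixes D :: "(bool, ('g, 'h) ell2) ell2 unbounded_op"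
  assumes D: "\<And>g x y. (x, y) \<in> D \<Longrightarrow> (fibre g x, fibre g y) \<in> D"
  shows "coaction_equivariant (crossed_product \<alpha> \<pi>) (rep_hat \<alpha> \<pi> u) D grading_hat (dual_coaction \<alpha> \<pi>)"
proof -
  let ?B = "crossed_product \<alpha> \<pi>" and ?r = "rep_hat \<alpha> \<pi> u"
  let ?X = "\<lambda>S. corep_unitary o\<^sub>L S :: ('g, complex) ell2 \<Rightarrow>\<^sub>L ('g, (bool, ('g, 'h) ell2) ell2) ell2"
  let ?Y = "\<lambda>S. corep_unitary_inv o\<^sub>L S :: ('g, complex) ell2 \<Rightarrow>\<^sub>L ('g, (bool, ('g, 'h) ell2) ell2) ell2"
  let ?\<Theta> = "corep :: (bool, ('g, 'h) ell2) ell2 \<Rightarrow> _"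
  let ?\<Psi> = "spatial corep_unitary corep_unitary_inv :: (bool, ('g, 'h) ell2) ell2 bop \<Rightarrow> _"
  note V = unitary_pairD[OF unitary_pair_corep]
  have r: "?r b = \<rho> b" if "b \<in> ?B" for b using that by (simp add: rep_hat_eq)
  have img: "?r ` ?B = \<rho> ` ?B" by (auto simp: r)
  have "?\<Theta> (?r b \<cdot> x) = bop_blinfun (tensor_id ?B ?r (dual_coaction \<alpha> \<pi> b)) o\<^sub>L ?\<Theta> x" if b: "b \<in> ?B" for b x
    unfolding spatial_corep_\<rho>[OF b, symmetric]
    by (rule blinfun_eqI) (simp add: corep_apply spatial_apply[OF unitary_pair_corep] V r[OF b])
  moreover have "?X (bop_blinfun (grading_hat \<otimes>\<^sub>b 1) o\<^sub>L S) = bop_blinfun (grading_hat \<otimes>\<^sub>b 1) o\<^sub>L ?X S" for S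
    by (rule blinfun_eqI, intro ell2_eqI) (simp add: tensor_bop_one_right grading_hat_eq sign_op_fun)
  moreover have "slice \<phi> (\<lambda>S. ?X (bop_blinfun (?r b \<otimes>\<^sub>b 1) o\<^sub>L ?Y S)) \<in> commutant (commutant (?r ` ?B))"
    if b: "b \<in> ?B" and \<phi>: "state Cred \<phi>" for b and \<phi> :: "('g, complex) ell2 bop \<Rightarrow> complex"
  proof -
    obtain S where S: "S \<in> commutant (commutant (\<rho> ` ?B))"
      "\<And>x y. cinner x (S \<cdot> y) = \<phi> (coefficient (?\<Psi> (\<rho> b)) x y)"
      using slice_bicommutant[OF \<phi> b] by blast
    have one: "mod_tensor x 1 = creation x" for x :: "(bool, ('g, 'h) ell2) ell2"
      by (rule blinfun_eqI) (simp add: bop_simps)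
    have "?X (bop_blinfun (?r b \<otimes>\<^sub>b 1) o\<^sub>L ?Y (creation y)) = bop_blinfun (?\<Psi> (\<rho> b)) o\<^sub>L creation y" for y
      by (rule blinfun_eqI) (simp add: tensor_bop_one_right spatial_apply[OF unitary_pair_corep] r[OF b])
    then have "slice \<phi> (\<lambda>S. ?X (bop_blinfun (?r b \<otimes>\<^sub>b 1) o\<^sub>L ?Y S)) = S"
      by (intro slice_eqI) (simp add: one S(2) coefficient_def)
    then show ?thesis using S(1) by (simp add: img)
  qed
  \<comment> \<open>The whole space serves as the dense invariant subspace.\<close>
  moreover have "csubspace (UNIV :: (bool, ('g, 'h) ell2) ell2 set)" by (simp add: csubspaceI)
  ultimately show ?thesis
    unfolding coaction_equivariant_def
    using dual_coaction_coaction unitary_corep_corep operator_form_corep map_corep_mod_op[OF D]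
    by (intro conjI exI[of _ UNIV] exI[of _ ?\<Theta>] exI[of _ ?X] exI[of _ ?Y]) auto
qed

end

section \<open>Unbounded operators\<close>

lemma bounded_linear_cinner_left: "bounded_linear (\<lambda>x. cinner x y)"
  by (rule bounded_linear_intro[where K = "norm y"])
     (simp_all add: cinner_add_left cinner_scaleR_left scaleR_conv_of_real order_trans[OF cinner_cauchy_schwarz])

lemma closed_adjoint_op: "closed (adjoint_op D)"
proof -
  have "adjoint_op D = (\<Inter>(x, w)\<in>D. {p. cinner (fst p) w = cinner (snd p) x})"
    by (auto simp: adjoint_op_def)
  moreover have "closed {p :: 'a \<times> 'a. cinner (fst p) w = cinner (snd p) x}" for x w :: 'a
    by (intro closed_Collect_eq bounded_linear.continuous_on[OF bounded_linear_cinner_left] continuous_intros)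
  ultimately show ?thesis by auto
qed

lemma
  assumes "self_adjoint_op D"
  shows self_adjoint_csubspace: "csubspace D" and self_adjoint_closed: "closed D"
    and self_adjoint_single_valued: "(x, y) \<in> D \<Longrightarrow> (x, z) \<in> D \<Longrightarrow> y = z"
    and self_adjoint_symmetric: "(x, y) \<in> D \<Longrightarrow> (v, w) \<in> D \<Longrightarrow> cinner x w = cinner y v"
    and self_adjoint_mem: "(\<And>v w. (v, w) \<in> D \<Longrightarrow> cinner x w = cinner y v) \<Longrightarrow> (x, y) \<in> D"
    and self_adjoint_dense: "closure (Domain D) = UNIV"
proof -
  have D: "csubspace D" "single_valued D" "closure (Domain D) = UNIV" "adjoint_op D = D"
    using assms by (auto simp: self_adjoint_op_def)
  show "csubspace D" "closure (Domain D) = UNIV" by fact+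
  show "closed D" using closed_adjoint_op[of D] by (simp add: D)
  show "y = z" if "(x, y) \<in> D" "(x, z) \<in> D" using that D(2) by (auto dest: single_valuedD)
  show "cinner x w = cinner y v" if "(x, y) \<in> D" "(v, w) \<in> D"
  proof -
    have "(x, y) \<in> adjoint_op D" using that D(4) by simp
    then show ?thesis using that(2) by (auto simp: adjoint_op_def)
  qed
  show "(x, y) \<in> D" if "\<And>v w. (v, w) \<in> D \<Longrightarrow> cinner x w = cinner y v"
  proof -
    have "(x, y) \<in> adjoint_op D" using that by (auto simp: adjoint_op_def)
    then show ?thesis using D(4) by simp
  qed
qed

lemma graph_intros:
  assumes "csubspace (D :: ('a::complex_vector \<times> 'b::complex_vector) set)"
  shows "(0, 0) \<in> D" "(x, y) \<in> D \<Longrightarrow> (x', y') \<in> D \<Longrightarrow> (x + x', y + y') \<in> D"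
    "(x, y) \<in> D \<Longrightarrow> (c *\<^sub>C x, c *\<^sub>C y) \<in> D" "(x, y) \<in> D \<Longrightarrow> (x', y') \<in> D \<Longrightarrow> (x - x', y - y') \<in> D"
    "(x, y) \<in> D \<Longrightarrow> (- x, - y) \<in> D"
  using csubspace_intros(1,6)[OF assms] csubspace_intros(2,4)[OF assms, of "(x, y)" "(x', y')"]
    csubspace_intros(3)[OF assms, of "(x, y)" c] csubspace_intros(6)[OF assms, of "(x, y)"]
  by (simp_all add: zero_prod_def scaleC_prod_def)

lemma csubspace_graphI:
  assumes "(0, 0) \<in> D" "\<And>x y x' y'. (x, y) \<in> D \<Longrightarrow> (x', y') \<in> D \<Longrightarrow> (x + x', y + y') \<in> D"
    "\<And>c x y. (x, y) \<in> D \<Longrightarrow> (c *\<^sub>C x, c *\<^sub>C y) \<in> D"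
  shows "csubspace D"
  by (rule csubspaceI) (use assms in \<open>auto simp: zero_prod_def scaleC_prod_def\<close>)

subsection \<open>Tensor products with one bounded or diagonal factor\<close>

lemma has_sum_Pair: "(f has_sum x) A \<Longrightarrow> (g has_sum y) A \<Longrightarrow> ((\<lambda>i. (f i, g i)) has_sum (x, y)) A"
  unfolding has_sum_def sum_prod by (rule tendsto_Pair)

text \<open>The way to compute the closure of an algebraic tensor product: guess its graph
  \<open>R\<close> in coordinates. The inclusion of \<open>R\<close> holds because each of its pairs
  is a series of elementary pairs along the basis, for which the kets must lie in the domain of
  \<open>T\<close>.\<close>

lemma tensor_op_eqI:
  fixes D :: "'h::chilbert_space unbounded_op" and T :: "('i, complex) ell2 unbounded_op"
  assumes R: "csubspace R" "closed R"
    and gen: "\<And>x y v w. (x, y) \<in> D \<Longrightarrow> (v, w) \<in> T \<Longrightarrow> (x \<otimes>\<^sub>v v, y \<otimes>\<^sub>v w) \<in> R"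
    and sum: "\<And>f g. (f, g) \<in> R \<Longrightarrow> \<exists>y w. (\<forall>i. (ell2_fun f i, y i) \<in> D \<and> (ket i, w i) \<in> T) \<and>
      ((\<lambda>i. y i \<otimes>\<^sub>v w i) has_sum g) UNIV"
  shows "D \<otimes>\<^sub>u T = R"
proof
  show "D \<otimes>\<^sub>u T \<subseteq> R"
    unfolding tensor_op_def by (rule closure_cspan_minimal[OF _ R]) (use gen in auto)
  show "R \<subseteq> D \<otimes>\<^sub>u T"
  proof (rule subrelI)
    fix f g assume "(f, g) \<in> R"
    then obtain y w where yw: "\<And>i. (ell2_fun f i, y i) \<in> D" "\<And>i. (ket i, w i) \<in> T" "((\<lambda>i. y i \<otimes>\<^sub>v w i) has_sum g) UNIV"
      using sum by blast
    have L: "csubspace (D \<otimes>\<^sub>u T)" "closed (D \<otimes>\<^sub>u T)"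
      unfolding tensor_op_def
      by (rule csubspace_closure_cspan[OF bounded_linear_scaleC_prod[OF bounded_linear_scaleC bounded_linear_scaleC]]) simp
    show "(f, g) \<in> D \<otimes>\<^sub>u T"
    proof (rule has_sum_in_closed[OF L(2) _ has_sum_Pair[OF ell2_has_sum yw(3)]])
      fix F :: "'i set"
      have "(ell2_fun f i \<otimes>\<^sub>v ket i, y i \<otimes>\<^sub>v w i) \<in> D \<otimes>\<^sub>u T" for i
        unfolding tensor_op_def using yw(1,2) by (intro closure_cspan_superset) blast
      then show "(\<Sum>i\<in>F. (ell2_fun f i \<otimes>\<^sub>v ket i, y i \<otimes>\<^sub>v w i)) \<in> D \<otimes>\<^sub>u T"
        by (intro csubspace_intros(5)[OF L(1)])
    qed
  qed
qed

lemma tensor_op_Id: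
  assumes D: "csubspace D" "closed D"
  shows "D \<otimes>\<^sub>u Id = {(f, g). \<forall>i. (ell2_fun f i, ell2_fun g i) \<in> D}" (is "_ = ?R")
proof (rule tensor_op_eqI)
  have "?R = (\<Inter>i. (\<lambda>p. (ell2_fun (fst p) i, ell2_fun (snd p) i)) -` D)" by auto
  then show "closed ?R" by (simp only:) (intro closed_INT ballI closed_vimage D continuous_intros)
  show "csubspace ?R" by (rule csubspace_graphI) (auto intro: graph_intros[OF D(1)])
  show "(x \<otimes>\<^sub>v v, y \<otimes>\<^sub>v w) \<in> ?R" if "(x, y) \<in> D" "(v, w) \<in> Id" for x y v w
    using that graph_intros(3)[OF D(1)] by auto
  show "\<exists>y w. (\<forall>i. (ell2_fun f i, y i) \<in> D \<and> (ket i, w i) \<in> Id) \<and> ((\<lambda>i. y i \<otimes>\<^sub>v w i) has_sum g) UNIV"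
    if "(f, g) \<in> ?R" for f g
    using that ell2_has_sum[of g] by (intro exI[of _ "ell2_fun g"] exI[of _ ket]) auto
qed

lemma tensor_Id_mult_op:
  "(Id :: 'h::chilbert_space unbounded_op) \<otimes>\<^sub>u mult_op l
    = {(f, g). \<forall>x. ell2_fun g x = complex_of_real (l x) *\<^sub>C ell2_fun f x}" (is "_ = ?R")
proof (rule tensor_op_eqI)
  have "?R = (\<Inter>x. {p. ell2_fun (snd p) x = complex_of_real (l x) *\<^sub>C ell2_fun (fst p) x})" by auto
  then show "closed ?R"
    by (simp only:) (intro closed_INT ballI closed_Collect_eq continuous_intros bounded_linear.continuous_on[OF bounded_linear_scaleC])
  show "csubspace ?R"
    by (rule csubspace_graphI) (auto simp: scaleC_add_right scaleC_scaleC mult.commute)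
  show "(x \<otimes>\<^sub>v v, y \<otimes>\<^sub>v w) \<in> ?R" if "(x, y) \<in> Id" "(v, w) \<in> mult_op l" for x y :: 'h and v w
    using that by (auto simp: mult_op_def scaleC_scaleC)
  show "\<exists>y w. (\<forall>i. (ell2_fun f i, y i) \<in> Id \<and> (ket i, w i) \<in> mult_op l) \<and> ((\<lambda>i. y i \<otimes>\<^sub>v w i) has_sum g) UNIV"
    if fg: "(f, g) \<in> ?R" for f g :: "('a, 'h) ell2"
  proof (intro exI[of _ "ell2_fun f"] exI[of _ "\<lambda>i. complex_of_real (l i) *\<^sub>C ket i"] conjI allI)
    show "(ket i, complex_of_real (l i) *\<^sub>C ket i) \<in> mult_op l" for i
      by (auto simp: mult_op_def scaleC_complex_def)
    have "ell2_fun f i \<otimes>\<^sub>v (complex_of_real (l i) *\<^sub>C ket i) = ell2_fun g i \<otimes>\<^sub>v ket i" for i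
      using fg by (simp add: tensor_vec_scaleC_right tensor_vec_scaleC_left)
    then show "((\<lambda>i. ell2_fun f i \<otimes>\<^sub>v (complex_of_real (l i) *\<^sub>C ket i)) has_sum g) UNIV"
      using ell2_has_sum[of g] by simp
  qed simp
qed

lemma pauli1_fun:
  fixes v :: "(bool, complex) ell2"
  shows "ell2_fun (pauli1 \<cdot> v) i = ell2_fun v (\<not> i)"
proof -
  have J: "unitary_pair (mono_op Not (\<lambda>_. id_blinfun)) (mono_op Not (\<lambda>_. id_blinfun) :: (bool, complex) ell2 \<Rightarrow>\<^sub>L _)"
    using unitary_pair_mono_op(1)[of Not Not "\<lambda>_. id_blinfun" "\<lambda>_. id_blinfun"] by (simp add: unitary_pair_id)
  let ?J = "Bop (mono_op Not (\<lambda>_. id_blinfun)) :: (bool, complex) ell2 bop"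
  have f: "ell2_fun (?J \<cdot> v) i = ell2_fun v (\<not> i)" for v :: "(bool, complex) ell2" and i
    unfolding Bop_blinfun[OF unitary_pairD(1)[OF J]]
    using unitary_pair_mono_op(2)[of Not Not "\<lambda>_. id_blinfun" "\<lambda>_. id_blinfun" v i] by (simp add: unitary_pair_id)
  have "pauli1 = ?J"
    unfolding pauli1_def by (rule bop_on_basis_eqI, rule ell2_eqI) (auto simp: f)
  then show ?thesis using f by simp
qed

lemma pauli2_fun: "ell2_fun (pauli2 \<cdot> v) i = (if i then \<i> else - \<i>) * ell2_fun v (\<not> i)"
proof -
  have f: "ell2_fun (((- \<i>) *\<^sub>C (sign_op * pauli1)) \<cdot> v) i = (if i then \<i> else - \<i>) * ell2_fun v (\<not> i)" for v i
    unfolding bop_simps by (simp add: sign_op_fun pauli1_fun scaleC_complex_def del: complex_vector.scale_minus_left)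
  have "pauli2 = (- \<i>) *\<^sub>C (sign_op * pauli1)"
    unfolding pauli2_def by (rule bop_on_basis_eqI, rule ell2_eqI)
      (unfold f, auto simp: scaleC_complex_def)
  then show ?thesis using f by simp
qed

text \<open>The operator \<open>P\<close> exchanges the two coordinates up to the phases
  \<open>c\<close>. Solving for the image under \<open>E\<close> divides by a phase, which is
  multiplication by its conjugate.\<close>

lemma tensor_op_swap:
  assumes E: "csubspace E" "closed E" and P: "\<And>v i. ell2_fun (P \<cdot> v) i = c i * ell2_fun v (\<not> i)" and c: "\<And>i. cnj (c i) * c i = 1"
  shows "E \<otimes>\<^sub>u bop_graph P = {(f, g). \<forall>i. (ell2_fun f i, cnj (c (\<not> i)) *\<^sub>C ell2_fun g (\<not> i)) \<in> E}" (is "_ = ?R")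
proof (rule tensor_op_eqI)
  have "?R = (\<Inter>i. (\<lambda>p. (ell2_fun (fst p) i, cnj (c (\<not> i)) *\<^sub>C ell2_fun (snd p) (\<not> i))) -` E)" by auto
  then show "closed ?R"
    by (simp only:) (intro closed_INT ballI closed_vimage E continuous_intros bounded_linear.continuous_on[OF bounded_linear_scaleC])
  show "csubspace ?R"
  proof (rule csubspace_graphI)
    fix d x y assume *: "(x, y) \<in> ?R"
    have "(d *\<^sub>C ell2_fun x i, d *\<^sub>C cnj (c (\<not> i)) *\<^sub>C ell2_fun y (\<not> i)) \<in> E" for i
      using * by (intro graph_intros(3)[OF E(1)]) auto
    then show "(d *\<^sub>C x, d *\<^sub>C y) \<in> ?R" by (simp add: scaleC_scaleC mult.commute)
  qed (auto simp: scaleC_add_right intro: graph_intros(1,2)[OF E(1)])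
  have c': "cnj (c i) * (c i * z) = z" for i z by (metis c mult.assoc mult_1)
  show "(x \<otimes>\<^sub>v v, y \<otimes>\<^sub>v w) \<in> ?R" if "(x, y) \<in> E" "(v, w) \<in> bop_graph P" for x y v w
    using that graph_intros(3)[OF E(1), of x y] by (auto simp: bop_graph_def P scaleC_scaleC c')
  show "\<exists>y w. (\<forall>i. (ell2_fun f i, y i) \<in> E \<and> (ket i, w i) \<in> bop_graph P) \<and> ((\<lambda>i. y i \<otimes>\<^sub>v w i) has_sum g) UNIV"
    if fg: "(f, g) \<in> ?R" for f g
  proof (intro exI[of _ "\<lambda>i. cnj (c (\<not> i)) *\<^sub>C ell2_fun g (\<not> i)"] exI[of _ "\<lambda>i. P \<cdot> ket i"] conjI allI)
    show "(ell2_fun f i, cnj (c (\<not> i)) *\<^sub>C ell2_fun g (\<not> i)) \<in> E" for i using fg by auto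
    show "(ket i, P \<cdot> ket i) \<in> bop_graph P" for i by (auto simp: bop_graph_def)
    have "g = (\<Sum>i\<in>UNIV. (cnj (c (\<not> i)) *\<^sub>C ell2_fun g (\<not> i)) \<otimes>\<^sub>v (P \<cdot> ket i))"
    proof (rule ell2_eqI)
      fix j
      have "ell2_fun ((cnj (c (\<not> i)) *\<^sub>C ell2_fun g (\<not> i)) \<otimes>\<^sub>v (P \<cdot> ket i)) j = (if i = (\<not> j) then ell2_fun g j else 0)" for i
        using c[of j] by (auto simp: P scaleC_scaleC mult.commute)
      then show "ell2_fun g j = ell2_fun (\<Sum>i\<in>UNIV. (cnj (c (\<not> i)) *\<^sub>C ell2_fun g (\<not> i)) \<otimes>\<^sub>v (P \<cdot> ket i)) j"
        unfolding ell2_fun_sum by simp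
    qed
    then show "((\<lambda>i. (cnj (c (\<not> i)) *\<^sub>C ell2_fun g (\<not> i)) \<otimes>\<^sub>v (P \<cdot> ket i)) has_sum g) UNIV"
      by (intro has_sum_finiteI) auto
  qed
qed

subsection \<open>The Dirac operator on the crossed product, fibre by fibre\<close>

abbreviation coord :: "(bool, ('g, 'h::chilbert_space) ell2) ell2 \<Rightarrow> bool \<Rightarrow> 'g \<Rightarrow> 'h" where
  "coord f i x \<equiv> ell2_fun (ell2_fun f i) x"

text \<open>Over \<open>x\<close> the operator is \<open>D \<otimes> \<sigma>\<^sub>1 + l x \<otimes> \<sigma>\<^sub>2\<close>, with off-diagonal entries \<open>D - \<i> l x\<close> and
  \<open>D + \<i> l x\<close>. The two summands anticommute, so the norm of each is bounded by that of the sum, and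
  square summability of the sum suffices.\<close>

definition dirac_fibre :: "'h::chilbert_space unbounded_op \<Rightarrow> ('g \<Rightarrow> real) \<Rightarrow> (bool, ('g, 'h) ell2) ell2 unbounded_op" where
  "dirac_fibre D l = {(f, g). \<forall>x. (coord f True x, coord g False x + (\<i> * l x) *\<^sub>C coord f True x) \<in> D \<and>
                                (coord f False x, coord g True x - (\<i> * l x) *\<^sub>C coord f False x) \<in> D}"

text \<open>By symmetry \<open>cinner a b\<close> is real, so \<open>b\<close> and the imaginary
  multiple of \<open>a\<close> are orthogonal for the real inner product and Pythagoras
  applies.\<close>

lemma norm_add_imaginary_le:
  assumes D: "self_adjoint_op D" and ab: "(a, b) \<in> D"
  shows "\<bar>r\<bar> * norm a \<le> norm (b + (\<i> * complex_of_real r) *\<^sub>C a)"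
proof -
  have "cinner a b = cnj (cinner a b)"
    using self_adjoint_symmetric[OF D ab ab] cinner_commute by metis
  then have "Im (cinner a b) = 0" by (metis Reals_cnj_iff complex_is_Real_iff)
  then have orth: "inner b ((\<i> * complex_of_real r) *\<^sub>C a) = 0"
    by (simp add: inner_eq_Re_cinner cinner_scaleC_right cinner_commute[of b a])
  have "(norm (b + (\<i> * complex_of_real r) *\<^sub>C a))\<^sup>2 = (norm b)\<^sup>2 + (norm ((\<i> * complex_of_real r) *\<^sub>C a))\<^sup>2"
    using orth by (simp add: power2_norm_eq_inner inner_add_left inner_add_right inner_commute)
  also have "\<dots> \<ge> (\<bar>r\<bar> * norm a)\<^sup>2" by (simp add: norm_scaleC_hilbert norm_mult)
  finally show ?thesis by (rule power2_le_imp_le) simp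
qed

lemma ell2_pair_exists:
  fixes p :: "bool \<Rightarrow> 'g \<Rightarrow> 'h::chilbert_space" and f :: "(bool, ('g, 'h) ell2) ell2"
  assumes K: "K \<ge> 0" and \<sigma>: "inj \<sigma>" and \<tau>: "inj \<tau>" and p: "\<And>i x. norm (p i x) \<le> K * norm (coord f (\<tau> i) (\<sigma> x))"
  obtains q where "\<And>i x. coord q i x = p i x" "norm q \<le> K * norm f"
proof -
  have 1: "ell2_fun (Ell2 (p i)) = p i" "norm (Ell2 (p i)) \<le> K * norm (ell2_fun f (\<tau> i))" for i
    using ell2_dominated[OF \<sigma> K, of "p i" "ell2_fun f (\<tau> i)"] p by auto
  have 2: "ell2_fun (Ell2 (\<lambda>i. Ell2 (p i))) = (\<lambda>i. Ell2 (p i))" "norm (Ell2 (\<lambda>i. Ell2 (p i))) \<le> K * norm f"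
    using ell2_dominated[OF \<tau> K, of "\<lambda>i. Ell2 (p i)" f] 1(2) by auto
  show thesis by (rule that[of "Ell2 (\<lambda>i. Ell2 (p i))"]) (simp_all add: 1 2)
qed

lemma bool_forall: "(\<forall>i. P i) \<longleftrightarrow> P False \<and> P True"
  by (metis (full_types))

lemma dirac_hat_eq:
  fixes D :: "'h::chilbert_space unbounded_op" and l :: "'g \<Rightarrow> real"
  assumes D: "self_adjoint_op D"
  shows "dirac_hat D l = dirac_fibre D l"
proof -
  note sub = self_adjoint_csubspace[OF D] and cl = self_adjoint_closed[OF D]
  have L: "csubspace (S \<otimes>\<^sub>u T)" "closed (S \<otimes>\<^sub>u T)" for S :: "'h unbounded_op" and T :: "('g, complex) ell2 unbounded_op"
    unfolding tensor_op_def
    by (rule csubspace_closure_cspan[OF bounded_linear_scaleC_prod[OF bounded_linear_scaleC bounded_linear_scaleC]]) simp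
  have 1: "(D \<otimes>\<^sub>u Id) \<otimes>\<^sub>u bop_graph pauli1
      = {(f, y). \<forall>x::'g. (coord f True x, coord y False x) \<in> D \<and> (coord f False x, coord y True x) \<in> D}"
    by (subst tensor_op_swap[OF L, where c = "\<lambda>_. 1"]) (auto simp: pauli1_fun tensor_op_Id[OF sub cl] bool_forall)
  have 2: "(Id \<otimes>\<^sub>u mult_op l) \<otimes>\<^sub>u bop_graph pauli2
      = {(f :: (bool, ('g, 'h) ell2) ell2, z). \<forall>x. coord z False x = - (\<i> * l x) *\<^sub>C coord f True x \<and> coord z True x = (\<i> * l x) *\<^sub>C coord f False x}"
  proof -
    have *: "c *\<^sub>C a = b \<longleftrightarrow> a = cnj c *\<^sub>C b" if "cnj c * c = 1" for a b :: 'h and c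
      using that by (metis mult.commute scaleC_one scaleC_scaleC)
    have i1: "\<i> *\<^sub>C a = complex_of_real r *\<^sub>C b \<longleftrightarrow> a = - ((\<i> * r) *\<^sub>C b)" for a b :: 'h and r
      using *[of \<i> a "complex_of_real r *\<^sub>C b"] by (simp add: scaleC_scaleC)
    have i2: "- (\<i> *\<^sub>C a) = complex_of_real r *\<^sub>C b \<longleftrightarrow> a = (\<i> * r) *\<^sub>C b" for a b :: 'h and r
      using *[of "- \<i>" a "complex_of_real r *\<^sub>C b"] by (simp add: scaleC_scaleC)
    show ?thesis
      by (subst tensor_op_swap[OF L, where c = "\<lambda>i. if i then \<i> else - \<i>"])
         (auto simp: pauli2_fun tensor_Id_mult_op bool_forall i1 i2)
  qed
  show ?thesis
  proof
    show "dirac_hat D l \<subseteq> dirac_fibre D l"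
      unfolding dirac_hat_def sum_op_def 1 2 dirac_fibre_def
      by (auto simp: complex_vector.scale_minus_left)
    show "dirac_fibre D l \<subseteq> dirac_hat D l"
    proof (rule subrelI)
      fix f g assume fg: "(f, g) \<in> dirac_fibre D l"
      \<comment> \<open>The image of \<open>f\<close> under the second summand, whose square
        summability is not given. It is dominated by \<open>g\<close> through
        \<open>norm_add_imaginary_le\<close>, so \<open>f\<close> lies in the domain of each summand
        separately.\<close>
      define p where "p i x = (if i then (\<i> * l x) *\<^sub>C coord f False x else - (\<i> * l x) *\<^sub>C coord f True x)" for i x
      have "norm (p i x) \<le> 1 * norm (coord g i x)" for i x
      proof (cases i)
        case True
        have "(coord f False x, coord g True x - (\<i> * l x) *\<^sub>C coord f False x) \<in> D" using fg by (auto simp: dirac_fibre_def)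
        from norm_add_imaginary_le[OF D this, of "l x"] show ?thesis
          using True by (simp add: p_def norm_scaleC_hilbert norm_mult)
      next
        case False
        have "(coord f True x, coord g False x + (\<i> * l x) *\<^sub>C coord f True x) \<in> D" using fg by (auto simp: dirac_fibre_def)
        from norm_add_imaginary_le[OF D this, of "- l x"] show ?thesis
          using False by (simp add: p_def norm_scaleC_hilbert norm_mult complex_vector.scale_minus_left)
      qed
      then obtain z where z: "\<And>i x. coord z i x = p i x"
        by (rule ell2_pair_exists[of 1 "\<lambda>x. x" "\<lambda>i. i" p g, rotated 3]) auto
      have "(f, g - z) \<in> (D \<otimes>\<^sub>u Id) \<otimes>\<^sub>u bop_graph pauli1"
        unfolding 1 using fg by (auto simp: dirac_fibre_def z p_def complex_vector.scale_minus_left)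
      moreover have "(f, z) \<in> (Id \<otimes>\<^sub>u mult_op l) \<otimes>\<^sub>u bop_graph pauli2"
        unfolding 2 by (auto simp: z p_def)
      ultimately have "(f, (g - z) + z) \<in> dirac_hat D l"
        unfolding dirac_hat_def sum_op_def by blast
      then show "(f, g) \<in> dirac_hat D l" by simp
    qed
  qed
qed

lemma dirac_fibre_fibre:
  assumes "csubspace D" "(f, g) \<in> dirac_fibre D l"
  shows "(fibre x f, fibre x g) \<in> dirac_fibre D l"
  using assms(2) graph_intros(1)[OF assms(1)] by (auto simp: dirac_fibre_def)

text \<open>The graph contains every pair that satisfies the fibrewise relation, so for a pair in
  the adjoint only that relation has to be verified. Test vectors supported in one fibre and one
  component deliver it from self-adjointness of \<open>D\<close>.\<close>

lemma self_adjoint_dirac_fibre: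
  assumes D: "self_adjoint_op D"
  shows "self_adjoint_op (dirac_fibre D l)"
  unfolding self_adjoint_op_def
proof (intro conjI)
  note sub = self_adjoint_csubspace[OF D]
  note gi = graph_intros[OF sub]
  have mem: "(coord f True x, coord g False x + (\<i> * l x) *\<^sub>C coord f True x) \<in> D"
    "(coord f False x, coord g True x - (\<i> * l x) *\<^sub>C coord f False x) \<in> D"
    if "(f, g) \<in> dirac_fibre D l" for f g x
    using that by (auto simp: dirac_fibre_def)
  show csub: "csubspace (dirac_fibre D l)"
  proof (rule csubspace_graphI)
    show "(0, 0) \<in> dirac_fibre D l" by (simp add: dirac_fibre_def gi(1))
    fix f g f' g' assume a: "(f, g) \<in> dirac_fibre D l" "(f', g') \<in> dirac_fibre D l"
    have "(coord (f + f') True x, coord (g + g') False x + (\<i> * l x) *\<^sub>C coord (f + f') True x) \<in> D"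
      "(coord (f + f') False x, coord (g + g') True x - (\<i> * l x) *\<^sub>C coord (f + f') False x) \<in> D" for x
      using gi(2)[OF mem(1)[OF a(1), of x] mem(1)[OF a(2), of x]] gi(2)[OF mem(2)[OF a(1), of x] mem(2)[OF a(2), of x]]
      by (simp_all add: scaleC_add_right algebra_simps)
    then show "(f + f', g + g') \<in> dirac_fibre D l" unfolding dirac_fibre_def by blast
  next
    fix c f g assume a: "(f, g) \<in> dirac_fibre D l"
    have "(coord (c *\<^sub>C f) True x, coord (c *\<^sub>C g) False x + (\<i> * l x) *\<^sub>C coord (c *\<^sub>C f) True x) \<in> D"
      "(coord (c *\<^sub>C f) False x, coord (c *\<^sub>C g) True x - (\<i> * l x) *\<^sub>C coord (c *\<^sub>C f) False x) \<in> D" for x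
      using gi(3)[OF mem(1)[OF a, of x], of c] gi(3)[OF mem(2)[OF a, of x], of c]
      by (simp_all add: scaleC_add_right complex_vector.scale_right_diff_distrib scaleC_scaleC mult.commute)
    then show "(c *\<^sub>C f, c *\<^sub>C g) \<in> dirac_fibre D l" unfolding dirac_fibre_def by blast
  qed
  show "single_valued (dirac_fibre D l)"
  proof (rule single_valuedI)
    fix f g g' assume a: "(f, g) \<in> dirac_fibre D l" "(f, g') \<in> dirac_fibre D l"
    have "coord g i x = coord g' i x" for i x
      using self_adjoint_single_valued[OF D mem(1)[OF a(1)] mem(1)[OF a(2)]]
        self_adjoint_single_valued[OF D mem(2)[OF a(1)] mem(2)[OF a(2)]] by (cases i) auto
    then show "g = g'" by (intro ell2_eqI)
  qed
  \<comment> \<open>These test vectors give both density of the domain and the bound on the adjoint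
    graph from above.\<close>
  have single: "((a \<otimes>\<^sub>v ket x) \<otimes>\<^sub>v ket i, ((if i then d - (\<i> * l x) *\<^sub>C a else d + (\<i> * l x) *\<^sub>C a) \<otimes>\<^sub>v ket x) \<otimes>\<^sub>v ket (\<not> i)) \<in> dirac_fibre D l"
    if "(a, d) \<in> D" for a d x i
    using that gi(1) by (cases i) (auto simp: dirac_fibre_def)
  show "closure (Domain (dirac_fibre D l)) = UNIV"
  proof -
    let ?N = "closure (Domain (dirac_fibre D l))"
    have "csubspace (Domain (dirac_fibre D l))"
      by (rule csubspaceI) (use graph_intros(1-3)[OF csub] in \<open>blast+\<close>)
    then have N: "csubspace ?N" "closed ?N" by (auto intro: csubspace_closure[OF bounded_linear_scaleC])
    have s: "(a \<otimes>\<^sub>v ket x) \<otimes>\<^sub>v ket i \<in> ?N" for a x i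
    proof -
      have "closure (Domain D) \<subseteq> (\<lambda>a. (a \<otimes>\<^sub>v ket x) \<otimes>\<^sub>v ket i) -` ?N"
      proof (rule closure_minimal)
        show "Domain D \<subseteq> (\<lambda>a. (a \<otimes>\<^sub>v ket x) \<otimes>\<^sub>v ket i) -` ?N"
        proof (rule subsetI, elim DomainE, rule vimageI2)
          fix a d assume "(a, d) \<in> D"
          show "(a \<otimes>\<^sub>v ket x) \<otimes>\<^sub>v ket i \<in> ?N"
            by (rule closure_subset[THEN subsetD], rule DomainI, rule single, fact)
        qed
        show "closed ((\<lambda>a. (a \<otimes>\<^sub>v ket x) \<otimes>\<^sub>v ket i) -` ?N)"
          by (intro closed_vimage N linear_continuous_on bounded_linear_compose[OF bounded_linear_tensor_left bounded_linear_tensor_left])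
      qed
      then show ?thesis using self_adjoint_dense[OF D] by blast
    qed
    have t: "v \<otimes>\<^sub>v ket i \<in> ?N" for v i
      by (rule has_sum_in_closed[OF N(2) _ has_sum_bounded_linear[OF bounded_linear_tensor_left ell2_has_sum[of v]]])
         (intro csubspace_intros(5)[OF N(1)] s)
    have "f \<in> ?N" for f
      by (rule has_sum_in_closed[OF N(2) _ ell2_has_sum[of f]]) (intro csubspace_intros(5)[OF N(1)] t)
    then show ?thesis by blast
  qed
  show "adjoint_op (dirac_fibre D l) = dirac_fibre D l"
  proof
    show "dirac_fibre D l \<subseteq> adjoint_op (dirac_fibre D l)"
      unfolding adjoint_op_def
    proof clarify
      fix y z f g assume a: "(y, z) \<in> dirac_fibre D l" "(f, g) \<in> dirac_fibre D l"
      have "cinner (coord y False x) (coord g False x) = cinner (coord z True x) (coord f True x)"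
        "cinner (coord y True x) (coord g True x) = cinner (coord z False x) (coord f False x)" for x
        using self_adjoint_symmetric[OF D mem(2)[OF a(1), of x] mem(1)[OF a(2), of x]]
          self_adjoint_symmetric[OF D mem(1)[OF a(1), of x] mem(2)[OF a(2), of x]]
        by (simp_all add: cinner_add_right cinner_add_left cinner_diff_left cinner_diff_right
            cinner_scaleC_left cinner_scaleC_right)
      then have "cinner (ell2_fun y False) (ell2_fun g False) = cinner (ell2_fun z True) (ell2_fun f True)"
        "cinner (ell2_fun y True) (ell2_fun g True) = cinner (ell2_fun z False) (ell2_fun f False)"
        by (simp_all add: cinner_ell2_fun)
      then show "cinner y g = cinner z f"
        by (simp add: cinner_ell2_fun[of y g] cinner_ell2_fun[of z f] UNIV_bool)
    qed
    show "adjoint_op (dirac_fibre D l) \<subseteq> dirac_fibre D l"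
    proof (rule subrelI)
      fix y z assume "(y, z) \<in> adjoint_op (dirac_fibre D l)"
      then have adj: "cinner y g = cinner z f" if "(f, g) \<in> dirac_fibre D l" for f g
        using that by (auto simp: adjoint_op_def)
      \<comment> \<open>Pairing with a test vector isolates one coordinate on each side.\<close>
      have key: "cinner (coord y (\<not> i) x) (if i then d - (\<i> * l x) *\<^sub>C a else d + (\<i> * l x) *\<^sub>C a) = cinner (coord z i x) a"
        if "(a, d) \<in> D" for a d i x
        using adj[OF single[OF that, of x i]] by (simp only: cinner_tensor_ket)
      have "(coord y False x, coord z True x - (\<i> * l x) *\<^sub>C coord y False x) \<in> D" for x
      proof (rule self_adjoint_mem[OF D])
        fix a d assume "(a, d) \<in> D"
        from key[OF this, of True x]
        show "cinner (coord y False x) d = cinner (coord z True x - (\<i> * l x) *\<^sub>C coord y False x) a"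
          by (simp add: cinner_diff_left cinner_diff_right cinner_scaleC_left cinner_scaleC_right algebra_simps)
      qed
      moreover have "(coord y True x, coord z False x + (\<i> * l x) *\<^sub>C coord y True x) \<in> D" for x
      proof (rule self_adjoint_mem[OF D])
        fix a d assume "(a, d) \<in> D"
        from key[OF this, of False x]
        show "cinner (coord y True x) d = cinner (coord z False x + (\<i> * l x) *\<^sub>C coord y True x) a"
          by (simp add: cinner_add_left cinner_add_right cinner_scaleC_left cinner_scaleC_right algebra_simps)
      qed
      ultimately show "(y, z) \<in> dirac_fibre D l" by (simp add: dirac_fibre_def)
    qed
  qed
qed

subsection \<open>Positive operators\<close>

lemma star_eqI:
  fixes R :: "'h::chilbert_space bop"
  assumes "\<And>x y. cinner (R \<cdot> x) y = cinner x (R \<cdot> y)"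
  shows "star R = R"
  by (rule bop_eqI_cinner) (simp add: cinner_star assms)

text \<open>Apply the binomial series to \<open>1 - R\<close> and take \<open>S = 1 - y\<close>;
  positivity of \<open>S\<close> is the bound \<open>norm y \<le> 1\<close>.\<close>

lemma positive_sqrt:
  fixes R :: "'h::chilbert_space bop"
  assumes R: "star R = R" "norm (1 - R) \<le> 1"
  shows "\<exists>S. positive_bop S \<and> star S = S \<and> S * S = R"
proof -
  have h: "star (1 - R) = 1 - R" by (simp add: star_diff R(1))
  obtain y where y: "y * y = 2 *\<^sub>R y - (1 - R)" "star y = y" "norm y \<le> 1"
    by (rule one_minus_sqrt_exists[OF h R(2)]) (rule that)
  define S where "S = 1 - y"
  have "S * S = R" by (simp add: S_def algebra_simps y(1)) (simp add: scaleR_2)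
  moreover have sS: "star S = S" by (simp add: S_def star_diff y(2))
  moreover have "positive_bop S"
    unfolding positive_bop_def
  proof
    fix x
    have "cnj (cinner x (S \<cdot> x)) = cinner x (S \<cdot> x)"
      by (metis cinner_commute cinner_star sS)
    moreover have "Re (cinner x (S \<cdot> x)) \<ge> 0"
    proof -
      have "cmod (cinner x (y \<cdot> x)) \<le> norm x * norm (y \<cdot> x)" by (rule cinner_cauchy_schwarz)
      also have "\<dots> \<le> norm x * (1 * norm x)"
        by (intro mult_left_mono order_trans[OF norm_bop_le mult_right_mono[OF y(3)]]) auto
      finally have "Re (cinner x (y \<cdot> x)) \<le> norm x * norm x" using complex_Re_le_cmod order_trans by fastforce
      then show ?thesis by (simp add: S_def cinner_diff_right bop_simps cinner_self power2_eq_square)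
    qed
    ultimately show "cinner x (S \<cdot> x) \<in> \<real>\<^sub>\<ge>\<^sub>0"
      by (auto simp: complex_nonneg_Reals_iff complex_eq_iff)
  qed
  ultimately show ?thesis by blast
qed

subsection \<open>Compact operators\<close>

text \<open>Total boundedness of the image of the unit ball, with centres of the nets anywhere in
  the target. It is stated for bare functions because coordinate maps between different spaces are
  composed below.\<close>

definition precompact_map :: "('v::real_normed_vector \<Rightarrow> 'w::real_normed_vector) \<Rightarrow> bool" where
  "precompact_map f \<longleftrightarrow> (\<forall>e>0. \<exists>k. finite k \<and> (\<forall>x. norm x \<le> 1 \<longrightarrow> (\<exists>y\<in>k. norm (f x - y) < e)))"

lemma precompact_mapD:
  "precompact_map f \<Longrightarrow> e > 0 \<Longrightarrow> \<exists>k. finite k \<and> (\<forall>x. norm x \<le> 1 \<longrightarrow> (\<exists>y\<in>k. norm (f x - y) < e))"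
  unfolding precompact_map_def by blast

lemma compact_bop_iff: "compact_bop S \<longleftrightarrow> precompact_map (blinfun_apply (bop_blinfun S))"
proof
  let ?I = "(\<lambda>x. S \<cdot> x) ` cball 0 1"
  assume "compact_bop S"
  then have c: "\<forall>e>0. \<exists>k. finite k \<and> closure ?I \<subseteq> (\<Union>y\<in>k. ball y e)"
    unfolding compact_bop_def compact_eq_totally_bounded by blast
  show "precompact_map (blinfun_apply (bop_blinfun S))"
    unfolding precompact_map_def
  proof (intro allI impI)
    fix e :: real assume "e > 0"
    then obtain k where k: "finite k" "closure ?I \<subseteq> (\<Union>y\<in>k. ball y e)" using c by blast
    have "\<exists>y\<in>k. norm (S \<cdot> x - y) < e" if "norm x \<le> 1" for x
    proof -
      have "S \<cdot> x \<in> closure ?I" using that by (intro closure_subset[THEN subsetD] imageI) simp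
      then obtain y where "y \<in> k" "S \<cdot> x \<in> ball y e" using k(2) by blast
      then show ?thesis by (auto simp: dist_norm norm_minus_commute)
    qed
    then show "\<exists>k. finite k \<and> (\<forall>x. norm x \<le> 1 \<longrightarrow> (\<exists>y\<in>k. norm (S \<cdot> x - y) < e))" using k(1) by blast
  qed
next
  let ?I = "(\<lambda>x. S \<cdot> x) ` cball 0 1"
  assume pc: "precompact_map (blinfun_apply (bop_blinfun S))"
  have "\<exists>k. finite k \<and> closure ?I \<subseteq> (\<Union>y\<in>k. ball y e)" if e: "e > 0" for e
  proof -
    obtain k where k: "finite k" "\<And>x. norm x \<le> 1 \<Longrightarrow> \<exists>y\<in>k. norm (S \<cdot> x - y) < e / 2"
      using precompact_mapD[OF pc half_gt_zero[OF e]] by blast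
    have "?I \<subseteq> (\<Union>y\<in>k. cball y (e / 2))"
      using k(2) by (force simp: dist_norm norm_minus_commute)
    then have "closure ?I \<subseteq> (\<Union>y\<in>k. cball y (e / 2))"
      by (intro closure_minimal closed_UN k) auto
    also have "\<dots> \<subseteq> (\<Union>y\<in>k. ball y e)" using that by (intro UN_mono) auto
    finally show ?thesis using k(1) by blast
  qed
  moreover have "complete (closure ?I)" by (simp add: complete_eq_closed)
  ultimately show "compact_bop S" unfolding compact_bop_def compact_eq_totally_bounded by blast
qed

lemma precompact_map_left:
  assumes f: "precompact_map f" and h: "bounded_linear h"
  shows "precompact_map (\<lambda>x. h (f x))"
  unfolding precompact_map_def
proof (intro allI impI)
  fix e :: real assume e: "e > 0"
  interpret h: bounded_linear h by fact
  obtain K where K: "K > 0" "\<And>x. norm (h x) \<le> norm x * K" using h.pos_bounded by blast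
  obtain k where k: "finite k" "\<And>x. norm x \<le> 1 \<Longrightarrow> \<exists>y\<in>k. norm (f x - y) < e / K"
    using precompact_mapD[OF f divide_pos_pos[OF e K(1)]] by blast
  have "\<exists>y\<in>h ` k. norm (h (f x) - y) < e" if x: "norm x \<le> 1" for x
  proof -
    obtain y where y: "y \<in> k" "norm (f x - y) < e / K" using k(2)[OF x] by blast
    have "norm (h (f x) - h y) \<le> norm (f x - y) * K" using K(2)[of "f x - y"] by (simp add: h.diff)
    also have "\<dots> < e" using y(2) K(1) by (simp add: field_simps)
    finally show ?thesis using y(1) by blast
  qed
  then show "\<exists>k. finite k \<and> (\<forall>x. norm x \<le> 1 \<longrightarrow> (\<exists>y\<in>k. norm (h (f x) - y) < e))"
    using k(1) by (intro exI[of _ "h ` k"]) auto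
qed

lemma precompact_map_right:
  assumes f: "precompact_map f" and lin: "\<And>r x. f (r *\<^sub>R x) = r *\<^sub>R f x" and g: "\<And>x. norm (g x) \<le> K * norm x"
  shows "precompact_map (\<lambda>x. f (g x))"
  unfolding precompact_map_def
proof (intro allI impI)
  fix e :: real assume e: "e > 0"
  define C where "C = max K 1"
  have C: "C > 0" by (simp add: C_def)
  have gC: "norm (g x) \<le> C" if "norm x \<le> 1" for x
  proof -
    have "K * norm x \<le> C * norm x" by (intro mult_right_mono) (auto simp: C_def)
    also have "\<dots> \<le> C" using that C by (simp add: mult_left_le)
    finally show ?thesis using g[of x] by linarith
  qed
  obtain k where k: "finite k" "\<And>x. norm x \<le> 1 \<Longrightarrow> \<exists>y\<in>k. norm (f x - y) < e / C"
    using precompact_mapD[OF f divide_pos_pos[OF e C]] by blast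
  have "\<exists>y\<in>(\<lambda>y. C *\<^sub>R y) ` k. norm (f (g x) - y) < e" if x: "norm x \<le> 1" for x
  proof -
    have "norm ((1 / C) *\<^sub>R g x) \<le> 1" using gC[OF x] C by (simp add: field_simps)
    then obtain y where y: "y \<in> k" "norm (f ((1 / C) *\<^sub>R g x) - y) < e / C" using k(2) by blast
    have "f (g x) - C *\<^sub>R y = C *\<^sub>R (f ((1 / C) *\<^sub>R g x) - y)" using C by (simp add: lin scaleR_diff_right)
    then have "norm (f (g x) - C *\<^sub>R y) = C * norm (f ((1 / C) *\<^sub>R g x) - y)" using C by simp
    also have "\<dots> < e" using y(2) C by (simp add: field_simps)
    finally show ?thesis using y(1) by blast
  qed
  then show "\<exists>k. finite k \<and> (\<forall>x. norm x \<le> 1 \<longrightarrow> (\<exists>y\<in>k. norm (f (g x) - y) < e))"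
    using k(1) by (intro exI[of _ "(\<lambda>y. C *\<^sub>R y) ` k"]) auto
qed

lemma precompact_map_add:
  assumes "precompact_map f" "precompact_map g"
  shows "precompact_map (\<lambda>x. f x + g x)"
  unfolding precompact_map_def
proof (intro allI impI)
  fix e :: real assume e: "e > 0"
  obtain k where k: "finite k" "\<And>x. norm x \<le> 1 \<Longrightarrow> \<exists>y\<in>k. norm (f x - y) < e / 2"
    using precompact_mapD[OF assms(1) half_gt_zero[OF e]] by blast
  obtain m where m: "finite m" "\<And>x. norm x \<le> 1 \<Longrightarrow> \<exists>y\<in>m. norm (g x - y) < e / 2"
    using precompact_mapD[OF assms(2) half_gt_zero[OF e]] by blast
  have "\<exists>y\<in>(\<lambda>(y, z). y + z) ` (k \<times> m). norm (f x + g x - y) < e" if x: "norm x \<le> 1" for x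
  proof -
    obtain y z where y: "y \<in> k" "norm (f x - y) < e / 2" and z: "z \<in> m" "norm (g x - z) < e / 2"
      using k(2)[OF x] m(2)[OF x] by blast
    have "norm (f x + g x - (y + z)) \<le> norm (f x - y) + norm (g x - z)"
      using norm_triangle_ineq[of "f x - y" "g x - z"] by (simp add: algebra_simps)
    then have "norm (f x + g x - (y + z)) < e" using y z by simp
    then show ?thesis using y(1) z(1) by force
  qed
  then show "\<exists>k. finite k \<and> (\<forall>x. norm x \<le> 1 \<longrightarrow> (\<exists>y\<in>k. norm (f x + g x - y) < e))"
    using k(1) m(1) by (intro exI[of _ "(\<lambda>(y, z). y + z) ` (k \<times> m)"]) auto
qed

lemma precompact_map_sum:
  assumes "finite F" "\<And>i. i \<in> F \<Longrightarrow> precompact_map (f i)"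
  shows "precompact_map (\<lambda>x. \<Sum>i\<in>F. f i x)"
  using assms
proof (induction F)
  case empty
  then show ?case by (auto simp: precompact_map_def intro!: exI[of _ "{0}"])
next
  case (insert i F)
  then show ?case by (simp add: precompact_map_add)
qed

lemma precompact_map_limit:
  assumes "\<And>e. e > 0 \<Longrightarrow> \<exists>g. precompact_map g \<and> (\<forall>x. norm x \<le> 1 \<longrightarrow> norm (f x - g x) \<le> e)"
  shows "precompact_map f"
  unfolding precompact_map_def
proof (intro allI impI)
  fix e :: real assume e: "e > 0"
  obtain g where g: "precompact_map g" "\<And>x. norm x \<le> 1 \<Longrightarrow> norm (f x - g x) \<le> e / 2"
    using assms[of "e / 2"] e by auto
  obtain k where k: "finite k" "\<And>x. norm x \<le> 1 \<Longrightarrow> \<exists>y\<in>k. norm (g x - y) < e / 2"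
    using precompact_mapD[OF g(1) half_gt_zero[OF e]] by blast
  have "\<exists>y\<in>k. norm (f x - y) < e" if x: "norm x \<le> 1" for x
  proof -
    obtain y where y: "y \<in> k" "norm (g x - y) < e / 2" using k(2)[OF x] by blast
    have "norm (f x - y) \<le> norm (f x - g x) + norm (g x - y)"
      using norm_triangle_ineq[of "f x - g x" "g x - y"] by simp
    then show ?thesis using g(2)[OF x] y by (intro bexI[of _ y]) auto
  qed
  then show "\<exists>k. finite k \<and> (\<forall>x. norm x \<le> 1 \<longrightarrow> (\<exists>y\<in>k. norm (f x - y) < e))" using k(1) by blast
qed

text \<open>Since \<open>\<parallel>S x\<parallel>\<^sup>2 = \<langle>x, S\<^sup>2 x\<rangle>\<close>, a net for \<open>S\<^sup>2\<close> yields one for \<open>S\<close>.\<close>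

lemma precompact_map_sqrt:
  fixes S :: "'h::chilbert_space bop"
  assumes S: "star S = S" and pc: "precompact_map (blinfun_apply (bop_blinfun (S * S)))"
  shows "precompact_map (blinfun_apply (bop_blinfun S))"
  unfolding precompact_map_def
proof (intro allI impI)
  fix e :: real assume e: "e > 0"
  \<comment> \<open>Differences of unit vectors have norm at most 2, so images under
    \<open>S * S\<close> closer than \<open>d\<close> give squared distance below
    \<open>2 * d = e\<^sup>2 / 2\<close> for \<open>S\<close>.\<close>
  define d where "d = e\<^sup>2 / 4"
  have d: "d > 0" using e by (simp add: d_def)
  obtain k where k: "finite k" "\<And>x. norm x \<le> 1 \<Longrightarrow> \<exists>y\<in>k. norm ((S * S) \<cdot> x - y) < d / 2"
    using precompact_mapD[OF pc half_gt_zero[OF d]] by blast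
  define c where "c y = (SOME x. norm x \<le> 1 \<and> norm ((S * S) \<cdot> x - y) < d / 2)" for y
  have "\<exists>y\<in>(\<lambda>y. S \<cdot> c y) ` k. norm (S \<cdot> x - y) < e" if x: "norm x \<le> 1" for x
  proof -
    obtain y where y: "y \<in> k" "norm ((S * S) \<cdot> x - y) < d / 2" using k(2)[OF x] by blast
    have cy: "norm (c y) \<le> 1" "norm ((S * S) \<cdot> c y - y) < d / 2"
      using someI[of "\<lambda>x. norm x \<le> 1 \<and> norm ((S * S) \<cdot> x - y) < d / 2" x] x y(2) by (auto simp: c_def)
    let ?z = "x - c y"
    have z: "norm ?z \<le> 2" using norm_triangle_ineq4[of x "c y"] x cy(1) by simp
    have "norm ((S * S) \<cdot> ?z) \<le> norm ((S * S) \<cdot> x - y) + norm ((S * S) \<cdot> c y - y)"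
      using norm_triangle_ineq4[of "(S * S) \<cdot> x - y" "(S * S) \<cdot> c y - y"] by (simp add: blinfun.diff_right)
    then have nz: "norm ((S * S) \<cdot> ?z) < d" using y(2) cy(2) by simp
    have "(norm (S \<cdot> ?z))\<^sup>2 = inner ?z ((S * S) \<cdot> ?z)"
      using cinner_star'[of ?z S "S \<cdot> ?z"] S by (simp add: power2_norm_eq_inner inner_eq_Re_cinner bop_simps)
    also have "\<dots> \<le> norm ?z * norm ((S * S) \<cdot> ?z)" by (rule norm_cauchy_schwarz)
    also have "\<dots> \<le> 2 * norm ((S * S) \<cdot> ?z)" using z by (intro mult_right_mono) auto
    also have "\<dots> < e\<^sup>2" using nz zero_less_power[OF e, of 2] unfolding d_def by linarith
    finally have "norm (S \<cdot> ?z) < e" using e by (simp add: power_less_imp_less_base)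
    then show ?thesis using y(1) by (auto simp: blinfun.diff_right)
  qed
  then show "\<exists>k. finite k \<and> (\<forall>x. norm x \<le> 1 \<longrightarrow> (\<exists>y\<in>k. norm (S \<cdot> x - y) < e))"
    using k(1) by (intro exI[of _ "(\<lambda>y. S \<cdot> c y) ` k"]) auto
qed

subsection \<open>Resolvents\<close>

text \<open>In terms of graphs, \<open>R\<close> is a right inverse of \<open>c + D\<^sup>2\<close>.\<close>

definition is_resolvent :: "'h::chilbert_space unbounded_op \<Rightarrow> real \<Rightarrow> 'h bop \<Rightarrow> bool" where
  "is_resolvent D c R \<longleftrightarrow> (\<forall>z. \<exists>d. (R \<cdot> z, d) \<in> D \<and> (d, z - c *\<^sub>R (R \<cdot> z)) \<in> D)"

text \<open>Here \<open>d\<close> stands for \<open>D r\<close> and \<open>z\<close> for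
  \<open>(c + D\<^sup>2) r\<close>. Pairing \<open>z\<close> with \<open>r\<close> and using
  symmetry gives the identity; the two bounds follow by Cauchy-Schwarz.\<close>

lemma resolvent_estimates:
  assumes D: "self_adjoint_op D" and rd: "(r, d) \<in> D" "(d, z - c *\<^sub>R r) \<in> D" and c: "c \<ge> 1"
  shows "inner r z = c * (norm r)\<^sup>2 + (norm d)\<^sup>2" "norm r \<le> norm z / c" "norm d \<le> norm z"
proof -
  have "cinner d d = cinner r (z - c *\<^sub>R r)" using self_adjoint_symmetric[OF D rd] by simp
  then have "inner d d = inner r z - c * inner r r"
    by (simp add: inner_eq_Re_cinner cinner_diff_right cinner_scaleR_right)
  then show 1: "inner r z = c * (norm r)\<^sup>2 + (norm d)\<^sup>2" by (simp add: power2_norm_eq_inner)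
  have 2: "inner r z \<le> norm r * norm z" by (rule norm_cauchy_schwarz)
  have "c * (norm r)\<^sup>2 \<le> norm r * norm z"
    using 1 2 zero_le_power2[of "norm d"] by linarith
  then have "norm r * (c * norm r) \<le> norm r * norm z" by (simp add: power2_eq_square mult_ac)
  then have 3: "c * norm r \<le> norm z" by (cases "norm r = 0") auto
  then show "norm r \<le> norm z / c" using c by (simp add: field_simps)
  have "norm r \<le> norm z" using 3 c mult_right_mono[OF c norm_ge_zero[of r]] by linarith
  then have "norm r * norm z \<le> norm z * norm z" by (intro mult_right_mono) auto
  moreover have "c * (norm r)\<^sup>2 \<ge> 0" using c by simp
  ultimately have "(norm d)\<^sup>2 \<le> norm z * norm z" using 1 2 by linarith
  then have "(norm d)\<^sup>2 \<le> (norm z)\<^sup>2" by (simp add: power2_eq_square)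
  then show "norm d \<le> norm z" by (simp add: power2_le_iff_abs_le)
qed

lemma resolvent_norm_le:
  assumes "self_adjoint_op D" "is_resolvent D c R" "c \<ge> 1"
  shows "norm (R \<cdot> z) \<le> norm z / c"
  using assms resolvent_estimates(2)[OF assms(1) _ _ assms(3)] unfolding is_resolvent_def by metis

text \<open>The squared norm of \<open>z - R \<cdot> z\<close> equals \<open>(norm z)\<^sup>2 -
  (norm (R \<cdot> z))\<^sup>2 - 2 * (norm d)\<^sup>2\<close> with \<open>d\<close> the image of
  \<open>R \<cdot> z\<close>. These are the hypotheses of \<open>positive_sqrt\<close>.\<close>

lemma resolvent_positive:
  assumes D: "self_adjoint_op D" and R: "is_resolvent D 1 R"
  shows "star R = R" "norm (1 - R) \<le> 1"
proof -
  have R': "\<exists>d. (R \<cdot> z, d) \<in> D \<and> (d, z - R \<cdot> z) \<in> D" for z using R by (simp add: is_resolvent_def)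
  show "star R = R"
  proof (rule star_eqI)
    fix x y
    obtain d e where d: "(R \<cdot> x, d) \<in> D" "(d, x - R \<cdot> x) \<in> D" and e: "(R \<cdot> y, e) \<in> D" "(e, y - R \<cdot> y) \<in> D"
      using R' by blast
    have "cinner (R \<cdot> x) (y - R \<cdot> y) = cinner d e" by (rule self_adjoint_symmetric[OF D d(1) e(2)])
    moreover have "cinner d e = cinner (x - R \<cdot> x) (R \<cdot> y)" by (rule self_adjoint_symmetric[OF D d(2) e(1)])
    ultimately show "cinner (R \<cdot> x) y = cinner x (R \<cdot> y)" by (simp add: cinner_diff_left cinner_diff_right)
  qed
  show "norm (1 - R) \<le> 1"
  proof (rule norm_bop_bound)
    fix z
    obtain d where d: "(R \<cdot> z, d) \<in> D" "(d, z - 1 *\<^sub>R (R \<cdot> z)) \<in> D" using R' by auto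
    have "inner (R \<cdot> z) z = (norm (R \<cdot> z))\<^sup>2 + (norm d)\<^sup>2" using resolvent_estimates(1)[OF D d] by simp
    moreover have "(norm (z - R \<cdot> z))\<^sup>2 = (norm z)\<^sup>2 - 2 * inner (R \<cdot> z) z + (norm (R \<cdot> z))\<^sup>2"
      by (simp add: power2_norm_eq_inner inner_diff_left inner_diff_right inner_commute)
    ultimately have "(norm (z - R \<cdot> z))\<^sup>2 \<le> (norm z)\<^sup>2"
      using zero_le_power2[of "norm d"] zero_le_power2[of "norm (R \<cdot> z)"] by linarith
    then show "norm ((1 - R) \<cdot> z) \<le> 1 * norm z" by (simp add: bop_simps power2_le_iff_abs_le)
  qed simp
qed

text \<open>A right inverse of \<open>1 + D\<^sup>2\<close> is two-sided: the difference of two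
  solutions solves the equation with right hand side 0, and \<open>resolvent_estimates\<close> makes
  it vanish.\<close>

lemma resolvent_graph:
  assumes D: "self_adjoint_op D" and R: "is_resolvent D 1 R"
  shows "bop_graph R = (sum_op Id (D O D))\<inverse>"
proof (intro set_eqI iffI; clarify)
  note gi = graph_intros[OF self_adjoint_csubspace[OF D]]
  have R': "\<exists>d. (R \<cdot> z, d) \<in> D \<and> (d, z - R \<cdot> z) \<in> D" for z using R by (simp add: is_resolvent_def)
  {
    fix z w assume "(z, w) \<in> bop_graph R"
    then have w: "w = R \<cdot> z" by (auto simp: bop_graph_def)
    obtain d where "(R \<cdot> z, d) \<in> D" "(d, z - R \<cdot> z) \<in> D" using R' by blast
    then have "(R \<cdot> z, R \<cdot> z + (z - R \<cdot> z)) \<in> sum_op Id (D O D)" unfolding sum_op_def by blast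
    then show "(w, z) \<in> sum_op Id (D O D)" by (simp add: w)
  }
  fix z0 w assume "(w, z0) \<in> sum_op Id (D O D)"
  then obtain z d where z: "z0 = w + z" "(w, d) \<in> D" "(d, z) \<in> D" by (auto simp: sum_op_def)
  obtain e where e: "(R \<cdot> z0, e) \<in> D" "(e, z0 - R \<cdot> z0) \<in> D" using R' by blast
  have "(w - R \<cdot> z0, d - e) \<in> D" "(d - e, 0 - 1 *\<^sub>R (w - R \<cdot> z0)) \<in> D"
    using gi(4)[OF z(2) e(1)] gi(4)[OF z(3) e(2)] by (simp_all add: z(1) algebra_simps)
  from resolvent_estimates(2)[OF D this] have "w = R \<cdot> z0" by simp
  then show "(z0, w) \<in> bop_graph R" by (auto simp: bop_graph_def)
qed

lemma inv_sqrt_exists: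
  assumes D: "self_adjoint_op D" and R: "is_resolvent D 1 R" and pc: "precompact_map (blinfun_apply (bop_blinfun R))"
  shows "\<exists>S. is_inv_sqrt_one_plus_square D S \<and> compact_bop S"
proof -
  obtain S where S: "positive_bop S" "star S = S" "S * S = R" using positive_sqrt[OF resolvent_positive[OF D R]] by blast
  then show ?thesis
    using precompact_map_sqrt[of S] pc resolvent_graph[OF D R]
    by (auto simp: is_inv_sqrt_one_plus_square_def compact_bop_iff)
qed

text \<open>If \<open>T\<close> inverts \<open>1 + D\<^sup>2\<close>, then \<open>T\<close> times
  the inverse of \<open>1 + c T\<close> inverts \<open>1 + c + D\<^sup>2\<close>, and it inherits
  compactness from \<open>T\<close>.\<close>

lemma resolvent_shift:
  assumes D: "self_adjoint_op D" and S: "is_inv_sqrt_one_plus_square D S" "compact_bop S" and c: "c \<ge> 0"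
  shows "\<exists>R. is_resolvent D (1 + c) R \<and> precompact_map (blinfun_apply (bop_blinfun R))"
proof -
  define T where "T = S * S"
  have T: "is_resolvent D 1 T"
    unfolding is_resolvent_def
  proof
    fix z
    have "(z, T \<cdot> z) \<in> (sum_op Id (D O D))\<inverse>"
      using S(1) unfolding is_inv_sqrt_one_plus_square_def T_def by (auto simp: bop_graph_def)
    then have "(T \<cdot> z, z) \<in> sum_op Id (D O D)" by simp
    then obtain y where "z = T \<cdot> z + y" "(T \<cdot> z, y) \<in> D O D" unfolding sum_op_def by auto
    then show "\<exists>d. (T \<cdot> z, d) \<in> D \<and> (d, z - 1 *\<^sub>R (T \<cdot> z)) \<in> D"
      by (metis add_diff_cancel_left' relcompE scaleR_one Pair_inject)
  qed
  have n: "norm (1 - T) \<le> 1" by (rule resolvent_positive(2)[OF D T])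
  have pS: "precompact_map (blinfun_apply (bop_blinfun S))" using S(2) by (simp add: compact_bop_iff)
  have pT: "precompact_map (blinfun_apply (bop_blinfun T))"
  proof -
    have "blinfun_apply (bop_blinfun T) = (\<lambda>x. S \<cdot> S \<cdot> x)" by (rule ext) (simp add: T_def bop_simps)
    then show ?thesis using precompact_map_left[OF pS blinfun.bounded_linear_right[of "bop_blinfun S"]] by simp
  qed
  \<comment> \<open>Since \<open>1 + c T = (1 + c) (1 - q (1 - T))\<close> with \<open>q < 1\<close>
    and \<open>1 - T\<close> a contraction, the inverse is obtained from a contractive fixed point
    equation.\<close>
  define q where "q = c / (1 + c)"
  have q: "0 \<le> q" "q < 1" using c by (auto simp: q_def)
  obtain Q where Q: "Q = 1 + (q *\<^sub>R (1 - T)) * Q"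
  proof -
    have "\<exists>!x. 1 + (q *\<^sub>R (1 - T)) * x = x"
    proof (rule banach_fix_type[OF q])
      show "\<forall>x. \<forall>y. dist (1 + (q *\<^sub>R (1 - T)) * x) (1 + (q *\<^sub>R (1 - T)) * y) \<le> q * dist x y"
      proof (intro allI)
        fix x y
        have "dist (1 + (q *\<^sub>R (1 - T)) * x) (1 + (q *\<^sub>R (1 - T)) * y) = norm ((q *\<^sub>R (1 - T)) * (x - y))"
          by (simp add: dist_norm right_diff_distrib)
        also have "\<dots> \<le> norm (q *\<^sub>R (1 - T)) * norm (x - y)" by (rule norm_mult_ineq)
        also have "\<dots> \<le> (q * 1) * norm (x - y)"
          using q mult_left_mono[OF n q(1)] by (intro mult_right_mono) auto
        finally show "dist (1 + (q *\<^sub>R (1 - T)) * x) (1 + (q *\<^sub>R (1 - T)) * y) \<le> q * dist x y" by (simp add: dist_norm)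
      qed
    qed
    then show thesis using that by metis
  qed
  define P where "P = (1 / (1 + c)) *\<^sub>R Q"
  have P: "P + c *\<^sub>R (T * P) = 1"
  proof -
    have "(1 + c) *\<^sub>R Q = (1 + c) *\<^sub>R (1 + (q *\<^sub>R (1 - T)) * Q)" using Q by simp
    also have "\<dots> = (1 + c) *\<^sub>R 1 + c *\<^sub>R Q - c *\<^sub>R (T * Q)"
    proof -
      have "(1 + c) *\<^sub>R ((q *\<^sub>R (1 - T)) * Q) = ((1 + c) * q) *\<^sub>R (Q - T * Q)"
        by (simp add: left_diff_distrib)
      also have "(1 + c) * q = c" using c by (simp add: q_def)
      finally show ?thesis by (simp add: scaleR_add_right scaleR_diff_right)
    qed
    finally have "Q + c *\<^sub>R (T * Q) = (1 + c) *\<^sub>R 1" by (simp add: scaleR_add_left algebra_simps)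
    then have "(1 / (1 + c)) *\<^sub>R (Q + c *\<^sub>R (T * Q)) = 1" using c by simp
    then show ?thesis by (simp add: P_def scaleR_add_right mult.commute)
  qed
  have "is_resolvent D (1 + c) (T * P)"
    unfolding is_resolvent_def
  proof
    fix z
    have "(P + c *\<^sub>R (T * P)) \<cdot> z = z" by (simp add: P bop_simps)
    then have Pz: "P \<cdot> z + c *\<^sub>R (T \<cdot> P \<cdot> z) = z" by (simp add: bop_simps scaleR_bop.rep_eq blinfun.scaleR_left)
    obtain d where d: "(T \<cdot> P \<cdot> z, d) \<in> D" "(d, P \<cdot> z - 1 *\<^sub>R (T \<cdot> P \<cdot> z)) \<in> D"
      using T unfolding is_resolvent_def by blast
    have "P \<cdot> z - 1 *\<^sub>R (T \<cdot> P \<cdot> z) = z - (1 + c) *\<^sub>R (T \<cdot> P \<cdot> z)"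
      using Pz by (simp add: scaleR_add_left algebra_simps)
    then show "\<exists>d. ((T * P) \<cdot> z, d) \<in> D \<and> (d, z - (1 + c) *\<^sub>R ((T * P) \<cdot> z)) \<in> D"
      using d by (auto simp: bop_simps)
  qed
  moreover have "precompact_map (blinfun_apply (bop_blinfun (T * P)))"
  proof -
    have "blinfun_apply (bop_blinfun (T * P)) = (\<lambda>x. T \<cdot> P \<cdot> x)" by (rule ext) (simp add: bop_simps)
    then show ?thesis using precompact_map_right[OF pT _ norm_bop_le[of P]] by (simp add: blinfun.scaleR_right)
  qed
  ultimately show ?thesis by blast
qed

text \<open>The resolvent is diagonal over \<open>x\<close>, with the entry of \<open>D\<close> at
  \<open>1 + (l x)\<^sup>2\<close>, of norm at most the reciprocal of that number. Properness makes
  all but finitely many entries small, so the whole is a norm limit of finite sums of compact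
  operators.\<close>

lemma dirac_fibre_inv_sqrt:
  fixes D :: "'h::chilbert_space unbounded_op" and l :: "'g \<Rightarrow> real"
  assumes D: "self_adjoint_op D" and S: "is_inv_sqrt_one_plus_square D S" "compact_bop S" and l: "proper_weight l"
  shows "\<exists>S. is_inv_sqrt_one_plus_square (dirac_fibre D l) S \<and> compact_bop S"
proof -
  have "\<exists>R. is_resolvent D (1 + (l x)\<^sup>2) R \<and> precompact_map (blinfun_apply (bop_blinfun R))" for x
    by (rule resolvent_shift[OF D S]) simp
  then obtain r where r: "\<And>x. is_resolvent D (1 + (l x)\<^sup>2) (r x)"
    "\<And>x. precompact_map (blinfun_apply (bop_blinfun (r x)))" by metis
  have rn: "norm (r x \<cdot> z) \<le> norm z / (1 + (l x)\<^sup>2)" for x z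
    by (rule resolvent_norm_le[OF D r(1)]) simp
  have rn1: "norm (bop_blinfun (r x)) \<le> 1" for x
  proof (rule norm_blinfun_bound)
    fix z :: 'h
    have "norm z / (1 + (l x)\<^sup>2) \<le> norm z / 1" by (intro divide_left_mono) (auto simp: add_pos_nonneg)
    then show "norm (r x \<cdot> z) \<le> 1 * norm z" using rn[of x z] by simp
  qed simp
  define R :: "(bool, ('g, 'h) ell2) ell2 bop" where "R = Bop (amp (mono_op id (\<lambda>x. bop_blinfun (r x))))"
  have R: "coord (R \<cdot> f) i x = r x \<cdot> coord f i x" for f i x
  proof -
    have "is_clinear (blinfun_apply (mono_op id (\<lambda>x. bop_blinfun (r x))))"
      by (rule is_clinear_mono_op[OF inj_on_id rn1]) simp
    then show ?thesis by (simp add: R_def mono_op_fun[OF inj_on_id rn1])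
  qed
  have "is_resolvent (dirac_fibre D l) 1 R"
    unfolding is_resolvent_def
  proof
    fix z
    have "\<exists>d. (r x \<cdot> coord z i x, d) \<in> D \<and> (d, coord z i x - (1 + (l x)\<^sup>2) *\<^sub>R (r x \<cdot> coord z i x)) \<in> D" for i x
      using r(1) unfolding is_resolvent_def by blast
    note ex = someI_ex[OF this]
    define d where "d i x = (SOME d. (r x \<cdot> coord z i x, d) \<in> D \<and> (d, coord z i x - (1 + (l x)\<^sup>2) *\<^sub>R (r x \<cdot> coord z i x)) \<in> D)" for i x
    have d: "(r x \<cdot> coord z i x, d i x) \<in> D" "(d i x, coord z i x - (1 + (l x)\<^sup>2) *\<^sub>R (r x \<cdot> coord z i x)) \<in> D" for i x
      using ex[of x i] by (simp_all add: d_def)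
    \<comment> \<open>The components of the Dirac operator on \<open>R \<cdot> z\<close>, with
      \<open>d i x\<close> standing for \<open>D\<close> applied to the coordinate \<open>i\<close>
      of \<open>R \<cdot> z\<close> over \<open>x\<close>. They are square summable because
      \<open>\<bar>l x\<bar>\<close> is at most \<open>1 + (l x)\<^sup>2\<close>, which the
      resolvent compensates.\<close>
    define p where "p i x = (if i then d False x + (\<i> * l x) *\<^sub>C (r x \<cdot> coord z False x)
                                 else d True x - (\<i> * l x) *\<^sub>C (r x \<cdot> coord z True x))" for i x
    have lr: "\<bar>l x\<bar> * norm (r x \<cdot> v) \<le> norm v" for x v
    proof -
      have "\<bar>l x\<bar> \<le> 1 + (l x)\<^sup>2" using zero_le_power2[of "\<bar>l x\<bar> - 1"] by (simp add: power2_diff)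
      then have "\<bar>l x\<bar> * norm (r x \<cdot> v) \<le> (1 + (l x)\<^sup>2) * (norm v / (1 + (l x)\<^sup>2))"
        by (intro mult_mono rn) auto
      also have "\<dots> = norm v" by (simp add: add_nonneg_eq_0_iff)
      finally show ?thesis .
    qed
    have nd: "norm (d j x) \<le> norm (coord z j x)" for j x
      by (rule resolvent_estimates(3)[OF D d]) simp
    have "norm (d j x) + norm ((\<i> * l x) *\<^sub>C (r x \<cdot> coord z j x)) \<le> 2 * norm (coord z j x)" for j x
      using add_mono[OF nd[of j x] lr[of x "coord z j x"]] by (simp add: norm_scaleC_hilbert norm_mult)
    then have "norm (p i x) \<le> 2 * norm (coord z (\<not> i) x)" for i x
      unfolding p_def
      by (cases i) (auto intro: order_trans[OF norm_triangle_ineq] order_trans[OF norm_triangle_ineq4])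
    then obtain e where e: "\<And>i x. coord e i x = p i x"
      by (rule ell2_pair_exists[of 2 "\<lambda>x. x" Not p z, rotated 3]) (auto simp: inj_on_def)
    have "(R \<cdot> z, e) \<in> dirac_fibre D l"
      using d(1) by (simp add: dirac_fibre_def R e p_def)
    moreover have "(e, z - 1 *\<^sub>R (R \<cdot> z)) \<in> dirac_fibre D l"
    proof -
      \<comment> \<open>In the second application the imaginary weights multiply to
        \<open>- (l x)\<^sup>2\<close>, which matches the shift of the resolvent over
        \<open>x\<close>; the terms in \<open>d\<close> are multiples of pairs of
        \<open>D\<close>.\<close>
      have sq: "(\<i> * complex_of_real (l x)) * (\<i> * complex_of_real (l x)) = - complex_of_real ((l x)\<^sup>2)" for x
        by (simp add: power2_eq_square complex_eq_iff)
      note gi = graph_intros[OF self_adjoint_csubspace[OF D]]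
      have 1: "(d False x + (\<i> * l x) *\<^sub>C (r x \<cdot> coord z False x),
          (coord z False x - r x \<cdot> coord z False x) + (\<i> * l x) *\<^sub>C (d False x + (\<i> * l x) *\<^sub>C (r x \<cdot> coord z False x))) \<in> D" for x
      proof -
        have eq: "(coord z False x - r x \<cdot> coord z False x) + (\<i> * l x) *\<^sub>C (d False x + (\<i> * l x) *\<^sub>C (r x \<cdot> coord z False x))
          = (coord z False x - (1 + (l x)\<^sup>2) *\<^sub>R (r x \<cdot> coord z False x)) + (\<i> * l x) *\<^sub>C d False x"
          by (simp add: scaleC_add_right scaleC_scaleC sq scaleR_scaleC scaleC_add_left complex_vector.scale_minus_left)
        show ?thesis unfolding eq by (rule gi(2)[OF d(2) gi(3)[OF d(1)]])
      qed
      have 2: "(d True x - (\<i> * l x) *\<^sub>C (r x \<cdot> coord z True x),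
          (coord z True x - r x \<cdot> coord z True x) - (\<i> * l x) *\<^sub>C (d True x - (\<i> * l x) *\<^sub>C (r x \<cdot> coord z True x))) \<in> D" for x
      proof -
        have eq: "(coord z True x - r x \<cdot> coord z True x) - (\<i> * l x) *\<^sub>C (d True x - (\<i> * l x) *\<^sub>C (r x \<cdot> coord z True x))
          = (coord z True x - (1 + (l x)\<^sup>2) *\<^sub>R (r x \<cdot> coord z True x)) - (\<i> * l x) *\<^sub>C d True x"
          by (simp add: complex_vector.scale_right_diff_distrib scaleC_scaleC sq scaleR_scaleC scaleC_add_left complex_vector.scale_minus_left)
        show ?thesis unfolding eq by (rule gi(4)[OF d(2) gi(3)[OF d(1)]])
      qed
      show ?thesis using 1 2 by (simp add: dirac_fibre_def R e p_def)
    qed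
    ultimately show "\<exists>d. (R \<cdot> z, d) \<in> dirac_fibre D l \<and> (d, z - 1 *\<^sub>R (R \<cdot> z)) \<in> dirac_fibre D l" by blast
  qed
  moreover have "precompact_map (blinfun_apply (bop_blinfun R))"
  proof (rule precompact_map_limit)
    fix e :: real assume e: "e > 0"
    \<comment> \<open>Off \<open>F\<close> one has
      \<open>1 / e < \<bar>l x\<bar> \<le> 1 + (l x)\<^sup>2\<close>, so truncation to
      \<open>F\<close> costs at most \<open>e\<close>.\<close>
    obtain m :: nat where m: "1 / e < real m" using reals_Archimedean2 by blast
    define F where "F = {x. - real m \<le> l x \<and> l x \<le> real m}"
    have F: "finite F" using l by (simp add: F_def proper_weight_def)
    define g where "g f = (\<Sum>i\<in>UNIV. \<Sum>x\<in>F. ((r x \<cdot> coord f i x) \<otimes>\<^sub>v ket x) \<otimes>\<^sub>v ket i)" for f :: "(bool, ('g, 'h) ell2) ell2"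
    have "precompact_map (\<lambda>f. ((r x \<cdot> coord f i x) \<otimes>\<^sub>v ket x) \<otimes>\<^sub>v ket i)" for i :: bool and x
    proof (rule precompact_map_left[where h = "\<lambda>v. (v \<otimes>\<^sub>v ket x) \<otimes>\<^sub>v ket i" and f = "\<lambda>f. r x \<cdot> coord f i x"])
      show "bounded_linear (\<lambda>v::'h. (v \<otimes>\<^sub>v ket x) \<otimes>\<^sub>v ket i)"
        by (rule bounded_linear_compose[OF bounded_linear_tensor_left bounded_linear_tensor_left])
      show "precompact_map (\<lambda>f. r x \<cdot> coord f i x)"
        by (rule precompact_map_right[OF r(2), where K = 1 and g = "\<lambda>f. coord f i x"])
           (auto simp: blinfun.scaleR_right intro: order_trans[OF ell2_coord_le ell2_coord_le])
    qed
    then have "precompact_map g" unfolding g_def by (intro precompact_map_sum F) auto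
    moreover have "norm (R \<cdot> f - g f) \<le> e" if f: "norm f \<le> 1" for f
    proof -
      have g: "coord (g f) i x = (if x \<in> F then r x \<cdot> coord f i x else 0)" for i x
      proof -
        have "coord (g f) i x = (\<Sum>j\<in>UNIV. \<Sum>y\<in>F. if y = x \<and> j = i then r x \<cdot> coord f i x else 0)"
          unfolding g_def ell2_fun_sum by (intro sum.cong refl) auto
        also have "\<dots> = (\<Sum>j\<in>UNIV. if j = i then (\<Sum>y\<in>F. if y = x then r x \<cdot> coord f i x else 0) else 0)"
          by (intro sum.cong refl) auto
        also have "\<dots> = (if x \<in> F then r x \<cdot> coord f i x else 0)" using F by simp
        finally show ?thesis .
      qed
      have "norm (coord (R \<cdot> f - g f) i x) \<le> e * norm (coord f i x)" for i x
      proof (cases "x \<in> F")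
        case False
        then have "real m < \<bar>l x\<bar>" by (auto simp: F_def)
        then have "1 / e < \<bar>l x\<bar>" using m by simp
        also have "\<bar>l x\<bar> \<le> 1 + (l x)\<^sup>2" using zero_le_power2[of "\<bar>l x\<bar> - 1"] by (simp add: power2_diff)
        finally have "1 < e * (1 + (l x)\<^sup>2)" using e by (simp add: field_simps)
        moreover have "1 + (l x)\<^sup>2 > 0" by (simp add: add_pos_nonneg)
        ultimately have *: "1 / (1 + (l x)\<^sup>2) \<le> e" by (simp add: pos_divide_le_eq)
        have "norm (r x \<cdot> coord f i x) \<le> (1 / (1 + (l x)\<^sup>2)) * norm (coord f i x)" using rn[of x "coord f i x"] by simp
        also have "\<dots> \<le> e * norm (coord f i x)" using * by (intro mult_right_mono) auto
        finally show ?thesis using False by (simp add: R g)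
      qed (use e in \<open>simp add: R g\<close>)
      then have n: "norm (ell2_fun (R \<cdot> f - g f) i) \<le> e * norm (ell2_fun f i)" for i
        using e by (intro ell2_norm_dominated[of id]) auto
      have "norm (R \<cdot> f - g f) \<le> e * norm f"
        by (rule ell2_norm_dominated[of id]) (use e n in \<open>simp_all del: minus_ell2.rep_eq\<close>)
      also have "\<dots> \<le> e" using f e by (simp add: mult_left_le)
      finally show ?thesis .
    qed
    ultimately show "\<exists>g. precompact_map g \<and> (\<forall>f. norm f \<le> 1 \<longrightarrow> norm (R \<cdot> f - g f) \<le> e)" by blast
  qed
  ultimately show ?thesis by (rule inv_sqrt_exists[OF self_adjoint_dirac_fibre[OF D]])
qed

subsection \<open>Bounded commutators\<close>

text \<open>Unlike the two conditions of a spectral triple separately, their conjunction in this form is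
  visibly stable under products and linear combinations.\<close>

definition good_commutator :: "'h::chilbert_space unbounded_op \<Rightarrow> 'h bop \<Rightarrow> bool" where
  "good_commutator D T \<longleftrightarrow> (\<exists>M\<ge>0. \<forall>(x, y)\<in>D. \<exists>z. (T \<cdot> x, z) \<in> D \<and> norm (z - T \<cdot> y) \<le> M * norm x)"

lemma good_commutatorD:
  "good_commutator D T \<Longrightarrow> \<exists>M\<ge>0. \<forall>x y. (x, y) \<in> D \<longrightarrow> (\<exists>z. (T \<cdot> x, z) \<in> D \<and> norm (z - T \<cdot> y) \<le> M * norm x)"
  unfolding good_commutator_def by auto

lemma good_commutatorI:
  "M \<ge> 0 \<Longrightarrow> (\<And>x y. (x, y) \<in> D \<Longrightarrow> \<exists>z. (T \<cdot> x, z) \<in> D \<and> norm (z - T \<cdot> y) \<le> M * norm x) \<Longrightarrow> good_commutator D T"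
  unfolding good_commutator_def by auto

lemma good_commutator_iff:
  assumes D: "self_adjoint_op D"
  shows "good_commutator D T \<longleftrightarrow> (\<lambda>x. T \<cdot> x) ` Domain D \<subseteq> Domain D \<and> commutator_bounded D T"
proof
  assume T: "good_commutator D T"
  obtain M where M: "\<And>x y. (x, y) \<in> D \<Longrightarrow> \<exists>z. (T \<cdot> x, z) \<in> D \<and> norm (z - T \<cdot> y) \<le> M * norm x"
    using good_commutatorD[OF T] by blast
  have "norm (z - T \<cdot> y) \<le> M * norm x" if "(x, y) \<in> D" "(T \<cdot> x, z) \<in> D" for x y z
    using M[OF that(1)] self_adjoint_single_valued[OF D that(2)] by blast
  then have "commutator_bounded D T" unfolding commutator_bounded_def by blast
  moreover have "T \<cdot> x \<in> Domain D" if "x \<in> Domain D" for x using that M by blast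
  ultimately show "(\<lambda>x. T \<cdot> x) ` Domain D \<subseteq> Domain D \<and> commutator_bounded D T" by blast
next
  assume *: "(\<lambda>x. T \<cdot> x) ` Domain D \<subseteq> Domain D \<and> commutator_bounded D T"
  then obtain M where M: "\<And>x y z. (x, y) \<in> D \<Longrightarrow> (T \<cdot> x, z) \<in> D \<Longrightarrow> norm (z - T \<cdot> y) \<le> M * norm x"
    unfolding commutator_bounded_def by blast
  show "good_commutator D T"
  proof (rule good_commutatorI[of "\<bar>M\<bar>"])
    fix x y assume xy: "(x, y) \<in> D"
    then obtain z where z: "(T \<cdot> x, z) \<in> D" using * by blast
    have "norm (z - T \<cdot> y) \<le> \<bar>M\<bar> * norm x"
      using M[OF xy z] by (rule order_trans) (simp add: mult_right_mono)
    then show "\<exists>z. (T \<cdot> x, z) \<in> D \<and> norm (z - T \<cdot> y) \<le> \<bar>M\<bar> * norm x" using z by blast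
  qed simp
qed

lemma good_commutator_mult:
  assumes S: "good_commutator D S" and T: "good_commutator D T"
  shows "good_commutator D (S * T)"
proof -
  obtain M where M: "M \<ge> 0" "\<And>x y. (x, y) \<in> D \<Longrightarrow> \<exists>z. (S \<cdot> x, z) \<in> D \<and> norm (z - S \<cdot> y) \<le> M * norm x"
    using good_commutatorD[OF S] by blast
  obtain N where N: "N \<ge> 0" "\<And>x y. (x, y) \<in> D \<Longrightarrow> \<exists>z. (T \<cdot> x, z) \<in> D \<and> norm (z - T \<cdot> y) \<le> N * norm x"
    using good_commutatorD[OF T] by blast
  show ?thesis
  proof (rule good_commutatorI[of "M * norm T + norm S * N"])
    fix x y assume "(x, y) \<in> D"
    then obtain z where z: "(T \<cdot> x, z) \<in> D" "norm (z - T \<cdot> y) \<le> N * norm x" using N by blast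
    then obtain w where w: "(S \<cdot> T \<cdot> x, w) \<in> D" "norm (w - S \<cdot> z) \<le> M * norm (T \<cdot> x)" using M by blast
    have "norm (w - S \<cdot> T \<cdot> y) \<le> norm (w - S \<cdot> z) + norm (S \<cdot> (z - T \<cdot> y))"
      using norm_triangle_ineq[of "w - S \<cdot> z" "S \<cdot> (z - T \<cdot> y)"] by (simp add: blinfun.diff_right)
    also have "\<dots> \<le> M * (norm T * norm x) + norm S * (N * norm x)"
      using w(2) M(1) norm_bop_le[of T x] norm_bop_le[of S "z - T \<cdot> y"] z(2)
      by (intro add_mono) (meson mult_left_mono order_trans norm_ge_zero)+
    finally show "\<exists>z. ((S * T) \<cdot> x, z) \<in> D \<and> norm (z - (S * T) \<cdot> y) \<le> (M * norm T + norm S * N) * norm x"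
      using w(1) by (auto simp: bop_simps algebra_simps)
  qed (use M(1) N(1) in simp)
qed

lemma csubspace_good_commutator:
  assumes D: "csubspace D"
  shows "csubspace {T. good_commutator D T}"
proof (rule csubspaceI; (unfold mem_Collect_eq)?)
  show "good_commutator D 0"
    by (rule good_commutatorI[of 0]) (auto simp: zero_bop.rep_eq graph_intros(1)[OF D] intro!: exI[of _ 0])
next
  fix S T assume S: "good_commutator D S" and T: "good_commutator D T"
  obtain M where M: "M \<ge> 0" "\<And>x y. (x, y) \<in> D \<Longrightarrow> \<exists>z. (S \<cdot> x, z) \<in> D \<and> norm (z - S \<cdot> y) \<le> M * norm x"
    using good_commutatorD[OF S] by blast
  obtain N where N: "N \<ge> 0" "\<And>x y. (x, y) \<in> D \<Longrightarrow> \<exists>z. (T \<cdot> x, z) \<in> D \<and> norm (z - T \<cdot> y) \<le> N * norm x"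
    using good_commutatorD[OF T] by blast
  show "good_commutator D (S + T)"
  proof (rule good_commutatorI[of "M + N"])
    fix x y assume xy: "(x, y) \<in> D"
    obtain z w where z: "(S \<cdot> x, z) \<in> D" "norm (z - S \<cdot> y) \<le> M * norm x"
      and w: "(T \<cdot> x, w) \<in> D" "norm (w - T \<cdot> y) \<le> N * norm x" using M(2)[OF xy] N(2)[OF xy] by blast
    have "norm (z + w - (S \<cdot> y + T \<cdot> y)) \<le> norm (z - S \<cdot> y) + norm (w - T \<cdot> y)"
      using norm_triangle_ineq[of "z - S \<cdot> y" "w - T \<cdot> y"] by (simp add: algebra_simps)
    then have "norm (z + w - (S \<cdot> y + T \<cdot> y)) \<le> (M + N) * norm x" using z w by (simp add: algebra_simps)
    then show "\<exists>z. ((S + T) \<cdot> x, z) \<in> D \<and> norm (z - (S + T) \<cdot> y) \<le> (M + N) * norm x"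
      using graph_intros(2)[OF D z(1) w(1)] by (auto simp: bop_simps)
  qed (use M(1) N(1) in simp)
next
  fix c T assume T: "good_commutator D T"
  obtain N where N: "N \<ge> 0" "\<And>x y. (x, y) \<in> D \<Longrightarrow> \<exists>z. (T \<cdot> x, z) \<in> D \<and> norm (z - T \<cdot> y) \<le> N * norm x"
    using good_commutatorD[OF T] by blast
  show "good_commutator D (c *\<^sub>C T)"
  proof (rule good_commutatorI[of "cmod c * N"])
    fix x y assume xy: "(x, y) \<in> D"
    obtain w where w: "(T \<cdot> x, w) \<in> D" "norm (w - T \<cdot> y) \<le> N * norm x" using N(2)[OF xy] by blast
    have "norm (c *\<^sub>C w - c *\<^sub>C (T \<cdot> y)) = cmod c * norm (w - T \<cdot> y)"
      by (simp add: norm_scaleC_hilbert flip: complex_vector.scale_right_diff_distrib)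
    also have "\<dots> \<le> cmod c * (N * norm x)" using w(2) by (intro mult_left_mono) auto
    finally show "\<exists>z. ((c *\<^sub>C T) \<cdot> x, z) \<in> D \<and> norm (z - (c *\<^sub>C T) \<cdot> y) \<le> (cmod c * N) * norm x"
      using graph_intros(3)[OF D w(1), of c] by (auto simp: bop_simps mult.assoc)
  qed (use N(1) in simp)
qed

context covariant_rep
begin

text \<open>Over \<open>x\<close> the commutator consists of that of \<open>D\<close> with
  \<open>\<pi> a * u h\<close> and of the difference of weights at \<open>x\<close> and
  \<open>- h + x\<close> times this operator. The Dirac condition bounds the difference uniformly,
  and \<open>K\<close> adds the two bounds.\<close>

lemma good_commutator_reg_elt:
  assumes D: "self_adjoint_op D" and l: "dirac_weight l" and \<pi>: "good_commutator D (\<pi> a)" and u: "good_commutator D (u h)"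
  shows "good_commutator (dirac_fibre D l) (\<rho> (reg_elt \<alpha> \<pi> a h))"
proof -
  let ?A = "\<pi> a * u h" and ?B = "\<rho> (reg_elt \<alpha> \<pi> a h)"
  obtain M where M: "M \<ge> 0" "\<And>x y. (x, y) \<in> D \<Longrightarrow> \<exists>z. (?A \<cdot> x, z) \<in> D \<and> norm (z - ?A \<cdot> y) \<le> M * norm x"
    using good_commutatorD[OF good_commutator_mult[OF \<pi> u]] by blast
  obtain L where L: "\<And>x. \<bar>l x - l (- h + x)\<bar> \<le> L"
    using l unfolding dirac_weight_def bounded_iff by auto
  have L0: "L \<ge> 0" using L[of 0] by linarith
  have B: "coord (?B \<cdot> f) i x = ?A \<cdot> coord f i (- h + x)" for f i x by (simp add: \<rho>_reg_elt_fun bop_simps)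
  define K where "K = M + L * norm ?A"
  show ?thesis
  proof (rule good_commutatorI[of K])
    show "K \<ge> 0" using M(1) L0 by (simp add: K_def)
    fix f g assume fg: "(f, g) \<in> dirac_fibre D l"
    \<comment> \<open>The signs put the two off-diagonal entries \<open>D - \<i> l\<close> and
      \<open>D + \<i> l\<close> into one formula.\<close>
    define s where "s i = (if i then - 1 else 1 :: real)" for i
    have fgD: "(coord f (\<not> i) y, coord g i y + (\<i> * (s i * l y)) *\<^sub>C coord f (\<not> i) y) \<in> D" for i y
      using fg by (cases i) (auto simp: dirac_fibre_def s_def complex_vector.scale_minus_left)
    from M(2)[OF this] obtain d where
      d: "\<And>i y. (?A \<cdot> coord f (\<not> i) y, d i y) \<in> D"
      "\<And>i y. norm (d i y - ?A \<cdot> (coord g i y + (\<i> * (s i * l y)) *\<^sub>C coord f (\<not> i) y)) \<le> M * norm (coord f (\<not> i) y)"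
      by metis
    \<comment> \<open>Component \<open>i\<close> over \<open>x\<close> of the Dirac operator on
      \<open>?B \<cdot> f\<close>, not yet known to be square summable.\<close>
    define w where "w i x = d i (- h + x) - (\<i> * (s i * l x)) *\<^sub>C (?A \<cdot> coord f (\<not> i) (- h + x))" for i x
    have w: "norm (w i x - coord (?B \<cdot> g) i x) \<le> K * norm (coord f (\<not> i) (- h + x))" for i x
    proof -
      let ?y = "- h + x"
      let ?v = "?A \<cdot> coord f (\<not> i) ?y"
      have "w i x - coord (?B \<cdot> g) i x = (d i ?y - ?A \<cdot> (coord g i ?y + (\<i> * (s i * l ?y)) *\<^sub>C coord f (\<not> i) ?y))
          + (\<i> * (s i * (l ?y - l x))) *\<^sub>C ?v"
        by (simp add: w_def B blinfun.add_right bop_scaleC algebra_simps scaleC_add_left[symmetric]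
            complex_vector.scale_left_diff_distrib)
      then have "norm (w i x - coord (?B \<cdot> g) i x) \<le> M * norm (coord f (\<not> i) ?y) + norm ((\<i> * (s i * (l ?y - l x))) *\<^sub>C ?v)"
        using norm_triangle_mono[OF d(2)[of i ?y] order_refl] by simp
      also have "norm ((\<i> * (s i * (l ?y - l x))) *\<^sub>C ?v) = \<bar>l x - l ?y\<bar> * norm ?v"
        by (simp add: norm_scaleC_hilbert norm_mult s_def abs_minus_commute flip: of_real_diff of_real_mult)
      also have "\<dots> \<le> L * (norm ?A * norm (coord f (\<not> i) ?y))"
        by (intro mult_mono L norm_bop_le L0) simp
      finally show ?thesis by (simp add: K_def algebra_simps)
    qed
    \<comment> \<open>The commutator on \<open>f\<close> is dominated by \<open>f\<close> and hence
      is a vector; adding \<open>?B \<cdot> g\<close> back shows that \<open>w\<close> is one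
      too.\<close>
    obtain q where q: "\<And>i x. coord q i x = w i x - coord (?B \<cdot> g) i x" "norm q \<le> K * norm f"
      by (rule ell2_pair_exists[of K "\<lambda>x. - h + x" Not "\<lambda>i x. w i x - coord (?B \<cdot> g) i x" f])
         (use \<open>K \<ge> 0\<close> w in \<open>auto simp: inj_on_def\<close>)
    have "(?A \<cdot> coord f (\<not> i) (- h + x), w i x + (\<i> * (s i * l x)) *\<^sub>C (?A \<cdot> coord f (\<not> i) (- h + x))) \<in> D" for i x
      using d(1)[of i "- h + x"] by (simp add: w_def)
    from this[of False] this[of True] have "(?B \<cdot> f, ?B \<cdot> g + q) \<in> dirac_fibre D l"
      by (auto simp: dirac_fibre_def B[of f] q(1) s_def complex_vector.scale_minus_left)
    then show "\<exists>z. (?B \<cdot> f, z) \<in> dirac_fibre D l \<and> norm (z - ?B \<cdot> g) \<le> K * norm f"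
      using q(2) by (intro exI[of _ "?B \<cdot> g + q"]) simp
  qed
qed

lemma sign_op_\<rho>: "sign_op * \<rho> b = \<rho> b * sign_op"
proof (rule bop_eqI, rule ell2_eqI)
  fix f i
  have "ell2_fun (\<rho> b \<cdot> f) i = \<Upsilon> (b \<cdot> \<Upsilon>_inv (ell2_fun f i))" for f i
    by (simp add: \<rho>_def spatial_apply[OF unitary_pair_amp[OF unitary_pair_\<Upsilon>]])
  then show "ell2_fun ((sign_op * \<rho> b) \<cdot> f) i = ell2_fun ((\<rho> b * sign_op) \<cdot> f) i"
    by (simp add: bop_simps sign_op_fun blinfun.minus_right)
qed

lemma even_spectral_triple_crossed_product:
  assumes T: "odd_spectral_triple UNIV \<A> \<pi> D" and inv: "\<And>g. \<alpha> g ` \<A> \<subseteq> \<A>"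
    and l: "proper_weight l" "dirac_weight l" and u: "\<And>g. good_commutator D (u g)"
  shows "even_spectral_triple (crossed_product \<alpha> \<pi>) (Cc \<alpha> \<pi> \<A>) (rep_hat \<alpha> \<pi> u) (dirac_fibre D l) sign_op"
proof -
  have D: "self_adjoint_op D" and A: "star_subalgebra \<A>" and dense: "UNIV \<subseteq> closure \<A>"
    and \<pi>D: "\<And>a. a \<in> \<A> \<Longrightarrow> good_commutator D (\<pi> a)"
    using T by (auto simp: odd_spectral_triple_def good_commutator_iff)
  obtain S where S: "is_inv_sqrt_one_plus_square D S" "compact_bop S" using T by (auto simp: odd_spectral_triple_def)
  have Asub: "csubspace \<A>" using A by (simp add: star_subalgebra_def)
  let ?D = "dirac_fibre D l" and ?B = "crossed_product \<alpha> \<pi>"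
  have D': "self_adjoint_op ?D" by (rule self_adjoint_dirac_fibre[OF D])
  have sub: "Cc \<alpha> \<pi> \<A> \<subseteq> ?B"
  proof -
    have "Cc \<alpha> \<pi> \<A> \<subseteq> Cc \<alpha> \<pi> UNIV" unfolding Cc_def by blast
    then show ?thesis unfolding crossed_product_def using closure_subset by blast
  qed
  have comm: "good_commutator ?D (\<rho> b)" if "b \<in> Cc \<alpha> \<pi> \<A>" for b
  proof -
    note G = csubspace_good_commutator[OF self_adjoint_csubspace[OF D']]
    have "\<rho> 0 = 0" using bounded_linear.linear[OF star_hom_bounded_linear[OF star_hom_\<rho>]] linear_0 by blast
    then have "csubspace {b. good_commutator ?D (\<rho> b)}"
      using star_hom_\<rho> csubspace_intros(1-3)[OF G] by (intro csubspaceI) (auto simp: star_hom_def)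
    moreover have "{reg_elt \<alpha> \<pi> a g | a g. a \<in> \<A>} \<subseteq> {b. good_commutator ?D (\<rho> b)}"
      using good_commutator_reg_elt[OF D l(2) \<pi>D u] by auto
    ultimately have "Cc \<alpha> \<pi> \<A> \<subseteq> {b. good_commutator ?D (\<rho> b)}"
      unfolding Cc_eq_cspan[OF Asub] by (intro complex_vector.span_minimal)
    then show ?thesis using that by blast
  qed
  have r: "rep_hat \<alpha> \<pi> u b = \<rho> b" if "b \<in> ?B" for b using that by (simp add: rep_hat_eq)
  have comm': "(\<lambda>x. rep_hat \<alpha> \<pi> u b \<cdot> x) ` Domain ?D \<subseteq> Domain ?D \<and> commutator_bounded ?D (rep_hat \<alpha> \<pi> u b)"
    if "b \<in> Cc \<alpha> \<pi> \<A>" for b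
  proof -
    have "b \<in> ?B" using sub that by blast
    then show ?thesis using comm[OF that] by (simp only: r good_commutator_iff[OF D'])
  qed
  have odd: "odd_spectral_triple ?B (Cc \<alpha> \<pi> \<A>) (rep_hat \<alpha> \<pi> u) ?D"
    unfolding odd_spectral_triple_def
    using crossed_product_unital Cc_star_subalgebra[OF A inv] sub Cc_dense[OF Asub dense] star_hom_rep_hat D'
      dirac_fibre_inv_sqrt[OF D S l(1)] comm' by blast
  have "star sign_op = (sign_op :: (bool, ('g, 'h) ell2) ell2 bop)"
    by (rule star_eqI) (auto simp: cinner_ell2_fun[where ?'a = bool] sign_op_fun intro!: infsum_cong sum.cong)
  moreover have "sign_op * sign_op = (1 :: (bool, ('g, 'h) ell2) ell2 bop)"
    by (rule bop_eqI, rule ell2_eqI) (simp add: bop_simps sign_op_fun)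
  moreover have sg: "(sign_op \<cdot> x, - (sign_op \<cdot> y)) \<in> ?D" if "(x, y) \<in> ?D" for x y
  proof -
    note gi = graph_intros[OF self_adjoint_csubspace[OF D]]
    have a: "(coord x True g, coord y False g + (\<i> * l g) *\<^sub>C coord x True g) \<in> D"
      "(coord x False g, coord y True g - (\<i> * l g) *\<^sub>C coord x False g) \<in> D" for g
      using that by (auto simp: dirac_fibre_def)
    show ?thesis using gi(5)[OF a(1)] a(2) by (simp add: dirac_fibre_def sign_op_fun)
  qed
  moreover have "(\<lambda>x. sign_op \<cdot> x) ` Domain ?D \<subseteq> Domain ?D" using sg by blast
  ultimately show ?thesis
    unfolding even_spectral_triple_def using odd by (auto simp: r sign_op_\<rho>)
qed

end

text \<open>Invariance of \<open>\<A>\<close> makes \<open>Cc\<close> closed under products and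
  adjoints, so it is the premise of the assertion on spectral triples. Equivariance speaks of the
  completed crossed product and the graph of the Dirac operator, and stands beside that
  implication.\<close>

theorem proposition3p19:
  fixes l :: "'g::{group_add, countable} \<Rightarrow> real"
    and \<alpha> :: "'g \<Rightarrow> 'a::cstar_algebra \<Rightarrow> 'a"
    and \<A> :: "'a set"
    and \<pi> :: "'a \<Rightarrow> 'h::chilbert_space bop"
    and D :: "'h unbounded_op"
    and u :: "'g \<Rightarrow> 'h bop"
  assumes "separable_space (euclidean :: 'a topology)" and "separable_space (euclidean :: 'h topology)"
    and "proper_weight l" and "dirac_weight l"
    and "cstar_action \<alpha>"
    and "odd_spectral_triple UNIV \<A> \<pi> D" and "equivariant_via \<alpha> \<pi> D u"
    and "inj \<pi>"
  shows "((\<forall>g. \<alpha> g ` \<A> \<subseteq> \<A>) \<longrightarrow>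
      even_spectral_triple (crossed_product \<alpha> \<pi>) (Cc \<alpha> \<pi> \<A>) (rep_hat \<alpha> \<pi> u) (dirac_hat D l) grading_hat)
    \<and> coaction_equivariant (crossed_product \<alpha> \<pi>) (rep_hat \<alpha> \<pi> u) (dirac_hat D l) grading_hat
        (dual_coaction \<alpha> \<pi>)"
proof -
  have D: "self_adjoint_op D" using assms(6) by (simp add: odd_spectral_triple_def)
  interpret covariant_rep \<alpha> \<pi> u
    using assms(5-7) by unfold_locales (auto simp: odd_spectral_triple_def equivariant_via_def)
  have "good_commutator D (u g)" for g
    using assms(7) by (auto simp: good_commutator_iff[OF D] equivariant_via_def)
  then show ?thesis
    unfolding dirac_hat_eq[OF D] 
    using even_spectral_triple_crossed_product[OF assms(6) _ assms(3,4)]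
      coaction_equivariant_dual[OF dirac_fibre_fibre[OF self_adjoint_csubspace[OF D]]]
    by (simp add: grading_hat_eq)
qed

end
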